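(* Let $d\in\mathbb{N}\cup\{\infty\}$ and fix $n\ge 2$. Let $X=\{x_1,\dots,x_n\}\subset\mathbb{B}_d$ be a set of $n$ distinct points and let $Y^{(k)}=\{y^{(k)}_1,\dots,y^{(k)}_n\}$, $k\in\mathbb{N}$, be a sequence of subsets of $\mathbb{B}_d$, each consisting of $n$ distinct points. Let $\tilde\rho_s$ be the automorphism invariant symmetric distance induced by the pseudohyperbolic metric $\rho_{\rm ph}$. Put $\mathcal{H}=H^2_d|_X$, $\mathcal{M}=\operatorname{Mult}(\mathcal{H})$, $\mathcal{H}_k=H^2_d|_{Y^{(k)}}$ and $\mathcal{M}_k=\operatorname{Mult}(\mathcal{H}_k)$. Then the following statements are equivalent: (1) $\tilde\rho_s(X,Y^{(k)})\to 0$ as $k\to\infty$; (2) $\rho_{RK}(\mathcal{H},\mathcal{H}_k)\to 0$ as $k\to\infty$; (3) $\rho_M(\mathcal{M},\mathcal{M}_k)\to 0$ as $k\to\infty$; (4) $\inf\{\|\varphi\|_{cb}\|\varphi^{-1}\|_{cb} : \varphi:\mathcal{M}\to\mathcal{M}_k \text{ is an algebra isomorphism}\}\to 1$ as $k\to\infty$. Moreover, if (3) holds, then $\delta_{mult}(X,Y^{(k)})\to 1$ as $k\to\infty$.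
   Context: $\mathbb{B}_d$ is the open unit ball of a complex Hilbert space of dimension $d$ ($\mathbb{C}^d$, or $\ell^2$ if $d=\infty$). $H^2_d$ (the Drury-Arveson space) is the reproducing kernel Hilbert space (RKHS) on $\mathbb{B}_d$ with kernel $k(z,w)=\frac{1}{1-\langle z,w\rangle}$, and $\mathcal{M}_d=\operatorname{Mult}(H^2_d)$. For $X\subseteq\mathbb{B}_d$, $H^2_d|_X$ is the RKHS on $X$ whose kernel is the restriction of $k$ to $X\times X$. The multiplier algebra $\operatorname{Mult}(\mathcal{H})$ of an RKHS $\mathcal{H}$ on a set $X$ is the algebra of functions $f:X\to\mathbb{C}$ with $f\mathcal{H}\subseteq\mathcal{H}$, viewed as an operator algebra by identifying $f$ with the multiplication operator $M_f:h\mapsto fh$ on $\mathcal{H}$. $\|\varphi\|_{cb}=\sup_m\|\varphi\otimes \mathrm{id}_{M_m}\|$ is the completely bounded norm. For RKHSs $\mathcal{H}_i$ on sets $X_i$ with kernel functions $k^i_x$ ($i=1,2$), an RKHS isomorphism is a bounded linear bijection $T:\mathcal{H}_1\to\mathcal{H}_2$ with $T(k^1_x)=\lambda_x k^2_{F(x)}$ for all $x\in X_1$, where $F:X_1\to X_2$ is a bijection and $x\mapsto\lambda_x\in\mathbb{C}$ is nowhere vanishing. Define $\delta_{RK}(\mathcal{H}_1,\mathcal{H}_2)=\inf\{\|T\|\|T^{-1}\|: T:\mathcal{H}_1\to\mathcal{H}_2\text{ an RKHS isomorphism}\}$ and $\rho_{RK}=\log\delta_{RK}$. A multiplier algebra isomorphism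 $\varphi:\operatorname{Mult}(\mathcal{H}_1)\to\operatorname{Mult}(\mathcal{H}_2)$ is a bijective algebra isomorphism of the form $\varphi(f)=f\circ G$ with $G:X_2\to X_1$ a bijection, such that $\varphi,\varphi^{-1}$ are completely bounded. Define $\delta_M(\operatorname{Mult}(\mathcal{H}_1),\operatorname{Mult}(\mathcal{H}_2))=\inf\{\|\varphi\|_{cb}\|\varphi^{-1}\|_{cb}\}$ over multiplier algebra isomorphisms $\varphi$, and $\rho_M=\log\delta_M$. The pseudohyperbolic metric on $\mathbb{B}_d$ is $\rho_{\rm ph}(z,w)=\|\Psi_w(z)\|$, where $\Psi_w(z)=\frac{w-P_wz-(1-\|w\|^2)^{1/2}P_w^\perp z}{1-\langle z,w\rangle}$, $P_w$ is the orthogonal projection onto the span of $w$ and $P_w^\perp=I-P_w$. For a metric $\rho$ and $n$-point sets $X=\{x_i\}$, $Y=\{y_i\}$, $\rho_s(X,Y)=\min_{\sigma\in S_n}\max_i\rho(x_i,y_{\sigma(i)})$. $\operatorname{Aut}(\mathbb{B}_d)$ is the group of biholomorphic automorphisms of $\mathbb{B}_d$, and $\tilde\rho_s(X,Y)=\inf\{\rho_s(X,\Phi(Y)):\Phi\in\operatorname{Aut}(\mathbb{B}_d)\}$. A vector valued multiplier $F=(F_1,F_2,\dots):\mathbb{B}_d\to\mathbb{C}^d$ is a function with all components in $\mathcal{M}_d$; its multiplier norm $\|F\|$ is the norm of the row operator $M_F:H^2_d\oplus H^2_d\oplus\cdots\to H^2_d$ ($d$ summands), $M_F(h_1\oplus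 h_2\oplus\cdots)=\sum_iF_ih_i$ (if $d=\infty$, $\mathbb{C}^d$ means $\ell^2$ and the row operator is required to be bounded). The multiplier discrepancy of two $n$-point sets $X,Y\subset\mathbb{B}_d$ is $\delta_{mult}(X,Y)=\inf\{\max\{\|F\|,\|G\|\}\}$, the infimum over vector valued multipliers $F,G:\mathbb{B}_d\to\mathbb{C}^d$ such that $F|_X$ is a bijection onto $Y$ and $G|_Y=(F|_X)^{-1}$. *)

theory Defs
  imports "HOL-Analysis.Analysis"
begin

section \<open>The Hilbert space \<open>\<ell>\<^sup>2\<close>, the spaces \<open>\<complex>\<^sup>d\<close> and their unit balls\<close>

typedef ell2 = "{z :: nat \<Rightarrow> complex. summable (\<lambda>i. (cmod (z i))\<^sup>2)}"
  morphisms coord Abs_ell2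
  by (rule exI[of _ "\<lambda>_. 0"]) simp

lemma summable_coord: "summable (\<lambda>i. (cmod (coord z i))\<^sup>2)"
  using coord[of z] by simp

lemma ell2_eqI: "(\<And>i. coord z i = coord w i) \<Longrightarrow> z = w"
  by (metis coord_inject ext)

lemma summable_lincomb:
  fixes z w :: "nat \<Rightarrow> complex"
  assumes "summable (\<lambda>i. (cmod (z i))\<^sup>2)" "summable (\<lambda>i. (cmod (w i))\<^sup>2)"
  shows "summable (\<lambda>i. (cmod (a * z i + b * w i))\<^sup>2)"
proof (rule summable_comparison_test')
  show "summable (\<lambda>i. 2 * (cmod a)\<^sup>2 * (cmod (z i))\<^sup>2 + 2 * (cmod b)\<^sup>2 * (cmod (w i))\<^sup>2)"
    by (intro summable_add summable_mult assms)
  fix i :: nat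
  have "(cmod (a * z i + b * w i))\<^sup>2 \<le> (cmod (a * z i) + cmod (b * w i))\<^sup>2"
    by (intro power_mono norm_triangle_ineq) simp
  also have "\<dots> \<le> 2 * (cmod (a * z i))\<^sup>2 + 2 * (cmod (b * w i))\<^sup>2"
    using sum_squares_bound[of "cmod (a * z i)" "cmod (b * w i)"]
    by (simp add: power2_sum)
  finally show "norm ((cmod (a * z i + b * w i))\<^sup>2)
      \<le> 2 * (cmod a)\<^sup>2 * (cmod (z i))\<^sup>2 + 2 * (cmod b)\<^sup>2 * (cmod (w i))\<^sup>2"
    by (simp add: norm_mult power_mult_distrib)
qed

lemma summable_coord_prod: "summable (\<lambda>i. coord z i * cnj (coord w i))"
proof (rule summable_comparison_test')
  show "summable (\<lambda>i. (cmod (coord z i))\<^sup>2 + (cmod (coord w i))\<^sup>2)"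
    by (intro summable_add summable_coord)
  fix i :: nat
  have "2 * (cmod (coord z i) * cmod (coord w i)) \<le> (cmod (coord z i))\<^sup>2 + (cmod (coord w i))\<^sup>2"
    using sum_squares_bound[of "cmod (coord z i)" "cmod (coord w i)"] by simp
  moreover have "0 \<le> cmod (coord z i) * cmod (coord w i)" by simp
  ultimately have "cmod (coord z i) * cmod (coord w i) \<le> (cmod (coord z i))\<^sup>2 + (cmod (coord w i))\<^sup>2"
    by linarith
  then show "norm (coord z i * cnj (coord w i)) \<le> (cmod (coord z i))\<^sup>2 + (cmod (coord w i))\<^sup>2"
    by (simp add: norm_mult)
qed

definition cscale :: "complex \<Rightarrow> ell2 \<Rightarrow> ell2" where
  "cscale c z = Abs_ell2 (\<lambda>i. c * coord z i)"

definition cinner :: "ell2 \<Rightarrow> ell2 \<Rightarrow> complex" where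
  "cinner z w = (\<Sum>i. coord z i * cnj (coord w i))"

lemma coord_cscale [simp]: "coord (cscale c z) i = c * coord z i"
  using summable_lincomb[OF summable_coord[of z] summable_coord[of z], of c 0]
  by (simp add: cscale_def Abs_ell2_inverse)

instantiation ell2 :: real_inner
begin

definition "0 = Abs_ell2 (\<lambda>_. 0)"
definition "z + w = Abs_ell2 (\<lambda>i. coord z i + coord w i)"
definition "z - w = Abs_ell2 (\<lambda>i. coord z i - coord w i)"
definition "- z = Abs_ell2 (\<lambda>i. - coord z i)" for z :: ell2
definition "r *\<^sub>R z = Abs_ell2 (\<lambda>i. complex_of_real r * coord z i)"
text \<open>The real inner product is the real part of the complex one, so that the norm is the
  usual one, \<open>(\<Sum>i. (cmod (coord z i))\<^sup>2) powr (1/2)\<close>; see \<open>norm_ell2\<close> below.\<close>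
definition "inner z w = Re (cinner z w)"
definition "norm z = sqrt (inner z z)" for z :: ell2
definition "sgn z = inverse (norm z) *\<^sub>R z" for z :: ell2
definition "dist z w = norm (z - w)" for z w :: ell2
definition [code del]:
  "(uniformity :: (ell2 \<times> ell2) filter) = (INF e\<in>{0<..}. principal {(x, y). dist x y < e})"
definition [code del]:
  "open (U :: ell2 set) \<longleftrightarrow> (\<forall>x\<in>U. \<forall>\<^sub>F (x', y) in uniformity. x' = x \<longrightarrow> y \<in> U)"

lemma coord_ops:
  "coord (0::ell2) i = 0"
  "coord (z + w) i = coord z i + coord w i"
  "coord (z - w) i = coord z i - coord w i"
  "coord (- z) i = - coord z i"
  "coord (r *\<^sub>R z) i = complex_of_real r * coord z i"
proof -
  note s = summable_lincomb[OF summable_coord[of z] summable_coord[of w]]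
  show "coord (0::ell2) i = 0" by (simp add: zero_ell2_def Abs_ell2_inverse)
  show "coord (z + w) i = coord z i + coord w i"
    using s[of 1 1] by (simp add: plus_ell2_def Abs_ell2_inverse)
  show "coord (z - w) i = coord z i - coord w i"
    using s[of 1 "-1"] by (simp add: minus_ell2_def Abs_ell2_inverse)
  show "coord (- z) i = - coord z i"
    using s[of "-1" 0] by (simp add: uminus_ell2_def Abs_ell2_inverse)
  show "coord (r *\<^sub>R z) i = complex_of_real r * coord z i"
    using s[of "complex_of_real r" 0] by (simp add: scaleR_ell2_def Abs_ell2_inverse)
qed

lemma cinner_self: "cinner z z = complex_of_real (\<Sum>i. (cmod (coord z i))\<^sup>2)"
  unfolding cinner_def
  by (simp only: complex_norm_square[symmetric] suminf_of_real[OF summable_coord])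

instance
proof
  fix x y z :: ell2 and r s :: real
  show "x + y + z = x + (y + z)" "x + y = y + x" "0 + x = x" "- x + x = 0" "x - y = x + - y"
    "r *\<^sub>R (x + y) = r *\<^sub>R x + r *\<^sub>R y" "(r + s) *\<^sub>R x = r *\<^sub>R x + s *\<^sub>R x"
    "r *\<^sub>R s *\<^sub>R x = (r * s) *\<^sub>R x" "1 *\<^sub>R x = x"
    by (rule ell2_eqI; simp add: coord_ops algebra_simps)+
  show "dist x y = norm (x - y)" by (rule dist_ell2_def)
  show "sgn x = inverse (norm x) *\<^sub>R x" by (rule sgn_ell2_def)
  show "(uniformity :: (ell2 \<times> ell2) filter) = (INF e\<in>{0<..}. principal {(x, y). dist x y < e})"
    by (rule uniformity_ell2_def)
  show "open U \<longleftrightarrow> (\<forall>x\<in>U. \<forall>\<^sub>F (x', y) in uniformity. x' = x \<longrightarrow> y \<in> U)" for U :: "ell2 set"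
    by (rule open_ell2_def)
  show "norm x = sqrt (inner x x)" by (rule norm_ell2_def)
  have "cinner y x = cnj (cinner x y)"
    unfolding cinner_def
    using summable_sums[OF summable_coord_prod[of x y], THEN sums_cnj[THEN iffD2], THEN sums_unique]
    by (simp add: mult.commute)
  then show "inner x y = inner y x" by (simp add: inner_ell2_def)
  have "cinner (x + y) z = cinner x z + cinner y z"
    unfolding cinner_def
    by (simp add: coord_ops distrib_right suminf_add[OF summable_coord_prod summable_coord_prod])
  then show "inner (x + y) z = inner x z + inner y z" by (simp add: inner_ell2_def)
  have "cinner (r *\<^sub>R x) y = complex_of_real r * cinner x y"
    unfolding cinner_def
    by (simp add: coord_ops mult.assoc suminf_mult[OF summable_coord_prod])
  then show "inner (r *\<^sub>R x) y = r * inner x y" by (simp add: inner_ell2_def)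
  have e: "inner x x = (\<Sum>i. (cmod (coord x i))\<^sup>2)"
    by (simp add: inner_ell2_def cinner_self)
  show "0 \<le> inner x x" unfolding e by (intro suminf_nonneg summable_coord) simp
  show "inner x x = 0 \<longleftrightarrow> x = 0"
    unfolding e using suminf_eq_zero_iff[OF summable_coord[of x]]
    by (auto intro!: ell2_eqI simp: coord_ops)
qed

end

lemma norm_ell2: "norm z = sqrt (\<Sum>i. (cmod (coord z i))\<^sup>2)"
  by (simp add: norm_ell2_def inner_ell2_def cinner_self)

text \<open>\<open>\<complex>\<^sup>d\<close> for \<open>d \<in> \<nat> \<union> {\<infinity>}\<close> is realised inside \<open>\<ell>\<^sup>2\<close>, with coordinates indexed
  by \<open>{i. enat i < d}\<close>; for \<open>d = \<infinity>\<close> it is all of \<open>\<ell>\<^sup>2\<close>.\<close>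

definition Cd :: "enat \<Rightarrow> ell2 set" where
  "Cd d = {z. \<forall>i. d \<le> enat i \<longrightarrow> coord z i = 0}"

definition Bd :: "enat \<Rightarrow> ell2 set" where
  "Bd d = {z \<in> Cd d. norm z < 1}"


section \<open>Automorphisms of the ball and the pseudohyperbolic metric\<close>

text \<open>Complex Frechet differentiability relative to \<open>Cd d\<close>. As \<open>Bd d\<close> is open in \<open>Cd d\<close>, the
  derivative only matters on \<open>Cd d\<close>; a complex linear derivative on \<open>Cd d\<close> extends to
  \<open>\<ell>\<^sup>2\<close> by composition with the coordinate projection.\<close>

definition ball_holomorphic :: "enat \<Rightarrow> (ell2 \<Rightarrow> ell2) \<Rightarrow> bool" where
  "ball_holomorphic d f \<longleftrightarrow>
    (\<forall>z\<in>Bd d. \<exists>D. (f has_derivative D) (at z within Bd d) \<and> (\<forall>c h. D (cscale c h) = cscale c (D h)))"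

definition ball_Aut :: "enat \<Rightarrow> (ell2 \<Rightarrow> ell2) set" where
  "ball_Aut d = {\<Phi>. bij_betw \<Phi> (Bd d) (Bd d) \<and> ball_holomorphic d \<Phi>
      \<and> ball_holomorphic d (inv_into (Bd d) \<Phi>)}"

text \<open>The orthogonal projection onto the span of \<open>w\<close>; it is \<open>0\<close> for \<open>w = 0\<close>.\<close>
definition span_proj :: "ell2 \<Rightarrow> ell2 \<Rightarrow> ell2" where
  "span_proj w z = cscale (cinner z w / cinner w w) w"

text \<open>The involutive automorphism \<open>\<Psi>\<^sub>w\<close> of the ball exchanging \<open>w\<close> and \<open>0\<close>.\<close>
definition ball_inv :: "ell2 \<Rightarrow> ell2 \<Rightarrow> ell2" where
  "ball_inv w z = cscale (1 / (1 - cinner z w))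
     (w - span_proj w z - sqrt (1 - (norm w)\<^sup>2) *\<^sub>R (z - span_proj w z))"

definition rho_ph :: "ell2 \<Rightarrow> ell2 \<Rightarrow> real" where
  "rho_ph z w = norm (ball_inv w z)"

text \<open>The \<open>n\<close>-point sets are given by enumerations \<open>x, y\<close> on \<open>{..<n}\<close>; \<open>n > 0\<close> is intended.\<close>
definition sym_dist :: "('a \<Rightarrow> 'a \<Rightarrow> real) \<Rightarrow> nat \<Rightarrow> (nat \<Rightarrow> 'a) \<Rightarrow> (nat \<Rightarrow> 'a) \<Rightarrow> real" where
  "sym_dist \<rho> n x y =
    Min ((\<lambda>\<sigma>. Max ((\<lambda>i. \<rho> (x i) (y (\<sigma> i))) ` {..<n})) ` {\<sigma>. \<sigma> permutes {..<n}})"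

definition aut_sym_dist :: "enat \<Rightarrow> nat \<Rightarrow> (nat \<Rightarrow> ell2) \<Rightarrow> (nat \<Rightarrow> ell2) \<Rightarrow> real" where
  "aut_sym_dist d n x y = (INF \<Phi>\<in>ball_Aut d. sym_dist rho_ph n x (\<Phi> \<circ> y))"


section \<open>Reproducing kernel Hilbert spaces\<close>

text \<open>Functions \<open>X \<rightarrow> \<complex>\<close> on a subset \<open>X\<close> of the type \<open>'a\<close> are represented by functions
  vanishing off \<open>X\<close>. The normalisations off \<open>pts\<close> and off \<open>space\<close> in the predicate below only
  serve to make the record determined by its points and its kernel.\<close>

record 'a rkhs =
  pts :: "'a set"
  kern :: "'a \<Rightarrow> 'a \<Rightarrow> complex"
  funs :: "('a \<Rightarrow> complex) set"
  ip :: "('a \<Rightarrow> complex) \<Rightarrow> ('a \<Rightarrow> complex) \<Rightarrow> complex"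

definition restr :: "'a set \<Rightarrow> ('a \<Rightarrow> complex) \<Rightarrow> 'a \<Rightarrow> complex" where
  "restr X f = (\<lambda>x. if x \<in> X then f x else 0)"

definition kfun :: "'a rkhs \<Rightarrow> 'a \<Rightarrow> 'a \<Rightarrow> complex" where
  "kfun H x = (\<lambda>y. kern H y x)"

definition fnorm :: "'a rkhs \<Rightarrow> ('a \<Rightarrow> complex) \<Rightarrow> real" where
  "fnorm H f = sqrt (Re (ip H f f))"

definition is_rkhs :: "'a rkhs \<Rightarrow> bool" where
  "is_rkhs H \<longleftrightarrow>
     \<comment> \<open>a complex vector space of functions on \<open>pts H\<close>\<close>
     (\<forall>f\<in>funs H. restr (pts H) f = f) \<and>
     (\<lambda>_. 0) \<in> funs H \<and>
     (\<forall>f\<in>funs H. \<forall>g\<in>funs H. \<forall>a b. (\<lambda>x. a * f x + b * g x) \<in> funs H) \<and>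
     \<comment> \<open>an inner product, linear in the first argument\<close>
     (\<forall>f\<in>funs H. \<forall>g\<in>funs H. \<forall>h\<in>funs H. \<forall>a b.
        ip H (\<lambda>x. a * f x + b * g x) h = a * ip H f h + b * ip H g h) \<and>
     (\<forall>f\<in>funs H. \<forall>g\<in>funs H. ip H g f = cnj (ip H f g)) \<and>
     (\<forall>f\<in>funs H. 0 \<le> Re (ip H f f) \<and> (ip H f f = 0 \<longrightarrow> f = (\<lambda>_. 0))) \<and>
     (\<forall>f g. f \<notin> funs H \<or> g \<notin> funs H \<longrightarrow> ip H f g = 0) \<and>
     \<comment> \<open>completeness\<close>
     (\<forall>s. (\<forall>i::nat. s i \<in> funs H) \<and>
          (\<forall>e>0. \<exists>N. \<forall>i\<ge>N. \<forall>j\<ge>N. fnorm H (\<lambda>x. s i x - s j x) < e) \<longrightarrow>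
          (\<exists>f\<in>funs H. (\<lambda>i. fnorm H (\<lambda>x. s i x - f x)) \<longlonglongrightarrow> 0)) \<and>
     \<comment> \<open>the reproducing property\<close>
     (\<forall>x y. x \<notin> pts H \<or> y \<notin> pts H \<longrightarrow> kern H x y = 0) \<and>
     (\<forall>x\<in>pts H. kfun H x \<in> funs H \<and> (\<forall>f\<in>funs H. f x = ip H f (kfun H x)))"

text \<open>The RKHS on \<open>X\<close> whose kernel is the restriction of \<open>k\<close> to \<open>X \<times> X\<close>; it exists and is
  unique for positive semidefinite \<open>k\<close> (Moore--Aronszajn).\<close>
definition rkhs_of :: "'a set \<Rightarrow> ('a \<Rightarrow> 'a \<Rightarrow> complex) \<Rightarrow> 'a rkhs" where
  "rkhs_of X k = (THE H. is_rkhs H \<and> pts H = X \<and> (\<forall>x\<in>X. \<forall>y\<in>X. kern H x y = k x y))"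

definition da_kernel :: "ell2 \<Rightarrow> ell2 \<Rightarrow> complex" where
  "da_kernel z w = 1 / (1 - cinner z w)"

definition drury_arveson :: "enat \<Rightarrow> ell2 rkhs" where
  "drury_arveson d = rkhs_of (Bd d) da_kernel"

definition da_restrict :: "ell2 set \<Rightarrow> ell2 rkhs" where
  "da_restrict X = rkhs_of X da_kernel"


section \<open>Operator norms and isomorphisms of RKHSs\<close>

text \<open>All operator norms take values in \<open>[0, \<infinity>]\<close>; finiteness is boundedness.\<close>

definition opnorm :: "'v set \<Rightarrow> ('v \<Rightarrow> ennreal) \<Rightarrow> ('w \<Rightarrow> ennreal) \<Rightarrow> ('v \<Rightarrow> 'w) \<Rightarrow> ennreal" where
  "opnorm V N1 N2 T = (SUP v\<in>{v\<in>V. N1 v \<le> 1}. N2 (T v))"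

definition rk_norm :: "'a rkhs \<Rightarrow> 'b rkhs \<Rightarrow> (('a \<Rightarrow> complex) \<Rightarrow> ('b \<Rightarrow> complex)) \<Rightarrow> ennreal" where
  "rk_norm H1 H2 T = opnorm (funs H1) (\<lambda>f. ennreal (fnorm H1 f)) (\<lambda>f. ennreal (fnorm H2 f)) T"

definition linear_between ::
    "('a \<Rightarrow> complex) set \<Rightarrow> (('a \<Rightarrow> complex) \<Rightarrow> ('b \<Rightarrow> complex)) \<Rightarrow> bool" where
  "linear_between V T \<longleftrightarrow>
    (\<forall>f\<in>V. \<forall>g\<in>V. \<forall>a b. T (\<lambda>x. a * f x + b * g x) = (\<lambda>y. a * T f y + b * T g y))"

definition rkhs_iso :: "'a rkhs \<Rightarrow> 'b rkhs \<Rightarrow> (('a \<Rightarrow> complex) \<Rightarrow> ('b \<Rightarrow> complex)) \<Rightarrow> bool" where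
  "rkhs_iso H1 H2 T \<longleftrightarrow>
     bij_betw T (funs H1) (funs H2) \<and> linear_between (funs H1) T \<and> rk_norm H1 H2 T < \<infinity> \<and>
     (\<exists>F lam. bij_betw F (pts H1) (pts H2) \<and>
        (\<forall>x\<in>pts H1. lam x \<noteq> 0 \<and> T (kfun H1 x) = (\<lambda>y. lam x * kfun H2 (F x) y)))"

definition delta_RK :: "'a rkhs \<Rightarrow> 'b rkhs \<Rightarrow> ennreal" where
  "delta_RK H1 H2 =
    (INF T\<in>{T. rkhs_iso H1 H2 T}. rk_norm H1 H2 T * rk_norm H2 H1 (inv_into (funs H1) T))"

definition ext_log :: "ennreal \<Rightarrow> ereal" where
  "ext_log a = (if a = \<infinity> then \<infinity> else if a = 0 then - \<infinity> else ereal (ln (enn2real a)))"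

definition rho_RK :: "'a rkhs \<Rightarrow> 'b rkhs \<Rightarrow> ereal" where
  "rho_RK H1 H2 = ext_log (delta_RK H1 H2)"


section \<open>Multiplier algebras\<close>

definition Mult :: "'a rkhs \<Rightarrow> ('a \<Rightarrow> complex) set" where
  "Mult H = {f. restr (pts H) f = f \<and> (\<forall>h\<in>funs H. (\<lambda>x. f x * h x) \<in> funs H)}"

text \<open>The norm of an \<open>m \<times> m\<close> matrix of multipliers as an operator on the \<open>m\<close>-fold direct sum of
  \<open>H\<close>; only indices below \<open>m\<close> are relevant.\<close>

definition tuple_norm :: "'a rkhs \<Rightarrow> nat \<Rightarrow> (nat \<Rightarrow> 'a \<Rightarrow> complex) \<Rightarrow> ennreal" where
  "tuple_norm H m h = ennreal (sqrt (\<Sum>i<m. (fnorm H (h i))\<^sup>2))"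

definition mat_mult_norm :: "'a rkhs \<Rightarrow> nat \<Rightarrow> (nat \<Rightarrow> nat \<Rightarrow> 'a \<Rightarrow> complex) \<Rightarrow> ennreal" where
  "mat_mult_norm H m A =
    opnorm {h. \<forall>i<m. h i \<in> funs H} (tuple_norm H m) (tuple_norm H m)
      (\<lambda>h i x. \<Sum>j<m. A i j x * h j x)"

text \<open>The norm of \<open>\<phi> \<otimes> id\<close> on \<open>m \<times> m\<close> matrices, and the completely bounded norm.\<close>

definition amp_norm ::
    "'a rkhs \<Rightarrow> 'b rkhs \<Rightarrow> nat \<Rightarrow> (('a \<Rightarrow> complex) \<Rightarrow> ('b \<Rightarrow> complex)) \<Rightarrow> ennreal" where
  "amp_norm H1 H2 m \<phi> =
    opnorm {A. \<forall>i<m. \<forall>j<m. A i j \<in> Mult H1} (mat_mult_norm H1 m) (mat_mult_norm H2 m)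
      (\<lambda>A i j. \<phi> (A i j))"

definition cb_norm ::
    "'a rkhs \<Rightarrow> 'b rkhs \<Rightarrow> (('a \<Rightarrow> complex) \<Rightarrow> ('b \<Rightarrow> complex)) \<Rightarrow> ennreal" where
  "cb_norm H1 H2 \<phi> = (SUP m\<in>{1..}. amp_norm H1 H2 m \<phi>)"

definition alg_iso :: "'a rkhs \<Rightarrow> 'b rkhs \<Rightarrow> (('a \<Rightarrow> complex) \<Rightarrow> ('b \<Rightarrow> complex)) \<Rightarrow> bool" where
  "alg_iso H1 H2 \<phi> \<longleftrightarrow>
     bij_betw \<phi> (Mult H1) (Mult H2) \<and> linear_between (Mult H1) \<phi> \<and>
     (\<forall>f\<in>Mult H1. \<forall>g\<in>Mult H1. \<phi> (\<lambda>x. f x * g x) = (\<lambda>y. \<phi> f y * \<phi> g y))"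

definition cb_distortion ::
    "'a rkhs \<Rightarrow> 'b rkhs \<Rightarrow> (('a \<Rightarrow> complex) \<Rightarrow> ('b \<Rightarrow> complex)) \<Rightarrow> ennreal" where
  "cb_distortion H1 H2 \<phi> = cb_norm H1 H2 \<phi> * cb_norm H2 H1 (inv_into (Mult H1) \<phi>)"

definition mult_alg_iso :: "'a rkhs \<Rightarrow> 'b rkhs \<Rightarrow> (('a \<Rightarrow> complex) \<Rightarrow> ('b \<Rightarrow> complex)) \<Rightarrow> bool" where
  "mult_alg_iso H1 H2 \<phi> \<longleftrightarrow>
     alg_iso H1 H2 \<phi> \<and>
     (\<exists>G. bij_betw G (pts H2) (pts H1) \<and> (\<forall>f\<in>Mult H1. \<phi> f = restr (pts H2) (f \<circ> G))) \<and>
     cb_norm H1 H2 \<phi> < \<infinity> \<and> cb_norm H2 H1 (inv_into (Mult H1) \<phi>) < \<infinity>"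

definition delta_M :: "'a rkhs \<Rightarrow> 'b rkhs \<Rightarrow> ennreal" where
  "delta_M H1 H2 = (INF \<phi>\<in>{\<phi>. mult_alg_iso H1 H2 \<phi>}. cb_distortion H1 H2 \<phi>)"

definition rho_M :: "'a rkhs \<Rightarrow> 'b rkhs \<Rightarrow> ereal" where
  "rho_M H1 H2 = ext_log (delta_M H1 H2)"


section \<open>Vector valued multipliers and the multiplier discrepancy\<close>

definition vcomp :: "enat \<Rightarrow> (ell2 \<Rightarrow> ell2) \<Rightarrow> nat \<Rightarrow> ell2 \<Rightarrow> complex" where
  "vcomp d F i = restr (Bd d) (\<lambda>z. coord (F z) i)"

text \<open>The Hilbert space direct sum of \<open>d\<close> copies of the Drury--Arveson space.\<close>

definition da_sum :: "enat \<Rightarrow> (nat \<Rightarrow> ell2 \<Rightarrow> complex) set" where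
  "da_sum d = {h. (\<forall>i. h i \<in> funs (drury_arveson d)) \<and> (\<forall>i. d \<le> enat i \<longrightarrow> h i = (\<lambda>_. 0))
      \<and> summable (\<lambda>i. (fnorm (drury_arveson d) (h i))\<^sup>2)}"

definition da_sum_norm :: "enat \<Rightarrow> (nat \<Rightarrow> ell2 \<Rightarrow> complex) \<Rightarrow> ennreal" where
  "da_sum_norm d h = ennreal (sqrt (\<Sum>i. (fnorm (drury_arveson d) (h i))\<^sup>2))"

text \<open>The series is taken pointwise. It converges absolutely, since \<open>F z\<close> is square summable and
  \<open>\<bar>h\<^sub>i z\<bar> \<le> \<parallel>h\<^sub>i\<parallel> \<parallel>k\<^sub>z\<parallel>\<close>. If it defines a bounded operator, then it also converges in norm.\<close>

definition row_op :: "enat \<Rightarrow> (ell2 \<Rightarrow> ell2) \<Rightarrow> (nat \<Rightarrow> ell2 \<Rightarrow> complex) \<Rightarrow> ell2 \<Rightarrow> complex" where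
  "row_op d F h = (\<lambda>z. \<Sum>i. vcomp d F i z * h i z)"

definition vmult_norm :: "enat \<Rightarrow> (ell2 \<Rightarrow> ell2) \<Rightarrow> ennreal" where
  "vmult_norm d F =
    opnorm (da_sum d) (da_sum_norm d) (\<lambda>f. ennreal (fnorm (drury_arveson d) f)) (row_op d F)"

definition vmult :: "enat \<Rightarrow> (ell2 \<Rightarrow> ell2) \<Rightarrow> bool" where
  "vmult d F \<longleftrightarrow>
     (\<forall>z\<in>Bd d. F z \<in> Cd d) \<and>
     (\<forall>i. vcomp d F i \<in> Mult (drury_arveson d)) \<and>
     (\<forall>h\<in>da_sum d. row_op d F h \<in> funs (drury_arveson d)) \<and>
     vmult_norm d F < \<infinity>"

definition delta_mult :: "enat \<Rightarrow> ell2 set \<Rightarrow> ell2 set \<Rightarrow> ennreal" where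
  "delta_mult d X Y =
    (INF (F, G)\<in>{(F, G). vmult d F \<and> vmult d G \<and> bij_betw F X Y \<and> (\<forall>x\<in>X. G (F x) = x)}.
       max (vmult_norm d F) (vmult_norm d G))"

end

theory Submission
  imports Defs "HOL-Complex_Analysis.Conformal_Mappings"
begin

text \<open>By Cartan's theorem an automorphism of the ball is an involution \<^term>\<open>ball_inv\<close> followed or
  preceded by a linear isometry, so it multiplies the Drury--Arveson kernel by \<open>g z * cnj (g w)\<close> with
  a nowhere vanishing \<open>g\<close>.

  If automorphic images of the points of \<open>Y\<^sup>k\<close> converge to those of \<open>X\<close>, then, up to such
  factors, the kernel matrices converge, so the obvious maps between kernel functions are almost
  isometric. The adjoint of an RKHS isomorphism is a weighted composition operator, which implements
  a similarity between the multiplier algebras; this bounds \<^term>\<open>delta_M\<close> by the square of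
  \<^term>\<open>delta_RK\<close>. Conversely, the row with the components of \<^term>\<open>ball_inv (x 0)\<close> is a
  contractive multiplier. A composition isomorphism with norms close to 1 turns it into a row of norm
  close to 1 on \<open>Y\<^sup>k\<close>; positivity of the resulting Pick matrix on three points, one of them moved
  to the origin, forces the Gram matrices of the normalised point sets to converge, and vectors with
  almost equal Gram matrices are almost unitarily equivalent. Algebra isomorphisms need not be treated
  separately, because those between algebras of all functions on finite sets are composition maps.

  For the multiplier discrepancy, an automorphism is a contractive vector valued multiplier, and adding
  a small combination of Lagrange polynomials corrects its values at the \<open>n\<close> points. The discrepancy
  is never below 1, since multipliers of norm below 1 strictly decrease pseudohyperbolic distances.\<close>

section \<open>The Hilbert space and the involutions of the ball\<close>

text \<open>\<open>rkhs_of\<close> is a definite description, so existence and uniqueness of the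
  space of a kernel must be established before anything can be said about it, and for the whole
  ball, not only for finite sets. Afterwards operators are replaced by quadratic forms in finitely
  supported coefficients: a row is bounded by \<open>C\<close> exactly when its adjoint is, which
  multiplies coefficients by conjugate values, and this is positivity of
  \<open>(C^2 - cinner (F u) (F v)) * da_kernel u v\<close>. Multipliers, automorphisms and Pick
  matrices are all treated in this form.

  Since \<open>d\<close> may be infinite, no compactness is available. Unitaries with convergent
  images are built from explicit reflections, and the smallest eigenvalue of a Gram matrix is
  replaced by multiplier norms of Lagrange polynomials. The points of \<open>y k\<close> may run to
  the boundary, so estimates are made after an automorphism has brought them near \<open>x\<close>,
  where these norms stay bounded.

  The infima take values in \<open>ennreal\<close>, where zero times infinity is zero; the lower
  bounds 1 rule this case out and turn convergence to 1 into upper bounds alone.\<close>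

lemma cinner_commute: "cinner w z = cnj (cinner z w)"
  unfolding cinner_def
  using summable_sums[OF summable_coord_prod[of z w], THEN sums_cnj[THEN iffD2], THEN sums_unique]
  by (simp add: mult.commute)

lemma cinner_add_left: "cinner (x + y) z = cinner x z + cinner y z"
  unfolding cinner_def
  by (simp add: coord_ops distrib_right suminf_add[OF summable_coord_prod summable_coord_prod])

lemma cinner_cscale_left: "cinner (cscale c x) z = c * cinner x z"
  unfolding cinner_def
  by (simp add: coord_ops mult.assoc suminf_mult[OF summable_coord_prod])

lemma cscale_of_real: "cscale (of_real r) z = r *\<^sub>R z"
  by (rule ell2_eqI) (simp add: coord_ops)

lemma cinner_scaleR_left: "cinner (r *\<^sub>R x) z = of_real r * cinner x z"
  by (simp flip: cscale_of_real add: cinner_cscale_left)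

lemma cinner_minus_left: "cinner (- x) z = - cinner x z"
  using cinner_scaleR_left[of "-1"] by simp

lemma cinner_diff_left: "cinner (x - y) z = cinner x z - cinner y z"
  using cinner_add_left[of x "- y" z] by (simp add: cinner_minus_left)

lemma cinner_zero_left: "cinner 0 z = 0"
  using cinner_scaleR_left[of 0 z] by simp

lemma cinner_add_right: "cinner z (x + y) = cinner z x + cinner z y"
  by (metis cinner_add_left cinner_commute complex_cnj_add)

lemma cinner_cscale_right: "cinner z (cscale c x) = cnj c * cinner z x"
  by (metis cinner_cscale_left cinner_commute complex_cnj_mult)

lemma cinner_scaleR_right: "cinner z (r *\<^sub>R x) = of_real r * cinner z x"
  by (simp flip: cscale_of_real add: cinner_cscale_right)

lemma cinner_minus_right: "cinner z (- x) = - cinner z x"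
  using cinner_scaleR_right[of z "-1"] by simp

lemma cinner_diff_right: "cinner z (x - y) = cinner z x - cinner z y"
  using cinner_add_right[of z x "- y"] by (simp add: cinner_minus_right)

lemma cinner_zero_right: "cinner z 0 = 0"
  using cinner_scaleR_right[of z 0] by simp

lemmas cinner_simps = cinner_add_left cinner_cscale_left cinner_scaleR_left cinner_minus_left
  cinner_diff_left cinner_zero_left cinner_add_right cinner_cscale_right cinner_scaleR_right
  cinner_minus_right cinner_diff_right cinner_zero_right

lemma cinner_sum_left: "cinner (\<Sum>i\<in>I. f i) z = (\<Sum>i\<in>I. cinner (f i) z)"
  by (induction I rule: infinite_finite_induct) (simp_all add: cinner_simps)

lemma cinner_sum_right: "cinner z (\<Sum>i\<in>I. f i) = (\<Sum>i\<in>I. cinner z (f i))"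
  by (induction I rule: infinite_finite_induct) (simp_all add: cinner_simps)

lemma cinner_norm: "cinner z z = of_real ((norm z)\<^sup>2)"
proof -
  have "0 \<le> (\<Sum>i. (cmod (coord z i))\<^sup>2)" by (intro suminf_nonneg summable_coord) simp
  then show ?thesis by (simp add: cinner_self norm_ell2)
qed

lemma cinner_eq_zero_iff: "cinner z z = 0 \<longleftrightarrow> z = 0"
  by (simp add: cinner_norm)

lemma norm_power2_cinner: "(norm z)\<^sup>2 = Re (cinner z z)"
  by (simp add: cinner_norm)

lemma norm_cscale: "norm (cscale c z) = cmod c * norm z"
proof -
  have "cinner (cscale c z) (cscale c z) = (c * cnj c) * cinner z z"
    by (simp only: cinner_cscale_left cinner_cscale_right ac_simps)
  also have "\<dots> = of_real ((cmod c * norm z)\<^sup>2)"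
    unfolding complex_norm_square[symmetric] cinner_norm by (simp add: power_mult_distrib)
  finally have "(norm (cscale c z))\<^sup>2 = (cmod c * norm z)\<^sup>2"
    by (simp only: cinner_norm of_real_eq_iff)
  then show ?thesis by (meson norm_ge_zero mult_nonneg_nonneg power2_eq_imp_eq)
qed

lemma cscale_simps:
  "cscale a (cscale b z) = cscale (a * b) z"
  "cscale 1 z = z"
  "cscale 0 z = 0"
  "cscale a 0 = 0"
  "cscale a (z + w) = cscale a z + cscale a w"
  "cscale a (z - w) = cscale a z - cscale a w"
  "cscale a (- z) = - cscale a z"
  "cscale (- a) z = - cscale a z"
  "cscale (a + b) z = cscale a z + cscale b z"
  "cscale (a - b) z = cscale a z - cscale b z"
  "cscale a (r *\<^sub>R z) = r *\<^sub>R cscale a z"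
  "cscale (r *\<^sub>R a) z = r *\<^sub>R cscale a z"
  by (rule ell2_eqI; simp add: coord_ops algebra_simps scaleR_conv_of_real)+

lemma cscale_sum: "cscale a (\<Sum>i\<in>I. f i) = (\<Sum>i\<in>I. cscale a (f i))"
  by (induction I rule: infinite_finite_induct) (simp_all add: cscale_simps)

lemma cinner_Cauchy_Schwarz: "cmod (cinner z w) \<le> norm z * norm w"
proof -
  \<comment> \<open>Rotating \<open>z\<close> by this phase makes the pairing real and nonnegative,
    which reduces the claim to the inequality of the real inner product. If
    \<open>cinner z w\<close> vanishes, the factor is 0.\<close>
  let ?c = "cnj (sgn (cinner z w))"
  have "cinner (cscale ?c z) w = of_real (cmod (cinner z w))"
    using complex_norm_square[of "cinner z w"]
    by (cases "cinner z w = 0")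
      (simp_all add: cinner_cscale_left sgn_eq power2_eq_square mult.commute field_simps)
  then have "cmod (cinner z w) = inner (cscale ?c z) w" by (simp add: inner_ell2_def)
  also have "\<dots> \<le> norm (cscale ?c z) * norm w" by (rule norm_cauchy_schwarz)
  also have "\<dots> \<le> norm z * norm w"
    by (intro mult_right_mono) (auto simp: norm_cscale norm_sgn)
  finally show ?thesis .
qed

lemma bounded_bilinear_cinner: "bounded_bilinear cinner"
  by standard (auto simp: cinner_simps scaleR_conv_of_real intro!: exI[of _ 1] cinner_Cauchy_Schwarz)

lemma bounded_bilinear_cscale: "bounded_bilinear cscale"
  by standard (auto simp: cscale_simps norm_cscale intro!: exI[of _ 1])

lemma norm_add_cinner: "(norm (z + w))\<^sup>2 = (norm z)\<^sup>2 + 2 * Re (cinner z w) + (norm w)\<^sup>2"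
proof -
  have "Re (cinner w z) = Re (cinner z w)" using cinner_commute[of w z] by simp
  then show ?thesis by (simp add: norm_power2_cinner cinner_simps)
qed

lemma norm_diff_cinner: "(norm (z - w))\<^sup>2 = (norm z)\<^sup>2 - 2 * Re (cinner z w) + (norm w)\<^sup>2"
  using norm_add_cinner[of z "- w"] by (simp add: cinner_simps)

lemma coord_sum: "coord (\<Sum>i\<in>I. f i) l = (\<Sum>i\<in>I. coord (f i) l)"
  by (induction I rule: infinite_finite_induct) (simp_all add: coord_ops)

lemma Cd_closed:
  "0 \<in> Cd d"
  "z \<in> Cd d \<Longrightarrow> w \<in> Cd d \<Longrightarrow> z + w \<in> Cd d"
  "z \<in> Cd d \<Longrightarrow> w \<in> Cd d \<Longrightarrow> z - w \<in> Cd d"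
  "z \<in> Cd d \<Longrightarrow> cscale c z \<in> Cd d"
  "z \<in> Cd d \<Longrightarrow> r *\<^sub>R z \<in> Cd d"
  by (auto simp: Cd_def coord_ops)

lemma Cd_sum: "(\<And>i. i \<in> I \<Longrightarrow> f i \<in> Cd d) \<Longrightarrow> (\<Sum>i\<in>I. f i) \<in> Cd d"
  by (induction I rule: infinite_finite_induct) (auto simp: Cd_closed)

lemma Bd_D: "z \<in> Bd d \<Longrightarrow> z \<in> Cd d" "z \<in> Bd d \<Longrightarrow> norm z < 1"
  by (auto simp: Bd_def)

lemma zero_in_Bd: "0 \<in> Bd d"
  by (simp add: Bd_def Cd_closed)

lemma cinner_ball_lt_1:
  assumes "norm z < 1" "norm w < 1"
  shows "cmod (cinner z w) < 1"
proof -
  have "norm z * norm w \<le> norm z" using assms by (intro mult_left_le) auto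
  then show ?thesis using cinner_Cauchy_Schwarz[of z w] assms by linarith
qed

lemma one_minus_cinner_neq_0:
  assumes "norm z < 1" "norm w < 1"
  shows "1 - cinner z w \<noteq> 0"
  using cinner_ball_lt_1[OF assms] by auto

section \<open>Orthogonal projections and the involutions of the ball\<close>

text \<open>Kept free of the denominator \<open>cinner a a\<close>, so that \<open>a = 0\<close> is
  covered. It trades the product of projections in \<open>cinner_ball_inv\<close> for
  \<open>cinner z a * cinner a w\<close>.\<close>

lemma span_proj_cinner:
  "cinner z a * cinner a w = cinner a a * cinner (span_proj a z) (span_proj a w)"
proof (cases "a = 0")
  case False
  then have "cinner a a \<noteq> 0" by (simp add: cinner_eq_zero_iff)
  moreover have "cnj (cinner a a) = cinner a a" "cnj (cinner w a) = cinner a w"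
    by (rule cinner_commute[symmetric])+
  ultimately show ?thesis by (simp add: span_proj_def cinner_simps)
qed (simp add: cinner_simps)

lemma cinner_span_proj_self: "cinner (span_proj a z) a = cinner z a" "cinner a (span_proj a z) = cinner a z"
proof -
  have *: "cnj (cinner a a) = cinner a a" "cnj (cinner z a) = cinner a z"
    by (rule cinner_commute[symmetric])+
  show "cinner (span_proj a z) a = cinner z a"
    by (cases "a = 0") (simp_all add: span_proj_def cinner_simps cinner_eq_zero_iff)
  show "cinner a (span_proj a z) = cinner a z"
    by (cases "a = 0") (simp_all add: span_proj_def cinner_simps cinner_eq_zero_iff *)
qed

lemma cinner_span_proj:
  "cinner (span_proj a z) w = cinner (span_proj a z) (span_proj a w)"
  "cinner z (span_proj a w) = cinner (span_proj a z) (span_proj a w)"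
proof -
  have *: "cinner (span_proj a z) w = cinner (span_proj a z) (span_proj a w)" for z w
    using cinner_span_proj_self(2)[of a w] by (simp add: span_proj_def[of a z] cinner_cscale_left)
  show "cinner (span_proj a z) w = cinner (span_proj a z) (span_proj a w)" by (rule *)
  show "cinner z (span_proj a w) = cinner (span_proj a z) (span_proj a w)"
    using *[of w z] cinner_commute by metis
qed

text \<open>Expand both numerators along \<open>a\<close> and its orthogonal complement:
  \<open>span_proj a\<close> is a self-adjoint projection, so mixed terms vanish, and the factor
  \<open>?s\<close> enters only through \<open>?s * ?s = 1 - cinner a a\<close>. What remains
  factors over the two denominators. All invariance properties below descend from this
  identity.\<close>

lemma cinner_ball_inv:
  assumes a: "norm a < 1" and z: "norm z < 1" and w: "norm w < 1"
  shows "1 - cinner (ball_inv a z) (ball_inv a w) =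
    of_real (1 - (norm a)\<^sup>2) * (1 - cinner z w) / ((1 - cinner z a) * (1 - cinner a w))"
proof -
  let ?s = "sqrt (1 - (norm a)\<^sup>2)"
  let ?n = "\<lambda>z. a - span_proj a z - ?s *\<^sub>R (z - span_proj a z)"
  let ?p = "cinner (span_proj a z) (span_proj a w)"
  have s2: "complex_of_real ?s * complex_of_real ?s = 1 - cinner a a"
    using a by (simp add: cinner_norm abs_square_le_1 flip: of_real_mult)
  have "cinner (?n z) (?n w) = cinner a a - cinner a w - cinner z a + ?p
      + (complex_of_real ?s * complex_of_real ?s) * (cinner z w - ?p)"
    unfolding cinner_simps cinner_span_proj_self
    unfolding cinner_span_proj(1)[of a z w] cinner_span_proj(2)[of z a w] complex_cnj_complex_of_real
    by algebra
  also have "\<dots> = cinner a a - cinner a w - cinner z a + ?p + (1 - cinner a a) * (cinner z w - ?p)"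
    unfolding s2 ..
  also have "\<dots> = cinner a a - cinner a w - cinner z a + (1 - cinner a a) * cinner z w + cinner z a * cinner a w"
    using span_proj_cinner[of z a w] by (simp add: algebra_simps)
  finally have n: "cinner (?n z) (?n w) = \<dots>" .
  have nz: "1 - cinner z a \<noteq> 0" "1 - cinner a w \<noteq> 0"
    using one_minus_cinner_neq_0 a z w by auto
  have "cnj (1 - cinner w a) = 1 - cinner a w" using cinner_commute[of a w] by simp
  then have "cinner (ball_inv a z) (ball_inv a w) = cinner (?n z) (?n w) / ((1 - cinner z a) * (1 - cinner a w))"
    by (simp add: ball_inv_def cinner_cscale_left cinner_cscale_right)
  moreover have "complex_of_real (1 - (norm a)\<^sup>2) = 1 - cinner a a" by (simp add: cinner_norm)
  ultimately show ?thesis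
    using nz unfolding n by (simp add: divide_simps) (simp add: algebra_simps)
qed

lemma ball_inv_in_Cd: "a \<in> Cd d \<Longrightarrow> z \<in> Cd d \<Longrightarrow> ball_inv a z \<in> Cd d"
  unfolding ball_inv_def span_proj_def by (intro Cd_closed)

lemma one_minus_ball_inv_norm:
  assumes a: "norm a < 1" and z: "norm z < 1"
  shows "1 - (norm (ball_inv a z))\<^sup>2 = (1 - (norm a)\<^sup>2) * (1 - (norm z)\<^sup>2) / (cmod (1 - cinner z a))\<^sup>2"
proof -
  have "cnj (1 - cinner z a) = 1 - cinner a z" using cinner_commute[of a z] by simp
  then have "(1 - cinner z a) * (1 - cinner a z) = of_real ((cmod (1 - cinner z a))\<^sup>2)"
    by (metis complex_norm_square)
  then have "complex_of_real (1 - (norm (ball_inv a z))\<^sup>2)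
      = of_real ((1 - (norm a)\<^sup>2) * (1 - (norm z)\<^sup>2) / (cmod (1 - cinner z a))\<^sup>2)"
    using cinner_ball_inv[OF a z z] by (simp add: cinner_norm)
  then show ?thesis using of_real_eq_iff by blast
qed

lemma ball_inv_in_Bd:
  assumes "a \<in> Bd d" "z \<in> Bd d"
  shows "ball_inv a z \<in> Bd d"
proof -
  have "0 < 1 - (norm (ball_inv a z))\<^sup>2"
    using assms one_minus_cinner_neq_0[of z a]
    by (subst one_minus_ball_inv_norm) (auto simp: Bd_def power_less_one_iff)
  then show ?thesis using assms by (auto simp: Bd_def ball_inv_in_Cd power_less_one_iff)
qed

text \<open>The components along \<open>a\<close> and orthogonal to \<open>a\<close> are followed
  separately. The second denominator, \<open>t * (1 - cinner a a)\<close>, and the square of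
  \<open>?s\<close> on the orthogonal component produce the same factor, which cancels.\<close>

lemma ball_inv_ball_inv:
  assumes a: "norm a < 1" and z: "norm z < 1"
  shows "ball_inv a (ball_inv a z) = z"
proof -
  let ?s = "sqrt (1 - (norm a)\<^sup>2)" and ?P = "span_proj a"
  define t where "t = 1 / (1 - cinner z a)"
  define Q where "Q = z - ?P z"
  have nz: "1 - cinner z a \<noteq> 0" using one_minus_cinner_neq_0 a z by auto
  have s0: "?s \<noteq> 0" using a by (simp add: power_less_one_iff abs_square_eq_1)
  have s2: "complex_of_real ?s * complex_of_real ?s = 1 - cinner a a"
    using a by (simp add: cinner_norm abs_square_le_1 flip: of_real_mult)
  have w: "ball_inv a z = cscale t (a - ?P z - ?s *\<^sub>R Q)" by (simp add: ball_inv_def t_def Q_def)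
  have Qa: "cinner Q a = 0" by (simp add: Q_def cinner_simps cinner_span_proj_self)
  have wa: "cinner (ball_inv a z) a = t * (cinner a a - cinner z a)"
    unfolding w by (simp add: cinner_simps cinner_span_proj_self Qa)
  have wa1: "1 - cinner (ball_inv a z) a = t * (1 - cinner a a)"
    unfolding wa using nz by (simp add: t_def field_simps)
  have Pw: "?P (ball_inv a z) = cscale t (a - ?P z)"
  proof (cases "a = 0")
    case False
    then have n: "cinner a a \<noteq> 0" by (simp add: cinner_eq_zero_iff)
    have "cscale (t * (cinner a a - cinner z a) / cinner a a) a = cscale t (a - cscale (cinner z a / cinner a a) a)"
      using n by (intro ell2_eqI) (simp add: coord_ops field_simps)
    then show ?thesis by (simp only: span_proj_def wa)
  qed (simp add: span_proj_def cscale_simps cinner_simps)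
  have Qw: "ball_inv a z - ?P (ball_inv a z) = - (?s *\<^sub>R cscale t Q)"
    unfolding Pw unfolding w by (simp add: cscale_simps)
  have t0: "t \<noteq> 0" using nz by (simp add: t_def)
  have Pz: "cscale (cinner z a) a = cscale (cinner a a) (?P z)"
    by (cases "a = 0") (simp_all add: span_proj_def cscale_simps cinner_eq_zero_iff)
  have it: "1 / t = 1 - cinner z a" by (simp add: t_def)
  have n1: "1 - cinner a a \<noteq> 0" using s2 s0 by (metis mult_eq_0_iff of_real_eq_0_iff)
  let ?r = "1 / (t * (1 - cinner a a))"
  have "ball_inv a (ball_inv a z) = cscale ?r (a - cscale t (a - ?P z) - ?s *\<^sub>R (- (?s *\<^sub>R cscale t Q)))"
    unfolding ball_inv_def[of a "ball_inv a z"] wa1 Qw unfolding Pw ..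
  also have "\<dots> = cscale (1 / (1 - cinner a a)) (cscale (1 / t) a - a + ?P z) + Q"
  proof (rule ell2_eqI)
    fix i
    define \<sigma> where "\<sigma> = complex_of_real ?s"
    have "\<sigma> * - (\<sigma> * (t * coord Q i)) = - (1 - cinner a a) * t * coord Q i"
      using s2 unfolding \<sigma>_def by algebra
    then show "coord (cscale ?r (a - cscale t (a - ?P z) - ?s *\<^sub>R (- (?s *\<^sub>R cscale t Q)))) i
        = coord (cscale (1 / (1 - cinner a a)) (cscale (1 / t) a - a + ?P z) + Q) i"
      unfolding coord_ops coord_cscale \<sigma>_def[symmetric]
      using t0 n1 by (simp add: divide_simps) (simp add: algebra_simps)
  qed
  also have "cscale (1 / t) a - a + ?P z = cscale (1 - cinner a a) (?P z)"
    unfolding it by (simp add: cscale_simps Pz)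
  finally show ?thesis using n1 by (simp only: cscale_simps(1) Q_def) (simp add: cscale_simps(2))
qed

lemma one_minus_rho_ph:
  assumes "norm z < 1" "norm w < 1"
  shows "1 - (rho_ph z w)\<^sup>2 = (1 - (norm w)\<^sup>2) * (1 - (norm z)\<^sup>2) / (cmod (1 - cinner z w))\<^sup>2"
  unfolding rho_ph_def by (rule one_minus_ball_inv_norm) (use assms in auto)

lemma rho_ph_nonneg: "0 \<le> rho_ph z w"
  by (simp add: rho_ph_def)

section \<open>Automorphisms of the ball\<close>

text \<open>\<open>inv_into\<close> agrees with a candidate for the inverse only on the ball, so
  holomorphy has to be transferable between functions that coincide there.\<close>

lemma ball_holomorphic_cong:
  assumes "\<And>z. z \<in> Bd d \<Longrightarrow> f z = g z"
  shows "ball_holomorphic d f \<longleftrightarrow> ball_holomorphic d g"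
  unfolding ball_holomorphic_def
  using assms by (intro ball_cong refl ex_cong1 conj_cong) (auto elim!: has_derivative_transform[rotated 2])

lemma ball_holomorphic_compose:
  assumes f: "ball_holomorphic d f" and g: "ball_holomorphic d g" and "f ` Bd d \<subseteq> Bd d"
  shows "ball_holomorphic d (g \<circ> f)"
  unfolding ball_holomorphic_def
proof
  fix z assume z: "z \<in> Bd d"
  obtain D where D: "(f has_derivative D) (at z within Bd d)" "\<And>c h. D (cscale c h) = cscale c (D h)"
    using f z unfolding ball_holomorphic_def by blast
  have "f z \<in> Bd d" using assms(3) z by auto
  then obtain E where E: "(g has_derivative E) (at (f z) within Bd d)" "\<And>c h. E (cscale c h) = cscale c (E h)"
    using g unfolding ball_holomorphic_def by blast
  have "(g has_derivative E) (at (f z) within f ` Bd d)"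
    by (rule has_derivative_subset[OF E(1) assms(3)])
  from diff_chain_within[OF D(1) this]
  show "\<exists>D. (g \<circ> f has_derivative D) (at z within Bd d) \<and> (\<forall>c h. D (cscale c h) = cscale c (D h))"
    using D(2) E(2) by (intro exI[of _ "E \<circ> D"]) simp
qed

lemma ball_AutI:
  assumes "f ` Bd d \<subseteq> Bd d" "g ` Bd d \<subseteq> Bd d"
    and "\<And>z. z \<in> Bd d \<Longrightarrow> g (f z) = z" "\<And>z. z \<in> Bd d \<Longrightarrow> f (g z) = z"
    and "ball_holomorphic d f" "ball_holomorphic d g"
  shows "f \<in> ball_Aut d"
proof -
  have b: "bij_betw f (Bd d) (Bd d)"
    by (rule bij_betw_byWitness[where f' = g]) (use assms in auto)
  have "inv_into (Bd d) f z = g z" if "z \<in> Bd d" for z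
    by (rule inv_into_f_eq) (use b assms that in \<open>auto simp: bij_betw_def\<close>)
  then show ?thesis
    using b assms(5,6) ball_holomorphic_cong[of d "inv_into (Bd d) f" g] by (simp add: ball_Aut_def)
qed

lemma ball_Aut_D:
  assumes "f \<in> ball_Aut d"
  shows "f ` Bd d = Bd d" "inj_on f (Bd d)" "ball_holomorphic d f"
  using assms by (auto simp: ball_Aut_def bij_betw_def)

lemma ball_Aut_obtain_inv:
  assumes "f \<in> ball_Aut d"
  obtains g where "g \<in> ball_Aut d" "g ` Bd d \<subseteq> Bd d" "f ` Bd d \<subseteq> Bd d"
    "\<And>z. z \<in> Bd d \<Longrightarrow> g (f z) = z" "\<And>z. z \<in> Bd d \<Longrightarrow> f (g z) = z"
    "ball_holomorphic d f" "ball_holomorphic d g"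
proof -
  let ?g = "inv_into (Bd d) f"
  have b: "bij_betw f (Bd d) (Bd d)" and h: "ball_holomorphic d f" "ball_holomorphic d ?g"
    using assms by (auto simp: ball_Aut_def)
  have i: "?g ` Bd d \<subseteq> Bd d" "f ` Bd d \<subseteq> Bd d"
    "\<And>z. z \<in> Bd d \<Longrightarrow> ?g (f z) = z" "\<And>z. z \<in> Bd d \<Longrightarrow> f (?g z) = z"
    using b bij_betw_inv_into[OF b] by (auto simp: bij_betw_def f_inv_into_f)
  moreover have "?g \<in> ball_Aut d" by (rule ball_AutI[of _ _ f]) (use i h in auto)
  ultimately show ?thesis using h that by blast
qed

lemma ball_Aut_compose:
  assumes f: "f \<in> ball_Aut d" and g: "g \<in> ball_Aut d"
  shows "g \<circ> f \<in> ball_Aut d"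
proof -
  from ball_Aut_obtain_inv[OF f] obtain f' where f': "f' \<in> ball_Aut d" "f' ` Bd d \<subseteq> Bd d" "f ` Bd d \<subseteq> Bd d"
    "\<And>z. z \<in> Bd d \<Longrightarrow> f' (f z) = z" "\<And>z. z \<in> Bd d \<Longrightarrow> f (f' z) = z"
    "ball_holomorphic d f" "ball_holomorphic d f'" by metis
  from ball_Aut_obtain_inv[OF g] obtain g' where g': "g' \<in> ball_Aut d" "g' ` Bd d \<subseteq> Bd d" "g ` Bd d \<subseteq> Bd d"
    "\<And>z. z \<in> Bd d \<Longrightarrow> g' (g z) = z" "\<And>z. z \<in> Bd d \<Longrightarrow> g (g' z) = z"
    "ball_holomorphic d g" "ball_holomorphic d g'" by metis
  show ?thesis
    by (rule ball_AutI[of _ _ "f' \<circ> g'"])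
      (use f' g' in \<open>auto intro!: ball_holomorphic_compose simp: image_subset_iff\<close>)
qed

lemma id_ball_Aut: "(\<lambda>z. z) \<in> ball_Aut d"
proof -
  have "ball_holomorphic d (\<lambda>z. z)"
    unfolding ball_holomorphic_def by (auto intro!: exI[of _ "\<lambda>h. h"])
  then show ?thesis by (intro ball_AutI[of _ _ "\<lambda>z. z"]) auto
qed

lemma ball_inv_holomorphic:
  assumes a: "a \<in> Bd d"
  shows "ball_holomorphic d (ball_inv a)"
  unfolding ball_holomorphic_def
proof
  fix z assume z: "z \<in> Bd d"
  let ?s = "sqrt (1 - (norm a)\<^sup>2)"
  let ?t = "1 - cinner z a"
  let ?N = "\<lambda>z. a - span_proj a z - ?s *\<^sub>R (z - span_proj a z)"
  have nz: "?t \<noteq> 0" using one_minus_cinner_neq_0 a z by (simp add: Bd_def)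
  note cinner_d = bounded_linear.has_derivative[OF
      bounded_bilinear.bounded_linear_left[OF bounded_bilinear_cinner]]
  have 1: "((\<lambda>z. 1 / (1 - cinner z a)) has_derivative (\<lambda>h. cinner h a / ?t\<^sup>2)) (at z within Bd d)"
    using nz by (auto intro!: derivative_eq_intros cinner_d simp: power2_eq_square field_simps)
  have P: "(span_proj a has_derivative span_proj a) (at z within Bd d)"
    unfolding span_proj_def[abs_def] divide_inverse
    by (auto intro!: derivative_eq_intros cinner_d bounded_linear.has_derivative[OF
          bounded_bilinear.bounded_linear_left[OF bounded_bilinear_cscale]])
  have 2: "(?N has_derivative (\<lambda>h. - span_proj a h - ?s *\<^sub>R (h - span_proj a h))) (at z within Bd d)"
    by (auto intro!: derivative_eq_intros P)
  have "(ball_inv a has_derivative (\<lambda>h. cscale (1 / ?t) (- span_proj a h - ?s *\<^sub>R (h - span_proj a h))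
      + cscale (cinner h a / ?t\<^sup>2) (?N z))) (at z within Bd d)"
    unfolding ball_inv_def[abs_def]
    by (rule bounded_bilinear.FDERIV[OF bounded_bilinear_cscale 1 2])
  moreover have "span_proj a (cscale c h) = cscale c (span_proj a h)" for c h
    by (simp add: span_proj_def cinner_simps cscale_simps)
  ultimately show "\<exists>D. (ball_inv a has_derivative D) (at z within Bd d) \<and> (\<forall>c h. D (cscale c h) = cscale c (D h))"
    by (intro exI conjI allI) (assumption, simp add: cscale_simps cinner_simps mult.commute)
qed

lemma ball_inv_ball_Aut: "a \<in> Bd d \<Longrightarrow> ball_inv a \<in> ball_Aut d"
  by (rule ball_AutI[of _ _ "ball_inv a"])
    (auto simp: ball_inv_in_Bd ball_inv_ball_inv Bd_D ball_inv_holomorphic)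

section \<open>Schwarz lemma and Cartan's theorem\<close>

lemma ball_inv_self: "norm a < 1 \<Longrightarrow> ball_inv a a = 0"
proof -
  assume a: "norm a < 1"
  have "span_proj a a = a" by (cases "a = 0") (simp_all add: span_proj_def cscale_simps cinner_eq_zero_iff)
  then show ?thesis by (simp add: ball_inv_def cscale_simps)
qed

lemma norm_ball_lt_1: "norm z < 1 \<Longrightarrow> norm (cscale c z) < 1" if "cmod c \<le> 1"
  using that mult_left_le_one_le[of "norm z" "cmod c"] by (simp add: norm_cscale)

text \<open>The parameters \<open>c\<close> form an open disc of the plane, so the derivative
  relative to \<open>Bd d\<close> becomes a full derivative along the line, and complex linearity of
  \<open>D\<close> makes it multiplication by a number.\<close>

lemma has_field_derivative_slice:
  assumes f: "ball_holomorphic d f" and u: "u \<in> Cd d" "norm u \<le> 1" and c: "cmod c < 1"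
  shows "(\<lambda>c. cinner (f (cscale c u)) v) field_differentiable (at c)"
proof -
  have in_B: "cscale e u \<in> Bd d" if "e \<in> ball 0 1" for e
  proof -
    have "cmod e * norm u \<le> cmod e" using u by (simp add: mult_left_le)
    then show ?thesis using that u by (simp add: Bd_def Cd_closed norm_cscale)
  qed
  obtain D where D: "(f has_derivative D) (at (cscale c u) within Bd d)" "\<And>c h. D (cscale c h) = cscale c (D h)"
    using f in_B[of c] c unfolding ball_holomorphic_def by auto
  have 1: "((\<lambda>c. cscale c u) has_derivative (\<lambda>h. cscale h u)) (at c within ball 0 1)"
    by (auto intro!: derivative_eq_intros bounded_linear.has_derivative[OF
          bounded_bilinear.bounded_linear_left[OF bounded_bilinear_cscale]])
  have "(f has_derivative D) (at (cscale c u) within (\<lambda>c. cscale c u) ` ball 0 1)"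
    by (rule has_derivative_subset[OF D(1)]) (use in_B in auto)
  from diff_chain_within[OF 1 this]
  have "((\<lambda>c. f (cscale c u)) has_derivative (\<lambda>h. D (cscale h u))) (at c within ball 0 1)"
    by (simp add: o_def)
  then have "((\<lambda>c. f (cscale c u)) has_derivative (\<lambda>h. D (cscale h u))) (at c)"
    using c by (simp add: at_within_open[of c "ball 0 1"])
  from bounded_linear.has_derivative[OF bounded_bilinear.bounded_linear_left[OF bounded_bilinear_cinner] this]
  have "((\<lambda>c. cinner (f (cscale c u)) v) has_derivative (\<lambda>h. cinner (D (cscale h u)) v)) (at c)" .
  moreover have "(\<lambda>h. cinner (D (cscale h u)) v) = (*) (cinner (D u) v)"
    by (simp add: D(2) cinner_simps mult.commute fun_eq_iff)
  ultimately show ?thesis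
    unfolding field_differentiable_def has_field_derivative_def by metis
qed

text \<open>Every complex line through the origin is reduced to the classical Schwarz lemma by pairing
  with a vector.\<close>
lemma ball_Schwarz:
  assumes f: "ball_holomorphic d f" "f ` Bd d \<subseteq> Bd d" "f 0 = 0" and z: "z \<in> Bd d"
  shows "norm (f z) \<le> norm z"
    and "norm (f z) = norm z \<Longrightarrow> cmod c \<le> 1 \<Longrightarrow> norm (f (cscale c z)) \<le> norm (cscale c z) \<Longrightarrow>
      f (cscale c z) = cscale c (f z)"
proof -
  have *: "norm (f z) \<le> norm z \<and> (norm (f z) = norm z \<longrightarrow>
      (\<forall>c. cmod c \<le> 1 \<and> norm (f (cscale c z)) \<le> norm (cscale c z) \<longrightarrow> f (cscale c z) = cscale c (f z)))"
  proof (cases "z = 0 \<or> f z = 0")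
    case True
    then show ?thesis using f(3) by (auto simp: cscale_simps)
  next
    case False
    \<comment> \<open>Pairing with the direction of \<open>f z\<close> loses nothing at
      \<open>z\<close> itself: there \<open>g\<close> takes the value \<open>norm (f z)\<close>, so
      the scalar bound is the bound for \<open>f z\<close>.\<close>
    define u v r where "u = (1 / norm z) *\<^sub>R z" and "v = (1 / norm (f z)) *\<^sub>R f z" and "r = norm z"
    have z1: "norm z < 1" "z \<in> Cd d" using z by (auto simp: Bd_def)
    have u: "u \<in> Cd d" "norm u = 1" and v: "norm v = 1" using False z1 by (auto simp: u_def v_def Cd_closed)
    have zu: "z = cscale (of_real r) u" using False by (simp add: cscale_of_real u_def r_def)
    define g where "g = (\<lambda>c. cinner (f (cscale c u)) v)"
    have in_B: "cscale e u \<in> Bd d" if "cmod e < 1" for e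
      using that u by (simp add: Bd_def Cd_closed norm_cscale)
    have hol: "g holomorphic_on ball 0 1"
      unfolding holomorphic_on_def g_def
      using has_field_derivative_slice[OF f(1) u(1)] u(2) by (auto intro: field_differentiable_at_within)
    have g0: "g 0 = 0" by (simp add: g_def cscale_simps f(3) cinner_simps)
    have gle: "cmod (g c) \<le> norm (f (cscale c u))" for c
      using cinner_Cauchy_Schwarz[of "f (cscale c u)" v] v by (simp add: g_def)
    have g1: "cmod (g c) < 1" if "cmod c < 1" for c
    proof -
      have "f (cscale c u) \<in> Bd d" using f(2) in_B[OF that] by blast
      then show ?thesis using gle[of c] by (simp add: Bd_def)
    qed
    have gr: "g (of_real r) = of_real (norm (f z))"
      unfolding g_def zu[symmetric] using False
      by (simp add: v_def cinner_simps cinner_norm power2_eq_square)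
    have r: "0 < r" "r < 1" using False z1 by (auto simp: r_def)
    have "cmod (g (of_real r)) \<le> cmod (of_real r)"
      by (rule Schwarz_Lemma(1)[OF hol g0 g1]) (use r in auto)
    then have le: "norm (f z) \<le> norm z" using r unfolding gr by (simp add: r_def)
    have "f (cscale c z) = cscale c (f z)"
      if eq: "norm (f z) = norm z" and c: "cmod c \<le> 1" "norm (f (cscale c z)) \<le> norm (cscale c z)" for c
    proof -
      \<comment> \<open>Equality in the scalar Schwarz lemma makes \<open>g\<close> a rotation, and
        its value at \<open>r\<close> shows that the rotation is trivial.\<close>
      have "\<exists>w. cmod w < 1 \<and> w \<noteq> 0 \<and> cmod (g w) = cmod w"
        by (rule exI[of _ "of_real r"]) (use r eq gr in \<open>simp add: r_def\<close>)
      then obtain \<alpha> where \<alpha>: "\<And>w. cmod w < 1 \<Longrightarrow> g w = \<alpha> * w"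
        using Schwarz_Lemma(3)[OF hol g0 g1, of 0] by auto
      have "\<alpha> * of_real r = of_real r" using \<alpha>[of "of_real r"] r gr eq by (simp add: r_def)
      then have a1: "\<alpha> = 1" using r by simp
      have "cmod c * r \<le> 1 * r" by (rule mult_right_mono) (use c r in auto)
      moreover have "cmod (c * of_real r) = cmod c * r" using r by (simp add: norm_mult)
      ultimately have "cmod (c * of_real r) < 1" using r by linarith
      then have gc: "g (c * of_real r) = c * of_real r" using \<alpha> a1 by simp
      have cz: "cscale (c * of_real r) u = cscale c z" unfolding zu by (simp add: cscale_simps)
      let ?w = "f (cscale c z)"
      have ip: "cinner ?w v = c * of_real r" using gc unfolding g_def cz .
      have nf: "f z = cscale (of_real r) v" using eq False by (simp add: v_def r_def cscale_of_real)
      have Re_cnj: "Re (cnj e * e) = (cmod e)\<^sup>2" for e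
        unfolding cmod_power2 by (simp add: power2_eq_square)
      \<comment> \<open>A vector whose component along the unit vector \<open>v\<close> is
        \<open>c * r\<close>, and whose norm is at most \<open>cmod c * r\<close>, has no other
        component.\<close>
      have "(norm (?w - cscale (c * of_real r) v))\<^sup>2
          = (norm ?w)\<^sup>2 - 2 * (cmod (c * of_real r))\<^sup>2 + (cmod (c * of_real r))\<^sup>2"
        unfolding norm_diff_cinner cinner_cscale_right ip norm_cscale v
        by (simp only: Re_cnj) simp
      also have "\<dots> \<le> 0"
        using c(2) r power_mono[OF c(2), of 2] by (simp add: norm_cscale norm_mult r_def[symmetric])
      finally show ?thesis unfolding nf by (simp add: cscale_simps)
    qed
    then show ?thesis using le by blast
  qed
  show "norm (f z) \<le> norm z" using * by blast
  show "norm (f z) = norm z \<Longrightarrow> cmod c \<le> 1 \<Longrightarrow> norm (f (cscale c z)) \<le> norm (cscale c z) \<Longrightarrow>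
      f (cscale c z) = cscale c (f z)" using * by blast
qed

text \<open>The Schwarz lemma for \<open>f\<close> and for its inverse makes \<open>f\<close> norm
  preserving; its equality case makes \<open>f\<close> homogeneous. Hence \<open>f\<close> agrees
  with its derivative at 0, is additive, and polarisation recovers the inner product from the
  norm.\<close>

lemma ball_Aut_fix_zero:
  assumes f: "f \<in> ball_Aut d" "f 0 = 0" and z: "z \<in> Bd d" and w: "w \<in> Bd d"
  shows "cinner (f z) (f w) = cinner z w"
proof -
  from ball_Aut_obtain_inv[OF f(1)] obtain g where g: "g ` Bd d \<subseteq> Bd d" "f ` Bd d \<subseteq> Bd d"
    "\<And>z. z \<in> Bd d \<Longrightarrow> g (f z) = z" "ball_holomorphic d f" "ball_holomorphic d g" by metis
  have g0: "g 0 = 0" using g(3)[OF zero_in_Bd] f(2) by simp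
  have iso: "norm (f z) = norm z" if "z \<in> Bd d" for z
    using ball_Schwarz(1)[OF g(4,2) f(2) that] ball_Schwarz(1)[OF g(5,1) g0, of "f z"] that g(2,3) by fastforce
  have hom: "f (cscale c z) = cscale c (f z)" if "z \<in> Bd d" "cmod c \<le> 1" for z c
  proof -
    have "cscale c z \<in> Bd d" using that norm_ball_lt_1[of c z] by (simp add: Bd_def Cd_closed)
    then show ?thesis
      by (intro ball_Schwarz(2)[OF g(4,2) f(2) that(1)]) (use that iso in auto)
  qed
  obtain D where D: "(f has_derivative D) (at 0 within Bd d)" "\<And>c h. D (cscale c h) = cscale c (D h)"
    using g(4) zero_in_Bd unfolding ball_holomorphic_def by blast
  have lin: "f z = D z" if z: "z \<in> Bd d" for z
  proof (cases "z = 0")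
    case True
    then show ?thesis using f(2) D(2)[of 0 0] by (simp add: cscale_simps)
  next
    case False
    \<comment> \<open>Along the points \<open>z / Suc n\<close> the difference quotient is constant
      by homogeneity, so its limit 0 is its value.\<close>
    have "((\<lambda>y. norm (f y - f 0 - D (y - 0)) / norm (y - 0)) \<longlongrightarrow> 0) (at 0 within Bd d)"
      using D(1) unfolding has_derivative_iff_norm by blast
    moreover have "filterlim (\<lambda>n. cscale (of_real (1 / Suc n)) z) (at 0 within Bd d) sequentially"
    proof (rule filterlim_at_withinI)
      have "(\<lambda>n. (1 / Suc n) *\<^sub>R z) \<longlonglongrightarrow> 0 *\<^sub>R z"
        by (intro tendsto_intros LIMSEQ_inverse_real_of_nat[unfolded inverse_eq_divide])
      then show "(\<lambda>n. cscale (of_real (1 / Suc n)) z) \<longlonglongrightarrow> 0"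
        by (simp add: cscale_of_real del: of_nat_Suc of_real_divide)
      have "cscale (of_real (1 / Suc n)) z \<in> Bd d" for n
        using z norm_ball_lt_1[of "of_real (1 / Suc n)" z]
        by (simp add: Bd_def Cd_closed norm_divide del: of_nat_Suc)
      moreover have "cscale (of_real (1 / Suc n)) z \<noteq> 0" for n
        using False by (simp only: cscale_of_real) simp
      ultimately show "\<forall>\<^sub>F n in sequentially. cscale (of_real (1 / Suc n)) z \<in> Bd d - {0}" by simp
    qed
    ultimately have "((\<lambda>n. norm (f (cscale (of_real (1 / Suc n)) z) - D (cscale (of_real (1 / Suc n)) z))
        / norm (cscale (of_real (1 / Suc n)) z)) \<longlonglongrightarrow> 0)"
      using f(2) by (auto dest: filterlim_compose)
    moreover have "norm (f (cscale (of_real (1 / Suc n)) z) - D (cscale (of_real (1 / Suc n)) z))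
        / norm (cscale (of_real (1 / Suc n)) z) = norm (f z - D z) / norm z" for n
    proof -
      have "cmod (of_real (1 / Suc n)) \<le> 1" by (simp add: norm_divide del: of_nat_Suc)
      then have "f (cscale (of_real (1 / Suc n)) z) - D (cscale (of_real (1 / Suc n)) z)
          = cscale (of_real (1 / Suc n)) (f z - D z)" using hom[OF z] D(2) by (simp add: cscale_simps)
      then show ?thesis by (simp only: norm_cscale) (simp add: norm_divide del: of_nat_Suc)
    qed
    ultimately have "norm (f z - D z) / norm z = 0" using LIMSEQ_unique tendsto_const by fastforce
    then show ?thesis using False by simp
  qed
  have lD: "D (p + q) = D p + D q" for p q
    using D(1) by (simp add: has_derivative_def bounded_linear.linear linear_add)
  have re: "Re (cinner (f z) (f w)) = Re (cinner z w)" if z: "z \<in> Bd d" and w: "w \<in> Bd d" for z w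
  proof -
    \<comment> \<open>The halves keep the sum \<open>p + q\<close> inside the ball; homogeneity
      undoes the scaling.\<close>
    define p q where "p = cscale (1/2) z" and "q = cscale (1/2) w"
    have zB: "norm z < 1" "norm w < 1" using z w by (auto simp: Bd_def)
    have pq: "p \<in> Bd d" "q \<in> Bd d" using z w by (auto simp: p_def q_def Bd_def Cd_closed norm_cscale norm_divide)
    have pqB: "p + q \<in> Bd d"
      using z w norm_triangle_ineq[of p q] zB
      by (auto simp: p_def q_def Bd_def Cd_closed norm_cscale norm_divide)
    have "(norm (f p + f q))\<^sup>2 = (norm (p + q))\<^sup>2"
      using iso[OF pqB] lin[OF pqB] lin[OF pq(1)] lin[OF pq(2)] lD by simp
    then have "Re (cinner (f p) (f q)) = Re (cinner p q)"
      using iso[OF pq(1)] iso[OF pq(2)] by (simp add: norm_add_cinner)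
    moreover have "f p = cscale (1/2) (f z)" "f q = cscale (1/2) (f w)"
      unfolding p_def q_def by (intro hom; use z w in \<open>simp add: norm_divide\<close>)+
    ultimately show ?thesis by (simp add: p_def q_def cinner_simps)
  qed
  have i: "cscale \<i> z \<in> Bd d" using z by (simp add: Bd_def Cd_closed norm_cscale)
  \<comment> \<open>Multiplying \<open>z\<close> by the imaginary unit exchanges the real and
    imaginary parts of the pairing up to sign.\<close>
  have "Im (cinner (f z) (f w)) = Im (cinner z w)"
    using re[OF i w] hom[OF z, of \<i>] by (simp add: cinner_simps)
  then show ?thesis using re[OF z w] by (simp add: complex_eq_iff)
qed

text \<open>Cartan's theorem: up to an involution \<^term>\<open>ball_inv\<close>, an automorphism is a linear isometry.
  Hence automorphisms rescale the Drury--Arveson kernel.\<close>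
lemma ball_Aut_kernel:
  assumes f: "f \<in> ball_Aut d"
  obtains g where "\<And>z. z \<in> Bd d \<Longrightarrow> g z \<noteq> 0"
    and "\<And>z w. z \<in> Bd d \<Longrightarrow> w \<in> Bd d \<Longrightarrow> 1 - cinner (f z) (f w) = g z * cnj (g w) * (1 - cinner z w)"
proof -
  define a where "a = f 0"
  have fB: "f z \<in> Bd d" if "z \<in> Bd d" for z using ball_Aut_D(1)[OF f] that by blast
  have a: "a \<in> Bd d" using fB zero_in_Bd by (simp add: a_def)
  define F where "F = ball_inv a \<circ> f"
  have F: "F \<in> ball_Aut d" unfolding F_def by (rule ball_Aut_compose[OF f ball_inv_ball_Aut[OF a]])
  have F0: "F 0 = 0" using a by (simp add: F_def a_def[symmetric] ball_inv_self Bd_def)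
  have FB: "F z \<in> Bd d" if "z \<in> Bd d" for z using ball_Aut_D(1)[OF F] that by blast
  have fF: "f z = ball_inv a (F z)" if "z \<in> Bd d" for z
    using fB[OF that] a by (simp add: F_def ball_inv_ball_inv Bd_def)
  have sa: "0 < 1 - (norm a)\<^sup>2" using a by (simp add: Bd_def power_less_one_iff)
  \<comment> \<open>The factor is read off from \<open>cinner_ball_inv\<close>, applied to
    \<open>f = ball_inv a \<circ> F\<close>; the inner product preserving \<open>F\<close>
    contributes none.\<close>
  let ?g = "\<lambda>z. of_real (sqrt (1 - (norm a)\<^sup>2)) / (1 - cinner (F z) a)"
  show ?thesis
  proof (rule that[of ?g])
    fix z assume z: "z \<in> Bd d"
    then show "?g z \<noteq> 0" using one_minus_cinner_neq_0[of "F z" a] FB[OF z] a sa by (auto simp: Bd_def)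
  next
    fix z w assume z: "z \<in> Bd d" and w: "w \<in> Bd d"
    have "cnj (cinner (F w) a) = cinner a (F w)" by (rule cinner_commute[symmetric])
    moreover have "complex_of_real (sqrt (1 - (norm a)\<^sup>2)) * complex_of_real (sqrt (1 - (norm a)\<^sup>2)) = of_real (1 - (norm a)\<^sup>2)"
      using sa by (simp flip: of_real_mult)
    moreover have "1 - cinner (f z) (f w) = of_real (1 - (norm a)\<^sup>2) * (1 - cinner (F z) (F w))
        / ((1 - cinner (F z) a) * (1 - cinner a (F w)))"
      unfolding fF[OF z] fF[OF w] by (rule cinner_ball_inv) (use a FB z w in \<open>auto simp: Bd_def\<close>)
    ultimately show "1 - cinner (f z) (f w) = ?g z * cnj (?g w) * (1 - cinner z w)"
      using ball_Aut_fix_zero[OF F F0 z w] by simp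
  qed
qed

text \<open>In the quotient of \<open>one_minus_rho_ph\<close> the factors \<open>g z\<close> and
  \<open>g w\<close> of \<open>ball_Aut_kernel\<close> cancel, so the rescaling of the kernel alone
  gives the invariance.\<close>

lemma rho_ph_ball_Aut:
  assumes f: "f \<in> ball_Aut d" and z: "z \<in> Bd d" and w: "w \<in> Bd d"
  shows "rho_ph (f z) (f w) = rho_ph z w"
proof -
  from ball_Aut_kernel[OF f] obtain g where g: "\<And>z. z \<in> Bd d \<Longrightarrow> g z \<noteq> 0"
    "\<And>z w. z \<in> Bd d \<Longrightarrow> w \<in> Bd d \<Longrightarrow> 1 - cinner (f z) (f w) = g z * cnj (g w) * (1 - cinner z w)" by metis
  have fB: "f z \<in> Bd d" if "z \<in> Bd d" for z using ball_Aut_D(1)[OF f] that by blast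
  have n: "1 - (norm (f z))\<^sup>2 = (cmod (g z))\<^sup>2 * (1 - (norm z)\<^sup>2)" if "z \<in> Bd d" for z
  proof -
    have "complex_of_real (1 - (norm (f z))\<^sup>2) = of_real ((cmod (g z))\<^sup>2 * (1 - (norm z)\<^sup>2))"
      using g(2)[OF that that] complex_norm_square[of "g z"] by (simp add: cinner_norm)
    then show ?thesis using of_real_eq_iff by blast
  qed
  have "1 - (rho_ph (f z) (f w))\<^sup>2 = 1 - (rho_ph z w)\<^sup>2"
    using g(1)[OF z] g(1)[OF w] fB[OF z] fB[OF w] z w
    by (simp add: one_minus_rho_ph Bd_D n g(2)[OF z w] norm_mult power_mult_distrib)
  then show ?thesis using rho_ph_nonneg by (simp add: power2_eq_iff_nonneg)
qed

section \<open>Gram matrices and unitaries\<close>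

text \<open>The maps act on all of \<open>ell2\<close>, so that linearity carries no side
  conditions; \<open>d\<close> enters only through the invariance of \<open>Cd d\<close>.\<close>

definition ciso :: "enat \<Rightarrow> (ell2 \<Rightarrow> ell2) \<Rightarrow> bool" where
  "ciso d U \<longleftrightarrow> (\<forall>z\<in>Cd d. U z \<in> Cd d) \<and> (\<forall>z w. cinner (U z) (U w) = cinner z w) \<and>
     (\<forall>z w. U (z + w) = U z + U w) \<and> (\<forall>c z. U (cscale c z) = cscale c (U z))"

text \<open>An isometry of an infinite dimensional space need not be onto, so an inverse is
  demanded, and it has to preserve \<open>Cd d\<close> as well.\<close>

definition cunitary :: "enat \<Rightarrow> (ell2 \<Rightarrow> ell2) \<Rightarrow> bool" where
  "cunitary d U \<longleftrightarrow> ciso d U \<and> (\<exists>V. ciso d V \<and> (\<forall>z. V (U z) = z \<and> U (V z) = z))"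

lemma cunitary_id: "cunitary d (\<lambda>z. z)"
  by (auto simp: cunitary_def ciso_def intro!: exI[of _ "\<lambda>z. z"])

lemma cunitary_compose:
  assumes "cunitary d U" "cunitary d V"
  shows "cunitary d (V \<circ> U)"
proof -
  obtain U' V' where "ciso d U'" "\<forall>z. U' (U z) = z \<and> U (U' z) = z" "ciso d V'" "\<forall>z. V' (V z) = z \<and> V (V' z) = z"
    using assms unfolding cunitary_def by blast
  then show ?thesis using assms unfolding cunitary_def
    by (auto simp: ciso_def intro!: exI[of _ "U' \<circ> V'"])
qed

lemma ciso_norm: "ciso d U \<Longrightarrow> norm (U z) = norm z"
  by (metis ciso_def norm_ge_zero norm_power2_cinner power2_eq_iff_nonneg)

lemma ciso_diff:
  assumes "ciso d U"
  shows "U (z - w) = U z - U w"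
proof -
  have "U (z + cscale (-1) w) = U z + cscale (-1) (U w)"
    using assms unfolding ciso_def by metis
  then show ?thesis by (simp add: cscale_simps)
qed

lemma ciso_ball:
  assumes U: "ciso d U"
  shows "U ` Bd d \<subseteq> Bd d" "ball_holomorphic d U"
proof -
  show "U ` Bd d \<subseteq> Bd d" using U ciso_norm[OF U] by (auto simp: Bd_def ciso_def)
  have "bounded_linear U"
  proof (rule bounded_linear_intro[where K = 1])
    show "U (x + y) = U x + U y" for x y using U by (simp add: ciso_def)
    show "U (r *\<^sub>R x) = r *\<^sub>R U x" for r x
      using U unfolding ciso_def by (metis cscale_of_real)
  qed (simp add: ciso_norm[OF U])
  then show "ball_holomorphic d U"
    unfolding ball_holomorphic_def
    using U bounded_linear_imp_has_derivative by (auto simp: ciso_def)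
qed

lemma cunitary_ball_Aut:
  assumes "cunitary d U"
  shows "U \<in> ball_Aut d"
proof -
  obtain V where V: "ciso d U" "ciso d V" "\<And>z. V (U z) = z" "\<And>z. U (V z) = z"
    using assms unfolding cunitary_def by blast
  show ?thesis
    by (rule ball_AutI[OF ciso_ball(1)[OF V(1)] ciso_ball(1)[OF V(2)] V(3,4) ciso_ball(2)[OF V(1)]
          ciso_ball(2)[OF V(2)]])
qed

text \<open>A complex Householder transformation.\<close>
definition creflect :: "complex \<Rightarrow> ell2 \<Rightarrow> ell2 \<Rightarrow> ell2" where
  "creflect \<alpha> q z = z - cscale (\<alpha> * cinner z q) q"

text \<open>On the span of \<open>q\<close> the map is multiplication by
  \<open>1 - \<alpha> * cinner q q\<close>, and it fixes the orthogonal complement. The condition on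
  \<open>\<alpha>\<close> makes this factor unimodular; the inverse belongs to
  \<open>cnj \<alpha>\<close>.\<close>

lemma creflect_unitary:
  assumes q: "q \<in> Cd d" and \<alpha>: "\<alpha> + cnj \<alpha> = \<alpha> * cnj \<alpha> * cinner q q"
  shows "cunitary d (creflect \<alpha> q)"
proof -
  have iso: "ciso d (creflect \<beta> q)" if \<beta>: "\<beta> + cnj \<beta> = \<beta> * cnj \<beta> * cinner q q" for \<beta>
    unfolding ciso_def
  proof (intro conjI ballI allI)
    show "creflect \<beta> q z \<in> Cd d" if "z \<in> Cd d" for z using that q by (simp add: creflect_def Cd_closed)
    show "creflect \<beta> q (z + w) = creflect \<beta> q z + creflect \<beta> q w" for z w
      by (simp add: creflect_def cinner_simps cscale_simps algebra_simps)
    show "creflect \<beta> q (cscale c z) = cscale c (creflect \<beta> q z)" for c z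
      by (simp add: creflect_def cinner_simps cscale_simps algebra_simps)
    show "cinner (creflect \<beta> q z) (creflect \<beta> q w) = cinner z w" for z w
    proof -
      have c: "cnj (cinner w q) = cinner q w" by (rule cinner_commute[symmetric])
      have "cinner (creflect \<beta> q z) (creflect \<beta> q w)
          = cinner z w - (\<beta> + cnj \<beta> - \<beta> * cnj \<beta> * cinner q q) * cinner z q * cinner q w"
        by (simp add: creflect_def cinner_simps c algebra_simps)
      then show ?thesis using \<beta> by simp
    qed
  qed
  have inv: "creflect (cnj \<beta>) q (creflect \<beta> q z) = z" if \<beta>: "\<beta> + cnj \<beta> = \<beta> * cnj \<beta> * cinner q q" for \<beta> z
  proof -
    have "creflect (cnj \<beta>) q (creflect \<beta> q z)
        = z - cscale ((\<beta> + cnj \<beta> - \<beta> * cnj \<beta> * cinner q q) * cinner z q) q"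
      by (rule ell2_eqI) (simp add: creflect_def cinner_simps coord_ops algebra_simps)
    then show ?thesis using \<beta> by (simp add: cscale_simps)
  qed
  have "cnj \<alpha> + cnj (cnj \<alpha>) = cnj \<alpha> * cnj (cnj \<alpha>) * cinner q q" using \<alpha> by (simp add: ac_simps)
  from iso[OF \<alpha>] iso[OF this] inv[OF \<alpha>] inv[OF this] show ?thesis
    unfolding cunitary_def by (auto intro!: exI[of _ "creflect (cnj \<alpha>) q"])
qed

text \<open>The classical Householder reflection in \<open>u - w\<close> moves \<open>u\<close> to
  \<open>w\<close> only if \<open>cinner u w\<close> is real; the factor
  \<open>1 / cinner u q\<close> corrects the phase. If \<open>cinner u q = 0\<close>, equality of
  the norms forces \<open>q = 0\<close>. The vectors left fixed are what the induction in
  \<open>Gram_convergence\<close> relies on.\<close>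

lemma cunitary_move:
  assumes "u \<in> Cd d" "w \<in> Cd d" "norm u = norm w"
  obtains U where "cunitary d U" "U u = w" "\<And>z. cinner z u = 0 \<Longrightarrow> cinner z w = 0 \<Longrightarrow> U z = z"
proof -
  define q where "q = u - w"
  define \<alpha> where "\<alpha> = 1 / cinner u q"
  have cn: "cnj (cinner u q) = cinner q u" by (rule cinner_commute[symmetric])
  have "cinner u u = cinner w w" using assms(3) by (simp add: cinner_norm)
  then have s: "cinner u q + cnj (cinner u q) = cinner q q"
    unfolding cn by (simp add: q_def cinner_simps)
  have "\<alpha> + cnj \<alpha> = \<alpha> * cnj \<alpha> * cinner q q"
    unfolding s[symmetric] by (cases "cinner u q = 0") (simp_all add: \<alpha>_def field_simps)
  then have U: "cunitary d (creflect \<alpha> q)" using assms by (intro creflect_unitary) (simp_all add: q_def Cd_closed)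
  have "creflect \<alpha> q u = w"
  proof (cases "cinner u q = 0")
    case True
    then have "q = 0" using s by (simp add: cinner_eq_zero_iff)
    then show ?thesis by (simp add: creflect_def cscale_simps q_def)
  next
    case False
    then show ?thesis by (simp add: creflect_def cscale_simps \<alpha>_def) (simp add: q_def)
  qed
  then show ?thesis
    by (intro that[OF U]) (simp_all add: creflect_def q_def cinner_simps cscale_simps)
qed

text \<open>The coefficients \<open>A\<close> serve to transfer convergence of inner products from \<open>x\<close> to \<open>e\<close>.\<close>
lemma orthonormal_basis_exists:
  fixes x :: "nat \<Rightarrow> ell2"
  assumes "\<And>i. i < m \<Longrightarrow> x i \<in> Cd d"
  shows "\<exists>p (e :: nat \<Rightarrow> ell2) A. (\<forall>j<p. e j \<in> Cd d) \<and> (\<forall>j<p. \<forall>l<p. cinner (e j) (e l) = (if j = l then 1 else 0)) \<and>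
     (\<forall>i<m. x i = (\<Sum>j<p. cscale (cinner (x i) (e j)) (e j))) \<and> (\<forall>j<p. e j = (\<Sum>i<m. cscale (A j i) (x i)))"
  using assms
proof (induction m)
  case 0
  then show ?case by (auto intro!: exI[of _ 0])
next
  case (Suc m)
  then obtain p and e :: "nat \<Rightarrow> ell2" and A where e: "\<forall>j<p. e j \<in> Cd d"
    and on: "\<forall>j<p. \<forall>l<p. cinner (e j) (e l) = (if j = l then 1 else 0)"
    and x: "\<forall>i<m. x i = (\<Sum>j<p. cscale (cinner (x i) (e j)) (e j))"
    and A: "\<forall>j<p. e j = (\<Sum>i<m. cscale (A j i) (x i))" by auto
  define r where "r = x m - (\<Sum>j<p. cscale (cinner (x m) (e j)) (e j))"
  have xm: "x m \<in> Cd d" using Suc.prems by simp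
  have rC: "r \<in> Cd d" unfolding r_def using e xm by (intro Cd_closed Cd_sum) auto
  have re: "cinner r (e l) = 0" if "l < p" for l
    using on that by (simp add: r_def cinner_simps cinner_sum_left if_distrib[of "\<lambda>t. _ * t"] cong: if_cong)
  show ?case
  \<comment> \<open>Gram-Schmidt without assuming independence: a dependent vector adds nothing to
    the basis, so \<open>p\<close> may be smaller than \<open>m\<close>.\<close>
  proof (cases "r = 0")
    case True
    then have "x m = (\<Sum>j<p. cscale (cinner (x m) (e j)) (e j))" by (simp add: r_def)
    then have "\<forall>i<Suc m. x i = (\<Sum>j<p. cscale (cinner (x i) (e j)) (e j))" using x by (auto simp: less_Suc_eq)
    moreover have "\<forall>j<p. e j = (\<Sum>i<Suc m. cscale (if i < m then A j i else 0) (x i))"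
      using A by (simp add: cscale_simps)
    ultimately show ?thesis using e on by (intro exI[of _ p] exI[of _ e] exI[of _ "\<lambda>j i. if i < m then A j i else 0"]) blast
  next
    case False
    let ?e = "\<lambda>j. if j < p then e j else (1 / norm r) *\<^sub>R r"
    have rr: "cinner r ((1 / norm r) *\<^sub>R r) = of_real (norm r)"
      using False by (simp add: cinner_simps cinner_norm power2_eq_square)
    have er: "cinner (e l) r = 0" if "l < p" for l using re[OF that] cinner_commute[of "e l" r] by simp
    have xr: "cinner (x i) r = 0" if "i < m" for i
    proof -
      have "cinner (x i) r = cinner (\<Sum>j<p. cscale (cinner (x i) (e j)) (e j)) r" using x that by metis
      then show ?thesis using er by (simp add: cinner_sum_left cinner_simps)
    qed
    have xm': "x m = (\<Sum>j<p. cscale (cinner (x m) (e j)) (e j)) + r" by (simp add: r_def)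
    have "cinner (x m) r = cinner ((\<Sum>j<p. cscale (cinner (x m) (e j)) (e j)) + r) r" using xm' by simp
    then have xmr: "cinner (x m) r = cinner r r" using er by (simp add: cinner_sum_left cinner_simps)
    have "\<forall>j<Suc p. ?e j \<in> Cd d" using e rC by (auto simp: Cd_closed)
    moreover have "\<forall>j<Suc p. \<forall>l<Suc p. cinner (?e j) (?e l) = (if j = l then 1 else 0)"
      using on er re rr False by (auto simp: less_Suc_eq cinner_simps)
    moreover have "\<forall>i<Suc m. x i = (\<Sum>j<Suc p. cscale (cinner (x i) (?e j)) (?e j))"
    proof (intro allI impI)
      fix i assume i: "i < Suc m"
      have s: "(\<Sum>j<Suc p. cscale (cinner (x i) (?e j)) (?e j)) =
          (\<Sum>j<p. cscale (cinner (x i) (e j)) (e j)) + cscale (cinner (x i) r / of_real ((norm r)\<^sup>2)) r"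
        by (rule ell2_eqI) (simp add: coord_ops coord_sum cinner_simps power2_eq_square)
      show "x i = (\<Sum>j<Suc p. cscale (cinner (x i) (?e j)) (?e j))"
      proof (cases "i < m")
        case True
        then show ?thesis unfolding s using xr x by (simp add: cscale_simps)
      next
        case False
        then have "i = m" using i by simp
        then show ?thesis unfolding s using xm' xmr \<open>r \<noteq> 0\<close> by (simp add: cinner_norm cscale_simps)
      qed
    qed
    moreover have "\<forall>j<Suc p. ?e j = (\<Sum>i<Suc m. cscale (if j < p then if i < m then A j i else 0 else
       of_real (1 / norm r) * (if i < m then - (\<Sum>l<p. cinner (x m) (e l) * A l i) else 1)) (x i))" (is "\<forall>j<Suc p. ?P j")
    proof (intro allI impI)
      fix j assume "j < Suc p"
      show "?P j"
      proof (cases "j < p")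
        case True
        then show ?thesis using A by (simp add: cscale_simps)
      next
        case False
        have "(\<Sum>l<p. cscale (cinner (x m) (e l)) (e l)) = (\<Sum>l<p. cscale (cinner (x m) (e l)) (\<Sum>i<m. cscale (A l i) (x i)))"
          using A by (intro sum.cong) auto
        also have "\<dots> = (\<Sum>i<m. cscale (\<Sum>l<p. cinner (x m) (e l) * A l i) (x i))"
          by (rule ell2_eqI) (simp add: coord_sum coord_ops sum_distrib_left sum_distrib_right mult.assoc sum.swap[of _ "{..<m}"])
        finally have r': "r = x m - \<dots>" unfolding r_def by simp
        have "(1 / norm r) *\<^sub>R r = cscale (of_real (1 / norm r)) r" by (simp only: cscale_of_real)
        also have "\<dots> = (\<Sum>i<Suc m. cscale (of_real (1 / norm r) * (if i < m then - (\<Sum>l<p. cinner (x m) (e l) * A l i) else 1)) (x i))"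
          unfolding cscale_simps(1)[symmetric] cscale_sum[symmetric]
          by (subst (2) r') (simp add: cscale_simps sum_negf)
        finally show ?thesis using False by simp
      qed
    qed
    ultimately show ?thesis
      by (intro exI[of _ "Suc p"] exI[of _ ?e] exI conjI) assumption+
  qed
qed

text \<open>Induction on the number of vectors. Once \<open>U k\<close> has aligned the first
  \<open>m\<close> of them, a reflection fixing their limits turns the residue of the next vector,
  modulo the span of these limits, into the direction of the residue \<open>r\<close> of
  \<open>x m\<close>. Inner products determine the component in the span and the length of the
  residue in the limit, which is all that is needed.\<close>

lemma Gram_convergence:
  fixes x :: "nat \<Rightarrow> ell2" and y :: "nat \<Rightarrow> nat \<Rightarrow> ell2"
  assumes xC: "\<And>i. i < m \<Longrightarrow> x i \<in> Cd d" and yC: "\<And>i k. i < m \<Longrightarrow> y k i \<in> Cd d"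
    and lim: "\<And>i j. i < m \<Longrightarrow> j < m \<Longrightarrow> (\<lambda>k. cinner (y k i) (y k j)) \<longlonglongrightarrow> cinner (x i) (x j)"
  shows "\<exists>U. (\<forall>k. cunitary d (U k)) \<and> (\<forall>i<m. (\<lambda>k. U k (y k i)) \<longlonglongrightarrow> x i)"
  using assms
proof (induction m)
  case 0
  then show ?case by (intro exI[of _ "\<lambda>_ z. z"]) (simp add: cunitary_id)
next
  case (Suc m)
  then have "\<exists>U. (\<forall>k. cunitary d (U k)) \<and> (\<forall>i<m. (\<lambda>k. U k (y k i)) \<longlonglongrightarrow> x i)" by simp
  then obtain U where U: "\<And>k. cunitary d (U k)" and Ux: "\<And>i. i < m \<Longrightarrow> (\<lambda>k. U k (y k i)) \<longlonglongrightarrow> x i" by blast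
  have xC: "\<And>i. i < m \<Longrightarrow> x i \<in> Cd d" using Suc.prems(1) by simp
  obtain p and e :: "nat \<Rightarrow> ell2" and A where basis: "\<forall>j<p. e j \<in> Cd d"
    "\<forall>j<p. \<forall>l<p. cinner (e j) (e l) = (if j = l then 1 else 0)"
    "\<forall>i<m. x i = (\<Sum>j<p. cscale (cinner (x i) (e j)) (e j))"
    "\<forall>j<p. e j = (\<Sum>i<m. cscale (A j i) (x i))"
    using orthonormal_basis_exists[of m x d, OF xC] by blast
  have e: "\<And>j. j < p \<Longrightarrow> e j \<in> Cd d"
    and on: "\<And>j l. j < p \<Longrightarrow> l < p \<Longrightarrow> cinner (e j) (e l) = (if j = l then 1 else 0)"
    and x: "\<And>i. i < m \<Longrightarrow> x i = (\<Sum>j<p. cscale (cinner (x i) (e j)) (e j))"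
    and A: "\<And>j. j < p \<Longrightarrow> e j = (\<Sum>i<m. cscale (A j i) (x i))"
    using basis by blast+
  define P where "P = (\<lambda>z. \<Sum>j<p. cscale (cinner z (e j)) (e j))"
  define v where "v = (\<lambda>k. U k (y k m))"
  note tendsto_cinner = bounded_bilinear.tendsto[OF bounded_bilinear_cinner]
  note tendsto_cscale = bounded_bilinear.tendsto[OF bounded_bilinear_cscale]
  have ci: "cinner (U k z) (U k w) = cinner z w" for k z w using U by (auto simp: cunitary_def ciso_def)
  have vv: "(\<lambda>k. cinner (v k) (v k)) \<longlonglongrightarrow> cinner (x m) (x m)"
    unfolding v_def ci by (rule Suc.prems) simp_all
  have nv: "(\<lambda>k. norm (v k)) \<longlonglongrightarrow> norm (x m)"
    using tendsto_real_sqrt[OF tendsto_Re[OF vv]] by (simp add: cinner_norm)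
  then obtain B where B: "\<And>k. norm (v k) \<le> B"
    by (metis Bseq_def convergentI convergent_imp_Bseq norm_ge_zero real_norm_def abs_of_nonneg)
  \<comment> \<open>The moving vector \<open>U k (y k i)\<close> may be replaced by its limit
    \<open>x i\<close> because the \<open>v k\<close> are bounded.\<close>
  have vx: "(\<lambda>k. cinner (v k) (x i)) \<longlonglongrightarrow> cinner (x m) (x i)" if i: "i < m" for i
  proof -
    have "(\<lambda>k. B * norm (x i - U k (y k i))) \<longlonglongrightarrow> B * norm (x i - x i)"
      by (intro tendsto_intros Ux i)
    then have "(\<lambda>k. B * norm (x i - U k (y k i))) \<longlonglongrightarrow> 0" by simp
    then have "(\<lambda>k. cinner (v k) (x i - U k (y k i))) \<longlonglongrightarrow> 0"
    proof (rule Lim_null_comparison[rotated], intro always_eventually allI)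
      fix k
      have "norm (cinner (v k) (x i - U k (y k i))) \<le> norm (v k) * norm (x i - U k (y k i))"
        by (rule cinner_Cauchy_Schwarz)
      also have "\<dots> \<le> B * norm (x i - U k (y k i))" by (intro mult_right_mono B) simp
      finally show "norm (cinner (v k) (x i - U k (y k i))) \<le> B * norm (x i - U k (y k i))" .
    qed
    moreover have "(\<lambda>k. cinner (v k) (U k (y k i))) \<longlonglongrightarrow> cinner (x m) (x i)"
      unfolding v_def ci by (rule Suc.prems) (use i in simp_all)
    ultimately have "(\<lambda>k. cinner (v k) (x i - U k (y k i)) + cinner (v k) (U k (y k i))) \<longlonglongrightarrow> 0 + cinner (x m) (x i)"
      by (rule tendsto_add)
    then show ?thesis by (simp add: cinner_simps)
  qed
  have ve: "(\<lambda>k. cinner (v k) (e j)) \<longlonglongrightarrow> cinner (x m) (e j)" if "j < p" for j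
    unfolding A[OF that] cinner_sum_right cinner_cscale_right
    by (intro tendsto_intros vx) simp
  have Pv: "(\<lambda>k. P (v k)) \<longlonglongrightarrow> P (x m)"
    unfolding P_def by (intro tendsto_sum tendsto_cscale ve tendsto_const) simp
  define r where "r = x m - P (x m)"
  have Pe: "cinner (P z) (e l) = cinner z (e l)" if "l < p" for z l
    using on that by (simp add: P_def cinner_simps cinner_sum_left if_distrib[of "\<lambda>t. _ * t"] cong: if_cong)
  have orth: "cinner (x i) (z - P z) = 0" if "i < m" for i z
  proof -
    have "cinner (e l) (z - P z) = 0" if "l < p" for l
      using Pe[OF that, of z] cinner_commute[of "e l" "z - P z"] by (simp add: cinner_simps)
    then show ?thesis by (subst x[OF that]) (simp add: cinner_sum_left cinner_cscale_left)
  qed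
  have orthP: "cinner (P w) (z - P z) = 0" for w z
  proof -
    have "cinner (e l) (z - P z) = 0" if "l < p" for l
      using Pe[OF that, of z] cinner_commute[of "e l" "z - P z"] by (simp add: cinner_simps)
    then show ?thesis by (simp add: P_def cinner_sum_left cinner_cscale_left)
  qed
  have xmC: "x m \<in> Cd d" using Suc.prems by simp
  have vC: "v k \<in> Cd d" for k using U Suc.prems(2)[of m k] by (simp add: v_def cunitary_def ciso_def)
  have PC: "P z \<in> Cd d" for z unfolding P_def using e by (intro Cd_sum Cd_closed) auto
  have nr: "(\<lambda>k. norm (v k - P (v k))) \<longlonglongrightarrow> norm r"
  proof -
    have pyth: "(norm (z - P z))\<^sup>2 = (norm z)\<^sup>2 - (norm (P z))\<^sup>2" for z
      using norm_add_cinner[of "P z" "z - P z"] orthP[of z z] by simp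
    have "(\<lambda>k. sqrt ((norm (v k))\<^sup>2 - (norm (P (v k)))\<^sup>2)) \<longlonglongrightarrow> sqrt ((norm (x m))\<^sup>2 - (norm (P (x m)))\<^sup>2)"
      by (intro tendsto_intros nv Pv)
    then show ?thesis unfolding pyth[symmetric] r_def by simp
  qed
  \<comment> \<open>Every \<open>x i\<close> and \<open>P (v k)\<close> is orthogonal to the old
    residue and to \<open>r\<close>, hence fixed by the reflection that exchanges these
    directions.\<close>
  have "\<exists>W. cunitary d W \<and> W (v k - P (v k)) = (norm (v k - P (v k)) / norm r) *\<^sub>R r \<and> (\<forall>i<m. W (x i) = x i)
     \<and> W (P (v k)) = P (v k)" if r0: "r \<noteq> 0" for k
  proof -
    have "norm (v k - P (v k)) = norm ((norm (v k - P (v k)) / norm r) *\<^sub>R r)" using r0 by simp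
    from cunitary_move[OF _ _ this, of d]
    obtain W where "cunitary d W" "W (v k - P (v k)) = (norm (v k - P (v k)) / norm r) *\<^sub>R r"
      "\<And>z. cinner z (v k - P (v k)) = 0 \<Longrightarrow> cinner z ((norm (v k - P (v k)) / norm r) *\<^sub>R r) = 0 \<Longrightarrow> W z = z"
      by (metis Cd_closed(3,5) vC PC xmC r_def)
    then show ?thesis using orth orthP by (auto intro!: exI[of _ W] simp: cinner_simps r_def)
  qed
  then obtain W where W: "r \<noteq> 0 \<Longrightarrow> cunitary d (W k)" "r \<noteq> 0 \<Longrightarrow> W k (v k - P (v k)) = (norm (v k - P (v k)) / norm r) *\<^sub>R r"
    "r \<noteq> 0 \<Longrightarrow> i < m \<Longrightarrow> W k (x i) = x i" "r \<noteq> 0 \<Longrightarrow> W k (P (v k)) = P (v k)" for k i by metis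
  \<comment> \<open>If \<open>r = 0\<close>, the residue of \<open>v k\<close> tends to 0 and
    nothing has to be rotated.\<close>
  define V where "V = (\<lambda>k. if r = 0 then (\<lambda>z. z) else W k)"
  have V: "cunitary d (V k)" for k using W(1) by (simp add: V_def cunitary_id)
  then have Vi: "ciso d (V k)" for k by (simp add: cunitary_def)
  have Vx: "V k (x i) = x i" if "i < m" for i k using W(3) that by (simp add: V_def)
  have "(\<lambda>k. V k (U k (y k i))) \<longlonglongrightarrow> x i" if i: "i < m" for i
  proof -
    have "norm (V k (U k (y k i)) - x i) = norm (U k (y k i) - x i)" for k
      using ciso_diff[OF Vi, of k "U k (y k i)" "x i"] Vx[OF i] ciso_norm[OF Vi] by metis
    moreover have "(\<lambda>k. norm (U k (y k i) - x i)) \<longlonglongrightarrow> 0" using Ux[OF i] by (simp add: LIM_zero tendsto_norm_zero)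
    ultimately have "(\<lambda>k. norm (V k (U k (y k i)) - x i)) \<longlonglongrightarrow> 0" by simp
    then show ?thesis by (rule LIM_zero_cancel[OF tendsto_norm_zero_cancel])
  qed
  moreover have "(\<lambda>k. V k (v k)) \<longlonglongrightarrow> x m"
  proof (cases "r = 0")
    case True
    then have "(\<lambda>k. v k - P (v k)) \<longlonglongrightarrow> 0" using nr by (simp add: tendsto_norm_zero_iff)
    from tendsto_add[OF this Pv] show ?thesis using True by (simp add: V_def r_def)
  next
    case False
    have "V k (v k) = P (v k) + (norm (v k - P (v k)) / norm r) *\<^sub>R r" for k
    proof -
      have "V k (P (v k) + (v k - P (v k))) = V k (P (v k)) + V k (v k - P (v k))"
        using Vi[of k] unfolding ciso_def by blast
      then show ?thesis using W(2,4) False by (simp add: V_def)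
    qed
    moreover have "(\<lambda>k. P (v k) + (norm (v k - P (v k)) / norm r) *\<^sub>R r) \<longlonglongrightarrow> P (x m) + (norm r / norm r) *\<^sub>R r"
      by (intro tendsto_intros Pv nr) (use False in simp)
    ultimately show ?thesis using False by (simp add: r_def)
  qed
  ultimately have "\<forall>i<Suc m. (\<lambda>k. (V k \<circ> U k) (y k i)) \<longlonglongrightarrow> x i" by (auto simp: less_Suc_eq v_def)
  moreover have "\<forall>k. cunitary d (V k \<circ> U k)" using cunitary_compose[OF U V] by blast
  ultimately show ?case by (intro exI[of _ "\<lambda>k. V k \<circ> U k"] conjI)
qed

section \<open>Reproducing kernel Hilbert spaces\<close>

text \<open>The determinant of a nonnegative form in two variables is nonnegative. Isolated because
  it serves the inner product of a given space, the seminorm of a kernel, and in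
  \<open>space_dense\<close> an estimate with no inner product behind it.\<close>

lemma quadratic_form_Cauchy_Schwarz:
  fixes a d :: real and b :: complex
  assumes nonneg: "\<And>s t. 0 \<le> (cmod s)\<^sup>2 * a + 2 * Re (s * cnj t * b) + (cmod t)\<^sup>2 * d"
  shows "(cmod b)\<^sup>2 \<le> a * d"
proof -
  have a: "0 \<le> a" using nonneg[of 1 0] by simp
  have q: "0 \<le> x\<^sup>2 * a - 2 * x * cmod b + d" for x
  proof (cases "b = 0")
    case True
    then show ?thesis using nonneg[of "of_real x" 1] by simp
  next
    case False
    have "cnj (sgn b) * b = of_real (cmod b)"
      using complex_norm_square[of b] False by (simp add: sgn_eq field_simps power2_eq_square)
    then have "of_real (- x) * cnj (sgn b) * cnj 1 * b = of_real (- x * cmod b)"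
      by (simp only: mult.assoc complex_cnj_one mult_1 of_real_mult)
    moreover have "cmod (of_real (- x) * cnj (sgn b)) = \<bar>x\<bar>"
      using False by (simp add: norm_mult norm_sgn)
    ultimately show ?thesis
      using nonneg[of "of_real (- x) * cnj (sgn b)" 1] by (simp only: Re_complex_of_real) simp
  qed
  show ?thesis
  proof (cases "a = 0")
    case True
    have "b = 0"
    proof (rule ccontr)
      assume b: "b \<noteq> 0"
      \<comment> \<open>For \<open>a = 0\<close> the form is linear in \<open>x\<close>; this
        \<open>x\<close> makes it equal to -1.\<close>
      have "0 \<le> d - (d + 1)" using q[of "(d + 1) / (2 * cmod b)"] b True by simp
      then show False by simp
    qed
    then show ?thesis using True by simp
  next
    case False
    have "0 \<le> (cmod b / a)\<^sup>2 * a - 2 * (cmod b / a) * cmod b + d" by (rule q)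
    also have "\<dots> = d - (cmod b)\<^sup>2 / a" using False by (simp add: power2_eq_square field_simps)
    finally show ?thesis using a False by (simp add: field_simps)
  qed
qed

section \<open>Elementary consequences of the axioms of an RKHS\<close>

locale rk_space =
  fixes H :: "'a rkhs"
  assumes is_rkhs: "is_rkhs H"
begin

lemma lincomb_in: "f \<in> funs H \<Longrightarrow> g \<in> funs H \<Longrightarrow> (\<lambda>x. a * f x + b * g x) \<in> funs H"
  and zero_in: "(\<lambda>_. 0) \<in> funs H"
  and restr_funs: "f \<in> funs H \<Longrightarrow> restr (pts H) f = f"
  and ip_lincomb_left: "f \<in> funs H \<Longrightarrow> g \<in> funs H \<Longrightarrow> h \<in> funs H \<Longrightarrow>
    ip H (\<lambda>x. a * f x + b * g x) h = a * ip H f h + b * ip H g h"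
  and ip_cnj: "f \<in> funs H \<Longrightarrow> g \<in> funs H \<Longrightarrow> ip H g f = cnj (ip H f g)"
  and ip_nonneg: "f \<in> funs H \<Longrightarrow> 0 \<le> Re (ip H f f)"
  and ip_definite: "f \<in> funs H \<Longrightarrow> ip H f f = 0 \<Longrightarrow> f = (\<lambda>_. 0)"
  and kfun_in: "x \<in> pts H \<Longrightarrow> kfun H x \<in> funs H"
  and reproducing: "x \<in> pts H \<Longrightarrow> f \<in> funs H \<Longrightarrow> ip H f (kfun H x) = f x"
  and ip_outside: "f \<notin> funs H \<or> g \<notin> funs H \<Longrightarrow> ip H f g = 0"
  and kern_outside: "x \<notin> pts H \<or> y \<notin> pts H \<Longrightarrow> kern H x y = 0"
  and complete: "(\<And>i::nat. s i \<in> funs H) \<Longrightarrow>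
    (\<And>e. 0 < e \<Longrightarrow> \<exists>N. \<forall>i\<ge>N. \<forall>j\<ge>N. fnorm H (\<lambda>x. s i x - s j x) < e) \<Longrightarrow>
    \<exists>f\<in>funs H. (\<lambda>i. fnorm H (\<lambda>x. s i x - f x)) \<longlonglongrightarrow> 0"
proof -
  note a0 = is_rkhs[unfolded is_rkhs_def]
  note a1 = a0[THEN conjunct2]
  note a2 = a1[THEN conjunct2]
  note a3 = a2[THEN conjunct2]
  note a4 = a3[THEN conjunct2]
  note a5 = a4[THEN conjunct2]
  note a6 = a5[THEN conjunct2]
  note a7 = a6[THEN conjunct2]
  note a8 = a7[THEN conjunct2]
  note a9 = a8[THEN conjunct2]
  show "f \<in> funs H \<Longrightarrow> g \<in> funs H \<Longrightarrow> (\<lambda>x. a * f x + b * g x) \<in> funs H"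
    by (rule a2[THEN conjunct1, rule_format])
  show "(\<lambda>_. 0) \<in> funs H" by (rule a1[THEN conjunct1])
  show "f \<in> funs H \<Longrightarrow> restr (pts H) f = f" by (rule a0[THEN conjunct1, rule_format])
  show "f \<in> funs H \<Longrightarrow> g \<in> funs H \<Longrightarrow> h \<in> funs H \<Longrightarrow>
    ip H (\<lambda>x. a * f x + b * g x) h = a * ip H f h + b * ip H g h" by (rule a3[THEN conjunct1, rule_format])
  show "f \<in> funs H \<Longrightarrow> g \<in> funs H \<Longrightarrow> ip H g f = cnj (ip H f g)" by (rule a4[THEN conjunct1, rule_format])
  show "f \<in> funs H \<Longrightarrow> 0 \<le> Re (ip H f f)" by (rule a5[THEN conjunct1, rule_format, THEN conjunct1])
  show "f \<in> funs H \<Longrightarrow> ip H f f = 0 \<Longrightarrow> f = (\<lambda>_. 0)"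
    by (rule a5[THEN conjunct1, rule_format, THEN conjunct2, rule_format])
  show "f \<notin> funs H \<or> g \<notin> funs H \<Longrightarrow> ip H f g = 0" by (rule a6[THEN conjunct1, rule_format])
  show "x \<notin> pts H \<or> y \<notin> pts H \<Longrightarrow> kern H x y = 0" by (rule a8[THEN conjunct1, rule_format])
  show "x \<in> pts H \<Longrightarrow> kfun H x \<in> funs H" by (rule a9[rule_format, THEN conjunct1])
  show "x \<in> pts H \<Longrightarrow> f \<in> funs H \<Longrightarrow> ip H f (kfun H x) = f x"
    by (rule a9[rule_format, THEN conjunct2, rule_format, symmetric])
  show "(\<And>i::nat. s i \<in> funs H) \<Longrightarrow> (\<And>e. 0 < e \<Longrightarrow> \<exists>N. \<forall>i\<ge>N. \<forall>j\<ge>N. fnorm H (\<lambda>x. s i x - s j x) < e) \<Longrightarrow>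
    \<exists>f\<in>funs H. (\<lambda>i. fnorm H (\<lambda>x. s i x - f x)) \<longlonglongrightarrow> 0"
    by (rule a7[THEN conjunct1, rule_format]) blast
qed

lemma funs_outside: "f \<in> funs H \<Longrightarrow> x \<notin> pts H \<Longrightarrow> f x = 0"
  using restr_funs[of f] by (metis restr_def)

lemma scale_in: "f \<in> funs H \<Longrightarrow> (\<lambda>x. a * f x) \<in> funs H"
  and add_in: "f \<in> funs H \<Longrightarrow> g \<in> funs H \<Longrightarrow> (\<lambda>x. f x + g x) \<in> funs H"
  and diff_in: "f \<in> funs H \<Longrightarrow> g \<in> funs H \<Longrightarrow> (\<lambda>x. f x - g x) \<in> funs H"
  using lincomb_in[of f f a 0] lincomb_in[of f g 1 1] lincomb_in[of f g 1 "-1"] by simp_all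

lemma sum_in: "(\<And>i. i \<in> I \<Longrightarrow> f i \<in> funs H) \<Longrightarrow> (\<lambda>x. \<Sum>i\<in>I. f i x) \<in> funs H"
  by (induction I rule: infinite_finite_induct) (simp_all add: zero_in add_in)

lemma ip_scale_left: "f \<in> funs H \<Longrightarrow> h \<in> funs H \<Longrightarrow> ip H (\<lambda>x. a * f x) h = a * ip H f h"
  and ip_add_left: "f \<in> funs H \<Longrightarrow> g \<in> funs H \<Longrightarrow> h \<in> funs H \<Longrightarrow> ip H (\<lambda>x. f x + g x) h = ip H f h + ip H g h"
  and ip_diff_left: "f \<in> funs H \<Longrightarrow> g \<in> funs H \<Longrightarrow> h \<in> funs H \<Longrightarrow> ip H (\<lambda>x. f x - g x) h = ip H f h - ip H g h"
  using ip_lincomb_left[of f f h a 0] ip_lincomb_left[of f g h 1 1] ip_lincomb_left[of f g h 1 "-1"] by simp_all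

lemma ip_scale_right: "f \<in> funs H \<Longrightarrow> h \<in> funs H \<Longrightarrow> ip H h (\<lambda>x. a * f x) = cnj a * ip H h f"
  by (subst (1 2) ip_cnj) (simp_all add: ip_scale_left scale_in)

lemma ip_add_right: "f \<in> funs H \<Longrightarrow> g \<in> funs H \<Longrightarrow> h \<in> funs H \<Longrightarrow> ip H h (\<lambda>x. f x + g x) = ip H h f + ip H h g"
  by (subst (1 2 3) ip_cnj) (simp_all add: ip_add_left add_in)

lemma ip_diff_right: "f \<in> funs H \<Longrightarrow> g \<in> funs H \<Longrightarrow> h \<in> funs H \<Longrightarrow> ip H h (\<lambda>x. f x - g x) = ip H h f - ip H h g"
  by (subst (1 2 3) ip_cnj) (simp_all add: ip_diff_left diff_in)

lemma ip_zero: "h \<in> funs H \<Longrightarrow> ip H (\<lambda>_. 0) h = 0" "h \<in> funs H \<Longrightarrow> ip H h (\<lambda>_. 0) = 0"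
  using ip_scale_left[of h h 0] ip_scale_right[of h h 0] by simp_all

lemma ip_sum_right:
  "(\<And>i. i \<in> I \<Longrightarrow> f i \<in> funs H) \<Longrightarrow> h \<in> funs H \<Longrightarrow> ip H h (\<lambda>x. \<Sum>i\<in>I. f i x) = (\<Sum>i\<in>I. ip H h (f i))"
  by (induction I rule: infinite_finite_induct) (simp_all add: ip_zero ip_add_right sum_in)

lemma fnorm_nonneg [simp]: "0 \<le> fnorm H f"
  using ip_nonneg[of f] ip_outside[of f f] by (cases "f \<in> funs H") (simp_all add: fnorm_def)

lemma fnorm_sq: "(fnorm H f)\<^sup>2 = Re (ip H f f)"
  using ip_nonneg[of f] ip_outside[of f f] by (cases "f \<in> funs H") (simp_all add: fnorm_def)

lemma ip_self: "ip H f f = of_real ((fnorm H f)\<^sup>2)"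
proof (cases "f \<in> funs H")
  case True
  then have "Im (ip H f f) = 0" using ip_cnj[of f f] by (metis complex_cnj complex.sel(2) neg_equal_zero complex_surj)
  then show ?thesis by (simp add: fnorm_sq complex_eq_iff)
qed (simp add: ip_outside fnorm_sq)

lemma fnorm_add_sq:
  assumes "f \<in> funs H" "g \<in> funs H"
  shows "(fnorm H (\<lambda>x. f x + g x))\<^sup>2 = (fnorm H f)\<^sup>2 + 2 * Re (ip H f g) + (fnorm H g)\<^sup>2"
  using assms ip_cnj[of f g] by (simp add: fnorm_sq ip_add_left ip_add_right add_in)

lemma fnorm_scale: "f \<in> funs H \<Longrightarrow> fnorm H (\<lambda>x. a * f x) = cmod a * fnorm H f"
proof -
  assume f: "f \<in> funs H"
  have "ip H (\<lambda>x. a * f x) (\<lambda>x. a * f x) = (a * cnj a) * ip H f f"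
    using f by (simp add: ip_scale_left ip_scale_right scale_in)
  then have "complex_of_real ((fnorm H (\<lambda>x. a * f x))\<^sup>2) = of_real ((cmod a * fnorm H f)\<^sup>2)"
    unfolding ip_self complex_norm_square[symmetric] by (simp add: power_mult_distrib)
  then have "(fnorm H (\<lambda>x. a * f x))\<^sup>2 = (cmod a * fnorm H f)\<^sup>2" using of_real_eq_iff by blast
  then show ?thesis by (meson fnorm_nonneg norm_ge_zero mult_nonneg_nonneg power2_eq_imp_eq)
qed

lemma Cauchy_Schwarz:
  assumes "f \<in> funs H" "g \<in> funs H"
  shows "cmod (ip H f g) \<le> fnorm H f * fnorm H g"
proof -
  have "(cmod (ip H f g))\<^sup>2 \<le> (fnorm H f)\<^sup>2 * (fnorm H g)\<^sup>2"
  proof (rule quadratic_form_Cauchy_Schwarz)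
    fix s t
    have "(fnorm H (\<lambda>x. s * f x + t * g x))\<^sup>2
        = (cmod s)\<^sup>2 * (fnorm H f)\<^sup>2 + 2 * Re (s * cnj t * ip H f g) + (cmod t)\<^sup>2 * (fnorm H g)\<^sup>2"
      using assms by (simp add: fnorm_add_sq scale_in fnorm_scale ip_scale_left ip_scale_right power_mult_distrib mult.assoc)
    then show "0 \<le> \<dots>" by (metis zero_le_power2)
  qed
  then show ?thesis by (metis power_mult_distrib fnorm_nonneg mult_nonneg_nonneg norm_ge_zero power2_le_imp_le)
qed

lemma fnorm_triangle:
  assumes "f \<in> funs H" "g \<in> funs H"
  shows "fnorm H (\<lambda>x. f x + g x) \<le> fnorm H f + fnorm H g"
proof (rule power2_le_imp_le)
  have "Re (ip H f g) \<le> fnorm H f * fnorm H g"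
    using Cauchy_Schwarz[OF assms] complex_Re_le_cmod order_trans by blast
  then show "(fnorm H (\<lambda>x. f x + g x))\<^sup>2 \<le> (fnorm H f + fnorm H g)\<^sup>2"
    using assms by (simp add: fnorm_add_sq power2_sum)
qed simp

lemma fnorm_zero: "fnorm H (\<lambda>_. 0) = 0"
  using ip_zero[OF zero_in] by (simp add: fnorm_def)

lemma fnorm_eq_0: "f \<in> funs H \<Longrightarrow> fnorm H f = 0 \<Longrightarrow> f = (\<lambda>_. 0)"
  using ip_definite[of f] by (simp add: ip_self)

lemma point_bound: "f \<in> funs H \<Longrightarrow> x \<in> pts H \<Longrightarrow> cmod (f x) \<le> fnorm H f * fnorm H (kfun H x)"
  using Cauchy_Schwarz[of f "kfun H x"] by (simp add: reproducing kfun_in)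

end

section \<open>Existence and uniqueness of the space of a positive kernel\<close>

definition coefs :: "'a set \<Rightarrow> ('a \<Rightarrow> complex) set" where
  "coefs X = {c. finite {v. c v \<noteq> 0} \<and> {v. c v \<noteq> 0} \<subseteq> X}"

text \<open>By the reproducing property this is the inner product of \<open>f\<close> with
  \<open>kcomb X k c\<close>. It makes sense for every function \<open>f\<close>, so it is available
  before the space exists.\<close>

definition pairing :: "('a \<Rightarrow> complex) \<Rightarrow> ('a \<Rightarrow> complex) \<Rightarrow> complex" where
  "pairing f c = (\<Sum>v | c v \<noteq> 0. f v * cnj (c v))"

definition kcomb :: "'a set \<Rightarrow> ('a \<Rightarrow> 'a \<Rightarrow> complex) \<Rightarrow> ('a \<Rightarrow> complex) \<Rightarrow> 'a \<Rightarrow> complex" where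
  "kcomb X k c = (\<lambda>u. if u \<in> X then \<Sum>v | c v \<noteq> 0. c v * k u v else 0)"

lemma pairing_eq: "finite S \<Longrightarrow> {v. c v \<noteq> 0} \<subseteq> S \<Longrightarrow> pairing f c = (\<Sum>v\<in>S. f v * cnj (c v))"
  unfolding pairing_def by (rule sum.mono_neutral_left) auto

lemma kcomb_eq: "finite S \<Longrightarrow> {v. c v \<noteq> 0} \<subseteq> S \<Longrightarrow> u \<in> X \<Longrightarrow> kcomb X k c u = (\<Sum>v\<in>S. c v * k u v)"
  unfolding kcomb_def by (simp, rule sum.mono_neutral_left) auto

lemma coefsI: "finite S \<Longrightarrow> S \<subseteq> X \<Longrightarrow> (\<And>v. v \<notin> S \<Longrightarrow> c v = 0) \<Longrightarrow> c \<in> coefs X"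
  unfolding coefs_def by (auto intro: finite_subset[of _ S])

lemma coefsD: "c \<in> coefs X \<Longrightarrow> finite {v. c v \<noteq> 0}" "c \<in> coefs X \<Longrightarrow> {v. c v \<noteq> 0} \<subseteq> X"
  by (auto simp: coefs_def)

lemma coefs_lincomb: "c \<in> coefs X \<Longrightarrow> e \<in> coefs X \<Longrightarrow> (\<lambda>v. a * c v + b * e v) \<in> coefs X"
  by (rule coefsI[of "{v. c v \<noteq> 0} \<union> {v. e v \<noteq> 0}"]) (auto simp: coefs_def)

lemma coefs_diff: "c \<in> coefs X \<Longrightarrow> e \<in> coefs X \<Longrightarrow> (\<lambda>v. c v - e v) \<in> coefs X"
  using coefs_lincomb[of c X e 1 "-1"] by simp

lemma coefs_mult: "c \<in> coefs X \<Longrightarrow> (\<lambda>v. a v * c v) \<in> coefs X"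
  by (rule coefsI[of "{v. c v \<noteq> 0}"]) (auto simp: coefs_def)

lemma coefs_single: "x \<in> X \<Longrightarrow> (\<lambda>v. if v = x then a else 0) \<in> coefs X"
  by (auto simp: coefs_def intro: finite_subset[of _ "{x}"])

lemma pairing_lincomb_left: "pairing (\<lambda>x. a * f x + b * g x) c = a * pairing f c + b * pairing g c"
  by (simp add: pairing_def sum_distrib_left sum.distrib algebra_simps)

lemma pairing_diff_left: "pairing (\<lambda>x. f x - g x) c = pairing f c - pairing g c"
  using pairing_lincomb_left[of 1 f "-1" g] by simp

lemma pairing_lincomb_right:
  assumes "c \<in> coefs X" "e \<in> coefs X"
  shows "pairing f (\<lambda>v. a * c v + b * e v) = cnj a * pairing f c + cnj b * pairing f e"
proof -
  let ?S = "{v. c v \<noteq> 0} \<union> {v. e v \<noteq> 0}"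
  have S: "finite ?S" using assms by (simp add: coefs_def)
  show ?thesis
    by (subst (1 2 3) pairing_eq[OF S]) (auto simp: sum_distrib_left sum.distrib algebra_simps)
qed

lemma pairing_diff_right: "c \<in> coefs X \<Longrightarrow> e \<in> coefs X \<Longrightarrow> pairing f (\<lambda>v. c v - e v) = pairing f c - pairing f e"
  using pairing_lincomb_right[of c X e f 1 "-1"] by simp

lemma kcomb_lincomb:
  assumes "c \<in> coefs X" "e \<in> coefs X"
  shows "kcomb X k (\<lambda>v. a * c v + b * e v) = (\<lambda>u. a * kcomb X k c u + b * kcomb X k e u)"
proof
  fix u
  let ?S = "{v. c v \<noteq> 0} \<union> {v. e v \<noteq> 0}"
  have S: "finite ?S" using assms by (simp add: coefs_def)
  show "kcomb X k (\<lambda>v. a * c v + b * e v) u = a * kcomb X k c u + b * kcomb X k e u"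
  proof (cases "u \<in> X")
    case True
    then show ?thesis
      by (subst (1 2 3) kcomb_eq[OF S]) (auto simp: sum_distrib_left sum.distrib algebra_simps)
  qed (simp add: kcomb_def)
qed

lemma kcomb_diff: "c \<in> coefs X \<Longrightarrow> e \<in> coefs X \<Longrightarrow> kcomb X k (\<lambda>v. c v - e v) = (\<lambda>u. kcomb X k c u - kcomb X k e u)"
  using kcomb_lincomb[of c X e k 1 "-1"] by simp

lemma pairing_single: "pairing f (\<lambda>v. if v = x then a else 0) = f x * cnj a"
  by (subst pairing_eq[of "{x}"]) auto

lemma kcomb_single: "u \<in> X \<Longrightarrow> kcomb X k (\<lambda>v. if v = x then a else 0) u = a * k u x"
  by (subst kcomb_eq[of "{x}"]) auto

lemma restr_kcomb: "restr X (kcomb X k c) = kcomb X k c"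
  by (auto simp: restr_def kcomb_def)

locale psd_kernel =
  fixes X :: "'a set" and k :: "'a \<Rightarrow> 'a \<Rightarrow> complex"
  assumes herm: "u \<in> X \<Longrightarrow> v \<in> X \<Longrightarrow> k v u = cnj (k u v)"
    and psd: "c \<in> coefs X \<Longrightarrow> 0 \<le> Re (pairing (kcomb X k c) c)"
begin

text \<open>The norm that \<open>kcomb X k c\<close> will have in the space under
  construction.\<close>

definition nrm :: "('a \<Rightarrow> complex) \<Rightarrow> real" where
  "nrm c = sqrt (Re (pairing (kcomb X k c) c))"

lemma pairing_kcomb_cnj:
  assumes "c \<in> coefs X" "e \<in> coefs X"
  shows "pairing (kcomb X k c) e = cnj (pairing (kcomb X k e) c)"
proof -
  have "pairing (kcomb X k c) e = (\<Sum>u | e u \<noteq> 0. \<Sum>v | c v \<noteq> 0. c v * k u v * cnj (e u))"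
    unfolding pairing_def using assms
    by (intro sum.cong) (auto simp: kcomb_def coefs_def sum_distrib_right)
  also have "\<dots> = (\<Sum>u | e u \<noteq> 0. \<Sum>v | c v \<noteq> 0. cnj (e u * k v u * cnj (c v)))"
  proof (intro sum.cong refl)
    fix u v assume "u \<in> {u. e u \<noteq> 0}" "v \<in> {v. c v \<noteq> 0}"
    then have "k u v = cnj (k v u)" using assms coefsD(2) by (intro herm) blast+
    then show "c v * k u v * cnj (e u) = cnj (e u * k v u * cnj (c v))" by simp
  qed
  also have "\<dots> = (\<Sum>v | c v \<noteq> 0. \<Sum>u | e u \<noteq> 0. cnj (e u * k v u * cnj (c v)))"
    by (rule sum.swap)
  also have "\<dots> = cnj (pairing (kcomb X k e) c)"
    unfolding pairing_def cnj_sum using assms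
    by (intro sum.cong) (auto simp: kcomb_def coefs_def sum_distrib_right)
  finally show ?thesis .
qed

lemma nrm_nonneg: "c \<in> coefs X \<Longrightarrow> 0 \<le> nrm c"
  by (simp add: nrm_def psd)

lemma nrm_sq: "c \<in> coefs X \<Longrightarrow> (nrm c)\<^sup>2 = Re (pairing (kcomb X k c) c)"
  by (simp add: nrm_def psd)

lemma pairing_self: "c \<in> coefs X \<Longrightarrow> pairing (kcomb X k c) c = of_real ((nrm c)\<^sup>2)"
  using pairing_kcomb_cnj[of c c] by (simp add: nrm_sq complex_eq_iff)

lemma nrm_lincomb_sq:
  assumes "c \<in> coefs X" "e \<in> coefs X"
  shows "(nrm (\<lambda>v. a * c v + b * e v))\<^sup>2
    = (cmod a)\<^sup>2 * (nrm c)\<^sup>2 + 2 * Re (a * cnj b * pairing (kcomb X k c) e) + (cmod b)\<^sup>2 * (nrm e)\<^sup>2"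
proof -
  have m: "Re (z * cnj z * of_real r) = (cmod z)\<^sup>2 * r" for z and r :: real
    unfolding complex_norm_square[symmetric] by simp
  have "Re (b * cnj a * pairing (kcomb X k e) c) = Re (a * cnj b * pairing (kcomb X k c) e)"
    using pairing_kcomb_cnj[OF assms] by (simp add: algebra_simps)
  then show ?thesis
    using assms m[of a "(nrm c)\<^sup>2"] m[of b "(nrm e)\<^sup>2"]
    by (simp add: nrm_sq[OF coefs_lincomb] kcomb_lincomb pairing_lincomb_left pairing_lincomb_right
        pairing_self algebra_simps)
qed

lemma pairing_Cauchy_Schwarz:
  assumes "c \<in> coefs X" "e \<in> coefs X"
  shows "cmod (pairing (kcomb X k c) e) \<le> nrm c * nrm e"
proof -
  have "(cmod (pairing (kcomb X k c) e))\<^sup>2 \<le> (nrm c)\<^sup>2 * (nrm e)\<^sup>2"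
    by (rule quadratic_form_Cauchy_Schwarz)
      (metis nrm_lincomb_sq[OF assms] zero_le_power2)
  then show ?thesis using nrm_nonneg assms
    by (metis power_mult_distrib mult_nonneg_nonneg norm_ge_zero power2_le_imp_le)
qed

text \<open>The space is realised as those functions whose pairing with kernel combinations is a
  bounded functional. It consists of functions from the start, so no abstract completion is needed,
  and the least bound becomes the norm.\<close>

definition bnd :: "('a \<Rightarrow> complex) \<Rightarrow> real \<Rightarrow> bool" where
  "bnd f C \<longleftrightarrow> 0 \<le> C \<and> (\<forall>c\<in>coefs X. cmod (pairing f c) \<le> C * nrm c)"

definition space :: "('a \<Rightarrow> complex) set" where
  "space = {f. restr X f = f \<and> (\<exists>C. bnd f C)}"

lemma bndD: "bnd f C \<Longrightarrow> c \<in> coefs X \<Longrightarrow> cmod (pairing f c) \<le> C * nrm c"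
  by (simp add: bnd_def)

lemma bnd_nonneg: "bnd f C \<Longrightarrow> 0 \<le> C"
  by (simp add: bnd_def)

lemma bnd_lincomb:
  assumes "bnd f C" "bnd g D"
  shows "bnd (\<lambda>x. a * f x + b * g x) (cmod a * C + cmod b * D)"
  unfolding bnd_def
proof (intro conjI ballI)
  fix c assume c: "c \<in> coefs X"
  have "cmod (pairing (\<lambda>x. a * f x + b * g x) c) \<le> cmod a * cmod (pairing f c) + cmod b * cmod (pairing g c)"
    unfolding pairing_lincomb_left by (metis norm_mult norm_triangle_ineq)
  also have "\<dots> \<le> cmod a * (C * nrm c) + cmod b * (D * nrm c)"
    by (intro add_mono mult_left_mono bndD[OF assms(1)] bndD[OF assms(2)] c) auto
  finally show "cmod (pairing (\<lambda>x. a * f x + b * g x) c) \<le> (cmod a * C + cmod b * D) * nrm c"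
    by (simp add: algebra_simps)
qed (use assms in \<open>simp add: bnd_nonneg\<close>)

lemma bnd_add: "bnd f C \<Longrightarrow> bnd g D \<Longrightarrow> bnd (\<lambda>x. f x + g x) (C + D)"
  and bnd_diff: "bnd f C \<Longrightarrow> bnd g D \<Longrightarrow> bnd (\<lambda>x. f x - g x) (C + D)"
  using bnd_lincomb[of f C g D 1 1] bnd_lincomb[of f C g D 1 "-1"] by simp_all

lemma bnd_kcomb: "c \<in> coefs X \<Longrightarrow> bnd (kcomb X k c) (nrm c)"
  by (simp add: bnd_def nrm_nonneg pairing_Cauchy_Schwarz)

lemma nrm_le_bnd:
  assumes "bnd (kcomb X k c) C" "c \<in> coefs X"
  shows "nrm c \<le> C"
proof -
  have "(nrm c)\<^sup>2 \<le> C * nrm c"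
    using bndD[OF assms] assms(2) by (simp add: pairing_self norm_power)
  then show ?thesis using nrm_nonneg[OF assms(2)] bnd_nonneg[OF assms(1)]
    by (cases "nrm c = 0") (auto simp: power2_eq_square)
qed

lemma kcomb_in_space: "c \<in> coefs X \<Longrightarrow> kcomb X k c \<in> space"
  using bnd_kcomb by (auto simp: space_def restr_kcomb)

lemma space_outside:
  assumes "f \<in> space" "x \<notin> X"
  shows "f x = 0"
proof -
  have "restr X f x = f x" using assms(1) by (simp add: space_def)
  then show ?thesis using assms(2) by (simp add: restr_def)
qed

lemma spaceI: "(\<And>x. x \<notin> X \<Longrightarrow> f x = 0) \<Longrightarrow> bnd f C \<Longrightarrow> f \<in> space"
  by (auto simp: space_def restr_def)

lemma space_lincomb: "f \<in> space \<Longrightarrow> g \<in> space \<Longrightarrow> (\<lambda>x. a * f x + b * g x) \<in> space"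
proof -
  assume *: "f \<in> space" "g \<in> space"
  then obtain C D where "bnd f C" "bnd g D" by (auto simp: space_def)
  from bnd_lincomb[OF this, of a b] show ?thesis by (rule spaceI[rotated]) (simp add: space_outside *)
qed

lemma bnd_mono: "bnd f C \<Longrightarrow> C \<le> D \<Longrightarrow> bnd f D"
  unfolding bnd_def by (meson mult_right_mono nrm_nonneg order_trans)

lemma bnd_point:
  assumes "bnd f C" "x \<in> X"
  shows "cmod (f x) \<le> C * nrm (\<lambda>v. if v = x then 1 else 0)"
  using bndD[OF assms(1) coefs_single[OF assms(2)], of 1] by (simp add: pairing_single)

text \<open>Riesz: an approximate minimiser of \<open>nrm c ^ 2 - 2 Re (pairing f c)\<close> approximates \<open>f\<close>.\<close>
lemma space_dense:
  assumes f: "bnd f C" and e: "0 < e"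
  shows "\<exists>c\<in>coefs X. bnd (\<lambda>x. f x - kcomb X k c x) e"
proof -
  define J where "J = (\<lambda>c. (nrm c)\<^sup>2 - 2 * Re (pairing f c))"
  have J: "- C\<^sup>2 \<le> J c" if "c \<in> coefs X" for c
  proof -
    have "Re (pairing f c) \<le> C * nrm c" using bndD[OF f that] complex_Re_le_cmod order_trans by blast
    moreover have "0 \<le> (C - nrm c)\<^sup>2" by simp
    ultimately show ?thesis by (simp add: J_def power2_diff)
  qed
  have ne: "(\<lambda>_. 0) \<in> coefs X" by (simp add: coefs_def)
  have bb: "bdd_below (J ` coefs X)" using J by (rule bdd_belowI2)
  \<comment> \<open>The infimum need not be attained; a slack of \<open>e^2\<close> is what yields
    the final bound \<open>e\<close>.\<close>
  have "\<exists>c\<in>coefs X. J c < (INF c\<in>coefs X. J c) + e\<^sup>2"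
    by (rule cINF_less_iff[THEN iffD1, OF _ bb]) (use ne e in auto)
  then obtain c where c: "c \<in> coefs X" and Jc: "J c < (INF c\<in>coefs X. J c) + e\<^sup>2" by blast
  have min: "J c - e\<^sup>2 \<le> J c'" if "c' \<in> coefs X" for c'
    using cINF_lower[OF bb that] Jc by linarith
  let ?h = "\<lambda>x. f x - kcomb X k c x"
  have "cmod (pairing ?h c') \<le> e * nrm c'" if c': "c' \<in> coefs X" for c'
  proof -
    have "(cmod (pairing ?h c'))\<^sup>2 \<le> (nrm c')\<^sup>2 * e\<^sup>2"
    proof (rule quadratic_form_Cauchy_Schwarz)
      fix s t :: complex
      show "0 \<le> (cmod s)\<^sup>2 * (nrm c')\<^sup>2 + 2 * Re (s * cnj t * pairing ?h c') + (cmod t)\<^sup>2 * e\<^sup>2"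
      proof (cases "t = 0")
        case False
        \<comment> \<open>Near-minimality at \<open>c + r c'\<close>, multiplied by
          \<open>(cmod t)^2\<close>, becomes exactly the nonnegativity required of the form in
          \<open>s\<close> and \<open>t\<close>.\<close>
        define r where "r = - cnj s * t / of_real ((cmod t)\<^sup>2)"
        have tt: "complex_of_real ((cmod t)\<^sup>2) = t * cnj t" by (rule complex_norm_square)
        have r2: "(cmod r)\<^sup>2 = (cmod s)\<^sup>2 / (cmod t)\<^sup>2"
        proof -
          have "cmod r = cmod s * cmod t / (cmod t)\<^sup>2"
            by (simp add: r_def norm_divide norm_mult norm_power)
          then show ?thesis using False by (simp add: power2_eq_square)
        qed
        have "J (\<lambda>v. 1 * c v + r * c' v) = J c + (cmod r)\<^sup>2 * (nrm c')\<^sup>2 - 2 * Re (cnj r * pairing ?h c')"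
          unfolding J_def nrm_lincomb_sq[OF c c'] pairing_lincomb_right[OF c c'] pairing_diff_left
          by (simp add: algebra_simps)
        with min[OF coefs_lincomb[OF c c', of 1 r]]
        have "0 \<le> (cmod r)\<^sup>2 * (nrm c')\<^sup>2 - 2 * Re (cnj r * pairing ?h c') + e\<^sup>2" by simp
        then have "0 \<le> (cmod t)\<^sup>2 * ((cmod r)\<^sup>2 * (nrm c')\<^sup>2 - 2 * Re (cnj r * pairing ?h c') + e\<^sup>2)" by simp
        also have "\<dots> = (cmod s)\<^sup>2 * (nrm c')\<^sup>2 - 2 * Re (of_real ((cmod t)\<^sup>2) * cnj r * pairing ?h c') + (cmod t)\<^sup>2 * e\<^sup>2"
          using False by (simp add: r2 algebra_simps)
        also have "of_real ((cmod t)\<^sup>2) * cnj r = - (s * cnj t)"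
          using False by (simp add: r_def)
        finally show ?thesis by simp
      qed simp
    qed
    then show ?thesis using nrm_nonneg[OF c'] e
      by (metis mult.commute power_mult_distrib mult_nonneg_nonneg norm_ge_zero power2_le_imp_le less_imp_le)
  qed
  then show ?thesis using c e by (auto simp: bnd_def intro!: bexI[of _ c])
qed

definition approx :: "('a \<Rightarrow> complex) \<Rightarrow> nat \<Rightarrow> 'a \<Rightarrow> complex" where
  "approx g n = (SOME c. c \<in> coefs X \<and> bnd (\<lambda>x. g x - kcomb X k c x) (1 / Suc n))"

lemma approx:
  assumes "g \<in> space"
  shows "approx g n \<in> coefs X" "bnd (\<lambda>x. g x - kcomb X k (approx g n) x) (1 / Suc n)"
proof -
  obtain C where "bnd g C" using assms by (auto simp: space_def)
  from space_dense[OF this, of "1 / Suc n"]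
  have "\<exists>c. c \<in> coefs X \<and> bnd (\<lambda>x. g x - kcomb X k c x) (1 / Suc n)" by auto
  from someI_ex[OF this] show "approx g n \<in> coefs X" "bnd (\<lambda>x. g x - kcomb X k (approx g n) x) (1 / Suc n)"
    by (simp_all add: approx_def)
qed

lemma nrm_diff_le:
  assumes "bnd (\<lambda>x. g x - kcomb X k c x) e" "bnd (\<lambda>x. g x - kcomb X k c' x) e'" "c \<in> coefs X" "c' \<in> coefs X"
  shows "nrm (\<lambda>v. c v - c' v) \<le> e + e'"
proof (rule nrm_le_bnd)
  show "bnd (kcomb X k (\<lambda>v. c v - c' v)) (e + e')"
    using bnd_diff[OF assms(2,1)] by (simp add: kcomb_diff assms add.commute)
qed (simp add: coefs_diff assms)

lemma pairing_diff_le: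
  assumes f: "bnd f C" and "bnd (\<lambda>x. g x - kcomb X k c x) e" "bnd (\<lambda>x. g x - kcomb X k c' x) e'" "c \<in> coefs X" "c' \<in> coefs X"
  shows "cmod (pairing f c - pairing f c') \<le> C * (e + e')"
proof -
  have "cmod (pairing f c - pairing f c') \<le> C * nrm (\<lambda>v. c v - c' v)"
    using bndD[OF f coefs_diff[OF assms(4,5)]] pairing_diff_right[OF assms(4,5)] by simp
  also have "\<dots> \<le> C * (e + e')" by (intro mult_left_mono nrm_diff_le[OF assms(2-5)] bnd_nonneg[OF f])
  finally show ?thesis .
qed

text \<open>Only the second argument is approximated by kernel combinations, so linearity in the
  first is immediate and symmetry has to be proved. The value 0 off \<open>space\<close> is the
  normalisation of \<open>is_rkhs\<close>.\<close>

definition inn :: "('a \<Rightarrow> complex) \<Rightarrow> ('a \<Rightarrow> complex) \<Rightarrow> complex" where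
  "inn f g = (if f \<in> space \<and> g \<in> space then lim (\<lambda>n. pairing f (approx g n)) else 0)"

lemma inn_tendsto:
  assumes f: "f \<in> space" and g: "g \<in> space"
  shows "(\<lambda>n. pairing f (approx g n)) \<longlonglongrightarrow> inn f g"
proof -
  obtain C where C: "bnd f C" using f by (auto simp: space_def)
  have "Cauchy (\<lambda>n. pairing f (approx g n))"
  proof (rule metric_CauchyI)
    fix e :: real assume e: "0 < e"
    obtain N where N: "C * (2 * inverse (Suc N)) < e"
    proof -
      have "(\<lambda>n. C * (2 * inverse (Suc n))) \<longlonglongrightarrow> C * (2 * 0)"
        by (intro tendsto_intros LIMSEQ_inverse_real_of_nat)
      then have "\<forall>\<^sub>F n in sequentially. C * (2 * inverse (Suc n)) < e"
        using e by (intro order_tendstoD(2)) simp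
      then show thesis using that by (auto simp: eventually_sequentially)
    qed
    have "dist (pairing f (approx g n)) (pairing f (approx g m)) < e" if "n \<ge> N" "m \<ge> N" for n m
    proof -
      have "dist (pairing f (approx g n)) (pairing f (approx g m)) \<le> C * (1 / Suc n + 1 / Suc m)"
        unfolding dist_norm by (rule pairing_diff_le[OF C]) (rule approx[OF g])+
      also have "\<dots> \<le> C * (2 * inverse (Suc N))"
      proof (rule mult_left_mono[OF _ bnd_nonneg[OF C]])
        have "1 / real (Suc n) \<le> 1 / Suc N" "1 / real (Suc m) \<le> 1 / Suc N" using that by (simp_all add: frac_le)
        then show "1 / real (Suc n) + 1 / real (Suc m) \<le> 2 * inverse (real (Suc N))"
          by (simp add: inverse_eq_divide)
      qed
      finally show ?thesis using N by linarith
    qed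
    then show "\<exists>M. \<forall>m\<ge>M. \<forall>n\<ge>M. dist (pairing f (approx g m)) (pairing f (approx g n)) < e" by blast
  qed
  then show ?thesis using f g by (simp add: inn_def Cauchy_convergent_iff convergent_LIMSEQ_iff)
qed

lemma inn_approx:
  assumes f: "bnd f C" "f \<in> space" and g: "bnd (\<lambda>x. g x - kcomb X k c x) e" "g \<in> space" "c \<in> coefs X"
  shows "cmod (inn f g - pairing f c) \<le> C * e"
proof -
  have "(\<lambda>n. cmod (pairing f (approx g n) - pairing f c)) \<longlonglongrightarrow> cmod (inn f g - pairing f c)"
    by (intro tendsto_intros inn_tendsto f g)
  moreover have "(\<lambda>n. C * (inverse (Suc n) + e)) \<longlonglongrightarrow> C * (0 + e)"
    by (intro tendsto_intros LIMSEQ_inverse_real_of_nat)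
  moreover have "cmod (pairing f (approx g n) - pairing f c) \<le> C * (inverse (Suc n) + e)" for n
    using pairing_diff_le[OF f(1) approx(2)[OF g(2)] g(1) approx(1)[OF g(2)] g(3)] by (simp add: inverse_eq_divide)
  ultimately have "cmod (inn f g - pairing f c) \<le> C * (0 + e)" by (blast intro: LIMSEQ_le)
  then show ?thesis by simp
qed

lemma inn_kcomb:
  assumes "f \<in> space" "c \<in> coefs X"
  shows "inn f (kcomb X k c) = pairing f c"
proof -
  obtain C where C: "bnd f C" using assms by (auto simp: space_def)
  have "bnd (\<lambda>x. kcomb X k c x - kcomb X k c x) 0" by (simp add: bnd_def pairing_def)
  from inn_approx[OF C assms(1) this kcomb_in_space] assms(2) show ?thesis by simp
qed

text \<open>Between kernel combinations the symmetry is \<open>pairing_kcomb_cnj\<close>. Both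
  functions are replaced by combinations within \<open>e\<close>, and the total error vanishes with
  \<open>e\<close>.\<close>

lemma inn_cnj:
  assumes f: "f \<in> space" and g: "g \<in> space"
  shows "inn g f = cnj (inn f g)"
proof -
  obtain C D where C: "bnd f C" and D: "bnd g D" using f g by (auto simp: space_def)
  have est: "cmod (inn g f - cnj (inn f g)) \<le> e * (2 * C + 2 * D + 2 * e)" if e: "0 < e" for e
  proof -
    obtain a where a: "a \<in> coefs X" "bnd (\<lambda>x. f x - kcomb X k a x) e" using space_dense[OF C e] by blast
    obtain b where b: "b \<in> coefs X" "bnd (\<lambda>x. g x - kcomb X k b x) e" using space_dense[OF D e] by blast
    have n: "nrm c \<le> E + e" if "c \<in> coefs X" "bnd (\<lambda>x. h x - kcomb X k c x) e" "bnd h E" for c h E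
    proof (rule nrm_le_bnd)
      show "bnd (kcomb X k c) (E + e)" using bnd_diff[OF that(3,2)] by simp
    qed fact
    have 1: "cmod (inn f g - pairing f b) \<le> C * e" by (rule inn_approx[OF C f b(2) g b(1)])
    have 2: "cmod (inn g f - pairing g a) \<le> D * e" by (rule inn_approx[OF D g a(2) f a(1)])
    have 3: "cmod (pairing f b - pairing (kcomb X k a) b) \<le> e * (D + e)"
      using order_trans[OF bndD[OF a(2) b(1)] mult_left_mono[OF n[OF b D]]] e by (simp add: pairing_diff_left)
    have 4: "cmod (pairing g a - pairing (kcomb X k b) a) \<le> e * (C + e)"
      using order_trans[OF bndD[OF b(2) a(1)] mult_left_mono[OF n[OF a C]]] e by (simp add: pairing_diff_left)
    have triangle: "cmod (p + q - r - s) \<le> cmod p + cmod q + cmod r + cmod s" for p q r s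
      by (smt (verit) norm_triangle_ineq norm_triangle_ineq4)
    have "inn g f - cnj (inn f g) = (inn g f - pairing g a) + (pairing g a - pairing (kcomb X k b) a)
       - cnj (pairing f b - pairing (kcomb X k a) b) - cnj (inn f g - pairing f b)"
      using pairing_kcomb_cnj[OF b(1) a(1)] by simp
    also have "cmod \<dots> \<le> D * e + e * (C + e) + e * (D + e) + C * e"
      using 1 2 3 4 complex_mod_cnj[of "pairing f b - pairing (kcomb X k a) b"]
        complex_mod_cnj[of "inn f g - pairing f b"] triangle by (smt (verit))
    also have "\<dots> = e * (2 * C + 2 * D + 2 * e)" by (simp add: algebra_simps)
    finally show ?thesis .
  qed
  have "((\<lambda>e. e * (2 * C + 2 * D + 2 * e)) \<longlongrightarrow> 0 * (2 * C + 2 * D + 2 * 0)) (at_right 0)"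
    by (intro tendsto_intros)
  then have "cmod (inn g f - cnj (inn f g)) \<le> 0 * (2 * C + 2 * D + 2 * 0)"
    by (rule tendsto_le[OF trivial_limit_at_right_real _ tendsto_const])
      (use est in \<open>auto simp: eventually_at_right_less eventually_at_filter intro!: eventuallyI\<close>)
  then show ?thesis by simp
qed

lemma inn_lincomb_left:
  assumes "f \<in> space" "g \<in> space" "h \<in> space"
  shows "inn (\<lambda>x. a * f x + b * g x) h = a * inn f h + b * inn g h"
proof (rule LIMSEQ_unique)
  show "(\<lambda>n. pairing (\<lambda>x. a * f x + b * g x) (approx h n)) \<longlonglongrightarrow> inn (\<lambda>x. a * f x + b * g x) h"
    by (intro inn_tendsto space_lincomb assms)
  show "(\<lambda>n. pairing (\<lambda>x. a * f x + b * g x) (approx h n)) \<longlonglongrightarrow> a * inn f h + b * inn g h"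
    unfolding pairing_lincomb_left by (intro tendsto_intros inn_tendsto assms)
qed

lemma inn_self_nrm: "f \<in> space \<Longrightarrow> (\<lambda>n. (nrm (approx f n))\<^sup>2) \<longlonglongrightarrow> Re (inn f f)"
proof -
  assume f: "f \<in> space"
  obtain C where C: "bnd f C" using f by (auto simp: space_def)
  note a = approx[OF f]
  have n: "nrm (approx f n) \<le> C + inverse (Suc n)" for n
  proof (rule nrm_le_bnd[OF _ a(1)])
    show "bnd (kcomb X k (approx f n)) (C + inverse (Suc n))"
      using bnd_diff[OF C a(2)[of n]] by (simp add: inverse_eq_divide)
  qed
  have "(\<lambda>n. pairing f (approx f n) - of_real ((nrm (approx f n))\<^sup>2)) \<longlonglongrightarrow> 0"
  proof (rule Lim_null_comparison[OF always_eventually], rule allI)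
    fix n
    have "norm (pairing f (approx f n) - of_real ((nrm (approx f n))\<^sup>2)) \<le> (1 / Suc n) * nrm (approx f n)"
      using bndD[OF a(2)[of n] a(1)[of n]] by (simp add: pairing_diff_left pairing_self[OF a(1)])
    also have "\<dots> \<le> (1 / Suc n) * (C + inverse (Suc n))" by (intro mult_left_mono n) simp
    finally show "norm (pairing f (approx f n) - of_real ((nrm (approx f n))\<^sup>2)) \<le> inverse (Suc n) * (C + inverse (Suc n))"
      by (simp add: inverse_eq_divide)
  next
    have "(\<lambda>n. inverse (Suc n) * (C + inverse (Suc n))) \<longlonglongrightarrow> 0 * (C + 0)"
      by (intro tendsto_intros LIMSEQ_inverse_real_of_nat)
    then show "(\<lambda>n. inverse (Suc n) * (C + inverse (Suc n))) \<longlonglongrightarrow> 0" by simp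
  qed
  from tendsto_diff[OF inn_tendsto[OF f f] this]
  have "(\<lambda>n. complex_of_real ((nrm (approx f n))\<^sup>2)) \<longlonglongrightarrow> inn f f" by simp
  from tendsto_Re[OF this] show ?thesis by (simp del: of_real_power)
qed

lemma inn_self_nonneg: "f \<in> space \<Longrightarrow> 0 \<le> Re (inn f f)"
  by (rule LIMSEQ_le_const[OF inn_self_nrm]) auto

lemma inn_self_le:
  assumes f: "f \<in> space" and C: "bnd f C"
  shows "Re (inn f f) \<le> C\<^sup>2"
proof -
  note a = approx[OF f]
  have n: "nrm (approx f n) \<le> C + inverse (Suc n)" for n
  proof (rule nrm_le_bnd[OF _ a(1)])
    show "bnd (kcomb X k (approx f n)) (C + inverse (Suc n))"
      using bnd_diff[OF C a(2)[of n]] by (simp add: inverse_eq_divide)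
  qed
  have "(\<lambda>n. (C + inverse (Suc n))\<^sup>2) \<longlonglongrightarrow> (C + 0)\<^sup>2"
    by (intro tendsto_intros LIMSEQ_inverse_real_of_nat)
  then have "Re (inn f f) \<le> (C + 0)\<^sup>2"
    by (rule LIMSEQ_le[OF inn_self_nrm[OF f]]) (use n nrm_nonneg[OF a(1)] in \<open>auto intro!: power_mono\<close>)
  then show ?thesis by simp
qed

text \<open>Together with \<open>inn_self_le\<close> this identifies the norm of \<open>f\<close>
  with its least bound in the sense of \<open>bnd\<close>.\<close>

lemma bnd_inn:
  assumes f: "f \<in> space"
  shows "bnd f (sqrt (Re (inn f f)))"
  unfolding bnd_def
proof (intro conjI ballI)
  fix c assume c: "c \<in> coefs X"
  have "cmod (pairing f c) \<le> sqrt (Re (inn f f)) * nrm c"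
  proof (rule LIMSEQ_le)
    have "(\<lambda>n. nrm (approx f n)) \<longlonglongrightarrow> sqrt (Re (inn f f))"
      using tendsto_real_sqrt[OF inn_self_nrm[OF f]] approx[OF f] nrm_nonneg by simp
    then show "(\<lambda>n. (nrm (approx f n) + inverse (Suc n)) * nrm c) \<longlonglongrightarrow> sqrt (Re (inn f f)) * nrm c"
      using tendsto_mult[OF tendsto_add[OF _ LIMSEQ_inverse_real_of_nat] tendsto_const[of "nrm c"]] by fastforce
    have "cmod (pairing f c) \<le> (nrm (approx f n) + inverse (Suc n)) * nrm c" for n
    proof -
      have "bnd (\<lambda>x. (f x - kcomb X k (approx f n) x) + kcomb X k (approx f n) x) (1 / Suc n + nrm (approx f n))"
        by (intro bnd_add approx bnd_kcomb f)
      then show ?thesis using bndD[OF _ c] by (simp add: inverse_eq_divide add.commute)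
    qed
    then show "\<exists>N. \<forall>n\<ge>N. cmod (pairing f c) \<le> (nrm (approx f n) + inverse (Suc n)) * nrm c" by blast
  qed simp
  then show "cmod (pairing f c) \<le> sqrt (Re (inn f f)) * nrm c" .
qed (simp add: inn_self_nonneg f)

definition the_space :: "'a rkhs" where
  "the_space = \<lparr>pts = X, kern = (\<lambda>x y. if x \<in> X \<and> y \<in> X then k x y else 0), funs = space, ip = inn\<rparr>"

lemma is_rkhs_the_space: "is_rkhs the_space"
  unfolding is_rkhs_def the_space_def rkhs.simps
proof (intro conjI ballI allI impI)
  show "restr X f = f" if "f \<in> space" for f using that by (simp add: space_def)
  show "(\<lambda>_. 0) \<in> space" by (auto simp: space_def restr_def bnd_def pairing_def nrm_nonneg intro!: exI[of _ 0])
  show "(\<lambda>x. a * f x + b * g x) \<in> space" if "f \<in> space" "g \<in> space" for f g a b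
    using that by (rule space_lincomb)
  show "inn (\<lambda>x. a * f x + b * g x) h = a * inn f h + b * inn g h"
    if "f \<in> space" "g \<in> space" "h \<in> space" for f g h a b using that by (rule inn_lincomb_left)
  show "inn g f = cnj (inn f g)" if "f \<in> space" "g \<in> space" for f g using that by (rule inn_cnj)
  show "0 \<le> Re (inn f f)" if "f \<in> space" for f using that by (rule inn_self_nonneg)
  show "f = (\<lambda>_. 0)" if f: "f \<in> space" and "inn f f = 0" for f
  proof
    fix x
    have "bnd f 0" using bnd_inn[OF f] that(2) by simp
    from bnd_point[OF this, of x] show "f x = 0"
      using space_outside[OF f] by (cases "x \<in> X") auto
  qed
  show "inn f g = 0" if "f \<notin> space \<or> g \<notin> space" for f g using that by (auto simp: inn_def)
  show "(if x \<in> X \<and> y \<in> X then k x y else 0) = 0" if "x \<notin> X \<or> y \<notin> X" for x y using that by auto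
next
  fix x assume x: "x \<in> X"
  have k: "kfun \<lparr>pts = X, kern = (\<lambda>x y. if x \<in> X \<and> y \<in> X then k x y else 0), funs = space, ip = inn\<rparr> x
      = kcomb X k (\<lambda>v. if v = x then 1 else 0)"
  proof
    fix u
    show "kfun \<lparr>pts = X, kern = (\<lambda>x y. if x \<in> X \<and> y \<in> X then k x y else 0), funs = space, ip = inn\<rparr> x u
      = kcomb X k (\<lambda>v. if v = x then 1 else 0) u"
      using x kcomb_single[of u X k x 1] by (cases "u \<in> X") (simp_all add: kfun_def kcomb_def)
  qed
  show "kfun \<lparr>pts = X, kern = (\<lambda>x y. if x \<in> X \<and> y \<in> X then k x y else 0), funs = space, ip = inn\<rparr> x \<in> space"
    unfolding k by (intro kcomb_in_space coefs_single x)
  show "f x = inn f (kfun \<lparr>pts = X, kern = (\<lambda>x y. if x \<in> X \<and> y \<in> X then k x y else 0), funs = space, ip = inn\<rparr> x)"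
    if "f \<in> space" for f
    unfolding k inn_kcomb[OF that coefs_single[OF x]] pairing_single by simp
next
  let ?H = "\<lparr>pts = X, kern = (\<lambda>x y. if x \<in> X \<and> y \<in> X then k x y else 0), funs = space, ip = inn\<rparr>"
  fix s :: "nat \<Rightarrow> 'a \<Rightarrow> complex"
  assume s: "(\<forall>i. s i \<in> space) \<and> (\<forall>e>0. \<exists>N. \<forall>i\<ge>N. \<forall>j\<ge>N. fnorm ?H (\<lambda>x. s i x - s j x) < e)"
  have sd: "(\<lambda>x. s i x - s j x) \<in> space" for i j
    using space_lincomb[of "s i" "s j" 1 "-1"] s by simp
  have bd: "bnd (\<lambda>x. s i x - s j x) e" if "fnorm ?H (\<lambda>x. s i x - s j x) < e" for i j e
    by (rule bnd_mono[OF bnd_inn[OF sd]]) (use that in \<open>simp add: fnorm_def\<close>)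
  have conv: "\<exists>l. (\<lambda>i. s i x) \<longlonglongrightarrow> l" for x
  proof (cases "x \<in> X")
    case False
    then have "s i x = 0" for i using s space_outside by blast
    then show ?thesis by auto
  next
    case True
    let ?n = "nrm (\<lambda>v. if v = x then 1 else 0)"
    have n0: "0 \<le> ?n" using nrm_nonneg[OF coefs_single[OF True]] .
    have "Cauchy (\<lambda>i. s i x)"
    proof (rule metric_CauchyI)
      fix e :: real assume e: "0 < e"
      have "0 < e / (?n + 1)" using e n0 by (intro divide_pos_pos) auto
      then obtain N where N: "\<forall>i\<ge>N. \<forall>j\<ge>N. fnorm ?H (\<lambda>x. s i x - s j x) < e / (?n + 1)"
        using conjunct2[OF s, rule_format] by blast
      have "dist (s i x) (s j x) < e" if "i \<ge> N" "j \<ge> N" for i j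
      proof -
        have "dist (s i x) (s j x) \<le> e / (?n + 1) * ?n"
          using bnd_point[OF bd True, of i j "e / (?n + 1)"] N that by (simp add: dist_norm)
        also have "\<dots> < e" using e n0 by (simp add: field_simps)
        finally show ?thesis .
      qed
      then show "\<exists>M. \<forall>m\<ge>M. \<forall>n\<ge>M. dist (s m x) (s n x) < e" by blast
    qed
    then show ?thesis by (simp add: Cauchy_convergent_iff convergent_def)
  qed
  then obtain f where f: "\<And>x. (\<lambda>i. s i x) \<longlonglongrightarrow> f x" by metis
  \<comment> \<open>Pairings are finite sums, so the bounds survive pointwise limits; the pointwise
    limit is therefore a limit in norm.\<close>
  have bf: "bnd (\<lambda>x. s i x - f x) e" if N: "\<forall>i\<ge>N. \<forall>j\<ge>N. fnorm ?H (\<lambda>x. s i x - s j x) < e" and i: "i \<ge> N" for e N i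
    unfolding bnd_def
  proof (intro conjI ballI)
    show "0 \<le> e" by (rule bnd_nonneg[OF bd[OF N[rule_format, OF i i]]])
    fix c assume c: "c \<in> coefs X"
    have "(\<lambda>j. cmod (pairing (\<lambda>x. s i x - s j x) c)) \<longlonglongrightarrow> cmod (pairing (\<lambda>x. s i x - f x) c)"
      unfolding pairing_def by (intro tendsto_intros f)
    then show "cmod (pairing (\<lambda>x. s i x - f x) c) \<le> e * nrm c"
      by (rule LIMSEQ_le_const2) (use bd N i bndD[OF _ c] in blast)
  qed
  have rf: "restr X f = f"
  proof
    fix x
    have "s i x = 0" if "x \<notin> X" for i using s that space_outside by blast
    then show "restr X f x = f x" using f[of x] by (auto simp: restr_def LIMSEQ_const_iff)
  qed
  obtain N where N: "\<forall>i\<ge>N. \<forall>j\<ge>N. fnorm ?H (\<lambda>x. s i x - s j x) < 1" using s zero_less_one by blast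
  have "s N \<in> space" using s by blast
  then obtain C where C: "bnd (s N) C" unfolding space_def by blast
  have "bnd f (C + 1)" using bnd_diff[OF C bf[OF N order_refl]] by simp
  then have fs: "f \<in> space" using rf by (auto simp: space_def)
  have "(\<lambda>i. fnorm ?H (\<lambda>x. s i x - f x)) \<longlonglongrightarrow> 0"
  proof (rule LIMSEQ_I)
    fix e :: real assume e: "0 < e"
    have "0 < e / 2" using e by simp
    then obtain N where N: "\<forall>i\<ge>N. \<forall>j\<ge>N. fnorm ?H (\<lambda>x. s i x - s j x) < e / 2"
      using conjunct2[OF s, rule_format] by blast
    have "norm (fnorm ?H (\<lambda>x. s i x - f x) - 0) < e" if "i \<ge> N" for i
    proof -
      have sf: "(\<lambda>x. s i x - f x) \<in> space" using space_lincomb[of "s i" f 1 "-1"] s fs by simp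
      have "Re (inn (\<lambda>x. s i x - f x) (\<lambda>x. s i x - f x)) \<le> (e / 2)\<^sup>2"
        by (rule inn_self_le[OF sf bf[OF N that]])
      then have "fnorm ?H (\<lambda>x. s i x - f x) \<le> e / 2"
        using e unfolding fnorm_def by (simp only: rkhs.simps) (rule real_le_lsqrt, simp_all)
      then show ?thesis using e inn_self_nonneg[OF sf] by (simp add: fnorm_def)
    qed
    then show "\<exists>no. \<forall>n\<ge>no. norm (fnorm ?H (\<lambda>x. s n x - f x) - 0) < e" by blast
  qed
  then show "\<exists>f\<in>space. (\<lambda>i. fnorm ?H (\<lambda>x. s i x - f x)) \<longlonglongrightarrow> 0" using fs by blast
qed

text \<open>In any space with this kernel, pairing computes inner products with kernel combinations,
  so every element is bounded in the sense of \<open>bnd\<close>. Conversely completeness gives the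
  approximating combinations of an element of \<open>space\<close> a limit, which agrees with it
  pointwise. The normalisations in \<open>is_rkhs\<close> then yield equality of records, as the
  description in \<open>rkhs_of\<close> requires.\<close>

lemma rkhs_unique:
  assumes H: "is_rkhs H" and p: "pts H = X" and kH: "\<forall>x\<in>X. \<forall>y\<in>X. kern H x y = k x y"
  shows "H = the_space"
proof -
  interpret rk_space H by unfold_locales (rule H)
  have K: "kcomb X k c \<in> funs H \<and> (\<forall>f\<in>funs H. ip H f (kcomb X k c) = pairing f c)" if c: "c \<in> coefs X" for c
  proof -
    let ?S = "{v. c v \<noteq> 0}"
    have S: "v \<in> X" if "v \<in> ?S" for v using c that by (auto simp: coefs_def)
    have e: "kcomb X k c = (\<lambda>u. \<Sum>v\<in>?S. c v * kfun H v u)"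
    proof
      fix u show "kcomb X k c u = (\<Sum>v\<in>?S. c v * kfun H v u)"
        using S kH kern_outside[of u] p by (auto simp: kcomb_def kfun_def intro!: sum.cong)
    qed
    have "(\<lambda>u. c v * kfun H v u) \<in> funs H" if "v \<in> ?S" for v
      using S[OF that] p by (intro scale_in kfun_in) simp
    moreover have "ip H f (\<lambda>u. \<Sum>v\<in>?S. c v * kfun H v u) = pairing f c" if "f \<in> funs H" for f
      unfolding pairing_def using that S p
      by (subst ip_sum_right) (auto simp: ip_scale_right scale_in kfun_in reproducing mult.commute)
    ultimately show ?thesis unfolding e by (auto intro: sum_in)
  qed
  have nK: "fnorm H (kcomb X k c) = nrm c" if c: "c \<in> coefs X" for c
    using K[OF c] by (simp add: fnorm_def nrm_def)
  have bnd_H: "bnd f (fnorm H f)" if "f \<in> funs H" for f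
    using K that Cauchy_Schwarz[OF that] nK by (auto simp: bnd_def) metis
  have sub: "f \<in> space" if "f \<in> funs H" for f
    using bnd_H[OF that] restr_funs[OF that] p by (auto simp: space_def)
  have app: "f \<in> funs H \<and> (\<lambda>n. fnorm H (\<lambda>x. kcomb X k (approx f n) x - f x)) \<longlonglongrightarrow> 0" if f: "f \<in> space" for f
  proof -
    note a = approx[OF f]
    let ?s = "\<lambda>n. kcomb X k (approx f n)"
    have sin: "?s n \<in> funs H" for n using K[OF a(1)] by blast
    have dist: "fnorm H (\<lambda>x. ?s i x - ?s j x) \<le> 1 / Suc i + 1 / Suc j" for i j
      using nK[OF coefs_diff[OF a(1) a(1)], of i j] nrm_diff_le[OF a(2) a(2) a(1) a(1), of i j]
      by (simp add: kcomb_diff[OF a(1) a(1)])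
    have "\<exists>N. \<forall>i\<ge>N. \<forall>j\<ge>N. fnorm H (\<lambda>x. ?s i x - ?s j x) < e" if e: "0 < e" for e
    proof -
      obtain N where N: "inverse (real (Suc N)) < e / 2" using reals_Archimedean[of "e / 2"] e by auto
      have "fnorm H (\<lambda>x. ?s i x - ?s j x) < e" if "i \<ge> N" "j \<ge> N" for i j
      proof -
        have "1 / real (Suc i) \<le> inverse (Suc N)" "1 / real (Suc j) \<le> inverse (Suc N)"
          using that by (simp_all add: inverse_eq_divide frac_le)
        then show ?thesis using dist[of i j] N by linarith
      qed
      then show ?thesis by blast
    qed
    from complete[OF sin this] obtain g where g: "g \<in> funs H" and lim: "(\<lambda>i. fnorm H (\<lambda>x. ?s i x - g x)) \<longlonglongrightarrow> 0"
      by blast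
    have "g x = f x" for x
    proof (cases "x \<in> X")
      case False
      then show ?thesis using funs_outside[OF g] p space_outside[OF f] by simp
    next
      case True
      have "(\<lambda>i. ?s i x - g x) \<longlonglongrightarrow> 0"
      proof (rule Lim_null_comparison[OF always_eventually], rule allI)
        show "norm (?s i x - g x) \<le> fnorm H (\<lambda>x. ?s i x - g x) * fnorm H (kfun H x)" for i
          using point_bound[OF diff_in[OF sin g]] True p by simp
        show "(\<lambda>i. fnorm H (\<lambda>x. ?s i x - g x) * fnorm H (kfun H x)) \<longlonglongrightarrow> 0"
          using tendsto_mult[OF lim tendsto_const] by fastforce
      qed
      moreover have "(\<lambda>i. ?s i x - g x) \<longlonglongrightarrow> f x - g x"
      proof -
        have "(\<lambda>i. f x - ?s i x) \<longlonglongrightarrow> 0"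
        proof (rule Lim_null_comparison[OF always_eventually], rule allI)
          show "norm (f x - ?s i x) \<le> inverse (Suc i) * nrm (\<lambda>v. if v = x then 1 else 0)" for i
            using bnd_point[OF a(2) True] by (simp add: inverse_eq_divide)
          show "(\<lambda>i. inverse (Suc i) * nrm (\<lambda>v. if v = x then 1 else 0)) \<longlonglongrightarrow> 0"
            using tendsto_mult[OF LIMSEQ_inverse_real_of_nat tendsto_const] by fastforce
        qed
        from tendsto_diff[OF tendsto_const this, of "f x - g x"] show ?thesis by simp
      qed
      ultimately show ?thesis using LIMSEQ_unique by fastforce
    qed
    then have "g = f" by blast
    then show ?thesis using g lim by blast
  qed
  have funs: "funs H = space" using sub app by blast
  have "ip H f g = inn f g" for f g
  proof (cases "f \<in> space \<and> g \<in> space")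
    case False
    then show ?thesis using ip_outside[of f g] funs by (auto simp: inn_def)
  next
    case True
    then have f: "f \<in> space" and g: "g \<in> space" by auto
    have fH: "f \<in> funs H" and gH: "g \<in> funs H" using f g funs by auto
    have "(\<lambda>n. pairing f (approx g n) - ip H f g) \<longlonglongrightarrow> 0"
    proof (rule Lim_null_comparison[OF always_eventually], rule allI)
      fix n
      have KH: "kcomb X k (approx g n) \<in> funs H" using K approx(1)[OF g] by blast
      have "pairing f (approx g n) - ip H f g = ip H f (\<lambda>x. kcomb X k (approx g n) x - g x)"
        using K[OF approx(1)[OF g]] fH gH KH by (simp add: ip_diff_right)
      then show "norm (pairing f (approx g n) - ip H f g) \<le> fnorm H f * fnorm H (\<lambda>x. kcomb X k (approx g n) x - g x)"
        using Cauchy_Schwarz[OF fH diff_in[OF KH gH]] by simp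
    next
      show "(\<lambda>n. fnorm H f * fnorm H (\<lambda>x. kcomb X k (approx g n) x - g x)) \<longlonglongrightarrow> 0"
        using tendsto_mult[OF tendsto_const conjunct2[OF app[OF g]]] by fastforce
    qed
    then have "(\<lambda>n. pairing f (approx g n)) \<longlonglongrightarrow> ip H f g" by (rule LIM_zero_cancel)
    then show ?thesis using inn_tendsto[OF f g] LIMSEQ_unique by blast
  qed
  then have ip: "ip H = inn" by blast
  have "kern H x y = (if x \<in> X \<and> y \<in> X then k x y else 0)" for x y
    using kH kern_outside[of x y] p by auto
  then have "kern H = (\<lambda>x y. if x \<in> X \<and> y \<in> X then k x y else 0)" by blast
  then show ?thesis using p funs ip by (simp add: the_space_def)
qed

lemma rkhs_of_eq: "rkhs_of X k = the_space"
  unfolding rkhs_of_def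
proof (rule the_equality)
  show "is_rkhs the_space \<and> pts the_space = X \<and> (\<forall>x\<in>X. \<forall>y\<in>X. kern the_space x y = k x y)"
    using is_rkhs_the_space by (simp add: the_space_def)
qed (rule rkhs_unique; elim conjE; assumption)

lemma is_rkhs_rkhs_of: "is_rkhs (rkhs_of X k)"
  using is_rkhs_the_space by (simp add: rkhs_of_eq)

lemma pts_rkhs_of: "pts (rkhs_of X k) = X"
  by (simp add: rkhs_of_eq the_space_def)

lemma kern_rkhs_of: "kern (rkhs_of X k) x y = (if x \<in> X \<and> y \<in> X then k x y else 0)"
  by (simp add: rkhs_of_eq the_space_def)

lemma kcomb_in_rkhs_of: "c \<in> coefs X \<Longrightarrow> kcomb X k c \<in> funs (rkhs_of X k)"
  by (simp add: rkhs_of_eq the_space_def kcomb_in_space)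

lemma ip_kcomb: "f \<in> funs (rkhs_of X k) \<Longrightarrow> c \<in> coefs X \<Longrightarrow> ip (rkhs_of X k) f (kcomb X k c) = pairing f c"
  by (simp add: rkhs_of_eq the_space_def inn_kcomb)

lemma fnorm_kcomb: "c \<in> coefs X \<Longrightarrow> fnorm (rkhs_of X k) (kcomb X k c) = nrm c"
  using ip_kcomb[OF kcomb_in_rkhs_of] by (simp add: fnorm_def nrm_def)

lemma rkhs_of_membership:
  assumes "restr X f = f" "0 \<le> C" "\<And>c. c \<in> coefs X \<Longrightarrow> cmod (pairing f c) \<le> C * nrm c"
  shows "f \<in> funs (rkhs_of X k)" "fnorm (rkhs_of X k) f \<le> C"
proof -
  have b: "bnd f C" using assms by (simp add: bnd_def)
  then have "f \<in> space" using assms(1) by (auto simp: space_def)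
  then show "f \<in> funs (rkhs_of X k)" "fnorm (rkhs_of X k) f \<le> C"
    using inn_self_le[OF _ b] assms(2) by (auto simp: rkhs_of_eq the_space_def fnorm_def real_le_lsqrt)
qed

end

section \<open>Drury--Arveson spaces and row multipliers\<close>

lemma quadratic_form_eq:
  assumes "c \<in> coefs X" "finite S" "S \<subseteq> X" "{v. c v \<noteq> 0} \<subseteq> S"
  shows "pairing (kcomb X k c) c = (\<Sum>u\<in>S. \<Sum>v\<in>S. c v * k u v * cnj (c u))"
proof -
  have "pairing (kcomb X k c) c = (\<Sum>u\<in>S. kcomb X k c u * cnj (c u))"
    using assms by (intro pairing_eq)
  also have "\<dots> = (\<Sum>u\<in>S. (\<Sum>v\<in>S. c v * k u v) * cnj (c u))"
    using assms by (intro sum.cong refl arg_cong2[of _ _ _ _ "(*)"] kcomb_eq) auto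
  finally show ?thesis by (simp add: sum_distrib_right)
qed

lemma quadratic_form_cong:
  assumes "c \<in> coefs X" "\<And>u v. u \<in> X \<Longrightarrow> v \<in> X \<Longrightarrow> k u v = k' u v"
  shows "pairing (kcomb X k c) c = pairing (kcomb X k' c) c"
proof -
  have "kcomb X k c = kcomb X k' c"
    using assms(2) coefsD[OF assms(1)] by (auto simp: kcomb_def fun_eq_iff intro!: sum.cong)
  then show ?thesis by simp
qed

lemma quadratic_form_diff:
  "pairing (kcomb X (\<lambda>u v. k u v - k' u v) c) c = pairing (kcomb X k c) c - pairing (kcomb X k' c) c"
proof -
  have "kcomb X (\<lambda>u v. k u v - k' u v) c = (\<lambda>u. kcomb X k c u - kcomb X k' c u)"
    by (auto simp: kcomb_def right_diff_distrib sum_subtractf)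
  then show ?thesis by (simp add: pairing_diff_left)
qed

lemma quadratic_form_scale:
  "pairing (kcomb X (\<lambda>u v. a * k u v) c) c = a * pairing (kcomb X k c) c"
  unfolding kcomb_def pairing_def
  by (auto simp: sum_distrib_left ac_simps intro!: sum.cong)

lemma quadratic_form_rank_one:
  assumes c: "c \<in> coefs X"
  shows "pairing (kcomb X (\<lambda>u v. g u * cnj (g v)) c) c = of_real ((cmod (pairing g c))\<^sup>2)"
proof -
  have "pairing (kcomb X (\<lambda>u v. g u * cnj (g v)) c) c
      = (\<Sum>u | c u \<noteq> 0. \<Sum>v | c v \<noteq> 0. c v * (g u * cnj (g v)) * cnj (c u))"
    by (rule quadratic_form_eq[OF c]) (use coefsD[OF c] in auto)
  also have "\<dots> = pairing g c * cnj (pairing g c)"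
    unfolding pairing_def cnj_sum sum_product by (intro sum.cong) (simp_all add: ac_simps)
  finally show ?thesis by (simp only: complex_norm_square)
qed

text \<open>\<open>cinner (F u) (F v)\<close> is a sum of rank-one kernels, one for each coordinate,
  and the factors of a rank-one kernel can be absorbed in the coefficients. This is both the Schur
  product theorem and the computation of the adjoint of a row.\<close>

lemma quadratic_form_Schur_sums:
  assumes c: "c \<in> coefs X"
  shows "(\<lambda>l. pairing (kcomb X k (\<lambda>u. cnj (coord (F u) l) * c u)) (\<lambda>u. cnj (coord (F u) l) * c u))
    sums pairing (kcomb X (\<lambda>u v. cinner (F u) (F v) * k u v) c) c"
proof -
  let ?S = "{u. c u \<noteq> 0}"
  note S = coefsD[OF c]
  have *: "(\<lambda>l. coord z l * cnj (coord w l)) sums cinner z w" for z w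
    unfolding cinner_def by (rule summable_sums[OF summable_coord_prod])
  have "(\<lambda>l. \<Sum>u\<in>?S. \<Sum>v\<in>?S. (coord (F u) l * cnj (coord (F v) l)) * (c v * k u v * cnj (c u)))
    sums (\<Sum>u\<in>?S. \<Sum>v\<in>?S. cinner (F u) (F v) * (c v * k u v * cnj (c u)))"
    by (intro sums_sum sums_mult2 *)
  moreover have "pairing (kcomb X k (\<lambda>u. cnj (coord (F u) l) * c u)) (\<lambda>u. cnj (coord (F u) l) * c u)
    = (\<Sum>u\<in>?S. \<Sum>v\<in>?S. (coord (F u) l * cnj (coord (F v) l)) * (c v * k u v * cnj (c u)))" for l
    by (subst quadratic_form_eq[OF coefs_mult[OF c] S]) (auto simp: ac_simps)
  moreover have "pairing (kcomb X (\<lambda>u v. cinner (F u) (F v) * k u v) c) c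
    = (\<Sum>u\<in>?S. \<Sum>v\<in>?S. cinner (F u) (F v) * (c v * k u v * cnj (c u)))"
    by (subst quadratic_form_eq[OF c S]) (auto simp: ac_simps)
  ultimately show ?thesis by simp
qed

lemma cinner_power_psd:
  "c \<in> coefs X \<Longrightarrow> 0 \<le> Re (pairing (kcomb X (\<lambda>u v. cinner u v ^ m) c) c)"
proof (induction m arbitrary: c)
  case 0
  then show ?case using quadratic_form_rank_one[OF 0, of "\<lambda>_. 1"] by simp
next
  case (Suc m)
  \<comment> \<open>One more factor \<open>cinner u v\<close> is the Schur sum with the identity in
    place of \<open>F\<close>.\<close>
  have "0 \<le> Re (pairing (kcomb X (\<lambda>u v. cinner u v * cinner u v ^ m) c) c)"
    by (rule sums_le[OF _ sums_zero sums_Re[OF quadratic_form_Schur_sums[OF Suc.prems]]])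
      (intro Suc.IH coefs_mult Suc.prems)
  then show ?case by simp
qed

text \<open>The kernel is the geometric series of the powers of \<open>cinner u v\<close>, each of
  which is positive.\<close>

lemma da_kernel_psd:
  assumes X: "\<And>x. x \<in> X \<Longrightarrow> norm x < 1"
  shows "psd_kernel X da_kernel"
proof
  fix u v :: ell2
  show "da_kernel v u = cnj (da_kernel u v)"
    using cinner_commute[of v u] by (simp add: da_kernel_def)
next
  fix c assume c: "c \<in> coefs X"
  let ?S = "{u. c u \<noteq> 0}"
  note S = coefsD[OF c]
  have "(\<lambda>m. \<Sum>u\<in>?S. \<Sum>v\<in>?S. c v * cinner u v ^ m * cnj (c u)) sums (\<Sum>u\<in>?S. \<Sum>v\<in>?S. c v * da_kernel u v * cnj (c u))"
    unfolding da_kernel_def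
    by (intro sums_sum sums_mult2 sums_mult geometric_sums cinner_ball_lt_1 X) (use S in auto)
  then have "(\<lambda>m. pairing (kcomb X (\<lambda>u v. cinner u v ^ m) c) c) sums pairing (kcomb X da_kernel c) c"
    by (simp only: quadratic_form_eq[OF c S order_refl])
  from sums_Re[OF this] show "0 \<le> Re (pairing (kcomb X da_kernel c) c)"
    by (rule sums_le[OF _ sums_zero, rotated]) (rule cinner_power_psd[OF c])
qed

text \<open>The sequences of absolute values are elements of \<open>ell2\<close>, whose
  Cauchy-Schwarz inequality is reused.\<close>

lemma suminf_Cauchy_Schwarz:
  fixes a b :: "nat \<Rightarrow> real"
  assumes a: "summable (\<lambda>i. (a i)\<^sup>2)" and b: "summable (\<lambda>i. (b i)\<^sup>2)"
  shows "summable (\<lambda>i. \<bar>a i * b i\<bar>)" "(\<Sum>i. \<bar>a i * b i\<bar>) \<le> sqrt (\<Sum>i. (a i)\<^sup>2) * sqrt (\<Sum>i. (b i)\<^sup>2)"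
proof -
  let ?z = "Abs_ell2 (\<lambda>i. of_real \<bar>a i\<bar>)" and ?w = "Abs_ell2 (\<lambda>i. of_real \<bar>b i\<bar>)"
  have z: "coord ?z i = of_real \<bar>a i\<bar>" and w: "coord ?w i = of_real \<bar>b i\<bar>" for i
    using a b by (simp_all add: Abs_ell2_inverse)
  have "(\<lambda>i. complex_of_real \<bar>a i * b i\<bar>) sums cinner ?z ?w"
    using summable_sums[OF summable_coord_prod[of ?z ?w]] unfolding cinner_def z w
    by (simp add: abs_mult)
  from sums_Re[OF this] have s: "(\<lambda>i. \<bar>a i * b i\<bar>) sums Re (cinner ?z ?w)" by simp
  then show "summable (\<lambda>i. \<bar>a i * b i\<bar>)" by (rule sums_summable)
  have "(\<Sum>i. \<bar>a i * b i\<bar>) = Re (cinner ?z ?w)" using s by (rule sums_unique[symmetric])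
  also have "\<dots> \<le> norm ?z * norm ?w" using cinner_Cauchy_Schwarz complex_Re_le_cmod order_trans by blast
  finally show "(\<Sum>i. \<bar>a i * b i\<bar>) \<le> sqrt (\<Sum>i. (a i)\<^sup>2) * sqrt (\<Sum>i. (b i)\<^sup>2)"
    unfolding norm_ell2 z w by simp
qed

section \<open>Rows of multipliers on a set of points\<close>

locale da_space =
  fixes X :: "ell2 set"
  assumes in_ball: "x \<in> X \<Longrightarrow> norm x < 1"
begin

sublocale psd_kernel X da_kernel
  by (rule da_kernel_psd) (rule in_ball)

sublocale rk_space "da_restrict X"
  by unfold_locales (unfold da_restrict_def, rule is_rkhs_rkhs_of)

abbreviation "H \<equiv> da_restrict X"

lemma pts_H [simp]: "pts H = X"
  by (simp add: da_restrict_def pts_rkhs_of)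

lemmas kcomb_in = kcomb_in_rkhs_of[folded da_restrict_def]
  and ip_kcomb_right = ip_kcomb[folded da_restrict_def]
  and norm_kcomb = fnorm_kcomb[folded da_restrict_def]
  and membership = rkhs_of_membership[folded da_restrict_def]

lemma kfun_kcomb: "x \<in> X \<Longrightarrow> kfun H x = kcomb X da_kernel (\<lambda>v. if v = x then 1 else 0)"
proof
  fix y assume "x \<in> X"
  then show "kfun H x y = kcomb X da_kernel (\<lambda>v. if v = x then 1 else 0) y"
    using kcomb_single[of y X da_kernel x 1]
    by (cases "y \<in> X") (simp_all add: kfun_def da_restrict_def kern_rkhs_of kcomb_def)
qed

lemma kfun_eq: "x \<in> X \<Longrightarrow> y \<in> X \<Longrightarrow> kfun H x y = da_kernel y x"
  by (simp add: kfun_def da_restrict_def kern_rkhs_of)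

lemma kcomb_kfun: "c \<in> coefs X \<Longrightarrow> kcomb X da_kernel c = (\<lambda>y. \<Sum>v | c v \<noteq> 0. c v * kfun H v y)"
  using coefsD[of c X]
  by (auto simp: fun_eq_iff kcomb_def kfun_def da_restrict_def kern_rkhs_of intro!: sum.cong sum.neutral[symmetric])

lemma pairing_le:
  assumes "f \<in> funs H" "c \<in> coefs X"
  shows "cmod (pairing f c) \<le> fnorm H f * nrm c"
  using Cauchy_Schwarz[OF assms(1) kcomb_in[OF assms(2)]] assms
  by (simp add: ip_kcomb_right norm_kcomb)

text \<open>Norm bound for the adjoint of the row operator, tested on kernel combinations: the
  adjoint sends the combination with coefficients \<open>c\<close> to the tuple with coefficients
  \<open>cnj (b i u) * c u\<close>.\<close>

definition rowbnd :: "(nat \<Rightarrow> ell2 \<Rightarrow> complex) \<Rightarrow> real \<Rightarrow> bool" where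
  "rowbnd b C \<longleftrightarrow> 0 \<le> C \<and> (\<forall>u\<in>X. summable (\<lambda>i. (cmod (b i u))\<^sup>2)) \<and>
    (\<forall>c\<in>coefs X. summable (\<lambda>i. (nrm (\<lambda>u. cnj (b i u) * c u))\<^sup>2) \<and>
      (\<Sum>i. (nrm (\<lambda>u. cnj (b i u) * c u))\<^sup>2) \<le> C\<^sup>2 * (nrm c)\<^sup>2)"

abbreviation comps :: "(ell2 \<Rightarrow> ell2) \<Rightarrow> nat \<Rightarrow> ell2 \<Rightarrow> complex" where
  "comps F \<equiv> (\<lambda>i u. coord (F u) i)"

lemma comps_sums:
  assumes "c \<in> coefs X"
  shows "(\<lambda>i. (nrm (\<lambda>u. cnj (coord (F u) i) * c u))\<^sup>2) sums
    Re (pairing (kcomb X (\<lambda>u v. cinner (F u) (F v) * da_kernel u v) c) c)"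
  using sums_Re[OF quadratic_form_Schur_sums[OF assms, of da_kernel F]]
  by (simp add: nrm_sq coefs_mult assms)

text \<open>The kernel form of the multiplier norm: positivity of
  \<open>(C^2 - cinner (F u) (F v)) * da_kernel u v\<close>. All coordinates have merged into one
  inner product.\<close>

lemma rowbnd_comps:
  "rowbnd (comps F) C \<longleftrightarrow> 0 \<le> C \<and>
    (\<forall>c\<in>coefs X. Re (pairing (kcomb X (\<lambda>u v. cinner (F u) (F v) * da_kernel u v) c) c) \<le> C\<^sup>2 * (nrm c)\<^sup>2)"
  unfolding rowbnd_def using comps_sums[of _ F] summable_coord
  by (auto simp: sums_iff)

text \<open>The hypothesis says that \<open>(1 - cinner (F u) (F v)) * da_kernel u v\<close> is the
  rank-one kernel \<open>g u * cnj (g v)\<close>. By \<open>ball_Aut_kernel\<close> this applies to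
  every automorphism.\<close>

lemma rowbnd_rank_one:
  assumes g: "\<And>u v. u \<in> X \<Longrightarrow> v \<in> X \<Longrightarrow> 1 - cinner (F u) (F v) = g u * cnj (g v) * (1 - cinner u v)"
  shows "rowbnd (comps F) 1"
  unfolding rowbnd_comps
proof (intro conjI ballI)
  fix c assume c: "c \<in> coefs X"
  have "pairing (kcomb X (\<lambda>u v. cinner (F u) (F v) * da_kernel u v) c) c
      = pairing (kcomb X (\<lambda>u v. da_kernel u v - g u * cnj (g v)) c) c"
  proof (rule quadratic_form_cong[OF c])
    fix u v assume uv: "u \<in> X" "v \<in> X"
    have "1 - cinner u v \<noteq> 0" using one_minus_cinner_neq_0 in_ball uv by blast
    moreover have "cinner (F u) (F v) = 1 - g u * cnj (g v) * (1 - cinner u v)" using g[OF uv] by (simp add: algebra_simps)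
    ultimately show "cinner (F u) (F v) * da_kernel u v = da_kernel u v - g u * cnj (g v)"
      by (simp add: da_kernel_def field_simps)
  qed
  also have "\<dots> = of_real ((nrm c)\<^sup>2) - of_real ((cmod (pairing g c))\<^sup>2)"
    by (simp only: quadratic_form_diff quadratic_form_rank_one[OF c] pairing_self[OF c])
  finally show "Re (pairing (kcomb X (\<lambda>u v. cinner (F u) (F v) * da_kernel u v) c) c) \<le> 1\<^sup>2 * (nrm c)\<^sup>2"
    by simp
qed simp

lemma rowbnd_const: "rowbnd (comps (\<lambda>_. v)) (norm v)"
  unfolding rowbnd_comps
  by (auto simp: quadratic_form_scale cinner_norm pairing_self simp flip: of_real_mult of_real_power)

lemma rowbnd_pairing_sums:
  assumes b: "\<forall>u\<in>X. summable (\<lambda>i. (cmod (b i u))\<^sup>2)" and c: "c \<in> coefs X"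
    and h: "\<And>i. h i \<in> funs H" and hs: "summable (\<lambda>i. (fnorm H (h i))\<^sup>2)"
  shows "(\<lambda>i. pairing (h i) (\<lambda>u. cnj (b i u) * c u)) sums pairing (\<lambda>u. \<Sum>i. b i u * h i u) c"
proof -
  have s: "(\<lambda>i. b i u * h i u) sums (\<Sum>i. b i u * h i u)" if u: "u \<in> X" for u
  proof (rule summable_sums, rule summable_norm_cancel, rule summable_comparison_test')
    show "summable (\<lambda>i. \<bar>cmod (b i u) * fnorm H (h i)\<bar> * fnorm H (kfun H u))"
      using b u hs by (intro summable_mult2 suminf_Cauchy_Schwarz) auto
    show "norm (norm (b i u * h i u)) \<le> \<bar>cmod (b i u) * fnorm H (h i)\<bar> * fnorm H (kfun H u)" for i
      using mult_left_mono[OF point_bound[OF h, of u i] norm_ge_zero[of "b i u"]] u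
      by (simp add: norm_mult abs_mult mult.assoc)
  qed
  have "(\<lambda>i. \<Sum>u | c u \<noteq> 0. b i u * h i u * cnj (c u)) sums (\<Sum>u | c u \<noteq> 0. (\<Sum>i. b i u * h i u) * cnj (c u))"
    by (intro sums_sum sums_mult2 s) (use coefsD[OF c] in auto)
  moreover have "pairing (h i) (\<lambda>u. cnj (b i u) * c u) = (\<Sum>u | c u \<noteq> 0. b i u * h i u * cnj (c u))" for i
    by (subst pairing_eq[of "{u. c u \<noteq> 0}"]) (use coefsD[OF c] in \<open>auto simp: ac_simps\<close>)
  ultimately show ?thesis by (simp add: pairing_def)
qed

text \<open>By duality: pairing the sum with \<open>c\<close> distributes over the entries of the
  adjoint tuple, and Cauchy-Schwarz is used in each entry and then over the index.\<close>

lemma rowbnd_imp_bounded: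
  assumes b: "rowbnd b C" and h: "\<And>i. h i \<in> funs H" and hs: "summable (\<lambda>i. (fnorm H (h i))\<^sup>2)"
  shows "(\<lambda>u. \<Sum>i. b i u * h i u) \<in> funs H"
    and "fnorm H (\<lambda>u. \<Sum>i. b i u * h i u) \<le> C * sqrt (\<Sum>i. (fnorm H (h i))\<^sup>2)"
proof -
  let ?f = "\<lambda>u. \<Sum>i. b i u * h i u"
  have r: "restr X ?f = ?f"
    using funs_outside[OF h] by (auto simp: restr_def fun_eq_iff)
  have "0 \<le> C" using b by (simp add: rowbnd_def)
  moreover have N: "0 \<le> (\<Sum>i. (fnorm H (h i))\<^sup>2)" by (intro suminf_nonneg hs) simp
  ultimately have C0: "0 \<le> C * sqrt (\<Sum>i. (fnorm H (h i))\<^sup>2)" by simp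
  have "cmod (pairing ?f c) \<le> C * sqrt (\<Sum>i. (fnorm H (h i))\<^sup>2) * nrm c" if c: "c \<in> coefs X" for c
  proof -
    let ?c = "\<lambda>i u. cnj (b i u) * c u"
    have cs: "summable (\<lambda>i. (nrm (?c i))\<^sup>2)" "(\<Sum>i. (nrm (?c i))\<^sup>2) \<le> C\<^sup>2 * (nrm c)\<^sup>2"
      using b c by (auto simp: rowbnd_def)
    have sums: "(\<lambda>i. pairing (h i) (?c i)) sums pairing ?f c"
      by (rule rowbnd_pairing_sums[OF _ c h hs]) (use b in \<open>simp add: rowbnd_def\<close>)
    have le: "norm (pairing (h i) (?c i)) \<le> \<bar>fnorm H (h i) * nrm (?c i)\<bar>" for i
      using pairing_le[OF h coefs_mult[OF c], of i "\<lambda>u. cnj (b i u)"] by linarith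
    note sm = suminf_Cauchy_Schwarz(1)[OF hs cs(1)]
    have sn: "summable (\<lambda>i. norm (pairing (h i) (?c i)))"
      by (rule summable_comparison_test'[OF sm]) (use le in simp)
    have "cmod (pairing ?f c) \<le> (\<Sum>i. norm (pairing (h i) (?c i)))"
      using summable_norm[OF sn] sums by (simp add: sums_iff)
    also have "\<dots> \<le> (\<Sum>i. \<bar>fnorm H (h i) * nrm (?c i)\<bar>)"
      by (intro suminf_le le sn sm)
    also have "\<dots> \<le> sqrt (\<Sum>i. (fnorm H (h i))\<^sup>2) * sqrt (\<Sum>i. (nrm (?c i))\<^sup>2)"
      by (rule suminf_Cauchy_Schwarz(2)[OF hs cs(1)])
    also have "\<dots> \<le> sqrt (\<Sum>i. (fnorm H (h i))\<^sup>2) * sqrt (C\<^sup>2 * (nrm c)\<^sup>2)"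
      using N cs(2) by (intro mult_left_mono real_sqrt_le_mono) auto
    also have "sqrt (C\<^sup>2 * (nrm c)\<^sup>2) = C * nrm c"
      using \<open>0 \<le> C\<close> nrm_nonneg[OF c] by (simp add: real_sqrt_mult)
    finally show ?thesis by (simp add: ac_simps)
  qed
  from membership[OF r C0 this] show "?f \<in> funs H" "fnorm H ?f \<le> C * sqrt (\<Sum>i. (fnorm H (h i))\<^sup>2)" by blast+
qed

text \<open>Feeding the operator the tuple which its adjoint should produce from \<open>c\<close>
  gives \<open>?N \<le> C * sqrt ?N * nrm c\<close>, and a factor \<open>sqrt ?N\<close> cancels.
  Only such tuples are tested, so the bound is required for them alone.\<close>

lemma rowbndI:
  assumes C: "0 \<le> C" and b: "\<forall>u\<in>X. summable (\<lambda>i. (cmod (b i u))\<^sup>2)"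
    and cs: "\<And>c. c \<in> coefs X \<Longrightarrow> summable (\<lambda>i. (nrm (\<lambda>u. cnj (b i u) * c u))\<^sup>2)"
    and bd: "\<And>c. c \<in> coefs X \<Longrightarrow>
      (\<lambda>u. \<Sum>i. b i u * kcomb X da_kernel (\<lambda>u. cnj (b i u) * c u) u) \<in> funs H \<and>
      fnorm H (\<lambda>u. \<Sum>i. b i u * kcomb X da_kernel (\<lambda>u. cnj (b i u) * c u) u)
        \<le> C * sqrt (\<Sum>i. (nrm (\<lambda>u. cnj (b i u) * c u))\<^sup>2)"
  shows "rowbnd b C"
  unfolding rowbnd_def
proof (intro conjI C b ballI cs)
  fix c assume c: "c \<in> coefs X"
  let ?c = "\<lambda>i u. cnj (b i u) * c u"
  let ?h = "\<lambda>i. kcomb X da_kernel (?c i)"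
  let ?f = "\<lambda>u. \<Sum>i. b i u * ?h i u"
  let ?N = "\<Sum>i. (nrm (?c i))\<^sup>2"
  have h: "?h i \<in> funs H" "fnorm H (?h i) = nrm (?c i)" for i
    using coefs_mult[OF c] by (simp_all add: kcomb_in norm_kcomb)
  have N: "0 \<le> ?N" by (intro suminf_nonneg cs c) simp
  have "(\<lambda>i. pairing (?h i) (?c i)) sums pairing ?f c"
    by (rule rowbnd_pairing_sums[OF b c h(1)]) (simp add: h cs c)
  moreover have "pairing (?h i) (?c i) = of_real ((nrm (?c i))\<^sup>2)" for i
    by (rule pairing_self[OF coefs_mult[OF c]])
  ultimately have "(\<lambda>i. complex_of_real ((nrm (?c i))\<^sup>2)) sums pairing ?f c" by simp
  from sums_Re[OF this] have "(\<lambda>i. (nrm (?c i))\<^sup>2) sums Re (pairing ?f c)" by (simp del: of_real_power)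
  then have "?N = Re (pairing ?f c)" by (simp add: sums_iff)
  also have "\<dots> \<le> fnorm H ?f * nrm c"
    using pairing_le[OF _ c] bd[OF c] complex_Re_le_cmod order_trans by blast
  also have "\<dots> \<le> (C * sqrt ?N) * nrm c"
    using bd[OF c] nrm_nonneg[OF c] by (intro mult_right_mono) auto
  finally have *: "sqrt ?N * sqrt ?N \<le> (C * nrm c) * sqrt ?N" using N by (simp add: ac_simps)
  have "sqrt ?N \<le> C * nrm c"
  proof (cases "sqrt ?N = 0")
    case True
    then show ?thesis using C nrm_nonneg[OF c] by simp
  next
    case False
    then have "0 < sqrt ?N" using N by simp
    from mult_right_le_imp_le[OF * this] show ?thesis .
  qed
  then have "(sqrt ?N)\<^sup>2 \<le> (C * nrm c)\<^sup>2" using N by (intro power_mono) auto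
  then show "?N \<le> C\<^sup>2 * (nrm c)\<^sup>2" using N by (simp add: power_mult_distrib)
qed

text \<open>Only values on \<open>X\<close> matter because members of \<open>funs H\<close> vanish
  elsewhere; in contrast to \<open>Mult\<close>, functions such as polynomials need no restriction
  to \<open>X\<close>.\<close>

definition mbd :: "(ell2 \<Rightarrow> complex) \<Rightarrow> real \<Rightarrow> bool" where
  "mbd p C \<longleftrightarrow> 0 \<le> C \<and> (\<forall>h\<in>funs H. (\<lambda>x. p x * h x) \<in> funs H \<and> fnorm H (\<lambda>x. p x * h x) \<le> C * fnorm H h)"

lemma mbd_const: "mbd (\<lambda>_. a) (cmod a)"
  by (simp add: mbd_def scale_in fnorm_scale)

lemma mbd_add:
  assumes p: "mbd p C" and q: "mbd q D"
  shows "mbd (\<lambda>x. p x + q x) (C + D)"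
  unfolding mbd_def
proof (intro conjI ballI)
  fix h assume h: "h \<in> funs H"
  have in': "(\<lambda>x. p x * h x) \<in> funs H" "(\<lambda>x. q x * h x) \<in> funs H" using p q h by (auto simp: mbd_def)
  show "(\<lambda>x. (p x + q x) * h x) \<in> funs H" using add_in[OF in'] by (simp add: distrib_right)
  have "fnorm H (\<lambda>x. p x * h x + q x * h x) \<le> C * fnorm H h + D * fnorm H h"
    by (rule order_trans[OF fnorm_triangle[OF in']]) (use p q h in \<open>auto simp: mbd_def intro!: add_mono\<close>)
  then show "fnorm H (\<lambda>x. (p x + q x) * h x) \<le> (C + D) * fnorm H h" by (simp add: distrib_right)
qed (use p q in \<open>auto simp: mbd_def\<close>)

lemma mbd_mult:
  assumes p: "mbd p C" and q: "mbd q D"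
  shows "mbd (\<lambda>x. p x * q x) (C * D)"
  unfolding mbd_def
proof (intro conjI ballI)
  fix h assume h: "h \<in> funs H"
  have q': "(\<lambda>x. q x * h x) \<in> funs H" "fnorm H (\<lambda>x. q x * h x) \<le> D * fnorm H h" using q h by (auto simp: mbd_def)
  have p': "(\<lambda>x. p x * (q x * h x)) \<in> funs H" "fnorm H (\<lambda>x. p x * (q x * h x)) \<le> C * fnorm H (\<lambda>x. q x * h x)"
    using p q'(1) by (auto simp: mbd_def)
  show "(\<lambda>x. p x * q x * h x) \<in> funs H" using p' by (simp add: mult.assoc)
  have "C * fnorm H (\<lambda>x. q x * h x) \<le> C * (D * fnorm H h)" using p q' by (intro mult_left_mono) (auto simp: mbd_def)
  then show "fnorm H (\<lambda>x. p x * q x * h x) \<le> C * D * fnorm H h" using p' by (simp add: mult.assoc)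
qed (use p q in \<open>auto simp: mbd_def\<close>)

lemma mbd_prod: "finite I \<Longrightarrow> (\<And>i. i \<in> I \<Longrightarrow> mbd (p i) (C i)) \<Longrightarrow> mbd (\<lambda>x. \<Prod>i\<in>I. p i x) (\<Prod>i\<in>I. C i)"
proof (induction I rule: finite_induct)
  case empty
  then show ?case using mbd_const[of 1] by simp
next
  case (insert i I)
  then show ?case using mbd_mult[of "p i" "C i" "\<lambda>x. \<Prod>i\<in>I. p i x"] by simp
qed

lemma rowbnd_id: "rowbnd (comps (\<lambda>z. z)) 1"
  by (rule rowbnd_rank_one[of _ "\<lambda>_. 1"]) simp

text \<open>The functional is the contractive row of coordinates applied to the column of constants
  \<open>cnj (coord v i)\<close>, whose norm is \<open>norm v\<close>.\<close>

lemma mbd_cinner: "mbd (\<lambda>z. cinner z v) (norm v)"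
  unfolding mbd_def
proof (intro conjI ballI)
  fix h assume h: "h \<in> funs H"
  let ?h = "\<lambda>i x. cnj (coord v i) * h x"
  have n: "(fnorm H (?h i))\<^sup>2 = (cmod (coord v i))\<^sup>2 * (fnorm H h)\<^sup>2" for i
    using h by (simp add: fnorm_scale power_mult_distrib)
  have sv: "summable (\<lambda>i. (cmod (coord v i))\<^sup>2)" by (rule summable_coord)
  have s: "summable (\<lambda>i. (fnorm H (?h i))\<^sup>2)" unfolding n by (intro summable_mult2 sv)
  have "(\<Sum>i. (fnorm H (?h i))\<^sup>2) = (norm v)\<^sup>2 * (fnorm H h)\<^sup>2"
    unfolding n using suminf_mult2[OF sv, of "(fnorm H h)\<^sup>2"] suminf_nonneg[OF sv] by (simp add: norm_ell2)
  then have "1 * sqrt (\<Sum>i. (fnorm H (?h i))\<^sup>2) = norm v * fnorm H h" by (simp add: real_sqrt_mult)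
  moreover have "(\<lambda>z. \<Sum>i. coord z i * ?h i z) = (\<lambda>z. cinner z v * h z)"
    using suminf_mult2[OF summable_coord_prod[of _ v]] by (auto simp: cinner_def mult.assoc)
  ultimately show "(\<lambda>z. cinner z v * h z) \<in> funs H" "fnorm H (\<lambda>z. cinner z v * h z) \<le> norm v * fnorm H h"
    using rowbnd_imp_bounded[OF rowbnd_id scale_in[OF h] s] by simp_all
qed simp

text \<open>\<open>da_kernel u v - 1 = cinner u v * da_kernel u v\<close> is a positive kernel, and
  subtracting the rank-one kernel of a function of the space with norm at most 1 is exactly what
  preserves positivity.\<close>

lemma one_in: "restr X (\<lambda>_. 1) \<in> funs H" "fnorm H (restr X (\<lambda>_. 1)) \<le> 1"
proof -
  have "cmod (pairing (restr X (\<lambda>_. 1)) c) \<le> 1 * nrm c" if c: "c \<in> coefs X" for c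
  proof -
    have "pairing (kcomb X (\<lambda>u v. cinner u v * da_kernel u v) c) c
        = pairing (kcomb X (\<lambda>u v. da_kernel u v - 1 * cnj 1) c) c"
    proof (rule quadratic_form_cong[OF c])
      fix u v assume uv: "u \<in> X" "v \<in> X"
      have "1 - cinner u v \<noteq> 0" using one_minus_cinner_neq_0 in_ball uv by blast
      then show "cinner u v * da_kernel u v = da_kernel u v - 1 * cnj 1"
        by (simp add: da_kernel_def field_simps)
    qed
    also have "\<dots> = of_real ((nrm c)\<^sup>2) - of_real ((cmod (pairing (\<lambda>_. 1) c))\<^sup>2)"
      using quadratic_form_rank_one[OF c, of "\<lambda>_. 1"] by (simp only: quadratic_form_diff pairing_self[OF c])
    finally have "Re (pairing (kcomb X (\<lambda>u v. cinner u v * da_kernel u v) c) c)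
      = (nrm c)\<^sup>2 - (cmod (pairing (\<lambda>_. 1) c))\<^sup>2" by simp
    moreover have "0 \<le> Re (pairing (kcomb X (\<lambda>u v. cinner u v * da_kernel u v) c) c)"
      by (rule sums_le[OF _ sums_zero comps_sums[OF c, of "\<lambda>z. z"]]) (rule zero_le_power2)
    ultimately have "(cmod (pairing (\<lambda>_. 1) c))\<^sup>2 \<le> (nrm c)\<^sup>2" by linarith
    then have "cmod (pairing (\<lambda>_. 1) c) \<le> nrm c" using nrm_nonneg[OF c] by (rule power2_le_imp_le)
    moreover have "pairing (restr X (\<lambda>_. 1)) c = pairing (\<lambda>_. 1) c"
      unfolding pairing_def using coefsD[OF c] by (intro sum.cong) (auto simp: restr_def)
    ultimately show ?thesis by simp
  qed
  moreover have "restr X (restr X (\<lambda>_. 1)) = restr X (\<lambda>_. 1)" by (auto simp: restr_def fun_eq_iff)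
  ultimately show "restr X (\<lambda>_. 1) \<in> funs H" "fnorm H (restr X (\<lambda>_. 1)) \<le> 1"
    using membership[of "restr X (\<lambda>_. 1)" 1] by simp_all
qed

end

section \<open>Lagrange interpolation in the ball\<close>

text \<open>The factor for \<open>t\<close> is the affine functional in the direction
  \<open>s - t\<close> that is 0 at \<open>t\<close> and 1 at \<open>s\<close>.\<close>

definition lagrange :: "ell2 set \<Rightarrow> ell2 \<Rightarrow> ell2 \<Rightarrow> complex" where
  "lagrange S s z = (\<Prod>t\<in>S - {s}. cinner (z - t) (s - t) / cinner (s - t) (s - t))"

text \<open>A factor has multiplier norm at most
  \<open>(norm (s - t) + norm t * norm (s - t)) / (norm (s - t))^2\<close>, where
  \<open>norm t < 1\<close>.\<close>

definition lagrange_bound :: "ell2 set \<Rightarrow> ell2 \<Rightarrow> real" where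
  "lagrange_bound S s = (\<Prod>t\<in>S - {s}. 2 / norm (s - t))"

lemma lagrange_same: "lagrange S s s = 1"
  unfolding lagrange_def by (intro prod.neutral) (auto simp: cinner_eq_zero_iff)

lemma lagrange_other: "finite S \<Longrightarrow> t \<in> S \<Longrightarrow> t \<noteq> s \<Longrightarrow> lagrange S s t = 0"
  unfolding lagrange_def by (rule prod_zero) (auto simp: cinner_simps intro!: bexI[of _ t])

lemma lagrange_bound_nonneg: "0 \<le> lagrange_bound S s"
  by (auto simp: lagrange_bound_def intro: prod_nonneg)

context da_space
begin

lemma mbd_mono: "mbd p C \<Longrightarrow> C \<le> D \<Longrightarrow> mbd p D"
  unfolding mbd_def by (meson fnorm_nonneg mult_right_mono order_trans)

lemma mbd_lagrange:
  assumes S: "finite S" "\<And>t. t \<in> S \<Longrightarrow> norm t < 1"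
  shows "mbd (lagrange S s) (lagrange_bound S s)"
  unfolding lagrange_def lagrange_bound_def
proof (rule mbd_prod)
  fix t assume t: "t \<in> S - {s}"
  let ?q = "s - t" and ?c = "1 / cinner (s - t) (s - t)"
  have q: "?q \<noteq> 0" using t by auto
  have c: "cmod ?c = 1 / (norm ?q)\<^sup>2" by (simp add: cinner_norm norm_divide norm_power)
  have "mbd (\<lambda>z. (cinner z ?q + - cinner t ?q) * ?c) ((norm ?q + cmod (- cinner t ?q)) * cmod ?c)"
    by (intro mbd_mult mbd_add mbd_cinner mbd_const)
  moreover have "(norm ?q + cmod (- cinner t ?q)) * cmod ?c \<le> 2 / norm ?q"
  proof -
    have "cmod (- cinner t ?q) \<le> norm t * norm ?q" using cinner_Cauchy_Schwarz[of t ?q] by simp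
    also have "\<dots> \<le> 1 * norm ?q" using S(2)[of t] t by (intro mult_right_mono) auto
    finally have "(norm ?q + cmod (- cinner t ?q)) * cmod ?c \<le> (norm ?q + norm ?q) * cmod ?c"
      by (intro mult_right_mono) auto
    also have "\<dots> = 2 / norm ?q" unfolding c using q by (simp add: power2_eq_square field_simps)
    finally show ?thesis .
  qed
  moreover have "(\<lambda>z. (cinner z ?q + - cinner t ?q) * ?c) = (\<lambda>z. cinner (z - t) ?q / cinner ?q ?q)"
    by (simp add: fun_eq_iff cinner_diff_left)
  ultimately show "mbd (\<lambda>z. cinner (z - t) ?q / cinner ?q ?q) (2 / norm ?q)"
    by (simp only: mbd_mono)
qed (use S in simp)

lemma lagrange_in:
  assumes S: "finite S" "\<And>t. t \<in> S \<Longrightarrow> norm t < 1"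
  shows "restr X (lagrange S s) \<in> funs H" "fnorm H (restr X (lagrange S s)) \<le> lagrange_bound S s"
proof -
  have e: "(\<lambda>x. lagrange S s x * restr X (\<lambda>_. 1) x) = restr X (lagrange S s)" by (auto simp: restr_def)
  have m: "mbd (lagrange S s) (lagrange_bound S s)" by (rule mbd_lagrange[OF S])
  from m one_in(1) show "restr X (lagrange S s) \<in> funs H" unfolding mbd_def e[symmetric] by blast
  have "fnorm H (restr X (lagrange S s)) \<le> lagrange_bound S s * fnorm H (restr X (\<lambda>_. 1))"
    using m one_in(1) unfolding mbd_def e[symmetric] by blast
  also have "\<dots> \<le> lagrange_bound S s" using one_in(2) lagrange_bound_nonneg by (simp add: mult_left_le)
  finally show "fnorm H (restr X (lagrange S s)) \<le> lagrange_bound S s" .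
qed

text \<open>Pairing with the Lagrange polynomial at \<open>s\<close> extracts the coefficient at
  \<open>s\<close>. This is a quantitative linear independence of kernel functions and takes the
  place of a bound on the inverse Gram matrix.\<close>

lemma coef_bound:
  assumes S: "finite S" "S \<subseteq> X" and c: "\<And>v. v \<notin> S \<Longrightarrow> c v = 0" and s: "s \<in> S"
  shows "cmod (c s) \<le> lagrange_bound S s * nrm c"
proof -
  have cc: "c \<in> coefs X" by (rule coefsI[OF S c])
  have "pairing (restr X (lagrange S s)) c = (\<Sum>v\<in>S. restr X (lagrange S s) v * cnj (c v))"
    using S(1) c by (intro pairing_eq) auto
  also have "\<dots> = (\<Sum>v\<in>S. if v = s then cnj (c s) else 0)"
    using S s by (intro sum.cong) (auto simp: restr_def lagrange_same lagrange_other)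
  also have "\<dots> = cnj (c s)" using S s by simp
  finally have "cmod (c s) = cmod (pairing (restr X (lagrange S s)) c)" by simp
  also have "\<dots> \<le> fnorm H (restr X (lagrange S s)) * nrm c"
    using S in_ball by (intro pairing_le cc lagrange_in) auto
  also have "\<dots> \<le> lagrange_bound S s * nrm c"
    using S in_ball by (intro mult_right_mono lagrange_in nrm_nonneg cc) auto
  finally show ?thesis .
qed

lemma finite_funs:
  assumes "finite X"
  shows "funs H = {f. restr X f = f}"
proof (intro equalityI subsetI CollectI)
  fix f assume "f \<in> {f. restr X f = f}"
  then have f: "restr X f = f" by simp
  have "f = (\<lambda>x. \<Sum>s\<in>X. f s * restr X (lagrange X s) x)"
  proof
    fix x
    show "f x = (\<Sum>s\<in>X. f s * restr X (lagrange X s) x)"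
    proof (cases "x \<in> X")
      case True
      have "(\<Sum>s\<in>X. f s * restr X (lagrange X s) x) = (\<Sum>s\<in>X. if s = x then f x else 0)"
        using True assms by (intro sum.cong) (auto simp: restr_def lagrange_same lagrange_other)
      then show ?thesis using True assms by simp
    next
      case False
      then show ?thesis using f by (simp add: restr_def fun_eq_iff) metis
    qed
  qed
  moreover have "(\<lambda>x. \<Sum>s\<in>X. f s * restr X (lagrange X s) x) \<in> funs H"
    using assms in_ball by (intro sum_in scale_in lagrange_in) auto
  ultimately show "f \<in> funs H" by simp
qed (use restr_funs in simp)

lemma finite_Mult:
  assumes "finite X"
  shows "Mult H = {f. restr X f = f}"
  unfolding Mult_def finite_funs[OF assms] pts_H
  by (auto simp: restr_def fun_eq_iff)

text \<open>The Lagrange functions are dual to the kernel functions, so the coefficients are the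
  inner products with them. The remainder is orthogonal to all Lagrange functions, and these span
  the space.\<close>

lemma finite_kcomb:
  assumes X: "finite X" and f: "f \<in> funs H"
  obtains c where "c \<in> coefs X" "f = kcomb X da_kernel c"
proof -
  let ?p = "\<lambda>s. restr X (lagrange X s)"
  have p: "?p s \<in> funs H" for s using X in_ball by (intro lagrange_in) auto
  define c where "c = (\<lambda>s. if s \<in> X then ip H f (?p s) else 0)"
  have c: "c \<in> coefs X" by (rule coefsI[of X]) (auto simp: c_def X)
  define g where "g = (\<lambda>x. f x - kcomb X da_kernel c x)"
  have g: "g \<in> funs H" unfolding g_def using f kcomb_in[OF c] by (intro diff_in)
  have gp: "ip H g (?p s) = 0" if s: "s \<in> X" for s
  proof -
    have "pairing (?p s) c = (\<Sum>v\<in>X. ?p s v * cnj (c v))"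
      using X by (intro pairing_eq) (auto simp: c_def)
    also have "\<dots> = (\<Sum>v\<in>X. if v = s then cnj (c s) else 0)"
      using X s by (intro sum.cong) (auto simp: restr_def lagrange_same lagrange_other)
    also have "\<dots> = cnj (c s)" using X s by simp
    finally have "ip H (kcomb X da_kernel c) (?p s) = c s"
      using ip_kcomb_right[OF p c] ip_cnj[OF p kcomb_in[OF c]] by simp
    then show ?thesis unfolding g_def using s f kcomb_in[OF c] p by (simp add: ip_diff_left c_def)
  qed
  have "g = (\<lambda>x. \<Sum>s\<in>X. g s * ?p s x)"
  proof
    fix x
    show "g x = (\<Sum>s\<in>X. g s * ?p s x)"
    proof (cases "x \<in> X")
      case True
      have "(\<Sum>s\<in>X. g s * ?p s x) = (\<Sum>s\<in>X. if s = x then g x else 0)"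
        using True X by (intro sum.cong) (auto simp: restr_def lagrange_same lagrange_other)
      then show ?thesis using True X by simp
    next
      case False
      then show ?thesis using funs_outside[OF g] by (simp add: restr_def)
    qed
  qed
  then have "ip H g g = ip H g (\<lambda>x. \<Sum>s\<in>X. g s * ?p s x)" by simp
  also have "\<dots> = (\<Sum>s\<in>X. ip H g (\<lambda>x. g s * ?p s x))" by (intro ip_sum_right scale_in p g)
  also have "\<dots> = 0" using gp g p by (simp add: ip_scale_right)
  finally have "g = (\<lambda>_. 0)" using ip_definite[OF g] by simp
  then have "f = kcomb X da_kernel c" by (simp add: g_def fun_eq_iff)
  then show ?thesis using that c by blast
qed

end

section \<open>RKHS isomorphisms\<close>

lemma opnorm_le:
  assumes "\<And>v. v \<in> V \<Longrightarrow> N2 (T v) \<le> C * N1 v"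
  shows "opnorm V N1 N2 T \<le> C"
  unfolding opnorm_def
proof (rule SUP_least)
  fix v assume v: "v \<in> {v \<in> V. N1 v \<le> 1}"
  then have "N2 (T v) \<le> C * N1 v" using assms by simp
  also have "\<dots> \<le> C * 1" using v by (intro mult_left_mono) auto
  finally show "N2 (T v) \<le> C" by simp
qed

lemma opnorm_lower: "v \<in> V \<Longrightarrow> N1 v \<le> 1 \<Longrightarrow> N2 (T v) \<le> opnorm V N1 N2 T"
  unfolding opnorm_def by (rule SUP_upper2[of v]) auto

lemma rk_norm_le:
  assumes "0 \<le> C" "\<And>f. f \<in> funs H1 \<Longrightarrow> fnorm H2 (T f) \<le> C * fnorm H1 f" "\<And>f. 0 \<le> fnorm H1 f"
  shows "rk_norm H1 H2 T \<le> ennreal C"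
  unfolding rk_norm_def
  by (rule opnorm_le) (use assms in \<open>simp add: ennreal_mult[symmetric]\<close>)

lemma rk_norm_bound:
  assumes H: "rk_space H1" "rk_space H2" and T: "linear_between (funs H1) T"
    "\<And>f. f \<in> funs H1 \<Longrightarrow> T f \<in> funs H2" and le: "rk_norm H1 H2 T \<le> ennreal C" "0 \<le> C" and f: "f \<in> funs H1"
  shows "fnorm H2 (T f) \<le> C * fnorm H1 f"
proof -
  interpret H1: rk_space H1 by fact
  interpret H2: rk_space H2 by fact
  have scale: "T (\<lambda>x. a * f x) = (\<lambda>y. a * T f y)" for a
    using T(1)[unfolded linear_between_def, rule_format, OF f f, of a 0] by simp
  show ?thesis
  proof (cases "fnorm H1 f = 0")
    case True
    then have "f = (\<lambda>_. 0)" using H1.fnorm_eq_0[OF f] by simp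
    then have "T f = (\<lambda>_. 0)" using scale[of 0] by simp
    then show ?thesis using le(2) by (simp add: H2.fnorm_zero H1.fnorm_nonneg)
  next
    case False
    define a where "a = complex_of_real (1 / fnorm H1 f)"
    have pos: "0 < fnorm H1 f" using False by (simp add: less_le)
    have "fnorm H1 (\<lambda>x. a * f x) = cmod a * fnorm H1 f" by (rule H1.fnorm_scale[OF f])
    then have "fnorm H1 (\<lambda>x. a * f x) = 1" using pos by (simp add: norm_divide a_def)
    then have "ennreal (fnorm H2 (T (\<lambda>x. a * f x))) \<le> ennreal C"
      by (intro order_trans[OF opnorm_lower le(1)[unfolded rk_norm_def]] H1.scale_in f) simp
    then have "fnorm H2 (T (\<lambda>x. a * f x)) \<le> C" using le(2) by simp
    moreover have "fnorm H2 (T (\<lambda>x. a * f x)) = cmod a * fnorm H2 (T f)"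
      unfolding scale by (rule H2.fnorm_scale[OF T(2)[OF f]])
    moreover have "cmod a = 1 / fnorm H1 f" using pos by (simp add: a_def norm_divide)
    ultimately have "fnorm H2 (T f) / fnorm H1 f \<le> C" by simp
    then show ?thesis using pos by (simp only: pos_divide_le_eq)
  qed
qed

context da_space
begin

lemma kcomb_inject:
  assumes c: "c \<in> coefs X" and e: "e \<in> coefs X" and eq: "kcomb X da_kernel c = kcomb X da_kernel e"
  shows "c = e"
proof
  fix s
  let ?d = "\<lambda>v. c v - e v" and ?S = "{v. c v \<noteq> 0} \<union> {v. e v \<noteq> 0}"
  have d: "?d \<in> coefs X" by (rule coefs_diff[OF c e])
  have "nrm ?d = 0" using norm_kcomb[OF d] eq by (simp add: kcomb_diff[OF c e] fnorm_zero)
  then have "cmod (?d s) \<le> 0" if "s \<in> ?S"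
    using coef_bound[of ?S ?d s] that coefsD[OF c] coefsD[OF e] by auto
  then show "c s = e s" by (cases "s \<in> ?S") auto
qed

lemma nrm_pos:
  assumes c: "c \<in> coefs X" and "c s \<noteq> 0"
  shows "0 < nrm c"
proof (rule ccontr)
  assume "\<not> 0 < nrm c"
  then have "nrm c = 0" using nrm_nonneg[OF c] by simp
  moreover have "cmod (c s) \<le> lagrange_bound {v. c v \<noteq> 0} s * nrm c"
    by (rule coef_bound) (use coefsD[OF c] assms(2) in auto)
  ultimately show False using assms(2) by simp
qed

end

text \<open>The isomorphism sends the kernel function at \<open>u\<close> to \<open>lam u\<close>
  times the one at \<open>F u\<close>. The norm of an image is then the weighted form on
  \<open>X\<close>, so comparing the two forms bounds the map by \<open>b\<close> and its inverse by
  \<open>1 / a\<close>.\<close>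

lemma delta_RK_le:
  fixes F :: "ell2 \<Rightarrow> ell2"
  assumes X: "da_space X" "finite X" and Y: "da_space Y" "finite Y"
    and F: "bij_betw F X Y" and lam: "\<And>u. u \<in> X \<Longrightarrow> lam u \<noteq> 0"
    and a: "0 < a" and b: "0 \<le> b"
    and lower: "\<And>c. c \<in> coefs X \<Longrightarrow> a\<^sup>2 * (psd_kernel.nrm X da_kernel c)\<^sup>2
      \<le> Re (pairing (kcomb X (\<lambda>u v. cnj (lam u) * lam v * da_kernel (F u) (F v)) c) c)"
    and upper: "\<And>c. c \<in> coefs X \<Longrightarrow> Re (pairing (kcomb X (\<lambda>u v. cnj (lam u) * lam v * da_kernel (F u) (F v)) c) c)
      \<le> b\<^sup>2 * (psd_kernel.nrm X da_kernel c)\<^sup>2"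
  shows "delta_RK (da_restrict X) (da_restrict Y) \<le> ennreal (b / a)"
proof -
  interpret A: da_space X by fact
  interpret B: da_space Y by fact
  define F' where "F' = inv_into X F"
  have F': "\<And>y. y \<in> Y \<Longrightarrow> F' y \<in> X" "\<And>y. y \<in> Y \<Longrightarrow> F (F' y) = y" "\<And>u. u \<in> X \<Longrightarrow> F' (F u) = u" "\<And>u. u \<in> X \<Longrightarrow> F u \<in> Y"
    using F by (auto simp: F'_def bij_betw_def f_inv_into_f inv_into_into)
  define P where "P = (\<lambda>c y. if y \<in> Y then c (F' y) * lam (F' y) else (0::complex))"
  \<comment> \<open>On a finite set every function has exactly one coefficient function
    (\<open>finite_kcomb\<close>, \<open>kcomb_inject\<close>), so the choice is harmless.\<close>
  define T where "T = (\<lambda>f. kcomb Y da_kernel (P (SOME c. c \<in> coefs X \<and> f = kcomb X da_kernel c)))"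
  have P: "P c \<in> coefs Y" for c by (rule coefsI[of Y]) (auto simp: P_def Y)
  have T_kcomb: "T (kcomb X da_kernel c) = kcomb Y da_kernel (P c)" if c: "c \<in> coefs X" for c
  proof -
    have "(SOME c'. c' \<in> coefs X \<and> kcomb X da_kernel c = kcomb X da_kernel c') = c"
      by (rule some_equality) (use c A.kcomb_inject in auto)
    then show ?thesis by (simp add: T_def)
  qed
  have nP: "(B.nrm (P c))\<^sup>2 = Re (pairing (kcomb X (\<lambda>u v. cnj (lam u) * lam v * da_kernel (F u) (F v)) c) c)"
    if c: "c \<in> coefs X" for c
  proof -
    have "pairing (kcomb Y da_kernel (P c)) (P c) = (\<Sum>u\<in>Y. \<Sum>v\<in>Y. P c v * da_kernel u v * cnj (P c u))"
      by (rule quadratic_form_eq[OF P Y(2)]) (auto simp: P_def)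
    also have "\<dots> = (\<Sum>u\<in>X. \<Sum>v\<in>X. P c (F v) * da_kernel (F u) (F v) * cnj (P c (F u)))"
      by (simp add: sum.reindex_bij_betw[OF F, symmetric])
    also have "\<dots> = (\<Sum>u\<in>X. \<Sum>v\<in>X. c v * (cnj (lam u) * lam v * da_kernel (F u) (F v)) * cnj (c u))"
      by (intro sum.cong refl) (simp add: P_def F')
    also have "\<dots> = pairing (kcomb X (\<lambda>u v. cnj (lam u) * lam v * da_kernel (F u) (F v)) c) c"
      by (rule quadratic_form_eq[OF c X(2), symmetric]) (use coefsD[OF c] in auto)
    finally show ?thesis by (simp add: B.nrm_sq P)
  qed
  have up: "B.nrm (P c) \<le> b * A.nrm c" if c: "c \<in> coefs X" for c
  proof (rule power2_le_imp_le)
    show "(B.nrm (P c))\<^sup>2 \<le> (b * A.nrm c)\<^sup>2"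
      unfolding nP[OF c] power_mult_distrib by (rule upper[OF c])
  qed (intro mult_nonneg_nonneg b A.nrm_nonneg[OF c])
  have low: "A.nrm c \<le> (1 / a) * B.nrm (P c)" if c: "c \<in> coefs X" for c
  proof -
    have "a * A.nrm c \<le> B.nrm (P c)"
    proof (rule power2_le_imp_le)
      show "(a * A.nrm c)\<^sup>2 \<le> (B.nrm (P c))\<^sup>2"
        unfolding nP[OF c] power_mult_distrib by (rule lower[OF c])
    qed (rule B.nrm_nonneg[OF P])
    then show ?thesis using a by (simp add: field_simps)
  qed
  have surj: "\<exists>c\<in>coefs X. e = P c" if e: "e \<in> coefs Y" for e
  proof (rule bexI)
    let ?c = "\<lambda>u. if u \<in> X then e (F u) / lam u else 0"
    show "?c \<in> coefs X" by (rule coefsI[of X]) (auto simp: X)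
    show "e = P ?c"
      using coefsD(2)[OF e] lam F' by (auto simp: P_def fun_eq_iff)
  qed
  have fX: "\<exists>c\<in>coefs X. f = kcomb X da_kernel c" if "f \<in> funs A.H" for f
    using A.finite_kcomb[OF X(2) that] by metis
  have fY: "\<exists>c\<in>coefs X. g = T (kcomb X da_kernel c)" if "g \<in> funs B.H" for g
    using B.finite_kcomb[OF Y(2) that] surj T_kcomb by metis
  have Tin: "T f \<in> funs B.H" if "f \<in> funs A.H" for f
    using fX[OF that] T_kcomb B.kcomb_in[OF P] by auto
  have P_inj: "c = e" if "c \<in> coefs X" "e \<in> coefs X" "P c = P e" for c e
  proof
    fix u
    show "c u = e u"
    proof (cases "u \<in> X")
      case True
      then show ?thesis using fun_cong[OF that(3), of "F u"] lam F' by (simp add: P_def)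
    next
      case False
      then have "c u = 0" "e u = 0" using coefsD(2)[OF that(1)] coefsD(2)[OF that(2)] by blast+
      then show ?thesis by simp
    qed
  qed
  have bij: "bij_betw T (funs A.H) (funs B.H)"
    unfolding bij_betw_def
  proof
    show "inj_on T (funs A.H)"
    proof (rule inj_onI)
      fix f g assume "f \<in> funs A.H" "g \<in> funs A.H" and eq: "T f = T g"
      then obtain c e where c: "c \<in> coefs X" "f = kcomb X da_kernel c" and e: "e \<in> coefs X" "g = kcomb X da_kernel e"
        using fX by metis
      then have "P c = P e" using eq T_kcomb B.kcomb_inject[OF P P] by simp
      then show "f = g" using P_inj[OF c(1) e(1)] c e by simp
    qed
    show "T ` funs A.H = funs B.H" using Tin fY A.kcomb_in by blast
  qed
  have lin: "linear_between (funs A.H) T"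
    unfolding linear_between_def
  proof (intro ballI allI)
    fix f g s t assume "f \<in> funs A.H" "g \<in> funs A.H"
    then obtain c e where c: "c \<in> coefs X" "f = kcomb X da_kernel c" and e: "e \<in> coefs X" "g = kcomb X da_kernel e"
      using fX by metis
    have "P (\<lambda>v. s * c v + t * e v) = (\<lambda>v. s * P c v + t * P e v)"
      by (auto simp: P_def fun_eq_iff algebra_simps)
    then show "T (\<lambda>x. s * f x + t * g x) = (\<lambda>y. s * T f y + t * T g y)"
      unfolding c(2) e(2) kcomb_lincomb[OF c(1) e(1), symmetric] T_kcomb[OF c(1)] T_kcomb[OF e(1)]
        T_kcomb[OF coefs_lincomb[OF c(1) e(1)]] kcomb_lincomb[OF P P, symmetric] by simp
  qed
  have nT: "rk_norm A.H B.H T \<le> ennreal b"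
  proof (rule rk_norm_le[OF b])
    fix f assume "f \<in> funs A.H"
    then obtain c where "c \<in> coefs X" "f = kcomb X da_kernel c" using fX by blast
    then show "fnorm B.H (T f) \<le> b * fnorm A.H f" using up by (simp add: T_kcomb B.norm_kcomb[OF P] A.norm_kcomb)
  qed simp
  have nT': "rk_norm B.H A.H (inv_into (funs A.H) T) \<le> ennreal (1 / a)"
  proof (rule rk_norm_le)
    fix g assume "g \<in> funs B.H"
    then obtain c where c: "c \<in> coefs X" "g = T (kcomb X da_kernel c)" using fY by blast
    have "inv_into (funs A.H) T g = kcomb X da_kernel c"
      unfolding c(2) using bij A.kcomb_in[OF c(1)] by (simp add: bij_betw_def)
    then show "fnorm A.H (inv_into (funs A.H) T g) \<le> (1 / a) * fnorm B.H g"
      using low[OF c(1)] c by (simp add: T_kcomb B.norm_kcomb[OF P] A.norm_kcomb)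
  qed (use a in simp_all)
  have "T (kfun A.H u) = (\<lambda>y. lam u * kfun B.H (F u) y)" if u: "u \<in> X" for u
  proof -
    have "T (kfun A.H u) = kcomb Y da_kernel (P (\<lambda>v. if v = u then 1 else 0))"
      unfolding A.kfun_kcomb[OF u] by (rule T_kcomb[OF coefs_single[OF u]])
    also have "P (\<lambda>v. if v = u then 1 else 0) = (\<lambda>v. if v = F u then lam u else 0)"
      using F' u by (auto simp: P_def fun_eq_iff)
    also have "kcomb Y da_kernel \<dots> = (\<lambda>y. lam u * kfun B.H (F u) y)"
    proof
      fix y
      show "kcomb Y da_kernel (\<lambda>v. if v = F u then lam u else 0) y = lam u * kfun B.H (F u) y"
        using F'(4)[OF u] B.funs_outside[OF B.kfun_in, of "F u" y]
        by (cases "y \<in> Y") (simp_all add: kcomb_single B.kfun_eq, simp add: kcomb_def)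
    qed
    finally show ?thesis .
  qed
  then have "rkhs_iso A.H B.H T"
    unfolding rkhs_iso_def using bij lin F lam nT
    by (auto intro!: exI[of _ F] exI[of _ lam] intro: le_less_trans)
  then have "delta_RK A.H B.H \<le> rk_norm A.H B.H T * rk_norm B.H A.H (inv_into (funs A.H) T)"
    unfolding delta_RK_def by (intro INF_lower) simp
  also have "\<dots> \<le> ennreal b * ennreal (1 / a)" by (intro mult_mono nT nT') auto
  also have "\<dots> = ennreal (b / a)" using a b by (simp add: ennreal_mult[symmetric])
  finally show ?thesis .
qed

lemma rkhs_iso_distortion_ge_1:
  assumes "da_space X" "X \<noteq> {}" "da_space Y" and T: "rkhs_iso (da_restrict X) (da_restrict Y) T"
  shows "1 \<le> rk_norm (da_restrict X) (da_restrict Y) T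
    * rk_norm (da_restrict Y) (da_restrict X) (inv_into (funs (da_restrict X)) T)"
proof -
  interpret A: da_space X by fact
  interpret B: da_space Y by fact
  have T: "bij_betw T (funs A.H) (funs B.H)" "linear_between (funs A.H) T" "rk_norm A.H B.H T < \<infinity>"
    using T by (auto simp: rkhs_iso_def)
  let ?T' = "inv_into (funs A.H) T"
  obtain u where u: "u \<in> X" using assms(2) by blast
  let ?f = "kfun A.H u"
  have f: "?f \<in> funs A.H" using u by (intro A.kfun_in) simp
  have "?f = kcomb X da_kernel (\<lambda>v. if v = u then 1 else 0)" by (rule A.kfun_kcomb[OF u])
  then have nf: "0 < fnorm A.H ?f"
    using A.norm_kcomb[OF coefs_single[OF u]] A.nrm_pos[OF coefs_single[OF u, of 1], of u] by simp
  define a where "a = enn2real (rk_norm A.H B.H T)"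
  have a: "rk_norm A.H B.H T = ennreal a" "0 \<le> a" using T(3) by (auto simp: a_def less_top)
  have Tf: "fnorm B.H (T ?f) \<le> a * fnorm A.H ?f"
    by (rule rk_norm_bound[OF A.rk_space_axioms B.rk_space_axioms T(2)])
      (use T(1) f a in \<open>auto simp: bij_betw_def\<close>)
  have T'T: "?T' (T ?f) = ?f" using T(1) f by (simp add: bij_betw_def)
  have Tin: "T ?f \<in> funs B.H" using T(1) f by (auto simp: bij_betw_def)
  have lin': "linear_between (funs B.H) ?T'"
    unfolding linear_between_def
  proof (intro ballI allI)
    fix g h s t assume g: "g \<in> funs B.H" and h: "h \<in> funs B.H"
    have g': "?T' g \<in> funs A.H" "T (?T' g) = g" and h': "?T' h \<in> funs A.H" "T (?T' h) = h"
      using T(1) g h by (auto simp: bij_betw_def f_inv_into_f inv_into_into)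
    have "T (\<lambda>x. s * ?T' g x + t * ?T' h x) = (\<lambda>y. s * g y + t * h y)"
      using T(2) g' h' unfolding linear_between_def by simp
    moreover have "(\<lambda>x. s * ?T' g x + t * ?T' h x) \<in> funs A.H" by (rule A.lincomb_in[OF g'(1) h'(1)])
    ultimately show "?T' (\<lambda>x. s * g x + t * h x) = (\<lambda>y. s * ?T' g y + t * ?T' h y)"
      by (intro inv_into_f_eq) (use T(1) in \<open>simp_all add: bij_betw_def\<close>)
  qed
  show "1 \<le> rk_norm A.H B.H T * rk_norm B.H A.H ?T'"
  proof (cases "rk_norm B.H A.H ?T' < \<infinity>")
    case True
    define b where "b = enn2real (rk_norm B.H A.H ?T')"
    have b: "rk_norm B.H A.H ?T' = ennreal b" "0 \<le> b" using True by (auto simp: b_def less_top)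
    have "fnorm A.H (?T' (T ?f)) \<le> b * fnorm B.H (T ?f)"
      by (rule rk_norm_bound[OF B.rk_space_axioms A.rk_space_axioms lin'])
        (use T(1) Tin b in \<open>auto simp: bij_betw_def inv_into_into\<close>)
    also have "\<dots> \<le> b * (a * fnorm A.H ?f)" using Tf b by (intro mult_left_mono) auto
    finally have "1 \<le> a * b" unfolding T'T using nf by (simp add: field_simps)
    then show ?thesis unfolding a(1) b(1) using a b by (simp add: ennreal_mult[symmetric] flip: ennreal_1)
  next
    case False
    then have top: "rk_norm B.H A.H ?T' = top"
      by (simp only: infinity_ennreal_def top.not_eq_extremum[symmetric] not_not)
    \<comment> \<open>In \<open>ennreal\<close> the product of 0 and \<open>top\<close> is 0, so an
      infinite norm of the inverse helps only if \<open>T\<close> has nonzero norm.\<close>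
    have "a \<noteq> 0"
    proof
      assume "a = 0"
      then have "T ?f = (\<lambda>_. 0)" using Tf B.fnorm_eq_0[OF Tin] B.fnorm_nonneg[of "T ?f"] by simp
      moreover have "T (\<lambda>x. 0 * ?f x + 0 * ?f x) = (\<lambda>y. 0 * T ?f y + 0 * T ?f y)"
        using T(2) f unfolding linear_between_def by blast
      ultimately have "T ?f = T (\<lambda>_. 0)" by simp
      then have "?f = (\<lambda>_. 0)" using T(1) f A.zero_in by (auto simp: bij_betw_def inj_on_def)
      then show False using nf by (simp add: A.fnorm_zero)
    qed
    then show ?thesis unfolding a(1) top using a(2) by (simp add: ennreal_mult_top)
  qed
qed

lemma delta_RK_ge_1:
  assumes "da_space X" "X \<noteq> {}" "da_space Y"
  shows "1 \<le> delta_RK (da_restrict X) (da_restrict Y)"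
  unfolding delta_RK_def by (rule INF_greatest) (use rkhs_iso_distortion_ge_1[OF assms] in blast)

section \<open>Multiplier algebras\<close>

context rk_space
begin

lemma Mult_in: "f \<in> Mult H \<Longrightarrow> h \<in> funs H \<Longrightarrow> (\<lambda>x. f x * h x) \<in> funs H"
  by (simp add: Mult_def)

lemma mat_mult_norm_bound:
  assumes A: "\<And>i j. i < m \<Longrightarrow> j < m \<Longrightarrow> A i j \<in> Mult H" and g: "\<And>i. i < m \<Longrightarrow> g i \<in> funs H"
  shows "tuple_norm H m (\<lambda>i x. \<Sum>j<m. A i j x * g j x) \<le> mat_mult_norm H m A * tuple_norm H m g"
proof -
  let ?T = "\<lambda>g i x. \<Sum>j<m. A i j x * g j x"
  define r where "r = sqrt (\<Sum>i<m. (fnorm H (g i))\<^sup>2)"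
  have r: "tuple_norm H m g = ennreal r" "0 \<le> r" by (simp_all add: tuple_norm_def r_def sum_nonneg)
  have Tg: "?T g i \<in> funs H" if "i < m" for i using A g that by (intro sum_in Mult_in) auto
  show ?thesis
  proof (cases "r = 0")
    case True
    then have "(\<Sum>i<m. (fnorm H (g i))\<^sup>2) = 0" by (simp add: r_def)
    then have "fnorm H (g i) = 0" if "i < m" for i using that by (subst (asm) sum_nonneg_eq_0_iff) auto
    then have "g i = (\<lambda>_. 0)" if "i < m" for i using that g fnorm_eq_0 by blast
    then have "?T g i = (\<lambda>_. 0)" for i by (auto intro!: sum.neutral)
    then show ?thesis by (simp add: tuple_norm_def fnorm_zero)
  next
    case False
    then have pos: "0 < r" using r by simp
    define a where "a = complex_of_real (1 / r)"
    have a: "cmod a = 1 / r" using pos by (simp add: a_def norm_divide)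
    have scale: "tuple_norm H m (\<lambda>i x. a * h i x) = ennreal ((1 / r) * sqrt (\<Sum>i<m. (fnorm H (h i))\<^sup>2))"
      if "\<And>i. i < m \<Longrightarrow> h i \<in> funs H" for h
    proof -
      have "(\<Sum>i<m. (fnorm H (\<lambda>x. a * h i x))\<^sup>2) = (1 / r)\<^sup>2 * (\<Sum>i<m. (fnorm H (h i))\<^sup>2)"
        unfolding sum_distrib_left
      proof (intro sum.cong refl)
        fix i assume "i \<in> {..<m}"
        then show "(fnorm H (\<lambda>x. a * h i x))\<^sup>2 = (1 / r)\<^sup>2 * (fnorm H (h i))\<^sup>2"
          using fnorm_scale[OF that, of i a] unfolding a by (simp add: power_mult_distrib power_divide)
      qed
      then show ?thesis using pos by (simp add: tuple_norm_def real_sqrt_mult real_sqrt_divide)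
    qed
    have "tuple_norm H m (?T (\<lambda>i x. a * g i x)) \<le> mat_mult_norm H m A"
      unfolding mat_mult_norm_def
    proof (rule opnorm_lower[of "\<lambda>i x. a * g i x"])
      show "(\<lambda>i x. a * g i x) \<in> {h. \<forall>i<m. h i \<in> funs H}" using g scale_in by blast
      show "tuple_norm H m (\<lambda>i x. a * g i x) \<le> 1"
      proof -
        have "tuple_norm H m (\<lambda>i x. a * g i x) = ennreal ((1 / r) * sqrt (\<Sum>i<m. (fnorm H (g i))\<^sup>2))"
          by (rule scale[OF g])
        also have "sqrt (\<Sum>i<m. (fnorm H (g i))\<^sup>2) = r" by (simp add: r_def)
        finally show ?thesis using pos by simp
      qed
    qed
    also have "?T (\<lambda>i x. a * g i x) = (\<lambda>i x. a * ?T g i x)" by (simp add: sum_distrib_left ac_simps)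
    finally have "ennreal ((1 / r) * sqrt (\<Sum>i<m. (fnorm H (?T g i))\<^sup>2)) \<le> mat_mult_norm H m A"
      using scale[OF Tg] by simp
    then have "ennreal ((1 / r) * sqrt (\<Sum>i<m. (fnorm H (?T g i))\<^sup>2)) * ennreal r \<le> mat_mult_norm H m A * ennreal r"
      by (rule mult_right_mono) simp
    moreover have "ennreal ((1 / r) * sqrt (\<Sum>i<m. (fnorm H (?T g i))\<^sup>2)) * ennreal r
        = ennreal (sqrt (\<Sum>i<m. (fnorm H (?T g i))\<^sup>2))"
      using pos by (subst ennreal_mult[symmetric]) (simp_all add: sum_nonneg)
    ultimately show ?thesis unfolding r(1) by (simp add: tuple_norm_def)
  qed
qed

end

text \<open>If \<open>S\<close> is a weighted composition operator, then it intertwines multiplication by \<open>\<phi> f\<close> and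
  by \<open>f\<close>, so that \<open>\<phi>\<close> is implemented by a similarity.\<close>
lemma cb_norm_le:
  assumes H: "rk_space H1" "rk_space H2" and ab: "0 \<le> a" "0 \<le> b"
    and S: "S = (\<lambda>h x. if x \<in> pts H1 then w x * h (F x) else 0)"
    and Sin: "\<And>h. h \<in> funs H2 \<Longrightarrow> S h \<in> funs H1"
    and Sa: "\<And>h. h \<in> funs H2 \<Longrightarrow> fnorm H1 (S h) \<le> a * fnorm H2 h"
    and Sb: "\<And>h. h \<in> funs H2 \<Longrightarrow> fnorm H2 h \<le> b * fnorm H1 (S h)"
    and F: "\<And>x. x \<in> pts H1 \<Longrightarrow> F x \<in> pts H2 \<and> G (F x) = x"
    and \<phi>: "\<And>f. f \<in> Mult H1 \<Longrightarrow> \<phi> f = restr (pts H2) (f \<circ> G) \<and> \<phi> f \<in> Mult H2"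
  shows "cb_norm H1 H2 \<phi> \<le> ennreal (a * b)"
  unfolding cb_norm_def
proof (rule SUP_least)
  interpret H1: rk_space H1 by fact
  interpret H2: rk_space H2 by fact
  note \<phi>2 = \<phi>[THEN conjunct2]
  fix m :: nat
  show "amp_norm H1 H2 m \<phi> \<le> ennreal (a * b)"
    unfolding amp_norm_def
  proof (rule opnorm_le)
    fix A assume "A \<in> {A. \<forall>i<m. \<forall>j<m. A i j \<in> Mult H1}"
    then have A: "A i j \<in> Mult H1" if "i < m" "j < m" for i j using that by blast
    show "mat_mult_norm H2 m (\<lambda>i j. \<phi> (A i j)) \<le> ennreal (a * b) * mat_mult_norm H1 m A"
      unfolding mat_mult_norm_def[of H2]
    proof (rule opnorm_le)
      fix h assume "h \<in> {h. \<forall>i<m. h i \<in> funs H2}"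
      then have h: "h i \<in> funs H2" if "i < m" for i using that by blast
      let ?g = "\<lambda>i x. \<Sum>j<m. \<phi> (A i j) x * h j x"
      have g: "?g i \<in> funs H2" if "i < m" for i using \<phi>2 A h that by (intro H2.sum_in H2.Mult_in) auto
      have Sg: "S (?g i) = (\<lambda>x. \<Sum>j<m. A i j x * S (h j) x)" if i: "i < m" for i
      proof
        fix x
        show "S (?g i) x = (\<Sum>j<m. A i j x * S (h j) x)"
        proof (cases "x \<in> pts H1")
          case True
          have "\<phi> (A i j) (F x) = A i j x" if "j < m" for j
            using \<phi>[OF A[OF i that]] F[OF True] by (simp add: restr_def)
          then show ?thesis using True by (simp add: S sum_distrib_left ac_simps)
        next
          case False
          then show ?thesis by (simp add: S)
        qed
      qed
      have "tuple_norm H2 m ?g \<le> ennreal b * tuple_norm H1 m (\<lambda>i. S (?g i))"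
      proof -
        have "(\<Sum>i<m. (fnorm H2 (?g i))\<^sup>2) \<le> (\<Sum>i<m. b\<^sup>2 * (fnorm H1 (S (?g i)))\<^sup>2)"
        proof (intro sum_mono)
          fix i assume "i \<in> {..<m}"
          then have "(fnorm H2 (?g i))\<^sup>2 \<le> (b * fnorm H1 (S (?g i)))\<^sup>2" using Sb[OF g] by (intro power_mono) auto
          then show "(fnorm H2 (?g i))\<^sup>2 \<le> b\<^sup>2 * (fnorm H1 (S (?g i)))\<^sup>2" by (simp only: power_mult_distrib)
        qed
        then have "sqrt (\<Sum>i<m. (fnorm H2 (?g i))\<^sup>2) \<le> sqrt (b\<^sup>2 * (\<Sum>i<m. (fnorm H1 (S (?g i)))\<^sup>2))"
          unfolding sum_distrib_left by (rule real_sqrt_le_mono)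
        also have "\<dots> = b * sqrt (\<Sum>i<m. (fnorm H1 (S (?g i)))\<^sup>2)" using ab by (simp add: real_sqrt_mult)
        finally show ?thesis using ab by (simp add: tuple_norm_def ennreal_mult[symmetric] sum_nonneg ennreal_leI)
      qed
      also have "tuple_norm H1 m (\<lambda>i. S (?g i)) = tuple_norm H1 m (\<lambda>i x. \<Sum>j<m. A i j x * S (h j) x)"
        unfolding tuple_norm_def using Sg by (intro arg_cong[of _ _ ennreal] arg_cong[of _ _ sqrt] sum.cong) auto
      also have "\<dots> \<le> mat_mult_norm H1 m A * tuple_norm H1 m (\<lambda>i. S (h i))"
        by (rule H1.mat_mult_norm_bound[OF A]) (use Sin h in auto)
      also have "tuple_norm H1 m (\<lambda>i. S (h i)) \<le> ennreal a * tuple_norm H2 m h"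
      proof -
        have "(\<Sum>i<m. (fnorm H1 (S (h i)))\<^sup>2) \<le> (\<Sum>i<m. a\<^sup>2 * (fnorm H2 (h i))\<^sup>2)"
        proof (intro sum_mono)
          fix i assume "i \<in> {..<m}"
          then have "(fnorm H1 (S (h i)))\<^sup>2 \<le> (a * fnorm H2 (h i))\<^sup>2" using Sa[OF h] by (intro power_mono) auto
          then show "(fnorm H1 (S (h i)))\<^sup>2 \<le> a\<^sup>2 * (fnorm H2 (h i))\<^sup>2" by (simp only: power_mult_distrib)
        qed
        then have "sqrt (\<Sum>i<m. (fnorm H1 (S (h i)))\<^sup>2) \<le> sqrt (a\<^sup>2 * (\<Sum>i<m. (fnorm H2 (h i))\<^sup>2))"
          unfolding sum_distrib_left by (rule real_sqrt_le_mono)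
        also have "\<dots> = a * sqrt (\<Sum>i<m. (fnorm H2 (h i))\<^sup>2)" using ab by (simp add: real_sqrt_mult)
        finally show ?thesis using ab by (simp add: tuple_norm_def ennreal_mult[symmetric] sum_nonneg ennreal_leI)
      qed
      finally have "tuple_norm H2 m ?g \<le> ennreal b * (mat_mult_norm H1 m A * (ennreal a * tuple_norm H2 m h))"
        by (meson mult_left_mono order_trans zero_le)
      also have "\<dots> = ennreal (a * b) * mat_mult_norm H1 m A * tuple_norm H2 m h"
        using ab by (simp add: ennreal_mult ac_simps)
      finally show "tuple_norm H2 m ?g \<le> ennreal (a * b) * mat_mult_norm H1 m A * tuple_norm H2 m h" .
    qed
  qed
qed

text \<open>\<open>S\<close> is the adjoint of \<open>T\<close>. As \<open>T\<close> maps kernel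
  functions to multiples of kernel functions, \<open>S\<close> is a weighted composition operator
  with weight \<open>cnj (lam x)\<close>, bounded by \<open>a\<close> with inverse bounded by
  \<open>b\<close>. Conjugation by it costs \<open>a * b\<close> in either direction, hence the
  square.\<close>

lemma delta_M_le:
  assumes X: "da_space X" "finite X" and Y: "da_space Y" "finite Y"
    and T: "rkhs_iso (da_restrict X) (da_restrict Y) T"
    and a: "rk_norm (da_restrict X) (da_restrict Y) T \<le> ennreal a" "0 \<le> a"
    and b: "rk_norm (da_restrict Y) (da_restrict X) (inv_into (funs (da_restrict X)) T) \<le> ennreal b" "0 \<le> b"
  shows "delta_M (da_restrict X) (da_restrict Y) \<le> ennreal ((a * b)\<^sup>2)"
proof -
  interpret A: da_space X by fact
  interpret B: da_space Y by fact
  let ?T' = "inv_into (funs A.H) T"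
  have bij: "bij_betw T (funs A.H) (funs B.H)" and lin: "linear_between (funs A.H) T"
    using T by (auto simp: rkhs_iso_def)
  obtain F lam where F: "bij_betw F X Y" and lam: "\<And>x. x \<in> X \<Longrightarrow> lam x \<noteq> 0"
    and Tk: "\<And>x. x \<in> X \<Longrightarrow> T (kfun A.H x) = (\<lambda>y. lam x * kfun B.H (F x) y)"
    using T unfolding rkhs_iso_def A.pts_H B.pts_H by metis
  define G where "G = inv_into X F"
  have FG: "\<And>y. y \<in> Y \<Longrightarrow> G y \<in> X" "\<And>y. y \<in> Y \<Longrightarrow> F (G y) = y" "\<And>u. u \<in> X \<Longrightarrow> G (F u) = u" "\<And>u. u \<in> X \<Longrightarrow> F u \<in> Y"
    using F by (auto simp: G_def bij_betw_def f_inv_into_f inv_into_into)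
  have T': "?T' g \<in> funs A.H" "T (?T' g) = g" if "g \<in> funs B.H" for g
    using bij that by (auto simp: bij_betw_def f_inv_into_f inv_into_into)
  have T'T: "?T' (T f) = f" if "f \<in> funs A.H" for f using bij that by (simp add: bij_betw_def)
  have Tin: "T f \<in> funs B.H" if "f \<in> funs A.H" for f using bij that by (auto simp: bij_betw_def)
  have lin': "linear_between (funs B.H) ?T'"
    unfolding linear_between_def
  proof (intro ballI allI)
    fix g h s t assume g: "g \<in> funs B.H" and h: "h \<in> funs B.H"
    have "T (\<lambda>x. s * ?T' g x + t * ?T' h x) = (\<lambda>y. s * g y + t * h y)"
      using lin T'[OF g] T'[OF h] unfolding linear_between_def by simp
    then show "?T' (\<lambda>x. s * g x + t * h x) = (\<lambda>y. s * ?T' g y + t * ?T' h y)"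
      by (intro inv_into_f_eq A.lincomb_in T'(1) g h) (use bij in \<open>simp_all add: bij_betw_def\<close>)
  qed
  have Tnorm: "fnorm B.H (T f) \<le> a * fnorm A.H f" if "f \<in> funs A.H" for f
    by (rule rk_norm_bound[OF A.rk_space_axioms B.rk_space_axioms lin Tin a that])
  have T'norm: "fnorm A.H (?T' g) \<le> b * fnorm B.H g" if "g \<in> funs B.H" for g
    by (rule rk_norm_bound[OF B.rk_space_axioms A.rk_space_axioms lin' T'(1) b that])
  define S where "S = (\<lambda>h x. if x \<in> X then cnj (lam x) * h (F x) else 0)"
  define S' where "S' = (\<lambda>f y. if y \<in> Y then inverse (cnj (lam (G y))) * f (G y) else 0)"
  have S: "S h \<in> funs A.H" for h by (simp add: A.finite_funs[OF X(2)] S_def restr_def fun_eq_iff)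
  have S': "S' f \<in> funs B.H" for f by (simp add: B.finite_funs[OF Y(2)] S'_def restr_def fun_eq_iff)
  have SS': "S (S' f) = f" if "f \<in> funs A.H" for f
    using FG lam A.funs_outside[OF that] by (auto simp: S_def S'_def fun_eq_iff)
  have Tsum: "T (\<lambda>y. \<Sum>v\<in>I. f v y) = (\<lambda>y. \<Sum>v\<in>I. T (f v) y)" if "finite I" "\<And>v. v \<in> I \<Longrightarrow> f v \<in> funs A.H" for I and f :: "ell2 \<Rightarrow> ell2 \<Rightarrow> complex"
    using that
  proof (induction I rule: finite_induct)
    case empty
    show ?case using lin[unfolded linear_between_def, rule_format, OF A.zero_in A.zero_in, of 0 0] by simp
  next
    case (insert i I)
    have "f i \<in> funs A.H" "(\<lambda>x. \<Sum>v\<in>I. f v x) \<in> funs A.H" using insert.prems by (auto intro: A.sum_in)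
    from lin[unfolded linear_between_def, rule_format, OF this, of 1 1] show ?case using insert by simp
  qed
  have adj: "ip A.H (S h) f = ip B.H h (T f)" if h: "h \<in> funs B.H" and f: "f \<in> funs A.H" for h f
  proof -
    obtain c where c: "c \<in> coefs X" "f = kcomb X da_kernel c" using A.finite_kcomb[OF X(2) f] by blast
    let ?I = "{v. c v \<noteq> 0}"
    have I: "finite ?I" "?I \<subseteq> X" using coefsD[OF c(1)] by auto
    have k: "kfun A.H v \<in> funs A.H" if "v \<in> ?I" for v using I that by (intro A.kfun_in) auto
    have k': "kfun B.H (F v) \<in> funs B.H" if "v \<in> ?I" for v using I that FG by (intro B.kfun_in) auto
    have Tck: "T (\<lambda>y. c v * kfun A.H v y) = (\<lambda>y. (c v * lam v) * kfun B.H (F v) y)" if v: "v \<in> ?I" for v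
    proof -
      have "T (\<lambda>y. c v * kfun A.H v y + 0 * kfun A.H v y) = (\<lambda>y. c v * T (kfun A.H v) y + 0 * T (kfun A.H v) y)"
        using lin k[OF v] unfolding linear_between_def by blast
      then show ?thesis using Tk[of v] I v by (auto simp: mult.assoc)
    qed
    have "T f = (\<lambda>y. \<Sum>v\<in>?I. T (\<lambda>y. c v * kfun A.H v y) y)"
      unfolding c(2) A.kcomb_kfun[OF c(1)] by (rule Tsum[OF I(1) A.scale_in[OF k]])
    also have "\<dots> = (\<lambda>y. \<Sum>v\<in>?I. (c v * lam v) * kfun B.H (F v) y)"
      by (intro ext sum.cong refl fun_cong[OF Tck])
    finally have "ip B.H h (T f) = ip B.H h (\<lambda>y. \<Sum>v\<in>?I. (c v * lam v) * kfun B.H (F v) y)" by simp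
    also have "\<dots> = (\<Sum>v\<in>?I. ip B.H h (\<lambda>y. (c v * lam v) * kfun B.H (F v) y))"
      by (intro B.ip_sum_right B.scale_in k' h)
    also have "\<dots> = (\<Sum>v\<in>?I. cnj (c v * lam v) * h (F v))"
      using h k' I FG by (intro sum.cong refl) (simp add: B.ip_scale_right B.reproducing subset_iff)
    also have "\<dots> = pairing (S h) c"
      unfolding pairing_def using I by (intro sum.cong refl) (auto simp: S_def)
    also have "\<dots> = ip A.H (S h) f" unfolding c(2) by (rule A.ip_kcomb_right[OF S c(1), symmetric])
    finally show ?thesis by simp
  qed
  \<comment> \<open>A bound passes to the adjoint: use \<open>adj\<close> with
    \<open>f = S h\<close> and cancel one factor. \<open>Sb\<close> repeats the argument for the
    inverse of \<open>T\<close>.\<close>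
  have Sa: "fnorm A.H (S h) \<le> a * fnorm B.H h" if h: "h \<in> funs B.H" for h
  proof -
    have "(fnorm A.H (S h))\<^sup>2 = Re (ip B.H h (T (S h)))" using adj[OF h S[of h]] by (simp add: A.fnorm_sq)
    also have "\<dots> \<le> fnorm B.H h * fnorm B.H (T (S h))"
      using B.Cauchy_Schwarz[OF h Tin[OF S]] complex_Re_le_cmod order_trans by blast
    also have "\<dots> \<le> fnorm B.H h * (a * fnorm A.H (S h))" by (intro mult_left_mono Tnorm S) simp
    finally have *: "fnorm A.H (S h) * fnorm A.H (S h) \<le> (a * fnorm B.H h) * fnorm A.H (S h)"
      by (simp add: power2_eq_square ac_simps)
    show ?thesis
    proof (cases "fnorm A.H (S h) = 0")
      case True
      then show ?thesis using a by simp
    next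
      case False
      then have "0 < fnorm A.H (S h)" by (simp add: less_le)
      from mult_right_le_imp_le[OF * this] show ?thesis .
    qed
  qed
  have Sb: "fnorm B.H h \<le> b * fnorm A.H (S h)" if h: "h \<in> funs B.H" for h
  proof -
    have "(fnorm B.H h)\<^sup>2 = Re (ip A.H (S h) (?T' h))" using adj[OF h T'(1)[OF h]] T'(2)[OF h] by (simp add: B.fnorm_sq)
    also have "\<dots> \<le> fnorm A.H (S h) * fnorm A.H (?T' h)"
      using A.Cauchy_Schwarz[OF S T'(1)[OF h]] complex_Re_le_cmod order_trans by blast
    also have "\<dots> \<le> fnorm A.H (S h) * (b * fnorm B.H h)" by (intro mult_left_mono T'norm h) simp
    finally have *: "fnorm B.H h * fnorm B.H h \<le> (b * fnorm A.H (S h)) * fnorm B.H h"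
      by (simp add: power2_eq_square ac_simps)
    show ?thesis
    proof (cases "fnorm B.H h = 0")
      case True
      then show ?thesis using b by simp
    next
      case False
      then have "0 < fnorm B.H h" by (simp add: less_le)
      from mult_right_le_imp_le[OF * this] show ?thesis .
    qed
  qed
  define \<phi> where "\<phi> = (\<lambda>f. restr Y (f \<circ> G))"
  note MA = A.finite_Mult[OF X(2)] and MB = B.finite_Mult[OF Y(2)]
  have \<phi>in: "\<phi> f \<in> Mult B.H" for f by (auto simp: MB \<phi>_def restr_def)
  have inj: "inj_on \<phi> (Mult A.H)"
  proof (rule inj_onI)
    fix f f' assume f: "f \<in> Mult A.H" "f' \<in> Mult A.H" "\<phi> f = \<phi> f'"
    have "restr X (\<phi> f \<circ> F) = restr X f" for f using FG by (auto simp: \<phi>_def restr_def)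
    then show "f = f'" using f by (simp add: MA) metis
  qed
  have inv: "inv_into (Mult A.H) \<phi> g = restr X (g \<circ> F)" if "g \<in> Mult B.H" for g
  proof (rule inv_into_f_eq)
    show "inj_on \<phi> (Mult A.H)" by (rule inj)
    show "restr X (g \<circ> F) \<in> Mult A.H" by (auto simp: MA restr_def)
    have "restr Y g = g" using that by (simp add: MB)
    moreover have "restr Y (restr X (g \<circ> F) \<circ> G) = restr Y g" using FG by (auto simp: restr_def)
    ultimately show "\<phi> (restr X (g \<circ> F)) = g" by (simp add: \<phi>_def)
  qed
  have surj: "\<phi> ` Mult A.H = Mult B.H"
  proof (intro equalityI subsetI)
    fix g assume g: "g \<in> Mult B.H"
    have "restr Y g = g" using g by (simp add: MB)
    moreover have "restr Y (restr X (g \<circ> F) \<circ> G) = restr Y g" using FG by (auto simp: restr_def)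
    ultimately have "g = \<phi> (restr X (g \<circ> F))" by (simp add: \<phi>_def)
    moreover have "restr X (g \<circ> F) \<in> Mult A.H" by (auto simp: MA restr_def)
    ultimately show "g \<in> \<phi> ` Mult A.H" by blast
  qed (use \<phi>in in auto)
  have alg: "alg_iso A.H B.H \<phi>"
    unfolding alg_iso_def bij_betw_def using inj surj
    by (auto simp: linear_between_def \<phi>_def restr_def)
  have cb1: "cb_norm A.H B.H \<phi> \<le> ennreal (a * b)"
    by (rule cb_norm_le[of A.H B.H a b S "\<lambda>x. cnj (lam x)" F G])
      (use a b S Sa Sb FG \<phi>in A.rk_space_axioms B.rk_space_axioms in \<open>auto simp: S_def \<phi>_def\<close>)
  have cb2: "cb_norm B.H A.H (inv_into (Mult A.H) \<phi>) \<le> ennreal (b * a)"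
  proof (rule cb_norm_le[of B.H A.H b a S' "\<lambda>y. inverse (cnj (lam (G y)))" G F])
    show "fnorm B.H (S' h) \<le> b * fnorm A.H h" if "h \<in> funs A.H" for h
      using Sb[OF S'[of h]] SS'[OF that] by simp
    show "fnorm A.H h \<le> a * fnorm B.H (S' h)" if "h \<in> funs A.H" for h
      using Sa[OF S'[of h]] SS'[OF that] by simp
    show "inv_into (Mult A.H) \<phi> f = restr (pts A.H) (f \<circ> F) \<and> inv_into (Mult A.H) \<phi> f \<in> Mult A.H"
      if "f \<in> Mult B.H" for f
      using inv[OF that] by (auto simp: MA restr_def)
  qed (use a b S' FG A.rk_space_axioms B.rk_space_axioms in \<open>auto simp: S'_def\<close>)
  have "bij_betw G Y X" unfolding G_def by (rule bij_betw_inv_into[OF F])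
  then have "mult_alg_iso A.H B.H \<phi>"
    unfolding mult_alg_iso_def using alg cb1 cb2
    by (auto intro!: exI[of _ G] intro: le_less_trans simp: \<phi>_def)
  then have "delta_M A.H B.H \<le> cb_distortion A.H B.H \<phi>"
    unfolding delta_M_def by (intro INF_lower) simp
  also have "\<dots> \<le> ennreal (a * b) * ennreal (b * a)"
    unfolding cb_distortion_def by (intro mult_mono cb1 cb2) auto
  also have "\<dots> = ennreal ((a * b)\<^sup>2)" using a b by (simp add: ennreal_mult[symmetric] power2_eq_square ac_simps)
  finally show ?thesis .
qed

lemma cb_norm_ge_1:
  assumes X: "da_space X" "finite X" and Y: "da_space Y" "finite Y" "Y \<noteq> {}"
    and one: "\<phi> (restr X (\<lambda>_. 1)) = restr Y (\<lambda>_. 1)"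
  shows "1 \<le> cb_norm (da_restrict X) (da_restrict Y) \<phi>"
proof -
  interpret A: da_space X by fact
  interpret B: da_space Y by fact
  let ?A = "\<lambda>i j. restr X (\<lambda>_. 1)"
  obtain u where u: "u \<in> Y" using Y by blast
  let ?k = "kfun B.H u"
  have k: "?k \<in> funs B.H" using u by (intro B.kfun_in) simp
  have "?k = kcomb Y da_kernel (\<lambda>v. if v = u then 1 else 0)" by (rule B.kfun_kcomb[OF u])
  then have nk: "0 < fnorm B.H ?k"
    using B.norm_kcomb[OF coefs_single[OF u]] B.nrm_pos[OF coefs_single[OF u, of 1], of u] by simp
  have m1: "mat_mult_norm A.H 1 ?A \<le> 1"
    unfolding mat_mult_norm_def
  proof (rule opnorm_le)
    fix h :: "nat \<Rightarrow> ell2 \<Rightarrow> complex" assume "h \<in> {h. \<forall>i<1. h i \<in> funs A.H}"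
    then have h: "h 0 \<in> funs A.H" by simp
    have "(\<lambda>x. restr X (\<lambda>_. 1) x * h 0 x) = h 0" using A.funs_outside[OF h] by (auto simp: restr_def fun_eq_iff)
    then show "tuple_norm A.H 1 (\<lambda>i x. \<Sum>j<1. restr X (\<lambda>_. 1) x * h j x) \<le> 1 * tuple_norm A.H 1 h"
      by (simp add: tuple_norm_def)
  qed
  have m2: "1 \<le> mat_mult_norm B.H 1 (\<lambda>i j. \<phi> (?A i j))"
  proof -
    have "(\<lambda>x. restr Y (\<lambda>_. 1) x * ?k x) = ?k" using B.funs_outside[OF k] by (auto simp: restr_def fun_eq_iff)
    moreover have "restr Y (\<lambda>_. 1) \<in> Mult B.H" by (auto simp: B.finite_Mult[OF Y(2)] restr_def)
    ultimately have "ennreal (fnorm B.H ?k) \<le> mat_mult_norm B.H 1 (\<lambda>i j. \<phi> (?A i j)) * ennreal (fnorm B.H ?k)"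
      using B.mat_mult_norm_bound[of 1 "\<lambda>i j. restr Y (\<lambda>_. 1)" "\<lambda>_. ?k"] k
      by (simp add: one tuple_norm_def)
    then have le: "ennreal (fnorm B.H ?k) \<le> mat_mult_norm B.H 1 (\<lambda>i j. \<phi> (?A i j)) * ennreal (fnorm B.H ?k)" .
    show ?thesis
    proof (cases "mat_mult_norm B.H 1 (\<lambda>i j. \<phi> (?A i j))")
      case (real r)
      have "ennreal (fnorm B.H ?k) \<le> ennreal (r * fnorm B.H ?k)"
        using le unfolding real(2) by (simp add: ennreal_mult[OF real(1)])
      then have "fnorm B.H ?k \<le> r * fnorm B.H ?k" using real(1) by (subst (asm) ennreal_le_iff) auto
      then have "1 \<le> r" using nk by simp
      then show ?thesis unfolding real(2) using ennreal_leI[of 1 r] by simp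
    qed simp
  qed
  also have "\<dots> \<le> amp_norm A.H B.H 1 \<phi>"
    unfolding amp_norm_def
    by (rule opnorm_lower) (use m1 in \<open>auto simp: A.finite_Mult[OF X(2)] restr_def fun_eq_iff\<close>)
  also have "\<dots> \<le> cb_norm A.H B.H \<phi>" unfolding cb_norm_def by (rule SUP_upper) simp
  finally show ?thesis .
qed

section \<open>Algebra isomorphisms over finite sets\<close>

text \<open>The indicators of points go to orthogonal idempotents with sum 1, so at each
  \<open>y\<close> exactly one of them is 1; this defines \<open>G y\<close>. Surjectivity of
  \<open>\<phi>\<close> makes \<open>G\<close> injective, and injectivity of \<open>\<phi>\<close>
  makes it surjective.\<close>

lemma alg_iso_composition:
  assumes X: "da_space X" "finite X" and Y: "da_space Y" "finite Y"
    and \<phi>: "alg_iso (da_restrict X) (da_restrict Y) \<phi>"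
  obtains G where "bij_betw G Y X" "\<And>f. f \<in> Mult (da_restrict X) \<Longrightarrow> \<phi> f = restr Y (f \<circ> G)"
proof -
  interpret A: da_space X by fact
  interpret B: da_space Y by fact
  note MA = A.finite_Mult[OF X(2)] and MB = B.finite_Mult[OF Y(2)]
  have bij: "bij_betw \<phi> (Mult A.H) (Mult B.H)" and lin: "linear_between (Mult A.H) \<phi>"
    and mult: "\<And>f g. f \<in> Mult A.H \<Longrightarrow> g \<in> Mult A.H \<Longrightarrow> \<phi> (\<lambda>x. f x * g x) = (\<lambda>y. \<phi> f y * \<phi> g y)"
    using \<phi> by (auto simp: alg_iso_def)
  define e :: "ell2 \<Rightarrow> ell2 \<Rightarrow> complex" where "e = (\<lambda>a x. if x = a then 1 else 0)"
  have eX: "e a \<in> Mult A.H" if "a \<in> X" for a using that by (auto simp: MA e_def restr_def)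
  have eY: "e b \<in> Mult B.H" if "b \<in> Y" for b using that by (auto simp: MB e_def restr_def)
  have in_X: "(\<lambda>x. \<Sum>a\<in>S. f a * e a x) \<in> Mult A.H" if "S \<subseteq> X" for S f
    using that by (auto simp: MA e_def restr_def fun_eq_iff intro!: sum.neutral)
  have expand: "\<phi> (\<lambda>x. \<Sum>a\<in>S. f a * e a x) = (\<lambda>y. \<Sum>a\<in>S. f a * \<phi> (e a) y)" if "finite S" "S \<subseteq> X" for S f
    using that
  proof (induction S rule: finite_induct)
    case empty
    have z: "(\<lambda>_. 0) \<in> Mult A.H" by (simp add: MA restr_def)
    show ?case using lin[unfolded linear_between_def, rule_format, OF z z, of 0 0] by simp
  next
    case (insert a S)
    have "e a \<in> Mult A.H" "(\<lambda>x. \<Sum>a\<in>S. f a * e a x) \<in> Mult A.H" using insert.prems by (auto intro: eX in_X)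
    from lin[unfolded linear_between_def, rule_format, OF this, of "f a" 1] show ?case using insert by simp
  qed
  have f_sum: "f = (\<lambda>x. \<Sum>a\<in>X. f a * e a x)" if "f \<in> Mult A.H" for f
  proof
    fix x
    have "restr X f x = f x" using that by (simp add: MA)
    moreover have "(\<Sum>a\<in>X. f a * e a x) = (\<Sum>a\<in>X. if a = x then f x else 0)" by (intro sum.cong) (auto simp: e_def)
    ultimately show "f x = (\<Sum>a\<in>X. f a * e a x)" using X(2) by (simp add: restr_def)
  qed
  have \<phi>_sum: "\<phi> f = (\<lambda>y. \<Sum>a\<in>X. f a * \<phi> (e a) y)" if "f \<in> Mult A.H" for f
    by (subst f_sum[OF that]) (rule expand[OF X(2) order_refl])
  have \<phi>in: "\<phi> f \<in> Mult B.H" if "f \<in> Mult A.H" for f using bij that by (auto simp: bij_betw_def)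
  have one_in: "restr X (\<lambda>_. 1) \<in> Mult A.H" by (auto simp: MA restr_def)
  \<comment> \<open>Preservation of the unit is not part of \<open>alg_iso\<close>; it follows
    because \<open>e y\<close> is in the range and the image of 1 acts on it as identity.\<close>
  have \<phi>1: "\<phi> (restr X (\<lambda>_. 1)) y = 1" if y: "y \<in> Y" for y
  proof -
    obtain f where f: "f \<in> Mult A.H" "\<phi> f = e y" using bij eY[OF y] by (metis bij_betw_def imageE)
    have "(\<lambda>x. restr X (\<lambda>_. 1) x * f x) = restr X f" by (auto simp: restr_def)
    also have "\<dots> = f" using f by (simp add: MA)
    finally have "(\<lambda>x. restr X (\<lambda>_. 1) x * f x) = f" .
    with mult[OF one_in f(1)] f(2) have "e y = (\<lambda>z. \<phi> (restr X (\<lambda>_. 1)) z * e y z)" by simp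
    from fun_cong[OF this, of y] show ?thesis by (simp add: e_def)
  qed
  have idem: "\<phi> (e a) y = 0 \<or> \<phi> (e a) y = 1" if "a \<in> X" for a y
  proof -
    have "(\<lambda>x. e a x * e a x) = e a" by (auto simp: e_def)
    with mult[OF eX[OF that] eX[OF that]] have "\<phi> (e a) = (\<lambda>y. \<phi> (e a) y * \<phi> (e a) y)" by simp
    from fun_cong[OF this, of y] show ?thesis by simp
  qed
  have orth: "\<phi> (e a) y * \<phi> (e b) y = 0" if "a \<in> X" "b \<in> X" "a \<noteq> b" for a b y
  proof -
    \<comment> \<open>The zero function is written as an empty sum so that \<open>expand\<close>
      yields its image.\<close>
    have "(\<lambda>x. e a x * e b x) = (\<lambda>x. \<Sum>a\<in>{}. 0 * e a x)" using that by (auto simp: e_def)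
    then have "(\<lambda>y. \<phi> (e a) y * \<phi> (e b) y) = (\<lambda>y. 0)"
      using mult[OF eX[OF that(1)] eX[OF that(2)]] expand[of "{}" "\<lambda>_. 0"] by simp
    then show ?thesis by (simp add: fun_eq_iff)
  qed
  have "\<exists>a\<in>X. \<phi> (e a) y = 1" if y: "y \<in> Y" for y
  proof (rule ccontr)
    assume "\<not> ?thesis"
    then have "\<phi> (e a) y = 0" if "a \<in> X" for a using idem that by blast
    then have "\<phi> (restr X (\<lambda>_. 1)) y = 0" unfolding \<phi>_sum[OF one_in] by simp
    then show False using \<phi>1[OF y] by simp
  qed
  then obtain G where G: "\<And>y. y \<in> Y \<Longrightarrow> G y \<in> X" "\<And>y. y \<in> Y \<Longrightarrow> \<phi> (e (G y)) y = 1" by metis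
  have comp: "\<phi> f = restr Y (f \<circ> G)" if f: "f \<in> Mult A.H" for f
  proof
    fix y
    show "\<phi> f y = restr Y (f \<circ> G) y"
    proof (cases "y \<in> Y")
      case True
      have "\<phi> f y = (\<Sum>a\<in>X. f a * \<phi> (e a) y)" using \<phi>_sum[OF f] by simp
      also have "\<dots> = (\<Sum>a\<in>X. if a = G y then f (G y) else 0)"
      proof (rule sum.cong)
        fix a assume "a \<in> X"
        then show "f a * \<phi> (e a) y = (if a = G y then f (G y) else 0)"
          using orth[of a "G y" y] G[OF True] by auto
      qed simp
      finally show ?thesis using True G X(2) by (simp add: restr_def)
    next
      case False
      have "restr Y (\<phi> f) = \<phi> f" using \<phi>in[OF f] by (simp add: MB)
      then have "\<phi> f y = restr Y (\<phi> f) y" by simp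
      then show ?thesis using False by (simp add: restr_def)
    qed
  qed
  have "inj_on G Y"
  proof (rule inj_onI, rule ccontr)
    fix y z assume y: "y \<in> Y" and z: "z \<in> Y" and eq: "G y = G z" and ne: "y \<noteq> z"
    obtain f where f: "f \<in> Mult A.H" "\<phi> f = e y" using bij eY[OF y] by (metis bij_betw_def imageE)
    have "e y y = e y z" using comp[OF f(1)] f(2) eq y z by (metis (no_types, lifting) comp_apply restr_def)
    then show False using ne by (simp add: e_def)
  qed
  moreover have "X \<subseteq> G ` Y"
  proof (rule ccontr)
    assume "\<not> X \<subseteq> G ` Y"
    then obtain a where a: "a \<in> X" "a \<notin> G ` Y" by blast
    have z: "(\<lambda>_. 0) \<in> Mult A.H" by (simp add: MA restr_def)
    have "\<phi> (e a) = restr Y (e a \<circ> G)" by (rule comp[OF eX[OF a(1)]])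
    also have "\<dots> = restr Y ((\<lambda>_. 0) \<circ> G)" using a(2) by (auto simp: restr_def e_def fun_eq_iff)
    also have "\<dots> = \<phi> (\<lambda>_. 0)" by (rule comp[OF z, symmetric])
    finally have "e a = (\<lambda>_. 0)" using bij eX[OF a(1)] z by (auto simp: bij_betw_def inj_on_def)
    then show False by (simp add: e_def fun_eq_iff) (metis zero_neq_one)
  qed
  ultimately have "bij_betw G Y X" using G by (auto simp: bij_betw_def)
  then show ?thesis using that comp by blast
qed

lemma composition_inverse:
  assumes X: "da_space X" "finite X" and Y: "da_space Y" "finite Y"
    and G: "bij_betw G Y X" and \<phi>: "\<And>f. f \<in> Mult (da_restrict X) \<Longrightarrow> \<phi> f = restr Y (f \<circ> G)"
    and g: "g \<in> Mult (da_restrict Y)"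
  shows "inv_into (Mult (da_restrict X)) \<phi> g = restr X (g \<circ> inv_into Y G)"
proof -
  interpret A: da_space X by fact
  interpret B: da_space Y by fact
  note MA = A.finite_Mult[OF X(2)] and MB = B.finite_Mult[OF Y(2)]
  let ?F = "inv_into Y G"
  have FG: "\<And>y. y \<in> Y \<Longrightarrow> G y \<in> X" "\<And>y. y \<in> Y \<Longrightarrow> ?F (G y) = y" "\<And>u. u \<in> X \<Longrightarrow> G (?F u) = u" "\<And>u. u \<in> X \<Longrightarrow> ?F u \<in> Y"
    using G by (auto simp: bij_betw_def f_inv_into_f inv_into_into)
  show ?thesis
  proof (rule inv_into_f_eq)
    show "inj_on \<phi> (Mult A.H)"
    proof (rule inj_onI)
      fix f f' assume f: "f \<in> Mult A.H" "f' \<in> Mult A.H" "\<phi> f = \<phi> f'"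
      have "restr X (\<phi> f \<circ> ?F) = f" if "f \<in> Mult A.H" for f
      proof -
        have "restr X (restr Y (f \<circ> G) \<circ> ?F) = restr X f" using FG by (auto simp: restr_def)
        then show ?thesis using that \<phi>[OF that] by (simp add: MA)
      qed
      then show "f = f'" using f by metis
    qed
    show m: "restr X (g \<circ> ?F) \<in> Mult A.H" by (auto simp: MA restr_def)
    have "restr Y g = g" using g by (simp add: MB)
    moreover have "restr Y (restr X (g \<circ> ?F) \<circ> G) = restr Y g" using FG by (auto simp: restr_def)
    ultimately show "\<phi> (restr X (g \<circ> ?F)) = g" by (simp add: \<phi>[OF m])
  qed
qed

lemma alg_iso_cb_norms_ge_1:
  assumes X: "da_space X" "finite X" "X \<noteq> {}" and Y: "da_space Y" "finite Y" "Y \<noteq> {}"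
    and \<phi>: "alg_iso (da_restrict X) (da_restrict Y) \<phi>"
  shows "1 \<le> cb_norm (da_restrict X) (da_restrict Y) \<phi>"
    "1 \<le> cb_norm (da_restrict Y) (da_restrict X) (inv_into (Mult (da_restrict X)) \<phi>)"
proof -
  interpret A: da_space X by fact
  interpret B: da_space Y by fact
  note MA = A.finite_Mult[OF X(2)] and MB = B.finite_Mult[OF Y(2)]
  obtain G where G: "bij_betw G Y X" "\<And>f. f \<in> Mult (da_restrict X) \<Longrightarrow> \<phi> f = restr Y (f \<circ> G)"
    using alg_iso_composition[OF X(1,2) Y(1,2) \<phi>] by blast
  have "restr X (\<lambda>_. 1) \<in> Mult A.H" by (auto simp: MA restr_def)
  then have "\<phi> (restr X (\<lambda>_. 1)) = restr Y (\<lambda>_. 1)"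
    using G by (auto simp: G(2) restr_def bij_betw_def fun_eq_iff)
  then show "1 \<le> cb_norm A.H B.H \<phi>" by (rule cb_norm_ge_1[OF X(1,2) Y])
  have "restr Y (\<lambda>_. 1) \<in> Mult B.H" by (auto simp: MB restr_def)
  then have "inv_into (Mult A.H) \<phi> (restr Y (\<lambda>_. 1)) = restr X (\<lambda>_. 1)"
    using bij_betw_inv_into[OF G(1)]
    by (auto simp: composition_inverse[OF X(1,2) Y(1,2) G] restr_def bij_betw_def fun_eq_iff)
  then show "1 \<le> cb_norm B.H A.H (inv_into (Mult A.H) \<phi>)" by (rule cb_norm_ge_1[OF Y(1,2) X])
qed

lemma alg_iso_distortion_ge_1:
  assumes "da_space X" "finite X" "X \<noteq> {}" "da_space Y" "finite Y" "Y \<noteq> {}"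
    "alg_iso (da_restrict X) (da_restrict Y) \<phi>"
  shows "1 \<le> cb_distortion (da_restrict X) (da_restrict Y) \<phi>"
  using mult_mono[OF alg_iso_cb_norms_ge_1[OF assms]] by (simp add: cb_distortion_def)

text \<open>By \<open>alg_iso_composition\<close> the two families can differ only in finiteness of
  the norms. Both norms are at least 1, so a finite product has finite factors, and isomorphisms
  with infinite distortion do not lower the infimum.\<close>

lemma delta_M_alg_iso:
  assumes X: "da_space X" "finite X" "X \<noteq> {}" and Y: "da_space Y" "finite Y" "Y \<noteq> {}"
  shows "(INF \<phi>\<in>{\<phi>. alg_iso (da_restrict X) (da_restrict Y) \<phi>}. cb_distortion (da_restrict X) (da_restrict Y) \<phi>)
    = delta_M (da_restrict X) (da_restrict Y)" (is "?I = _")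
proof (rule antisym)
  interpret A: da_space X by fact
  interpret B: da_space Y by fact
  show "?I \<le> delta_M A.H B.H"
    unfolding delta_M_def by (rule INF_superset_mono) (auto simp: mult_alg_iso_def)
  show "delta_M A.H B.H \<le> ?I"
  proof (rule INF_greatest)
    fix \<phi> assume "\<phi> \<in> {\<phi>. alg_iso A.H B.H \<phi>}"
    then have \<phi>: "alg_iso A.H B.H \<phi>" by simp
    show "delta_M A.H B.H \<le> cb_distortion A.H B.H \<phi>"
    proof (cases "cb_distortion A.H B.H \<phi> < \<infinity>")
      case True
      note ge = alg_iso_cb_norms_ge_1[OF X Y \<phi>]
      have "cb_norm A.H B.H \<phi> < \<infinity>" "cb_norm B.H A.H (inv_into (Mult A.H) \<phi>) < \<infinity>"
        using True ge unfolding cb_distortion_def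
        by (auto simp: ennreal_mult_less_top)
      moreover obtain G where "bij_betw G Y X" "\<And>f. f \<in> Mult A.H \<Longrightarrow> \<phi> f = restr Y (f \<circ> G)"
        using alg_iso_composition[OF X(1,2) Y(1,2) \<phi>] by blast
      ultimately have "mult_alg_iso A.H B.H \<phi>" using \<phi> by (auto simp: mult_alg_iso_def)
      then show ?thesis unfolding delta_M_def by (intro INF_lower) simp
    next
      case False
      then have "cb_distortion A.H B.H \<phi> = top"
        by (simp only: infinity_ennreal_def top.not_eq_extremum[symmetric] not_not)
      then show ?thesis by simp
    qed
  qed
qed

section \<open>Pick matrices\<close>

lemma quadratic_form_weight:
  assumes c: "c \<in> coefs X"
  shows "pairing (kcomb X k (\<lambda>v. w v * c v)) (\<lambda>v. w v * c v)
    = pairing (kcomb X (\<lambda>u v. cnj (w u) * w v * k u v) c) c"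
proof -
  let ?S = "{v. c v \<noteq> 0}"
  note S = coefsD[OF c]
  show ?thesis
    by (subst quadratic_form_eq[OF coefs_mult[OF c] S], force, subst quadratic_form_eq[OF c S order_refl])
      (simp add: ac_simps)
qed

text \<open>Complete Pick property: the row \<^term>\<open>ball_inv a\<close> is a contractive multiplier which
  determines the kernel. Amplifying to \<open>m * m\<close> matrices sees its first \<open>m\<close> entries.\<close>
lemma Pick_rowbnd:
  assumes X: "da_space X" "finite X" and Y: "da_space Y" "finite Y"
    and G: "bij_betw G Y X" and \<phi>: "\<And>f. f \<in> Mult (da_restrict X) \<Longrightarrow> \<phi> f = restr Y (f \<circ> G)"
    and C: "cb_norm (da_restrict X) (da_restrict Y) \<phi> \<le> ennreal C" "0 \<le> C"
    and a: "norm a < 1"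
  shows "da_space.rowbnd Y (\<lambda>i u. coord (ball_inv a (G u)) i) C"
proof -
  interpret A: da_space X by fact
  interpret B: da_space Y by fact
  note MA = A.finite_Mult[OF X(2)] and MB = B.finite_Mult[OF Y(2)]
  let ?P = "ball_inv a"
  \<comment> \<open>Inside \<open>Bd \<infinity>\<close> the facts on automorphisms apply to any
    points of norm below 1, without reference to \<open>d\<close>.\<close>
  have UN: "z \<in> Bd \<infinity> \<longleftrightarrow> norm z < 1" for z by (simp add: Bd_def Cd_def)
  obtain g where "\<And>z w. z \<in> Bd \<infinity> \<Longrightarrow> w \<in> Bd \<infinity> \<Longrightarrow> 1 - cinner (?P z) (?P w) = g z * cnj (g w) * (1 - cinner z w)"
    using ball_Aut_kernel[OF ball_inv_ball_Aut, of a \<infinity>] a UN by metis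
  then have row: "A.rowbnd (A.comps ?P) 1"
    using A.in_ball by (intro A.rowbnd_rank_one) (auto simp: UN)
  have GX: "G y \<in> X" if "y \<in> Y" for y using G that by (auto simp: bij_betw_def)
  have fin: "(\<Sum>j<m. (B.nrm (\<lambda>u. cnj (coord (?P (G u)) j) * c u))\<^sup>2) \<le> C\<^sup>2 * (B.nrm c)\<^sup>2"
    if m: "0 < m" and c: "c \<in> coefs Y" for m c
  proof -
    \<comment> \<open>\<open>cb_norm\<close> knows only square matrices, so the row is placed in the
      first line and padded with zeros.\<close>
    define A0 where "A0 = (\<lambda>i j. if i = (0::nat) then restr X (\<lambda>u. coord (?P u) j) else (\<lambda>_. 0))"
    have A0M: "A0 i j \<in> Mult A.H" for i j by (auto simp: A0_def MA restr_def)
    have n1: "mat_mult_norm A.H m A0 \<le> 1"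
      unfolding mat_mult_norm_def
    proof (rule opnorm_le)
      fix h assume "h \<in> {h. \<forall>i<m. h i \<in> funs A.H}"
      then have h: "h i \<in> funs A.H" if "i < m" for i using that by blast
      define h' where "h' = (\<lambda>i. if i < m then h i else (\<lambda>_. 0))"
      have h': "h' i \<in> funs A.H" for i using h A.zero_in by (simp add: h'_def)
      have s: "(\<lambda>i. (fnorm A.H (h' i))\<^sup>2) sums (\<Sum>i<m. (fnorm A.H (h i))\<^sup>2)"
        using sums_finite[of "{..<m}" "\<lambda>i. (fnorm A.H (h' i))\<^sup>2"] by (simp add: h'_def A.fnorm_zero)
      let ?f = "\<lambda>u. \<Sum>i. coord (?P u) i * h' i u"
      have f: "?f \<in> funs A.H" "fnorm A.H ?f \<le> 1 * sqrt (\<Sum>i. (fnorm A.H (h' i))\<^sup>2)"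
        by (rule A.rowbnd_imp_bounded[OF row h' sums_summable[OF s]])+
      have f_eq: "(\<lambda>x. \<Sum>j<m. A0 0 j x * h j x) = ?f"
      proof
        fix x
        have "(\<Sum>j<m. A0 0 j x * h j x) = (\<Sum>j<m. coord (?P x) j * h' j x)"
          using A.funs_outside h by (intro sum.cong) (auto simp: A0_def restr_def h'_def)
        also have "\<dots> = ?f x" by (rule suminf_finite[symmetric]) (auto simp: h'_def)
        finally show "(\<Sum>j<m. A0 0 j x * h j x) = ?f x" .
      qed
      have "(\<Sum>i<m. (fnorm A.H (\<lambda>x. \<Sum>j<m. A0 i j x * h j x))\<^sup>2) = (\<Sum>i<m. if i = 0 then (fnorm A.H ?f)\<^sup>2 else 0)"
      proof (rule sum.cong)
        fix i
        have "(\<lambda>x. \<Sum>j<m. A0 i j x * h j x) = (\<lambda>_. 0)" if "i \<noteq> 0" using that by (simp add: A0_def)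
        then show "(fnorm A.H (\<lambda>x. \<Sum>j<m. A0 i j x * h j x))\<^sup>2 = (if i = 0 then (fnorm A.H ?f)\<^sup>2 else 0)"
          using f_eq A.fnorm_zero by (cases "i = 0") simp_all
      qed simp
      also have "\<dots> = (fnorm A.H ?f)\<^sup>2" using m by simp
      finally have "tuple_norm A.H m (\<lambda>i x. \<Sum>j<m. A0 i j x * h j x) = ennreal (fnorm A.H ?f)"
        by (simp add: tuple_norm_def)
      also have "\<dots> \<le> tuple_norm A.H m h"
        using f(2) s by (auto simp: tuple_norm_def sums_iff intro!: ennreal_leI)
      finally show "tuple_norm A.H m (\<lambda>i x. \<Sum>j<m. A0 i j x * h j x) \<le> 1 * tuple_norm A.H m h" by simp
    qed
    have "mat_mult_norm B.H m (\<lambda>i j. \<phi> (A0 i j)) \<le> amp_norm A.H B.H m \<phi>"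
      unfolding amp_norm_def by (rule opnorm_lower) (use n1 A0M in auto)
    also have "\<dots> \<le> cb_norm A.H B.H \<phi>" unfolding cb_norm_def by (rule SUP_upper) (use m in simp)
    also have "\<dots> \<le> ennreal C" by (rule C(1))
    finally have nC: "mat_mult_norm B.H m (\<lambda>i j. \<phi> (A0 i j)) \<le> ennreal C" .
    \<comment> \<open>The truncated transported row; \<open>rowbnd\<close> expects an infinite
      sequence of entries.\<close>
    define b where "b = (\<lambda>i u. if i < m then coord (?P (G u)) i else 0)"
    have bsupp: "(\<lambda>i. (B.nrm (\<lambda>u. cnj (b i u) * c u))\<^sup>2) sums (\<Sum>i<m. (B.nrm (\<lambda>u. cnj (coord (?P (G u)) i) * c u))\<^sup>2)"
      if "c \<in> coefs Y" for c
    proof -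
      have "B.nrm (\<lambda>_. 0) = 0" by (simp add: B.nrm_def pairing_def)
      then show ?thesis
        using sums_finite[of "{..<m}" "\<lambda>i. (B.nrm (\<lambda>u. cnj (b i u) * c u))\<^sup>2"] by (simp add: b_def)
    qed
    have "B.rowbnd b C"
    proof (rule B.rowbndI[OF C(2)])
      show "\<forall>u\<in>Y. summable (\<lambda>i. (cmod (b i u))\<^sup>2)"
        by (intro ballI summable_finite[of "{..<m}"]) (auto simp: b_def)
      fix c assume c: "c \<in> coefs Y"
      show "summable (\<lambda>i. (B.nrm (\<lambda>u. cnj (b i u) * c u))\<^sup>2)" using bsupp[OF c] by (rule sums_summable)
      let ?h = "\<lambda>j. kcomb Y da_kernel (\<lambda>u. cnj (b j u) * c u)"
      have h: "?h j \<in> funs B.H" for j by (rule B.kcomb_in[OF coefs_mult[OF c]])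
      let ?f = "\<lambda>u. \<Sum>i. b i u * ?h i u"
      have f_eq: "(\<lambda>x. \<Sum>j<m. \<phi> (A0 0 j) x * ?h j x) = ?f"
      proof
        fix x
        have "(\<Sum>j<m. \<phi> (A0 0 j) x * ?h j x) = (\<Sum>j<m. b j x * ?h j x)"
        proof (rule sum.cong)
          fix j assume "j \<in> {..<m}"
          then have "\<phi> (A0 0 j) x = b j x" if "x \<in> Y"
            unfolding \<phi>[OF A0M] using GX that by (simp add: A0_def restr_def b_def)
          moreover have "?h j x = 0" if "x \<notin> Y" by (rule B.funs_outside[OF h]) (use that in simp)
          ultimately show "\<phi> (A0 0 j) x * ?h j x = b j x * ?h j x" by auto
        qed simp
        also have "\<dots> = ?f x" by (rule suminf_finite[symmetric]) (auto simp: b_def)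
        finally show "(\<Sum>j<m. \<phi> (A0 0 j) x * ?h j x) = ?f x" .
      qed
      have "(\<lambda>x. \<Sum>j<m. \<phi> (A0 0 j) x * ?h j x) \<in> funs B.H"
        using h by (intro B.sum_in B.Mult_in) (auto simp: \<phi>[OF A0M] MB restr_def)
      then have f_in: "?f \<in> funs B.H" by (simp only: f_eq)
      have "ennreal (fnorm B.H ?f) \<le> tuple_norm B.H m (\<lambda>i x. \<Sum>j<m. \<phi> (A0 i j) x * ?h j x)"
        unfolding tuple_norm_def
      proof (rule ennreal_leI, rule real_le_rsqrt)
        show "(fnorm B.H ?f)\<^sup>2 \<le> (\<Sum>i<m. (fnorm B.H (\<lambda>x. \<Sum>j<m. \<phi> (A0 i j) x * ?h j x))\<^sup>2)"
          using member_le_sum[of 0 "{..<m}" "\<lambda>i. (fnorm B.H (\<lambda>x. \<Sum>j<m. \<phi> (A0 i j) x * ?h j x))\<^sup>2"] m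
          by (simp only: f_eq) simp
      qed
      also have "\<dots> \<le> mat_mult_norm B.H m (\<lambda>i j. \<phi> (A0 i j)) * tuple_norm B.H m ?h"
        by (rule B.mat_mult_norm_bound) (use h in \<open>auto simp: \<phi>[OF A0M] MB restr_def\<close>)
      also have "\<dots> \<le> ennreal C * tuple_norm B.H m ?h" by (intro mult_right_mono nC) simp
      also have "tuple_norm B.H m ?h = ennreal (sqrt (\<Sum>i. (B.nrm (\<lambda>u. cnj (b i u) * c u))\<^sup>2))"
        unfolding tuple_norm_def B.norm_kcomb[OF coefs_mult[OF c]] using bsupp[OF c]
        by (intro arg_cong[of _ _ ennreal] arg_cong[of _ _ sqrt]) (simp add: sums_iff b_def)
      also have "ennreal C * \<dots> = ennreal (C * sqrt (\<Sum>i. (B.nrm (\<lambda>u. cnj (b i u) * c u))\<^sup>2))"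
        using C(2) by (rule ennreal_mult'[symmetric])
      finally have "fnorm B.H ?f \<le> C * sqrt (\<Sum>i. (B.nrm (\<lambda>u. cnj (b i u) * c u))\<^sup>2)"
        using bsupp[OF c] C(2) by (subst (asm) ennreal_le_iff) (auto intro!: mult_nonneg_nonneg suminf_nonneg dest: sums_summable)
      then show "?f \<in> funs B.H \<and> fnorm B.H ?f \<le> C * sqrt (\<Sum>i. (B.nrm (\<lambda>u. cnj (b i u) * c u))\<^sup>2)"
        using f_in by blast
    qed
    then show ?thesis using c bsupp[OF c] by (auto simp: B.rowbnd_def sums_iff)
  qed
  show ?thesis
    unfolding B.rowbnd_comps
  proof (intro conjI ballI C(2))
    fix c assume c: "c \<in> coefs Y"
    \<comment> \<open>An amplification sees only finitely many coordinates, but \<open>C\<close>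
      does not depend on \<open>m\<close>, so the partial sums carry the bound over to the full
      row.\<close>
    have "(\<lambda>m. \<Sum>j<m. (B.nrm (\<lambda>u. cnj (coord (?P (G u)) j) * c u))\<^sup>2) \<longlonglongrightarrow>
      Re (pairing (kcomb Y (\<lambda>u v. cinner (?P (G u)) (?P (G v)) * da_kernel u v) c) c)"
      using B.comps_sums[OF c, of "\<lambda>u. ?P (G u)"] by (simp add: sums_def)
    then show "Re (pairing (kcomb Y (\<lambda>u v. cinner (?P (G u)) (?P (G v)) * da_kernel u v) c) c) \<le> C\<^sup>2 * (B.nrm c)\<^sup>2"
      by (rule LIMSEQ_le_const2) (use fin c in \<open>auto intro!: exI[of _ 1]\<close>)
  qed
qed

lemma (in psd_kernel) two_point:
  assumes "u \<in> X" "v \<in> X"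
  shows "(cmod (k u v))\<^sup>2 \<le> Re (k u u) * Re (k v v)" "0 \<le> Re (k u u)"
proof -
  let ?d = "\<lambda>w v. if v = w then 1 else 0 :: complex"
  have d: "?d w \<in> coefs X" if "w \<in> X" for w by (rule coefs_single[OF that])
  have e: "pairing (kcomb X k (?d v)) (?d u) = k u v" if "u \<in> X" for u v
    using that by (simp add: pairing_single kcomb_single)
  have n: "(nrm (?d w))\<^sup>2 = Re (k w w)" if "w \<in> X" for w
    using nrm_sq[OF d[OF that]] e[OF that] by simp
  have "(cmod (k u v))\<^sup>2 \<le> (nrm (?d v) * nrm (?d u))\<^sup>2"
    using pairing_Cauchy_Schwarz[OF d[OF assms(2)] d[OF assms(1)]] e[OF assms(1)] by (intro power_mono) auto
  then show "(cmod (k u v))\<^sup>2 \<le> Re (k u u) * Re (k v v)" using n assms by (simp add: power_mult_distrib ac_simps)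
  show "0 \<le> Re (k u u)" using n[OF assms(1)] by (metis zero_le_power2)
qed

text \<open>After the weights \<open>w\<close> have replaced the points by their images under
  \<open>ball_inv y0\<close>, positivity for the row reads
  \<open>(C^2 - cinner (x' u) (x' v)) / (1 - q)\<close> with \<open>q\<close> the inner product of
  the images. This is the kernel claimed plus the constant \<open>C^2\<close>, which is its row at
  \<open>y0\<close>, where \<open>x'\<close> and the image both vanish. Removing it is a Schur
  complement, carried out by testing only coefficients with sum 0.\<close>

lemma Pick_psd:
  assumes Y: "da_space Y" and y0: "y0 \<in> Y" and x0: "x' y0 = 0"
    and row: "da_space.rowbnd Y (\<lambda>i u. coord (x' u) i) C"
  shows "psd_kernel Y (\<lambda>u v. (of_real (C\<^sup>2) * cinner (ball_inv y0 u) (ball_inv y0 v) - cinner (x' u) (x' v))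
    / (1 - cinner (ball_inv y0 u) (ball_inv y0 v)))"
proof
  interpret B: da_space Y by fact
  let ?y = "ball_inv y0"
  let ?q = "\<lambda>u v. cinner (?y u) (?y v)"
  let ?B = "\<lambda>u v. (of_real (C\<^sup>2) * ?q u v - cinner (x' u) (x' v)) / (1 - ?q u v)"
  have UN: "z \<in> Bd \<infinity> \<longleftrightarrow> norm z < 1" for z by (simp add: Bd_def Cd_def)
  have n0: "norm y0 < 1" using y0 B.in_ball by simp
  obtain g where g: "\<And>z. z \<in> Bd \<infinity> \<Longrightarrow> g z \<noteq> 0"
    "\<And>z w. z \<in> Bd \<infinity> \<Longrightarrow> w \<in> Bd \<infinity> \<Longrightarrow> 1 - ?q z w = g z * cnj (g w) * (1 - cinner z w)"
    using ball_Aut_kernel[OF ball_inv_ball_Aut, of y0 \<infinity>] n0 UN by metis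
  have nz: "1 - ?q u v \<noteq> 0" if "u \<in> Y" "v \<in> Y" for u v
    using g[of u] g(1)[of v] g(2)[of u v] that B.in_ball one_minus_cinner_neq_0[of u v] by (simp add: UN)
  show "?B v u = cnj (?B u v)" if "u \<in> Y" "v \<in> Y" for u v
    using cinner_commute[of "?y v" "?y u"] cinner_commute[of "x' v" "x' u"] by simp
  fix e assume e: "e \<in> coefs Y"
  let ?S = "insert y0 {v. e v \<noteq> 0}"
  have S: "finite ?S" "?S \<subseteq> Y" using coefsD[OF e] y0 by auto
  define t where "t = (\<Sum>v | e v \<noteq> 0. e v)"
  \<comment> \<open>Changing the coefficient at \<open>y0\<close> makes the sum zero, so the
    constant drops out; the kernel claimed vanishes as soon as one argument is \<open>y0\<close> and
    does not notice the change.\<close>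
  define e' where "e' = (\<lambda>v. 1 * e v + (- 1) * (if v = y0 then t else 0))"
  have e': "e' \<in> coefs Y" unfolding e'_def by (intro coefs_lincomb e coefs_single y0)
  have sub: "{v. e' v \<noteq> 0} \<subseteq> ?S" "{v. e v \<noteq> 0} \<subseteq> ?S" by (auto simp: e'_def)
  have sum0: "pairing (\<lambda>_. 1) e' = 0"
  proof -
    have "pairing (\<lambda>_. 1) e = cnj t" by (simp add: pairing_def t_def)
    then show ?thesis unfolding e'_def pairing_lincomb_right[OF e coefs_single[OF y0]] pairing_single by simp
  qed
  have yy: "?y y0 = 0" by (rule ball_inv_self[OF n0])
  have B0: "?B y0 v = 0" "?B u y0 = 0" for u v by (simp_all add: yy x0 cinner_simps)
  define w where "w = (\<lambda>v. 1 / cnj (g v))"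
  have wk: "cnj (w u) * w v * da_kernel u v = 1 / (1 - ?q u v)" if "u \<in> Y" "v \<in> Y" for u v
    using g(2)[of u v] that B.in_ball by (simp add: w_def da_kernel_def UN)
  let ?c = "\<lambda>v. w v * e' v"
  have c: "?c \<in> coefs Y" by (rule coefs_mult[OF e'])
  have "0 \<le> C\<^sup>2 * (B.nrm ?c)\<^sup>2 - Re (pairing (kcomb Y (\<lambda>u v. cinner (x' u) (x' v) * da_kernel u v) ?c) ?c)"
    using row c unfolding B.rowbnd_comps by auto
  also have "\<dots> = Re (of_real (C\<^sup>2) * pairing (kcomb Y da_kernel ?c) ?c
      - pairing (kcomb Y (\<lambda>u v. cinner (x' u) (x' v) * da_kernel u v) ?c) ?c)"
    using B.nrm_sq[OF c] by (simp flip: of_real_power)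
  also have "of_real (C\<^sup>2) * pairing (kcomb Y da_kernel ?c) ?c
      - pairing (kcomb Y (\<lambda>u v. cinner (x' u) (x' v) * da_kernel u v) ?c) ?c
    = pairing (kcomb Y (\<lambda>u v. of_real (C\<^sup>2) * da_kernel u v - cinner (x' u) (x' v) * da_kernel u v) ?c) ?c"
    by (simp only: quadratic_form_diff quadratic_form_scale)
  also have "\<dots> = pairing (kcomb Y (\<lambda>u v. ?B u v + of_real (C\<^sup>2) * (1 * cnj 1)) e') e'"
    unfolding quadratic_form_weight[OF e']
  proof (rule quadratic_form_cong[OF e'])
    fix u v assume uv: "u \<in> Y" "v \<in> Y"
    have "cnj (w u) * w v * (of_real (C\<^sup>2) * da_kernel u v - cinner (x' u) (x' v) * da_kernel u v)
        = (cnj (w u) * w v * da_kernel u v) * (of_real (C\<^sup>2) - cinner (x' u) (x' v))" by (simp add: algebra_simps)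
    also have "\<dots> = ?B u v + of_real (C\<^sup>2) * (1 * cnj 1)"
      unfolding wk[OF uv] using nz[OF uv] by (simp add: field_simps)
    finally show "cnj (w u) * w v * (of_real (C\<^sup>2) * da_kernel u v - cinner (x' u) (x' v) * da_kernel u v)
      = ?B u v + of_real (C\<^sup>2) * (1 * cnj 1)" .
  qed
  also have "\<dots> = pairing (kcomb Y (\<lambda>u v. ?B u v - (- of_real (C\<^sup>2)) * (1 * cnj 1)) e') e'" by simp
  also have "\<dots> = pairing (kcomb Y ?B e') e'"
    using quadratic_form_rank_one[OF e', of "\<lambda>_. 1"] sum0
    by (simp only: quadratic_form_diff quadratic_form_scale) simp
  also have "\<dots> = pairing (kcomb Y ?B e) e"
    unfolding quadratic_form_eq[OF e' S sub(1)] quadratic_form_eq[OF e S sub(2)]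
  proof (intro sum.cong refl)
    fix u v
    show "e' v * ?B u v * cnj (e' u) = e v * ?B u v * cnj (e u)"
      using B0 by (cases "u = y0 \<or> v = y0") (auto simp: e'_def)
  qed
  finally show "0 \<le> Re (pairing (kcomb Y ?B e) e)" .
qed

section \<open>Vector valued multipliers\<close>

lemma rho_ph_commute: "norm z < 1 \<Longrightarrow> norm w < 1 \<Longrightarrow> rho_ph z w = rho_ph w z"
proof -
  assume *: "norm z < 1" "norm w < 1"
  have "cnj (1 - cinner w z) = 1 - cinner z w" using cinner_commute[of z w] by simp
  then have "cmod (1 - cinner z w) = cmod (1 - cinner w z)" by (metis complex_mod_cnj)
  then have "1 - (rho_ph z w)\<^sup>2 = 1 - (rho_ph w z)\<^sup>2"
    using * by (simp add: one_minus_rho_ph mult.commute)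
  then show ?thesis using rho_ph_nonneg by (simp add: power2_eq_iff_nonneg)
qed

text \<open>Write \<open>w = ball_inv z \<xi>\<close> with \<open>norm \<xi>\<close> equal to the
  pseudohyperbolic distance. Then \<open>w - z\<close>, multiplied by the denominator, is a
  combination of three vectors of norm at most one, one and two times \<open>norm \<xi>\<close>, and
  the denominator is at least \<open>1 - norm \<xi>\<close>. The estimate is uniform over the ball,
  also near the boundary.\<close>

lemma norm_diff_le_rho_ph:
  assumes z: "norm z < 1" and w: "norm w < 1"
  shows "norm (z - w) * (1 - rho_ph z w) \<le> 4 * rho_ph z w"
proof -
  define \<xi> where "\<xi> = ball_inv z w"
  define s where "s = sqrt (1 - (norm z)\<^sup>2)"
  let ?t = "1 - cinner \<xi> z" and ?P = "span_proj z \<xi>"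
  have r: "norm \<xi> = rho_ph z w" using rho_ph_commute[OF z w] by (simp add: \<xi>_def rho_ph_def)
  have \<xi>1: "norm \<xi> < 1"
    using ball_inv_in_Bd[of z \<infinity> w] z w by (simp add: \<xi>_def Bd_def Cd_def)
  have w_eq: "w = cscale (1 / ?t) (z - ?P - s *\<^sub>R (\<xi> - ?P))"
    using ball_inv_ball_inv[OF z w] by (simp add: ball_inv_def[of z \<xi>] \<xi>_def[symmetric] s_def)
  have t0: "?t \<noteq> 0" using one_minus_cinner_neq_0[OF \<xi>1 z] .
  have "cscale ?t (w - z) = cscale (cinner \<xi> z) z - ?P - s *\<^sub>R (\<xi> - ?P)"
    using t0 by (subst w_eq) (simp add: cscale_simps)
  then have "norm (cscale ?t (w - z)) \<le> norm (cscale (cinner \<xi> z) z) + norm ?P + norm (s *\<^sub>R (\<xi> - ?P))"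
    by (smt (verit) norm_triangle_ineq4)
  moreover have P: "norm ?P \<le> norm \<xi>"
  proof (cases "z = 0")
    case False
    have "cmod (cinner z z) = norm z * norm z" by (simp only: cinner_norm norm_of_real) (simp add: power2_eq_square)
    then have "norm ?P = cmod (cinner \<xi> z) / norm z"
      using False by (simp add: span_proj_def norm_cscale norm_divide)
    also have "\<dots> \<le> norm \<xi>" using False cinner_Cauchy_Schwarz[of \<xi> z] by (simp add: divide_le_eq)
    finally show ?thesis .
  qed (simp add: span_proj_def cscale_simps)
  moreover have "norm (cscale (cinner \<xi> z) z) \<le> norm \<xi>"
  proof -
    have "cmod (cinner \<xi> z) * norm z \<le> (norm \<xi> * norm z) * norm z"
      by (intro mult_right_mono cinner_Cauchy_Schwarz) simp
    also have "\<dots> \<le> norm \<xi> * 1 * 1" using z by (intro mult_mono) auto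
    finally show ?thesis by (simp add: norm_cscale)
  qed
  moreover have "norm (s *\<^sub>R (\<xi> - ?P)) \<le> 2 * norm \<xi>"
  proof -
    have "0 \<le> s" "s \<le> 1" using z by (auto simp: s_def abs_square_le_1)
    then have "norm (s *\<^sub>R (\<xi> - ?P)) \<le> norm (\<xi> - ?P)" by (simp add: mult_left_le_one_le)
    also have "\<dots> \<le> norm \<xi> + norm ?P" by (rule norm_triangle_ineq4)
    finally show ?thesis using P by simp
  qed
  ultimately have n: "cmod ?t * norm (w - z) \<le> 4 * norm \<xi>" by (simp add: norm_cscale)
  have "cmod (cinner \<xi> z) \<le> norm \<xi>"
    using cinner_Cauchy_Schwarz[of \<xi> z] mult_left_le[of "norm z" "norm \<xi>"] z by simp
  then have "1 - norm \<xi> \<le> cmod ?t" using norm_triangle_ineq2[of 1 "cinner \<xi> z"] by simp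
  then have "(1 - norm \<xi>) * norm (w - z) \<le> cmod ?t * norm (w - z)" by (rule mult_right_mono) simp
  then show ?thesis using n unfolding r by (simp add: norm_minus_commute mult.commute)
qed

lemma quadratic_form_reindex:
  assumes f: "bij_betw f X Y" and c: "c \<in> coefs X"
  defines "c' \<equiv> \<lambda>w. if w \<in> Y then c (inv_into X f w) else 0"
  shows "c' \<in> coefs Y" "pairing (kcomb X (\<lambda>u v. k (f u) (f v)) c) c = pairing (kcomb Y k c') c'"
proof -
  let ?S = "{v. c v \<noteq> 0}"
  have S: "finite ?S" "?S \<subseteq> X" using coefsD[OF c] by auto
  have inv: "inv_into X f (f u) = u" if "u \<in> X" for u using f that by (simp add: bij_betw_def)
  have fS: "finite (f ` ?S)" "f ` ?S \<subseteq> Y" using S f by (auto simp: bij_betw_def)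
  have z: "c' w = 0" if "w \<notin> f ` ?S" for w
    using that f by (auto simp: c'_def bij_betw_def f_inv_into_f image_iff)
  show c': "c' \<in> coefs Y" by (rule coefsI[OF fS z])
  have c'f: "c' (f u) = c u" if "u \<in> ?S" for u
  proof -
    have "u \<in> X" using that S by blast
    moreover have "f u \<in> Y" using that fS by blast
    ultimately show ?thesis by (simp add: c'_def inv)
  qed
  have injS: "inj_on f ?S" using f S by (meson bij_betw_def inj_on_subset)
  have "pairing (kcomb Y k c') c' = (\<Sum>u\<in>f ` ?S. \<Sum>v\<in>f ` ?S. c' v * k u v * cnj (c' u))"
    by (rule quadratic_form_eq[OF c' fS]) (use z in auto)
  also have "\<dots> = (\<Sum>u\<in>?S. \<Sum>v\<in>?S. c v * k (f u) (f v) * cnj (c u))"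
    by (simp add: sum.reindex[OF injS] c'f)
  also have "\<dots> = pairing (kcomb X (\<lambda>u v. k (f u) (f v)) c) c"
    by (rule quadratic_form_eq[OF c S order_refl, symmetric])
  finally show "pairing (kcomb X (\<lambda>u v. k (f u) (f v)) c) c = pairing (kcomb Y k c') c'" by simp
qed

section \<open>Sums and products of rows; strict contraction\<close>

context da_space
begin

lemma row_summable:
  assumes h: "\<And>i. h i \<in> funs H" and hs: "summable (\<lambda>i. (fnorm H (h i))\<^sup>2)"
  shows "summable (\<lambda>i. coord (F u) i * h i u)"
proof (cases "u \<in> X")
  case True
  have "(\<lambda>i. pairing (h i) (\<lambda>v. cnj (coord (F v) i) * (if v = u then 1 else 0))) sums
    pairing (\<lambda>u. \<Sum>i. coord (F u) i * h i u) (\<lambda>v. if v = u then 1 else 0)"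
    by (rule rowbnd_pairing_sums[OF _ coefs_single[OF True] h hs]) (simp add: summable_coord)
  moreover have "(\<lambda>v. cnj (coord (F v) i) * (if v = u then 1 else 0)) = (\<lambda>v. if v = u then cnj (coord (F u) i) else 0)" for i
    by auto
  ultimately show ?thesis by (simp add: pairing_single sums_iff mult.commute)
next
  case False
  then have "h i u = 0" for i using funs_outside[OF h] by simp
  then show ?thesis by simp
qed

lemma rowbnd_compsI:
  assumes C: "0 \<le> C" and op: "\<And>h. (\<And>i. h i \<in> funs H) \<Longrightarrow> summable (\<lambda>i. (fnorm H (h i))\<^sup>2) \<Longrightarrow>
    (\<lambda>u. \<Sum>i. coord (F u) i * h i u) \<in> funs H \<and>
    fnorm H (\<lambda>u. \<Sum>i. coord (F u) i * h i u) \<le> C * sqrt (\<Sum>i. (fnorm H (h i))\<^sup>2)"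
  shows "rowbnd (comps F) C"
proof (rule rowbndI[OF C])
  fix c assume c: "c \<in> coefs X"
  show cs: "summable (\<lambda>i. (nrm (\<lambda>u. cnj (coord (F u) i) * c u))\<^sup>2)" using comps_sums[OF c] by (rule sums_summable)
  note m = coefs_mult[OF c]
  show "(\<lambda>u. \<Sum>i. coord (F u) i * kcomb X da_kernel (\<lambda>u. cnj (coord (F u) i) * c u) u) \<in> funs H \<and>
    fnorm H (\<lambda>u. \<Sum>i. coord (F u) i * kcomb X da_kernel (\<lambda>u. cnj (coord (F u) i) * c u) u)
      \<le> C * sqrt (\<Sum>i. (nrm (\<lambda>u. cnj (coord (F u) i) * c u))\<^sup>2)"
    using op[of "\<lambda>i. kcomb X da_kernel (\<lambda>u. cnj (coord (F u) i) * c u)"] cs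
    by (simp add: kcomb_in[OF m] norm_kcomb[OF m])
qed (simp add: summable_coord)

lemma rowbnd_add:
  assumes F: "rowbnd (comps F) C" and G: "rowbnd (comps G) D"
  shows "rowbnd (comps (\<lambda>u. F u + G u)) (C + D)"
proof (rule rowbnd_compsI)
  show "0 \<le> C + D" using F G by (simp add: rowbnd_def)
  fix h :: "nat \<Rightarrow> ell2 \<Rightarrow> complex"
  assume h: "\<And>i. h i \<in> funs H" "summable (\<lambda>i. (fnorm H (h i))\<^sup>2)"
  note f = rowbnd_imp_bounded[OF F h] and g = rowbnd_imp_bounded[OF G h]
  have e: "(\<lambda>u. \<Sum>i. coord (F u + G u) i * h i u) = (\<lambda>u. (\<Sum>i. coord (F u) i * h i u) + (\<Sum>i. coord (G u) i * h i u))"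
    by (simp add: coord_ops distrib_right suminf_add[OF row_summable[OF h] row_summable[OF h]])
  show "(\<lambda>u. \<Sum>i. coord (F u + G u) i * h i u) \<in> funs H \<and>
      fnorm H (\<lambda>u. \<Sum>i. coord (F u + G u) i * h i u) \<le> (C + D) * sqrt (\<Sum>i. (fnorm H (h i))\<^sup>2)"
    unfolding e using add_in[OF f(1) g(1)] fnorm_triangle[OF f(1) g(1)] f(2) g(2)
    by (simp add: distrib_right)
qed

lemma rowbnd_mult:
  assumes p: "mbd p C" and F: "rowbnd (comps F) D"
  shows "rowbnd (comps (\<lambda>u. cscale (p u) (F u))) (C * D)"
proof (rule rowbnd_compsI)
  show "0 \<le> C * D" using F p by (simp add: rowbnd_def mbd_def)
  fix h :: "nat \<Rightarrow> ell2 \<Rightarrow> complex"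
  assume h: "\<And>i. h i \<in> funs H" "summable (\<lambda>i. (fnorm H (h i))\<^sup>2)"
  note f = rowbnd_imp_bounded[OF F h]
  have e: "(\<lambda>u. \<Sum>i. coord (cscale (p u) (F u)) i * h i u) = (\<lambda>u. p u * (\<Sum>i. coord (F u) i * h i u))"
    by (simp add: mult.assoc suminf_mult[OF row_summable[OF h]])
  have "fnorm H (\<lambda>u. p u * (\<Sum>i. coord (F u) i * h i u)) \<le> C * fnorm H (\<lambda>u. \<Sum>i. coord (F u) i * h i u)"
    using p f(1) by (simp add: mbd_def)
  also have "\<dots> \<le> C * (D * sqrt (\<Sum>i. (fnorm H (h i))\<^sup>2))" using p f(2) by (intro mult_left_mono) (auto simp: mbd_def)
  finally show "(\<lambda>u. \<Sum>i. coord (cscale (p u) (F u)) i * h i u) \<in> funs H \<and>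
      fnorm H (\<lambda>u. \<Sum>i. coord (cscale (p u) (F u)) i * h i u) \<le> C * D * sqrt (\<Sum>i. (fnorm H (h i))\<^sup>2)"
    unfolding e using p f(1) by (simp add: mbd_def mult.assoc)
qed

lemma rowbnd_lagrange_sum:
  assumes S: "finite S" "\<And>t. t \<in> S \<Longrightarrow> norm t < 1" and F: "rowbnd (comps F) C"
  shows "finite I \<Longrightarrow> rowbnd (comps (\<lambda>u. F u + (\<Sum>i\<in>I. cscale (lagrange S (s i) u) (v i))))
    (C + (\<Sum>i\<in>I. lagrange_bound S (s i) * norm (v i)))"
proof (induction I rule: finite_induct)
  case (insert i I)
  have "rowbnd (comps (\<lambda>u. cscale (lagrange S (s i) u) (v i))) (lagrange_bound S (s i) * norm (v i))"
    by (rule rowbnd_mult[OF mbd_lagrange[OF S] rowbnd_const])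
  from rowbnd_add[OF insert.IH this] show ?case using insert by (simp add: add_ac)
qed (simp add: F)

lemma rowbnd_mono: "rowbnd b C \<Longrightarrow> C \<le> D \<Longrightarrow> rowbnd b D"
proof -
  assume *: "rowbnd b C" "C \<le> D"
  then have "0 \<le> C" by (simp add: rowbnd_def)
  then have "C\<^sup>2 * (nrm c)\<^sup>2 \<le> D\<^sup>2 * (nrm c)\<^sup>2" for c using * by (intro mult_right_mono power_mono) auto
  then show ?thesis using * unfolding rowbnd_def by (meson order_trans)
qed

text \<open>A strict Schwarz-Pick lemma. The Pick matrix \<open>M\<close> at \<open>u\<close>,
  \<open>v\<close> dominates \<open>1 - c^2\<close> times the kernel matrix, which is definite, so
  its determinant is positive; by \<open>one_minus_rho_ph\<close> this is the strict inequality of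
  distances.\<close>

lemma rho_ph_contraction:
  assumes F: "rowbnd (comps F) c" and c: "c < 1" and uv: "u \<in> X" "v \<in> X" "u \<noteq> v"
    and Fuv: "norm (F u) < 1" "norm (F v) < 1"
  shows "rho_ph (F u) (F v) < rho_ph u v"
proof -
  define M where "M = (\<lambda>p q. da_kernel p q - cinner (F p) (F q) * da_kernel p q)"
  have uv1: "norm u < 1" "norm v < 1" using in_ball uv by auto
  have M: "M p q = (1 - cinner (F p) (F q)) / (1 - cinner p q)" for p q
    by (simp add: M_def da_kernel_def diff_divide_distrib)
  have Mr: "M p p = of_real ((1 - (norm (F p))\<^sup>2) / (1 - (norm p)\<^sup>2))" for p
    by (simp add: M cinner_norm)
  define \<alpha> \<beta> m where "\<alpha> = (1 - (norm (F u))\<^sup>2) / (1 - (norm u)\<^sup>2)"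
    and "\<beta> = (1 - (norm (F v))\<^sup>2) / (1 - (norm v)\<^sup>2)" and "m = M u v"
  have Mvu: "M v u = cnj m" using cinner_commute[of v u] cinner_commute[of "F v" "F u"] by (simp add: m_def M)
  have \<alpha>: "0 < \<alpha>" using uv1 Fuv by (simp add: \<alpha>_def power_less_one_iff)
  \<comment> \<open>For these coefficients the form of \<open>M\<close> equals
    \<open>\<alpha>\<close> times the determinant.\<close>
  define e where "e = (\<lambda>w. if w = u then - m else if w = v then of_real \<alpha> else 0)"
  have e: "e \<in> coefs X" by (rule coefsI[of "{u, v}"]) (use uv in \<open>auto simp: e_def\<close>)
  have "pairing (kcomb X M e) e = (\<Sum>p\<in>{u, v}. \<Sum>q\<in>{u, v}. e q * M p q * cnj (e p))"
    by (rule quadratic_form_eq[OF e]) (use uv in \<open>auto simp: e_def\<close>)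
  also have "\<dots> = of_real \<alpha> * (of_real (\<alpha> * \<beta>) - m * cnj m)"
    using uv by (simp add: e_def Mr[of u, folded \<alpha>_def] Mr[of v, folded \<beta>_def] Mvu m_def[symmetric] algebra_simps)
  also have "\<dots> = of_real (\<alpha> * (\<alpha> * \<beta> - (cmod m)\<^sup>2))"
    unfolding complex_norm_square[symmetric] by simp
  finally have Q: "Re (pairing (kcomb X M e) e) = \<alpha> * (\<alpha> * \<beta> - (cmod m)\<^sup>2)" by simp
  have "Re (pairing (kcomb X M e) e) = (nrm e)\<^sup>2 - Re (pairing (kcomb X (\<lambda>p q. cinner (F p) (F q) * da_kernel p q) e) e)"
    unfolding M_def quadratic_form_diff using nrm_sq[OF e] by simp
  also have "\<dots> \<ge> (nrm e)\<^sup>2 - c\<^sup>2 * (nrm e)\<^sup>2"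
    using F e unfolding rowbnd_comps by (intro diff_left_mono) auto
  moreover have "0 < (nrm e)\<^sup>2 - c\<^sup>2 * (nrm e)\<^sup>2"
  proof -
    have "0 < nrm e" by (rule nrm_pos[OF e, of v]) (use uv \<alpha> in \<open>simp add: e_def\<close>)
    moreover have "c\<^sup>2 < 1" using F c by (simp add: rowbnd_def power_less_one_iff)
    ultimately have "c\<^sup>2 * (nrm e)\<^sup>2 < 1 * (nrm e)\<^sup>2" by (intro mult_strict_right_mono) auto
    then show ?thesis by simp
  qed
  ultimately have "0 < \<alpha> * (\<alpha> * \<beta> - (cmod m)\<^sup>2)" using Q by linarith
  then have lt: "(cmod m)\<^sup>2 < \<alpha> * \<beta>" using \<alpha> by (simp add: zero_less_mult_iff)
  have nz: "0 < cmod (1 - cinner u v)" "0 < cmod (1 - cinner (F u) (F v))"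
    using one_minus_cinner_neq_0 uv1 Fuv by auto
  have "1 - (rho_ph u v)\<^sup>2 < 1 - (rho_ph (F u) (F v))\<^sup>2"
  proof -
    have "0 < (1 - (norm u)\<^sup>2) * (1 - (norm v)\<^sup>2)" using uv1 by (simp add: power_less_one_iff)
    moreover have "(cmod (1 - cinner (F u) (F v)))\<^sup>2 / (cmod (1 - cinner u v))\<^sup>2
        < (1 - (norm (F u))\<^sup>2) * (1 - (norm (F v))\<^sup>2) / ((1 - (norm u)\<^sup>2) * (1 - (norm v)\<^sup>2))"
      using lt by (simp add: m_def M norm_divide power_divide \<alpha>_def \<beta>_def)
    ultimately show ?thesis
      using nz uv1 Fuv by (simp add: one_minus_rho_ph divide_simps mult.commute mult.left_commute split: if_splits)
  qed
  then show ?thesis using rho_ph_nonneg by (simp add: power2_less_imp_less)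
qed

end

section \<open>Vector valued multipliers on the ball as bounded rows\<close>

lemma da_space_Bd: "da_space (Bd d)"
  by unfold_locales (simp add: Bd_def)

lemma drury_arveson_eq: "drury_arveson d = da_restrict (Bd d)"
  by (simp add: drury_arveson_def da_restrict_def)

text \<open>By \<open>ball_Aut_kernel\<close> an automorphism only rescales the kernel. The factors
  go into the coefficients and the points are renamed, which turns both forms for the composition
  into the forms for \<open>F\<close> at the same coefficients \<open>?e\<close>.\<close>

lemma rowbnd_compose_ball_Aut:
  assumes \<Phi>: "\<Phi> \<in> ball_Aut d" and F: "da_space.rowbnd (Bd d) (\<lambda>i u. coord (F u) i) C"
  shows "da_space.rowbnd (Bd d) (\<lambda>i u. coord (F (\<Phi> u)) i) C"
proof -
  interpret B: da_space "Bd d" by (rule da_space_Bd)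
  obtain g where g: "\<And>z. z \<in> Bd d \<Longrightarrow> g z \<noteq> 0"
    "\<And>z w. z \<in> Bd d \<Longrightarrow> w \<in> Bd d \<Longrightarrow> 1 - cinner (\<Phi> z) (\<Phi> w) = g z * cnj (g w) * (1 - cinner z w)"
    using ball_Aut_kernel[OF \<Phi>] by metis
  have bij: "bij_betw \<Phi> (Bd d) (Bd d)" using \<Phi> by (simp add: ball_Aut_def)
  have k: "da_kernel u v = cnj (cnj (g u)) * cnj (g v) * da_kernel (\<Phi> u) (\<Phi> v)" if "u \<in> Bd d" "v \<in> Bd d" for u v
    using g(1)[OF that(1)] g(1)[OF that(2)] g(2)[OF that] by (simp add: da_kernel_def)
  show ?thesis
    unfolding B.rowbnd_comps
  proof (intro conjI ballI)
    show "0 \<le> C" using F by (simp add: B.rowbnd_def)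
    fix c assume c: "c \<in> coefs (Bd d)"
    let ?c = "\<lambda>v. cnj (g v) * c v"
    let ?e = "\<lambda>w. if w \<in> Bd d then ?c (inv_into (Bd d) \<Phi> w) else 0"
    have c': "?c \<in> coefs (Bd d)" by (rule coefs_mult[OF c])
    have e: "?e \<in> coefs (Bd d)" by (rule quadratic_form_reindex(1)[OF bij c'])
    have "pairing (kcomb (Bd d) (\<lambda>u v. cinner (F (\<Phi> u)) (F (\<Phi> v)) * da_kernel u v) c) c
        = pairing (kcomb (Bd d) (\<lambda>u v. cnj (cnj (g u)) * cnj (g v) * (cinner (F (\<Phi> u)) (F (\<Phi> v)) * da_kernel (\<Phi> u) (\<Phi> v))) c) c"
      by (rule quadratic_form_cong[OF c]) (simp add: k ac_simps)
    also have "\<dots> = pairing (kcomb (Bd d) (\<lambda>u v. cinner (F (\<Phi> u)) (F (\<Phi> v)) * da_kernel (\<Phi> u) (\<Phi> v)) ?c) ?c"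
      by (rule quadratic_form_weight[OF c, symmetric])
    also have "\<dots> = pairing (kcomb (Bd d) (\<lambda>u v. cinner (F u) (F v) * da_kernel u v) ?e) ?e"
      by (rule quadratic_form_reindex(2)[OF bij c'])
    finally have 1: "Re (pairing (kcomb (Bd d) (\<lambda>u v. cinner (F (\<Phi> u)) (F (\<Phi> v)) * da_kernel u v) c) c) \<le> C\<^sup>2 * (B.nrm ?e)\<^sup>2"
      using F e unfolding B.rowbnd_comps by auto
    have "pairing (kcomb (Bd d) da_kernel c) c
        = pairing (kcomb (Bd d) (\<lambda>u v. cnj (cnj (g u)) * cnj (g v) * da_kernel (\<Phi> u) (\<Phi> v)) c) c"
      by (rule quadratic_form_cong[OF c k])
    also have "\<dots> = pairing (kcomb (Bd d) (\<lambda>u v. da_kernel (\<Phi> u) (\<Phi> v)) ?c) ?c"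
      by (rule quadratic_form_weight[OF c, symmetric])
    also have "\<dots> = pairing (kcomb (Bd d) da_kernel ?e) ?e"
      by (rule quadratic_form_reindex(2)[OF bij c'])
    finally have "(B.nrm c)\<^sup>2 = (B.nrm ?e)\<^sup>2" using B.nrm_sq[OF c] B.nrm_sq[OF e] by simp
    then show "Re (pairing (kcomb (Bd d) (\<lambda>u v. cinner (F (\<Phi> u)) (F (\<Phi> v)) * da_kernel u v) c) c) \<le> C\<^sup>2 * (B.nrm c)\<^sup>2"
      using 1 by simp
  qed
qed

lemma rowbnd_ball_Aut:
  assumes \<Phi>: "\<Phi> \<in> ball_Aut d"
  shows "da_space.rowbnd (Bd d) (\<lambda>i u. coord (\<Phi> u) i) 1"
proof -
  interpret B: da_space "Bd d" by (rule da_space_Bd)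
  obtain g where "\<And>z w. z \<in> Bd d \<Longrightarrow> w \<in> Bd d \<Longrightarrow> 1 - cinner (\<Phi> z) (\<Phi> w) = g z * cnj (g w) * (1 - cinner z w)"
    using ball_Aut_kernel[OF \<Phi>] by metis
  then show ?thesis by (rule B.rowbnd_rank_one)
qed

lemma row_op_eq:
  assumes "h \<in> da_sum d"
  shows "row_op d F h = (\<lambda>z. \<Sum>i. coord (F z) i * h i z)"
proof -
  interpret B: da_space "Bd d" by (rule da_space_Bd)
  have h: "h i \<in> funs B.H" for i using assms by (simp add: da_sum_def drury_arveson_eq)
  have *: "restr (Bd d) (\<lambda>z. coord (F z) i) z * h i z = coord (F z) i * h i z" for i z
    using B.funs_outside[OF h, of z i] by (auto simp: restr_def)
  show ?thesis unfolding row_op_def vcomp_def by (intro ext suminf_cong) (rule *)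
qed

lemma vmultI:
  assumes F: "\<And>z. z \<in> Bd d \<Longrightarrow> F z \<in> Cd d" and row: "da_space.rowbnd (Bd d) (\<lambda>i u. coord (F u) i) C"
  shows "vmult d F" "vmult_norm d F \<le> ennreal C"
proof -
  interpret B: da_space "Bd d" by (rule da_space_Bd)
  have C: "0 \<le> C" using row by (simp add: B.rowbnd_def)
  have op: "row_op d F h \<in> funs B.H" "fnorm B.H (row_op d F h) \<le> C * sqrt (\<Sum>i. (fnorm B.H (h i))\<^sup>2)"
    if "h \<in> da_sum d" for h
    unfolding row_op_eq[OF that]
    by (intro B.rowbnd_imp_bounded[OF row]; use that in \<open>simp add: da_sum_def drury_arveson_eq\<close>)+
  show n: "vmult_norm d F \<le> ennreal C"
    unfolding vmult_norm_def
  proof (rule opnorm_le)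
    fix h assume h: "h \<in> da_sum d"
    show "ennreal (fnorm (drury_arveson d) (row_op d F h)) \<le> ennreal C * da_sum_norm d h"
      using op(2)[OF h] C h
      by (simp add: da_sum_norm_def drury_arveson_eq ennreal_mult[symmetric] da_sum_def suminf_nonneg ennreal_leI)
  qed
  have "vcomp d F i \<in> Mult B.H" for i
  proof -
    have "(\<lambda>x. vcomp d F i x * f x) \<in> funs B.H" if f: "f \<in> funs B.H" for f
    proof -
      let ?h = "\<lambda>j. if j = i then f else (\<lambda>_. 0)"
      have h: "?h j \<in> funs B.H" for j using f B.zero_in by simp
      have "summable (\<lambda>j. (fnorm B.H (?h j))\<^sup>2)"
        by (rule summable_finite[of "{i}"]) (auto simp: B.fnorm_zero)
      from B.rowbnd_imp_bounded(1)[OF row h this]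
      have "(\<lambda>u. \<Sum>j. coord (F u) j * ?h j u) \<in> funs B.H" .
      moreover have "(\<Sum>j. coord (F u) j * ?h j u) = vcomp d F i u * f u" for u
      proof -
        have "(\<Sum>j. coord (F u) j * ?h j u) = (\<Sum>j\<in>{i}. coord (F u) j * ?h j u)"
          by (rule suminf_finite) auto
        then show ?thesis using B.funs_outside[OF f, of u] by (auto simp: vcomp_def restr_def)
      qed
      ultimately show ?thesis by simp
    qed
    then show ?thesis by (auto simp: Mult_def vcomp_def restr_def)
  qed
  then show "vmult d F"
    using F op n unfolding vmult_def drury_arveson_eq by (auto intro: le_less_trans)
qed

lemma vmultD:
  assumes F: "vmult d F" and n: "vmult_norm d F \<le> ennreal C" "0 \<le> C"
  shows "da_space.rowbnd (Bd d) (\<lambda>i u. coord (F u) i) C"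
proof -
  interpret B: da_space "Bd d" by (rule da_space_Bd)
  have FC: "F z \<in> Cd d" if "z \<in> Bd d" for z using F that by (simp add: vmult_def)
  have op_in: "row_op d F h \<in> funs B.H" if "h \<in> da_sum d" for h
    using F that by (simp add: vmult_def drury_arveson_eq)
  have op: "fnorm B.H (row_op d F h) \<le> C * sqrt (\<Sum>i. (fnorm B.H (h i))\<^sup>2)" if h: "h \<in> da_sum d" for h
  proof -
    have hin: "\<And>i. h i \<in> funs B.H" and hd: "\<And>i. d \<le> enat i \<Longrightarrow> h i = (\<lambda>_. 0)" and hs: "summable (\<lambda>i. (fnorm B.H (h i))\<^sup>2)"
      using h by (auto simp: da_sum_def drury_arveson_eq)
    define N where "N = sqrt (\<Sum>i. (fnorm B.H (h i))\<^sup>2)"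
    have N0: "0 \<le> N" by (simp add: N_def suminf_nonneg hs)
    have N2: "(\<Sum>i. (fnorm B.H (h i))\<^sup>2) = N\<^sup>2" by (simp add: N_def suminf_nonneg hs)
    show ?thesis
    proof (cases "N = 0")
      case True
      then have "(fnorm B.H (h i))\<^sup>2 = 0" for i
        using suminf_eq_zero_iff[OF hs] N2 by simp
      then have "h i = (\<lambda>_. 0)" for i using B.fnorm_eq_0[OF hin] by simp
      then have "row_op d F h = (\<lambda>_. 0)" by (simp add: row_op_def)
      then show ?thesis using N0 n(2) unfolding N_def[symmetric] by (simp add: B.fnorm_zero)
    next
      case False
      then have N: "0 < N" using N0 by simp
      define a where "a = complex_of_real (1 / N)"
      have ca: "cmod a = 1 / N" using N by (simp add: a_def norm_divide)
      let ?h = "\<lambda>i x. a * h i x"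
      have sq: "(fnorm B.H (?h i))\<^sup>2 = (1 / N)\<^sup>2 * (fnorm B.H (h i))\<^sup>2" for i
        using B.fnorm_scale[OF hin[of i], of a] unfolding ca by (simp add: power_mult_distrib power_divide)
      have "summable (\<lambda>i. (fnorm B.H (?h i))\<^sup>2)" unfolding sq by (intro summable_mult hs)
      then have ah: "?h \<in> da_sum d"
        using hin hd by (auto simp: da_sum_def drury_arveson_eq intro: B.scale_in)
      have "(\<Sum>i. (fnorm B.H (?h i))\<^sup>2) = 1"
        unfolding sq using suminf_mult[OF hs, of "(1 / N)\<^sup>2"] N by (simp add: N2 power_divide)
      then have "da_sum_norm d ?h \<le> 1" by (simp add: da_sum_norm_def drury_arveson_eq)
      then have "ennreal (fnorm B.H (row_op d F ?h)) \<le> vmult_norm d F"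
        unfolding vmult_norm_def drury_arveson_eq
        by (rule opnorm_lower[OF ah, where ?N1.0 = "da_sum_norm d" and T = "row_op d F"
              and ?N2.0 = "\<lambda>f. ennreal (fnorm B.H f)"])
      then have "fnorm B.H (row_op d F ?h) \<le> C" using n by (meson ennreal_le_iff order_trans)
      moreover have "row_op d F ?h = (\<lambda>z. a * row_op d F h z)"
        unfolding row_op_eq[OF ah] row_op_eq[OF h]
        using suminf_mult[OF B.row_summable[OF hin hs], of a] by (simp add: ac_simps)
      ultimately have "fnorm B.H (row_op d F h) / N \<le> C"
        using B.fnorm_scale[OF op_in[OF h], of a] by (simp add: ca)
      then show ?thesis using N unfolding N_def[symmetric] by (simp add: pos_divide_le_eq)
    qed
  qed
  show ?thesis
  proof (rule B.rowbndI[OF n(2)])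
    fix c assume c: "c \<in> coefs (Bd d)"
    show cs: "summable (\<lambda>i. (B.nrm (\<lambda>u. cnj (coord (F u) i) * c u))\<^sup>2)" using B.comps_sums[OF c] by (rule sums_summable)
    note m = coefs_mult[OF c]
    let ?h = "\<lambda>i. kcomb (Bd d) da_kernel (\<lambda>u. cnj (coord (F u) i) * c u)"
    \<comment> \<open>\<open>da_sum\<close> admits only tuples that vanish from index
      \<open>d\<close> on; the adjoint tuple does, since \<open>F\<close> takes values in
      \<open>Cd d\<close>.\<close>
    have "?h i = (\<lambda>_. 0)" if "d \<le> enat i" for i
    proof -
      have "cnj (coord (F u) i) * c u = 0" for u
        using FC[of u] that coefsD(2)[OF c] by (auto simp: Cd_def)
      then have e0: "(\<lambda>u. cnj (coord (F u) i) * c u) = (\<lambda>_. 0)" by blast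
      show ?thesis unfolding e0 by (simp add: kcomb_def fun_eq_iff)
    qed
    then have h: "?h \<in> da_sum d"
      using cs by (simp add: da_sum_def drury_arveson_eq B.kcomb_in[OF m] B.norm_kcomb[OF m])
    show "(\<lambda>u. \<Sum>i. coord (F u) i * ?h i u) \<in> funs B.H \<and>
      fnorm B.H (\<lambda>u. \<Sum>i. coord (F u) i * ?h i u) \<le> C * sqrt (\<Sum>i. (B.nrm (\<lambda>u. cnj (coord (F u) i) * c u))\<^sup>2)"
      using op_in[OF h] op[OF h] unfolding row_op_eq[OF h] B.norm_kcomb[OF m] by blast
  qed (simp add: summable_coord)
qed

text \<open>If both norms were below 1, \<open>F\<close> and then \<open>G\<close> would strictly
  decrease the distance of \<open>u\<close> and \<open>v\<close>, although \<open>G\<close> undoes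
  \<open>F\<close> there. Two distinct points are essential.\<close>

lemma delta_mult_ge_1:
  assumes X: "X \<subseteq> Bd d" and Y: "Y \<subseteq> Bd d" and uv: "u \<in> X" "v \<in> X" "u \<noteq> v"
  shows "1 \<le> delta_mult d X Y"
  unfolding delta_mult_def
proof (rule INF_greatest, clarify)
  interpret B: da_space "Bd d" by (rule da_space_Bd)
  fix F G assume F: "vmult d F" and G: "vmult d G" and bij: "bij_betw F X Y" and GF: "\<forall>x\<in>X. G (F x) = x"
  show "1 \<le> max (vmult_norm d F) (vmult_norm d G)"
  proof (rule ccontr)
    assume "\<not> ?thesis"
    then have lt: "max (vmult_norm d F) (vmult_norm d G) < 1" by (simp only: not_le)
    define c where "c = enn2real (max (vmult_norm d F) (vmult_norm d G))"
    have c: "ennreal c = max (vmult_norm d F) (vmult_norm d G)" "0 \<le> c"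
      using lt by (auto simp: c_def intro!: ennreal_enn2real order.strict_trans[OF lt])
    have c1: "c < 1" using lt c by (metis ennreal_less_iff ennreal_1)
    have rF: "B.rowbnd (B.comps F) c" by (rule vmultD[OF F _ c(2)]) (simp add: c(1))
    have rG: "B.rowbnd (B.comps G) c" by (rule vmultD[OF G _ c(2)]) (simp add: c(1))
    have FY: "F u \<in> Bd d" "F v \<in> Bd d" using bij uv Y by (auto simp: bij_betw_def)
    have ne: "F u \<noteq> F v" using bij uv by (auto simp: bij_betw_def inj_on_def)
    have uB: "u \<in> Bd d" "v \<in> Bd d" using uv X by auto
    have "rho_ph (F u) (F v) < rho_ph u v"
      by (rule B.rho_ph_contraction[OF rF c1 uB uv(3)]) (use FY in \<open>auto simp: Bd_def\<close>)
    moreover have "rho_ph (G (F u)) (G (F v)) < rho_ph (F u) (F v)"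
      by (rule B.rho_ph_contraction[OF rG c1 FY ne]) (use uB uv GF in \<open>auto simp: Bd_def\<close>)
    ultimately show False using GF uv by simp
  qed
qed

section \<open>The implications between the four statements\<close>

lemma sym_dist_attained:
  assumes "0 < n"
  obtains \<sigma> where "\<sigma> permutes {..<n}" "\<And>i. i < n \<Longrightarrow> \<rho> (x i) (y (\<sigma> i)) \<le> sym_dist \<rho> n x y"
proof -
  let ?D = "\<lambda>\<sigma>. Max ((\<lambda>i. \<rho> (x i) (y (\<sigma> i))) ` {..<n})"
  have "finite (?D ` {\<sigma>. \<sigma> permutes {..<n}})" "?D ` {\<sigma>. \<sigma> permutes {..<n}} \<noteq> {}"
    using permutes_id[of "{..<n}"] finite_permutations[of "{..<n}"] by blast+
  from Min_in[OF this] obtain \<sigma> where \<sigma>: "\<sigma> permutes {..<n}" "sym_dist \<rho> n x y = ?D \<sigma>"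
    by (auto simp: sym_dist_def)
  then show ?thesis by (intro that[OF \<sigma>(1)]) (auto intro: Max_ge)
qed

lemma sym_dist_le:
  assumes "0 < n" "\<sigma> permutes {..<n}" "\<And>i. i < n \<Longrightarrow> \<rho> (x i) (y (\<sigma> i)) \<le> r"
  shows "sym_dist \<rho> n x y \<le> r"
proof -
  have "sym_dist \<rho> n x y \<le> Max ((\<lambda>i. \<rho> (x i) (y (\<sigma> i))) ` {..<n})"
    unfolding sym_dist_def using assms(2) by (intro Min_le) (auto simp: finite_permutations)
  also have "\<dots> \<le> r" using assms by (subst Max_le_iff) auto
  finally show ?thesis .
qed

lemma sym_dist_rho_ph_nonneg: "0 < n \<Longrightarrow> 0 \<le> sym_dist rho_ph n x y"
  using sym_dist_attained[of n rho_ph x y] rho_ph_nonneg by (metis order_trans)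

lemma aut_sym_dist_nonneg: "0 < n \<Longrightarrow> 0 \<le> aut_sym_dist d n x y"
  unfolding aut_sym_dist_def by (rule cINF_greatest) (use id_ball_Aut sym_dist_rho_ph_nonneg in blast)+

lemma aut_sym_dist_le:
  assumes n: "0 < n" and "\<Phi> \<in> ball_Aut d" "\<sigma> permutes {..<n}" "\<And>i. i < n \<Longrightarrow> rho_ph (x i) (\<Phi> (y (\<sigma> i))) \<le> r"
  shows "aut_sym_dist d n x y \<le> r"
proof -
  have "aut_sym_dist d n x y \<le> sym_dist rho_ph n x (\<Phi> \<circ> y)"
    unfolding aut_sym_dist_def
    by (rule cINF_lower) (use assms sym_dist_rho_ph_nonneg[OF n] in \<open>auto intro!: bdd_belowI2\<close>)
  also have "\<dots> \<le> r" by (rule sym_dist_le) (use assms in auto)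
  finally show ?thesis .
qed

lemma aut_sym_dist_approx:
  assumes n: "0 < n" and e: "0 < e"
  obtains \<Phi> \<sigma> where "\<Phi> \<in> ball_Aut d" "\<sigma> permutes {..<n}"
    "\<And>i. i < n \<Longrightarrow> rho_ph (x i) (\<Phi> (y (\<sigma> i))) \<le> aut_sym_dist d n x y + e"
proof -
  have "\<exists>\<Phi>\<in>ball_Aut d. sym_dist rho_ph n x (\<Phi> \<circ> y) < aut_sym_dist d n x y + e"
    unfolding aut_sym_dist_def
    by (rule cINF_less_iff[THEN iffD1])
      (use id_ball_Aut sym_dist_rho_ph_nonneg[OF n] e in \<open>auto intro!: bdd_belowI2\<close>)
  then obtain \<Phi> where \<Phi>: "\<Phi> \<in> ball_Aut d" "sym_dist rho_ph n x (\<Phi> \<circ> y) < aut_sym_dist d n x y + e" by blast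
  obtain \<sigma> where "\<sigma> permutes {..<n}" "\<And>i. i < n \<Longrightarrow> rho_ph (x i) ((\<Phi> \<circ> y) (\<sigma> i)) \<le> sym_dist rho_ph n x (\<Phi> \<circ> y)"
    using sym_dist_attained[OF n] by blast
  then show ?thesis using \<Phi> by (intro that[of \<Phi> \<sigma>]) force+
qed

lemma da_space_subset: "X \<subseteq> Bd d \<Longrightarrow> da_space X"
  by unfold_locales (auto simp: Bd_def)

section \<open>From automorphisms to RKHS isomorphisms\<close>

text \<open>\<open>coef_bound\<close> controls every coefficient by the norm, so an entrywise error
  \<open>E\<close> of the kernel changes the quadratic form by at most the fraction
  \<open>L^2 * E\<close> of it. The square roots are the resulting bounds for the map and its
  inverse.\<close>

lemma delta_RK_perturb:
  fixes F :: "ell2 \<Rightarrow> ell2"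
  assumes X: "da_space X" "finite X" and Y: "da_space Y" "finite Y"
    and F: "bij_betw F X Y" and lam: "\<And>u. u \<in> X \<Longrightarrow> lam u \<noteq> 0"
    and E: "(\<Sum>u\<in>X. \<Sum>v\<in>X. cmod (cnj (lam u) * lam v * da_kernel (F u) (F v) - da_kernel u v)) \<le> E"
    and small: "(\<Sum>u\<in>X. lagrange_bound X u)\<^sup>2 * E < 1"
  shows "delta_RK (da_restrict X) (da_restrict Y)
    \<le> ennreal (sqrt (1 + (\<Sum>u\<in>X. lagrange_bound X u)\<^sup>2 * E) / sqrt (1 - (\<Sum>u\<in>X. lagrange_bound X u)\<^sup>2 * E))"
proof -
  interpret A: da_space X by fact
  define L where "L = (\<Sum>u\<in>X. lagrange_bound X u)"
  let ?M = "\<lambda>u v. cnj (lam u) * lam v * da_kernel (F u) (F v)"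
  have E0: "0 \<le> E" by (rule order_trans[OF _ E]) (intro sum_nonneg norm_ge_zero)
  have L0: "0 \<le> L" unfolding L_def by (intro sum_nonneg lagrange_bound_nonneg)
  have est: "\<bar>Re (pairing (kcomb X ?M c) c) - (A.nrm c)\<^sup>2\<bar> \<le> L\<^sup>2 * E * (A.nrm c)\<^sup>2" if c: "c \<in> coefs X" for c
  proof -
    have cX: "c v = 0" if "v \<notin> X" for v using coefsD(2)[OF c] that by auto
    have cb: "cmod (c u) \<le> L * A.nrm c" if u: "u \<in> X" for u
    proof -
      have "cmod (c u) \<le> lagrange_bound X u * A.nrm c" by (rule A.coef_bound[OF X(2) order_refl cX u])
      also have "\<dots> \<le> L * A.nrm c"
        unfolding L_def using u X(2) A.nrm_nonneg[OF c] lagrange_bound_nonneg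
        by (intro mult_right_mono member_le_sum) auto
      finally show ?thesis .
    qed
    let ?d = "\<lambda>u v. ?M u v - da_kernel u v"
    have "pairing (kcomb X ?M c) c - of_real ((A.nrm c)\<^sup>2) = pairing (kcomb X ?d c) c"
      unfolding quadratic_form_diff by (simp add: A.pairing_self[OF c])
    also have "\<dots> = (\<Sum>u\<in>X. \<Sum>v\<in>X. c v * ?d u v * cnj (c u))"
      by (rule quadratic_form_eq[OF c X(2)]) (use cX in auto)
    also have "cmod \<dots> \<le> (\<Sum>u\<in>X. \<Sum>v\<in>X. cmod (?d u v) * (L * A.nrm c)\<^sup>2)"
    proof (intro sum_norm_le)
      fix u v assume uv: "u \<in> X" "v \<in> X"
      have "cmod (c v) * cmod (c u) \<le> (L * A.nrm c) * (L * A.nrm c)"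
        using cb uv A.nrm_nonneg[OF c] L0 by (intro mult_mono) auto
      from mult_left_mono[OF this norm_ge_zero[of "?d u v"]]
      show "cmod (c v * ?d u v * cnj (c u)) \<le> cmod (?d u v) * (L * A.nrm c)\<^sup>2"
        by (simp only: norm_mult complex_mod_cnj power2_eq_square ac_simps)
    qed
    also have "\<dots> = (\<Sum>u\<in>X. \<Sum>v\<in>X. cmod (?d u v)) * (L * A.nrm c)\<^sup>2" by (simp add: sum_distrib_right)
    also have "\<dots> \<le> E * (L * A.nrm c)\<^sup>2" by (intro mult_right_mono E) simp
    finally have "cmod (pairing (kcomb X ?M c) c - of_real ((A.nrm c)\<^sup>2)) \<le> L\<^sup>2 * E * (A.nrm c)\<^sup>2"
      by (simp add: power_mult_distrib ac_simps)
    moreover have "\<bar>Re (pairing (kcomb X ?M c) c - of_real ((A.nrm c)\<^sup>2))\<bar> \<le> cmod (pairing (kcomb X ?M c) c - of_real ((A.nrm c)\<^sup>2))"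
      by (rule abs_Re_le_cmod)
    ultimately show ?thesis by simp
  qed
  have s: "L\<^sup>2 * E < 1" using small by (simp add: L_def)
  have p: "0 \<le> L\<^sup>2 * E" using E0 by simp
  show ?thesis
    unfolding L_def[symmetric]
  proof (rule delta_RK_le[OF X Y F lam])
    fix c assume c: "c \<in> coefs X"
    have "(sqrt (1 - L\<^sup>2 * E))\<^sup>2 = 1 - L\<^sup>2 * E" "(sqrt (1 + L\<^sup>2 * E))\<^sup>2 = 1 + L\<^sup>2 * E" using s p by simp_all
    then show "(sqrt (1 - L\<^sup>2 * E))\<^sup>2 * (A.nrm c)\<^sup>2 \<le> Re (pairing (kcomb X ?M c) c)"
      "Re (pairing (kcomb X ?M c) c) \<le> (sqrt (1 + L\<^sup>2 * E))\<^sup>2 * (A.nrm c)\<^sup>2"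
      using est[OF c] by (simp_all only: abs_le_iff left_diff_distrib distrib_right) linarith+
  qed (use s p in auto)
qed

lemma aut_sym_dist_matching:
  assumes n: "0 < n" and x: "x ` {..<n} \<subseteq> Bd d" and y: "\<And>k. y k ` {..<n} \<subseteq> Bd d"
    and lim: "(\<lambda>k. aut_sym_dist d n x (y k)) \<longlonglongrightarrow> 0"
  obtains \<Phi> \<sigma> where "\<And>k. \<Phi> k \<in> ball_Aut d" "\<And>k. \<sigma> k permutes {..<n}"
    "\<And>i. i < n \<Longrightarrow> (\<lambda>k. rho_ph (x i) (\<Phi> k (y k (\<sigma> k i)))) \<longlonglongrightarrow> 0"
    "\<And>i. i < n \<Longrightarrow> (\<lambda>k. \<Phi> k (y k (\<sigma> k i))) \<longlonglongrightarrow> x i"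
proof -
  \<comment> \<open>The infimum over automorphisms need not be attained; the slack
    \<open>inverse (Suc k)\<close> vanishes in the limit.\<close>
  have "\<exists>\<Phi> \<sigma>. \<Phi> \<in> ball_Aut d \<and> \<sigma> permutes {..<n} \<and>
    (\<forall>i<n. rho_ph (x i) (\<Phi> (y k (\<sigma> i))) \<le> aut_sym_dist d n x (y k) + inverse (Suc k))" for k
    using aut_sym_dist_approx[OF n, of "inverse (Suc k)" d x "y k"] by (metis inverse_positive_iff_positive of_nat_0_less_iff zero_less_Suc)
  then obtain \<Phi> \<sigma> where P: "\<And>k. \<Phi> k \<in> ball_Aut d" "\<And>k. \<sigma> k permutes {..<n}"
    and r: "\<And>k i. i < n \<Longrightarrow> rho_ph (x i) (\<Phi> k (y k (\<sigma> k i))) \<le> aut_sym_dist d n x (y k) + inverse (Suc k)"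
    by metis
  have rho: "(\<lambda>k. rho_ph (x i) (\<Phi> k (y k (\<sigma> k i)))) \<longlonglongrightarrow> 0" if i: "i < n" for i
  proof (rule Lim_null_comparison[OF always_eventually], rule allI)
    show "norm (rho_ph (x i) (\<Phi> k (y k (\<sigma> k i)))) \<le> aut_sym_dist d n x (y k) + inverse (Suc k)" for k
      using r[OF i, of k] rho_ph_nonneg by simp
    show "(\<lambda>k. aut_sym_dist d n x (y k) + inverse (Suc k)) \<longlonglongrightarrow> 0"
      using tendsto_add[OF lim LIMSEQ_inverse_real_of_nat] by simp
  qed
  have z: "(\<lambda>k. \<Phi> k (y k (\<sigma> k i))) \<longlonglongrightarrow> x i" if i: "i < n" for i
  proof -
    have xi: "norm (x i) < 1" using x i by (auto simp: Bd_def)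
    have zB: "\<Phi> k (y k (\<sigma> k i)) \<in> Bd d" for k
      using ball_Aut_D(1)[OF P(1)[of k]] y[of k] permutes_in_image[OF P(2)[of k], of i] i by blast
    let ?r = "\<lambda>k. rho_ph (x i) (\<Phi> k (y k (\<sigma> k i)))"
    \<comment> \<open>Below 1/2 the factor \<open>1 - ?r k\<close> in
      \<open>norm_diff_le_rho_ph\<close> costs at most 2, whence the constant 8.\<close>
    have "\<forall>\<^sub>F k in sequentially. ?r k < 1/2" by (rule order_tendstoD(2)[OF rho[OF i]]) simp
    then have "\<forall>\<^sub>F k in sequentially. norm (\<Phi> k (y k (\<sigma> k i)) - x i) \<le> 8 * ?r k"
    proof eventually_elim
      case (elim k)
      have "norm (x i - \<Phi> k (y k (\<sigma> k i))) * (1 - ?r k) \<le> 4 * ?r k"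
        by (rule norm_diff_le_rho_ph[OF xi]) (use zB[of k] in \<open>simp add: Bd_def\<close>)
      moreover have "norm (x i - \<Phi> k (y k (\<sigma> k i))) * (1/2) \<le> norm (x i - \<Phi> k (y k (\<sigma> k i))) * (1 - ?r k)"
        by (rule mult_left_mono) (use elim in auto)
      ultimately show ?case by (simp add: norm_minus_commute)
    qed
    moreover have "(\<lambda>k. 8 * ?r k) \<longlonglongrightarrow> 0" using tendsto_mult[OF tendsto_const rho[OF i], of 8] by simp
    ultimately have "(\<lambda>k. \<Phi> k (y k (\<sigma> k i)) - x i) \<longlonglongrightarrow> 0" by (rule Lim_null_comparison)
    then show ?thesis by (rule LIM_zero_cancel)
  qed
  show ?thesis using that P rho z by blast
qed

lemma delta_RK_of_aut:
  assumes n: "0 < n" and x: "inj_on x {..<n}" "x ` {..<n} \<subseteq> Bd d"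
    and y: "\<And>k. inj_on (y k) {..<n}" "\<And>k. y k ` {..<n} \<subseteq> Bd d"
    and lim: "(\<lambda>k. aut_sym_dist d n x (y k)) \<longlonglongrightarrow> 0" and c: "1 < c"
  shows "\<forall>\<^sub>F k in sequentially. delta_RK (da_restrict (x ` {..<n})) (da_restrict (y k ` {..<n})) < ennreal c"
proof -
  let ?X = "x ` {..<n}" and ?Y = "\<lambda>k. y k ` {..<n}"
  obtain \<Phi> \<sigma> where \<Phi>: "\<And>k. \<Phi> k \<in> ball_Aut d" and \<sigma>: "\<And>k. \<sigma> k permutes {..<n}"
    and zx: "\<And>i. i < n \<Longrightarrow> (\<lambda>k. \<Phi> k (y k (\<sigma> k i))) \<longlonglongrightarrow> x i"
    using aut_sym_dist_matching[OF n x(2) y(2) lim] by metis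
  define z where "z = (\<lambda>k i. \<Phi> k (y k (\<sigma> k i)))"
  have \<sigma>n: "\<sigma> k i < n" if "i < n" for k i using permutes_in_image[OF \<sigma>[of k], of i] that by simp
  have xB: "norm (x i) < 1" if "i < n" for i using x that by (auto simp: Bd_def)
  define E where "E = (\<lambda>k. \<Sum>i<n. \<Sum>j<n. cmod (da_kernel (z k i) (z k j) - da_kernel (x i) (x j)))"
  define L where "L = (\<Sum>u\<in>?X. lagrange_bound ?X u)"
  have "(\<lambda>k. E k) \<longlonglongrightarrow> (\<Sum>i<n. \<Sum>j<n. cmod (da_kernel (x i) (x j) - da_kernel (x i) (x j)))"
    unfolding E_def da_kernel_def z_def
    by (intro tendsto_intros bounded_bilinear.tendsto[OF bounded_bilinear_cinner] zx one_minus_cinner_neq_0 xB) auto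
  then have E: "E \<longlonglongrightarrow> 0" by simp
  have "(\<lambda>k. sqrt (1 + L\<^sup>2 * E k) / sqrt (1 - L\<^sup>2 * E k)) \<longlonglongrightarrow> sqrt (1 + L\<^sup>2 * 0) / sqrt (1 - L\<^sup>2 * 0)"
    by (intro tendsto_intros E) simp
  then have "\<forall>\<^sub>F k in sequentially. sqrt (1 + L\<^sup>2 * E k) / sqrt (1 - L\<^sup>2 * E k) < c"
    using c by (intro order_tendstoD(2)) auto
  moreover have "\<forall>\<^sub>F k in sequentially. L\<^sup>2 * E k < 1"
    using order_tendstoD(2)[OF tendsto_mult[OF tendsto_const E, of "L\<^sup>2"], of 1] by simp
  ultimately show ?thesis
  proof eventually_elim
    case (elim k)
    obtain g where g: "\<And>z. z \<in> Bd d \<Longrightarrow> g z \<noteq> 0"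
      "\<And>z w. z \<in> Bd d \<Longrightarrow> w \<in> Bd d \<Longrightarrow> 1 - cinner (\<Phi> k z) (\<Phi> k w) = g z * cnj (g w) * (1 - cinner z w)"
      using ball_Aut_kernel[OF \<Phi>[of k]] by metis
    define ix where "ix = inv_into {..<n} x"
    have ix: "ix (x i) = i" if "i < n" for i using x(1) that by (simp add: ix_def)
    define F where "F = (\<lambda>u. y k (\<sigma> k (ix u)))"
    \<comment> \<open>Dividing by these weights turns the kernel at the points of \<open>y k\<close>
      into the kernel at their images \<open>z k\<close>, which converge even if the points do
      not.\<close>
    define lam where "lam = (\<lambda>u. cnj (g (F u)))"
    have Fx: "F (x i) = y k (\<sigma> k i)" if "i < n" for i using ix[OF that] by (simp add: F_def)
    have yB: "y k (\<sigma> k i) \<in> Bd d" if "i < n" for i using y(2)[of k] \<sigma>n[OF that, of k] by blast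
    have F: "bij_betw F ?X (?Y k)"
      unfolding bij_betw_def
    proof
      show "inj_on F ?X"
      proof (rule inj_onI)
        fix u v assume "u \<in> ?X" "v \<in> ?X" and eq: "F u = F v"
        then obtain i j where ij: "i < n" "u = x i" "j < n" "v = x j" by auto
        then have "\<sigma> k i = \<sigma> k j" using eq Fx \<sigma>n y(1)[of k] by (auto simp: inj_on_def)
        then show "u = v" using permutes_inj[OF \<sigma>[of k]] ij by (auto simp: inj_def)
      qed
      show "F ` ?X = ?Y k"
      proof -
        have "F ` ?X = (\<lambda>i. y k (\<sigma> k i)) ` {..<n}" using Fx by (auto simp: image_image)
        also have "\<dots> = y k ` (\<sigma> k ` {..<n})" by (simp add: image_image)
        finally show ?thesis using permutes_image[OF \<sigma>[of k]] by simp
      qed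
    qed
    have M: "cnj (1 / lam (x i)) * (1 / lam (x j)) * da_kernel (F (x i)) (F (x j)) = da_kernel (z k i) (z k j)"
      if "i < n" "j < n" for i j
      using g(2)[OF yB[OF that(1)] yB[OF that(2)]] by (simp add: lam_def Fx that da_kernel_def z_def)
    have "delta_RK (da_restrict ?X) (da_restrict (?Y k)) \<le> ennreal (sqrt (1 + L\<^sup>2 * E k) / sqrt (1 - L\<^sup>2 * E k))"
      unfolding L_def
    proof (rule delta_RK_perturb[OF da_space_subset[OF x(2)] _ da_space_subset[OF y(2)] _ F])
      show "1 / lam u \<noteq> 0" if "u \<in> ?X" for u
        using that g(1) yB by (auto simp: lam_def Fx)
      have "(\<Sum>u\<in>?X. \<Sum>v\<in>?X. cmod (cnj (1 / lam u) * (1 / lam v) * da_kernel (F u) (F v) - da_kernel u v)) = E k"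
        unfolding E_def sum.reindex[OF x(1)] o_def by (intro sum.cong refl) (simp only: M lessThan_iff)
      then show "(\<Sum>u\<in>?X. \<Sum>v\<in>?X. cmod (cnj (1 / lam u) * (1 / lam v) * da_kernel (F u) (F v) - da_kernel u v)) \<le> E k"
        by simp
      show "(\<Sum>u\<in>?X. lagrange_bound ?X u)\<^sup>2 * E k < 1" using elim(2) by (simp add: L_def)
    qed auto
    also have "\<dots> < ennreal c" using elim(1) c by (intro ennreal_lessI) auto
    finally show ?case .
  qed
qed

section \<open>Comparison of distances and reformulation of the limits\<close>

lemma delta_M_of_delta_RK:
  assumes X: "da_space X" "finite X" "X \<noteq> {}" and Y: "da_space Y" "finite Y"
    and lt: "delta_RK (da_restrict X) (da_restrict Y) < ennreal c" and c: "0 \<le> c"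
  shows "delta_M (da_restrict X) (da_restrict Y) \<le> ennreal (c\<^sup>2)"
proof -
  let ?H = "da_restrict X" and ?K = "da_restrict Y"
  let ?a = "\<lambda>T. rk_norm ?H ?K T" and ?b = "\<lambda>T. rk_norm ?K ?H (inv_into (funs ?H) T)"
  obtain T where T: "rkhs_iso ?H ?K T" "?a T * ?b T < ennreal c"
    using lt unfolding delta_RK_def INF_less_iff by auto
  \<comment> \<open>Excludes a zero factor, so that finiteness of the product gives finiteness of
    each norm.\<close>
  have ge: "1 \<le> ?a T * ?b T" by (rule rkhs_iso_distortion_ge_1[OF X(1,3) Y(1) T(1)])
  then have "?a T \<noteq> 0" "?b T \<noteq> 0" by auto
  moreover have "?a T * ?b T < top" using T(2) by (rule less_trans) simp
  ultimately have fin: "?a T < top" "?b T < top" by (auto simp: ennreal_mult_less_top)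
  define a b where "a = enn2real (?a T)" and "b = enn2real (?b T)"
  have ab: "?a T = ennreal a" "0 \<le> a" "?b T = ennreal b" "0 \<le> b" using fin by (simp_all add: a_def b_def)
  have "a * b < c" using T(2) ab c by (simp add: ennreal_mult[symmetric] ennreal_less_iff)
  then have "(a * b)\<^sup>2 \<le> c\<^sup>2" using ab by (intro power_mono) auto
  have "delta_M ?H ?K \<le> ennreal ((a * b)\<^sup>2)"
    by (rule delta_M_le[OF X(1,2) Y T(1)]) (use ab in simp_all)
  also have "\<dots> \<le> ennreal (c\<^sup>2)" by (rule ennreal_leI) fact
  finally show ?thesis .
qed

text \<open>With the lower bound 1 in place only upper bounds remain.
  \<open>ext_log_tendsto_0_iff\<close> gives the same right-hand side for the logarithms, so the
  conditions on isomorphisms are compared without logarithms.\<close>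

lemma ennreal_tendsto_1_iff:
  assumes ge: "\<And>k. 1 \<le> a k"
  shows "(a \<longlonglongrightarrow> (1::ennreal)) \<longleftrightarrow> (\<forall>c>1. \<forall>\<^sub>F k in sequentially. a k < ennreal c)"
proof
  assume "a \<longlonglongrightarrow> 1"
  then show "\<forall>c>1. \<forall>\<^sub>F k in sequentially. a k < ennreal c"
    by (auto intro!: order_tendstoD(2) simp: ennreal_1[symmetric] ennreal_less_iff simp del: ennreal_1)
next
  assume *: "\<forall>c>1. \<forall>\<^sub>F k in sequentially. a k < ennreal c"
  show "a \<longlonglongrightarrow> 1"
  proof (rule order_tendstoI)
    fix u :: ennreal assume "u < 1"
    then show "\<forall>\<^sub>F k in sequentially. u < a k" using ge by (intro always_eventually allI) (rule less_le_trans)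
  next
    fix u :: ennreal assume "1 < u"
    then obtain c where "1 < c" "ennreal c \<le> u"
    proof (cases u)
      case (real r)
      then have "1 < r" using \<open>1 < u\<close> by (simp add: ennreal_1[symmetric] ennreal_less_iff del: ennreal_1)
      then show ?thesis using that[of r] real by simp
    next
      case top
      then show ?thesis using that[of 2] by simp
    qed
    then show "\<forall>\<^sub>F k in sequentially. a k < u"
      using * by (auto elim!: eventually_mono intro: less_le_trans)
  qed
qed

lemma ext_log_tendsto_0_iff:
  assumes ge: "\<And>k. 1 \<le> a k"
  shows "((\<lambda>k. ext_log (a k)) \<longlonglongrightarrow> 0) \<longleftrightarrow> (\<forall>c>1. \<forall>\<^sub>F k in sequentially. a k < ennreal c)"
proof -
  have less: "ext_log (a k) < ereal (ln c) \<longleftrightarrow> a k < ennreal c" if c: "1 < c" for k c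
  proof (cases "a k")
    case (real r)
    then have "1 \<le> r" using ge[of k] by (simp add: ennreal_1[symmetric] del: ennreal_1)
    then show ?thesis using real c by (simp add: ext_log_def ennreal_less_iff)
  qed (simp add: ext_log_def)
  have nonneg: "0 \<le> ext_log (a k)" for k
  proof (cases "a k")
    case (real r)
    then have "1 \<le> r" using ge[of k] by (simp add: ennreal_1[symmetric] del: ennreal_1)
    then show ?thesis using real by (simp add: ext_log_def)
  qed (simp add: ext_log_def)
  show ?thesis
  proof
    assume *: "(\<lambda>k. ext_log (a k)) \<longlonglongrightarrow> 0"
    show "\<forall>c>1. \<forall>\<^sub>F k in sequentially. a k < ennreal c"
    proof (intro allI impI)
      fix c :: real assume c: "1 < c"
      have "\<forall>\<^sub>F k in sequentially. ext_log (a k) < ereal (ln c)"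
        by (rule order_tendstoD(2)[OF *]) (use c in simp)
      then show "\<forall>\<^sub>F k in sequentially. a k < ennreal c" using less[OF c] by simp
    qed
  next
    assume *: "\<forall>c>1. \<forall>\<^sub>F k in sequentially. a k < ennreal c"
    show "(\<lambda>k. ext_log (a k)) \<longlonglongrightarrow> 0"
    proof (rule order_tendstoI)
      fix u :: ereal assume "u < 0"
      then show "\<forall>\<^sub>F k in sequentially. u < ext_log (a k)"
        using nonneg by (intro always_eventually allI) (rule less_le_trans)
    next
      fix u :: ereal assume "0 < u"
      then obtain e where e: "0 < e" "ereal e \<le> u" by (cases u) (auto intro: that[of 1])
      have "\<forall>\<^sub>F k in sequentially. a k < ennreal (exp e)" using * e by simp
      then have "\<forall>\<^sub>F k in sequentially. ext_log (a k) < ereal e" using less[of "exp e"] e by simp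
      then show "\<forall>\<^sub>F k in sequentially. ext_log (a k) < u" using e by (auto elim!: eventually_mono intro: less_le_trans)
    qed
  qed
qed

section \<open>From multiplier algebras to automorphisms\<close>

text \<open>Let \<open>a i\<close>, \<open>b i\<close> be the points after the base points have been
  moved to 0. The diagonal of the Pick kernel for the inverse gives
  \<open>(norm (b i))^2 \<le> c^2 * (norm (a i))^2\<close>; inserted in the diagonal of the other
  Pick kernel it produces the two factors under the root. Its minors then bound
  \<open>c^2 * cinner (b i) (b j) - cinner (a i) (a j)\<close> divided by
  \<open>1 - cinner (b i) (b j)\<close>, a denominator of modulus at most 2, and
  \<open>c^2 - 1\<close> pays for the factor \<open>c^2\<close>. The conditions in the statement
  keep the denominators positive and hold once \<open>c\<close> is close to 1.\<close>

lemma delta_M_matching: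
  fixes x y :: "nat \<Rightarrow> ell2"
  assumes n: "0 < n" and x: "inj_on x {..<n}" "x ` {..<n} \<subseteq> Bd d" and y: "inj_on y {..<n}" "y ` {..<n} \<subseteq> Bd d"
    and lt: "delta_M (da_restrict (x ` {..<n})) (da_restrict (y ` {..<n})) < ennreal c"
  shows "\<exists>\<tau>. \<tau> permutes {..<n} \<and> (\<forall>i<n. \<forall>j<n.
    c\<^sup>2 * (norm (ball_inv (x 0) (x i)))\<^sup>2 < 1 \<longrightarrow> c\<^sup>2 * (norm (ball_inv (x 0) (x j)))\<^sup>2 < 1 \<longrightarrow>
    cmod (cinner (ball_inv (y (\<tau> 0)) (y (\<tau> i))) (ball_inv (y (\<tau> 0)) (y (\<tau> j)))
        - cinner (ball_inv (x 0) (x i)) (ball_inv (x 0) (x j)))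
      \<le> 2 * sqrt (((c ^ 4 - 1) * (norm (ball_inv (x 0) (x i)))\<^sup>2 / (1 - c\<^sup>2 * (norm (ball_inv (x 0) (x i)))\<^sup>2))
          * ((c ^ 4 - 1) * (norm (ball_inv (x 0) (x j)))\<^sup>2 / (1 - c\<^sup>2 * (norm (ball_inv (x 0) (x j)))\<^sup>2)))
        + (c\<^sup>2 - 1))"
proof -
  let ?X = "x ` {..<n}" and ?Y = "y ` {..<n}"
  interpret A: da_space ?X by (rule da_space_subset[OF x(2)])
  interpret B: da_space ?Y by (rule da_space_subset[OF y(2)])
  note X = A.da_space_axioms finite_imageI[OF finite_lessThan, of x n]
  note Y = B.da_space_axioms finite_imageI[OF finite_lessThan, of y n]
  have ne: "?X \<noteq> {}" "?Y \<noteq> {}" using n by auto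
  obtain \<phi> where \<phi>: "mult_alg_iso A.H B.H \<phi>" "cb_distortion A.H B.H \<phi> < ennreal c"
    using lt unfolding delta_M_def INF_less_iff by auto
  then have alg: "alg_iso A.H B.H \<phi>" by (simp add: mult_alg_iso_def)
  note ge = alg_iso_cb_norms_ge_1[OF X ne(1) Y ne(2) alg]
  \<comment> \<open>Each norm is at least 1, so the bound on the product bounds both norms
    separately.\<close>
  have le: "cb_norm A.H B.H \<phi> \<le> ennreal c" "cb_norm B.H A.H (inv_into (Mult A.H) \<phi>) \<le> ennreal c"
    using mult_left_mono[OF ge(2), of "cb_norm A.H B.H \<phi>"] mult_right_mono[OF ge(1), of "cb_norm B.H A.H (inv_into (Mult A.H) \<phi>)"]
      \<phi>(2) unfolding cb_distortion_def by (auto intro: order_trans less_imp_le)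
  have c1: "1 \<le> c"
  proof -
    have "ennreal 1 \<le> ennreal c" using order_trans[OF ge(1) le(1)] by simp
    then show ?thesis by (simp only: ennreal_le_iff2) auto
  qed
  obtain G where G: "bij_betw G ?Y ?X" "\<And>f. f \<in> Mult A.H \<Longrightarrow> \<phi> f = restr ?Y (f \<circ> G)"
    using alg_iso_composition[OF X Y alg] by blast
  define F where "F = inv_into ?Y G"
  have FG: "\<And>v. v \<in> ?Y \<Longrightarrow> G v \<in> ?X" "\<And>v. v \<in> ?Y \<Longrightarrow> F (G v) = v" "\<And>u. u \<in> ?X \<Longrightarrow> G (F u) = u" "\<And>u. u \<in> ?X \<Longrightarrow> F u \<in> ?Y"
    using G(1) by (auto simp: F_def bij_betw_def f_inv_into_f inv_into_into)
  have F: "bij_betw F ?X ?Y" unfolding F_def by (rule bij_betw_inv_into[OF G(1)])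
  have x0: "x 0 \<in> ?X" "norm (x 0) < 1" using n A.in_ball by auto
  define y0 where "y0 = F (x 0)"
  have y0: "y0 \<in> ?Y" "norm y0 < 1" "G y0 = x 0" using FG x0 B.in_ball by (auto simp: y0_def)
  let ?x = "ball_inv (x 0)" and ?y = "ball_inv y0"
  have row1: "B.rowbnd (\<lambda>i u. coord (?x (G u)) i) c"
    by (rule Pick_rowbnd[OF X Y G le(1)]) (use c1 x0 in auto)
  have row2: "A.rowbnd (\<lambda>i u. coord (?y (F u)) i) c"
    by (rule Pick_rowbnd[OF Y X F _ le(2)]) (use composition_inverse[OF X Y G] c1 y0 in \<open>auto simp: F_def\<close>)
  interpret P: psd_kernel ?Y "\<lambda>u v. (of_real (c\<^sup>2) * cinner (?y u) (?y v) - cinner (?x (G u)) (?x (G v))) / (1 - cinner (?y u) (?y v))"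
    by (rule Pick_psd[OF Y(1) y0(1) _ row1]) (simp add: y0 ball_inv_self x0)
  interpret Q: psd_kernel ?X "\<lambda>u v. (of_real (c\<^sup>2) * cinner (?x u) (?x v) - cinner (?y (F u)) (?y (F v))) / (1 - cinner (?x u) (?x v))"
    by (rule Pick_psd[OF X(1) x0(1) _ row2]) (simp add: y0_def[symmetric] ball_inv_self y0)
  define a where "a = (\<lambda>i. ?x (x i))"
  define b where "b = (\<lambda>i. ?y (F (x i)))"
  have xi: "x i \<in> ?X" if "i < n" for i using that by simp
  have Bd_inf: "z \<in> Bd \<infinity> \<longleftrightarrow> norm z < 1" for z by (simp add: Bd_def Cd_def)
  have a1: "norm (a i) < 1" if "i < n" for i
    using ball_inv_in_Bd[of "x 0" \<infinity> "x i"] x0 A.in_ball[OF xi[OF that]] by (simp add: a_def Bd_inf)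
  have b1: "norm (b i) < 1" if "i < n" for i
    using ball_inv_in_Bd[of y0 \<infinity> "F (x i)"] y0 B.in_ball[OF FG(4)[OF xi[OF that]]] by (simp add: b_def Bd_inf)
  have re: "Re ((of_real r * cinner z z - cinner w w) / (1 - cinner z z)) = (r * (norm z)\<^sup>2 - (norm w)\<^sup>2) / (1 - (norm z)\<^sup>2)" for r z w
  proof -
    have "(of_real r * cinner z z - cinner w w) / (1 - cinner z z) = of_real ((r * (norm z)\<^sup>2 - (norm w)\<^sup>2) / (1 - (norm z)\<^sup>2))"
      by (simp add: cinner_norm)
    then show ?thesis by (simp only: Re_complex_of_real)
  qed
  have ba: "(norm (b i))\<^sup>2 \<le> c\<^sup>2 * (norm (a i))\<^sup>2" if i: "i < n" for i
  proof -
    have "0 \<le> (c\<^sup>2 * (norm (a i))\<^sup>2 - (norm (b i))\<^sup>2) / (1 - (norm (a i))\<^sup>2)"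
      using Q.two_point(2)[OF xi[OF i] xi[OF i]] unfolding re by (simp add: a_def b_def)
    moreover have "0 < 1 - (norm (a i))\<^sup>2" using a1[OF i] by (simp add: power_less_one_iff)
    ultimately show ?thesis by (simp add: zero_le_divide_iff)
  qed
  define e where "e = (\<lambda>i. (c ^ 4 - 1) * (norm (a i))\<^sup>2 / (1 - c\<^sup>2 * (norm (a i))\<^sup>2))"
  have c2: "1 \<le> c\<^sup>2" "1 \<le> c ^ 4" using c1 by simp_all
  have key: "cmod (cinner (b i) (b j) - cinner (a i) (a j)) \<le> 2 * sqrt (e i * e j) + (c\<^sup>2 - 1)"
    if i: "i < n" and j: "j < n" and si: "c\<^sup>2 * (norm (a i))\<^sup>2 < 1" and sj: "c\<^sup>2 * (norm (a j))\<^sup>2 < 1" for i j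
  proof -
    let ?K = "\<lambda>i j. (of_real (c\<^sup>2) * cinner (b i) (b j) - cinner (a i) (a j)) / (1 - cinner (b i) (b j))"
    have K: "(cmod (?K i j))\<^sup>2 \<le> Re (?K i i) * Re (?K j j)" "0 \<le> Re (?K i i)" "0 \<le> Re (?K j j)"
      using P.two_point[OF FG(4)[OF xi[OF i]] FG(4)[OF xi[OF j]]] P.two_point(2)[OF FG(4)[OF xi[OF j]] FG(4)[OF xi[OF j]]]
      by (simp_all add: FG(3)[OF xi[OF i]] FG(3)[OF xi[OF j]] a_def b_def)
    have Ke: "Re (?K l l) \<le> e l" if l: "l < n" "c\<^sup>2 * (norm (a l))\<^sup>2 < 1" for l
      unfolding re e_def
    proof (rule frac_le)
      have "c\<^sup>2 * (norm (b l))\<^sup>2 \<le> c\<^sup>2 * (c\<^sup>2 * (norm (a l))\<^sup>2)" by (intro mult_left_mono ba l) simp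
      then show "c\<^sup>2 * (norm (b l))\<^sup>2 - (norm (a l))\<^sup>2 \<le> (c ^ 4 - 1) * (norm (a l))\<^sup>2"
        by (simp add: power4_eq_xxxx power2_eq_square algebra_simps)
      show "0 \<le> (c ^ 4 - 1) * (norm (a l))\<^sup>2" using c2 by simp
      show "0 < 1 - c\<^sup>2 * (norm (a l))\<^sup>2" using l by simp
      show "1 - c\<^sup>2 * (norm (a l))\<^sup>2 \<le> 1 - (norm (b l))\<^sup>2" using ba[OF l(1)] by simp
    qed
    have "(cmod (?K i j))\<^sup>2 \<le> e i * e j"
      by (rule order_trans[OF K(1)]) (intro mult_mono Ke i j si sj K order_trans[OF K(2) Ke[OF i si]])
    then have Kij: "cmod (?K i j) \<le> sqrt (e i * e j)" by (simp add: real_le_rsqrt)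
    have q1: "cmod (cinner (b i) (b j)) < 1" by (rule cinner_ball_lt_1[OF b1[OF i] b1[OF j]])
    have "1 - cinner (b i) (b j) \<noteq> 0" by (rule one_minus_cinner_neq_0[OF b1[OF i] b1[OF j]])
    then have "of_real (c\<^sup>2) * cinner (b i) (b j) - cinner (a i) (a j) = ?K i j * (1 - cinner (b i) (b j))" by simp
    then have "cmod (of_real (c\<^sup>2) * cinner (b i) (b j) - cinner (a i) (a j)) = cmod (?K i j * (1 - cinner (b i) (b j)))"
      by (rule arg_cong)
    also have "\<dots> = cmod (?K i j) * cmod (1 - cinner (b i) (b j))" by (rule norm_mult)
    also have "\<dots> \<le> sqrt (e i * e j) * 2"
      using Kij q1 norm_triangle_ineq4[of 1 "cinner (b i) (b j)"] order_trans[OF norm_ge_zero Kij]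
      by (intro mult_mono) auto
    finally have 1: "cmod (of_real (c\<^sup>2) * cinner (b i) (b j) - cinner (a i) (a j)) \<le> 2 * sqrt (e i * e j)" by simp
    have "cmod (of_real (c\<^sup>2 - 1) * cinner (b i) (b j)) = (c\<^sup>2 - 1) * cmod (cinner (b i) (b j))"
      using c2 by (simp only: norm_mult norm_of_real)
    also have "\<dots> \<le> (c\<^sup>2 - 1) * 1" using c2 q1 by (intro mult_left_mono) auto
    finally have 2: "cmod (of_real (c\<^sup>2 - 1) * cinner (b i) (b j)) \<le> c\<^sup>2 - 1" by simp
    have "cinner (b i) (b j) - cinner (a i) (a j)
        = (of_real (c\<^sup>2) * cinner (b i) (b j) - cinner (a i) (a j)) - of_real (c\<^sup>2 - 1) * cinner (b i) (b j)"
      by (simp add: algebra_simps)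
    then show ?thesis using 1 2 norm_triangle_ineq4 by (smt (verit))
  qed
  \<comment> \<open>Extended by the identity because \<open>permutes\<close> demands it off
    \<open>{..<n}\<close>.\<close>
  define \<tau> where "\<tau> = (\<lambda>i. if i < n then inv_into {..<n} y (F (x i)) else i)"
  have y\<tau>: "y (\<tau> i) = F (x i)" "\<tau> i < n" if "i < n" for i
  proof -
    have "F (x i) \<in> ?Y" using FG(4)[OF xi[OF that]] .
    then show "y (\<tau> i) = F (x i)" "\<tau> i < n"
      using that inv_into_into[of "F (x i)" y "{..<n}"] by (auto simp: \<tau>_def f_inv_into_f)
  qed
  have "inj_on \<tau> {..<n}"
  proof (rule inj_onI)
    fix i j assume ij: "i \<in> {..<n}" "j \<in> {..<n}" "\<tau> i = \<tau> j"
    then have "F (x i) = F (x j)" using y\<tau>(1)[of i] y\<tau>(1)[of j] by simp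
    then have "x i = x j" using F ij by (auto simp: bij_betw_def inj_on_def)
    then show "i = j" using x(1) ij by (auto simp: inj_on_def)
  qed
  moreover have "\<tau> ` {..<n} \<subseteq> {..<n}" using y\<tau>(2) by auto
  ultimately have "bij_betw \<tau> {..<n} {..<n}" by (simp add: bij_betw_def endo_inj_surj)
  then have "\<tau> permutes {..<n}" by (rule bij_imp_permutes) (simp add: \<tau>_def)
  moreover have "y (\<tau> 0) = y0" using y\<tau>(1)[OF n] by (simp add: y0_def)
  ultimately show ?thesis
    using key y\<tau>(1) by (intro exI[of _ \<tau>]) (auto simp: a_def b_def e_def)
qed

lemma rho_ph_tendsto_0:
  assumes z: "norm z < 1" and w: "\<And>k. norm (w k) < 1" and lim: "w \<longlonglongrightarrow> z"
  shows "(\<lambda>k. rho_ph z (w k)) \<longlonglongrightarrow> 0"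
proof -
  have r: "(rho_ph z (w k))\<^sup>2 = 1 - (1 - (norm (w k))\<^sup>2) * (1 - (norm z)\<^sup>2) / (cmod (1 - cinner z (w k)))\<^sup>2" for k
    using one_minus_rho_ph[OF z w] by (simp add: algebra_simps)
  have nz: "1 - cinner z z \<noteq> 0" by (rule one_minus_cinner_neq_0[OF z z])
  have "(\<lambda>k. (rho_ph z (w k))\<^sup>2) \<longlonglongrightarrow> 1 - (1 - (norm z)\<^sup>2) * (1 - (norm z)\<^sup>2) / (cmod (1 - cinner z z))\<^sup>2"
    unfolding r by (intro tendsto_intros lim bounded_bilinear.tendsto[OF bounded_bilinear_cinner]) (use nz in simp)
  moreover have "1 - (1 - (norm z)\<^sup>2) * (1 - (norm z)\<^sup>2) / (cmod (1 - cinner z z))\<^sup>2 = 0"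
  proof -
    have "1 - cinner z z = of_real (1 - (norm z)\<^sup>2)" by (simp add: cinner_norm)
    then have "(cmod (1 - cinner z z))\<^sup>2 = (1 - (norm z)\<^sup>2)\<^sup>2" by (simp only: norm_of_real power2_abs)
    moreover have "1 - (norm z)\<^sup>2 \<noteq> 0" using z by (simp add: abs_square_eq_1)
    ultimately show ?thesis by (simp add: power2_eq_square)
  qed
  ultimately have "(\<lambda>k. sqrt ((rho_ph z (w k))\<^sup>2)) \<longlonglongrightarrow> sqrt 0" by (intro tendsto_real_sqrt) simp
  then show ?thesis using rho_ph_nonneg by simp
qed

text \<open>The estimate of \<open>delta_M_matching\<close> tends to 0, so the Gram matrices of the
  moved points converge and \<open>Gram_convergence\<close> supplies unitaries. Unitaries and
  involutions of the ball combine to the automorphisms sought.\<close>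

lemma aut_of_delta_M:
  fixes x :: "nat \<Rightarrow> ell2" and y :: "nat \<Rightarrow> nat \<Rightarrow> ell2"
  assumes n: "0 < n" and x: "inj_on x {..<n}" "x ` {..<n} \<subseteq> Bd d"
    and y: "\<And>k. inj_on (y k) {..<n}" "\<And>k. y k ` {..<n} \<subseteq> Bd d"
    and lim: "(\<lambda>k. delta_M (da_restrict (x ` {..<n})) (da_restrict (y k ` {..<n}))) \<longlonglongrightarrow> 1"
  shows "(\<lambda>k. aut_sym_dist d n x (y k)) \<longlonglongrightarrow> 0"
proof -
  define D where "D = (\<lambda>k. delta_M (da_restrict (x ` {..<n})) (da_restrict (y k ` {..<n})))"
  \<comment> \<open>The slack makes the inequality \<open>D k < ennreal (c k)\<close> strict
    wherever \<open>D k\<close> is finite.\<close>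
  define c where "c = (\<lambda>k. enn2real (D k) + inverse (Suc k))"
  have lim: "D \<longlonglongrightarrow> ennreal 1" using lim by (simp add: D_def)
  have c: "c \<longlonglongrightarrow> 1"
    using tendsto_add[OF tendsto_enn2real[OF lim] LIMSEQ_inverse_real_of_nat] by (simp add: c_def)
  have ev: "\<forall>\<^sub>F k in sequentially. D k < ennreal (c k)"
  proof -
    have "\<forall>\<^sub>F k in sequentially. D k < top" by (rule order_tendstoD(2)[OF lim]) simp
    then show ?thesis
    proof eventually_elim
      case (elim k)
      then have "D k = ennreal (enn2real (D k))" by simp
      also have "\<dots> < ennreal (c k)" by (rule ennreal_lessI) (simp_all add: c_def add_nonneg_pos)
      finally show ?case .
    qed
  qed
  define a where "a = (\<lambda>i. ball_inv (x 0) (x i))"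
  have x0: "x 0 \<in> Bd d" using x n by blast
  have xB: "x i \<in> Bd d" if "i < n" for i using x that by blast
  have aB: "a i \<in> Bd d" if "i < n" for i using xB[OF that] x0 by (simp add: a_def ball_inv_in_Bd)
  define e where "e = (\<lambda>c i. (c ^ 4 - 1) * (norm (a i))\<^sup>2 / (1 - c\<^sup>2 * (norm (a i))\<^sup>2))"
  \<comment> \<open>Where the bound fails any permutation will do; this happens for finitely many
    \<open>k\<close> only and lets \<open>\<tau>\<close> be chosen for all of them.\<close>
  have "\<exists>\<tau>. \<tau> permutes {..<n} \<and> (D k < ennreal (c k) \<longrightarrow> (\<forall>i<n. \<forall>j<n.
      (c k)\<^sup>2 * (norm (a i))\<^sup>2 < 1 \<longrightarrow> (c k)\<^sup>2 * (norm (a j))\<^sup>2 < 1 \<longrightarrow>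
      cmod (cinner (ball_inv (y k (\<tau> 0)) (y k (\<tau> i))) (ball_inv (y k (\<tau> 0)) (y k (\<tau> j))) - cinner (a i) (a j))
      \<le> 2 * sqrt (e (c k) i * e (c k) j) + ((c k)\<^sup>2 - 1)))" for k
  proof (cases "D k < ennreal (c k)")
    case True
    from delta_M_matching[OF n x y[of k] this[unfolded D_def]] show ?thesis
      unfolding a_def e_def by blast
  next
    case False
    then show ?thesis using permutes_id by blast
  qed
  then obtain \<tau> where \<tau>: "\<And>k. \<tau> k permutes {..<n}"
    and est: "\<And>k i j. D k < ennreal (c k) \<Longrightarrow> i < n \<Longrightarrow> j < n \<Longrightarrow>
      (c k)\<^sup>2 * (norm (a i))\<^sup>2 < 1 \<Longrightarrow> (c k)\<^sup>2 * (norm (a j))\<^sup>2 < 1 \<Longrightarrow>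
      cmod (cinner (ball_inv (y k (\<tau> k 0)) (y k (\<tau> k i))) (ball_inv (y k (\<tau> k 0)) (y k (\<tau> k j))) - cinner (a i) (a j))
      \<le> 2 * sqrt (e (c k) i * e (c k) j) + ((c k)\<^sup>2 - 1)" by metis
  define b where "b = (\<lambda>k i. ball_inv (y k (\<tau> k 0)) (y k (\<tau> k i)))"
  have y\<tau>: "y k (\<tau> k i) \<in> Bd d" if "i < n" for k i
    using y(2)[of k] permutes_in_image[OF \<tau>[of k], of i] that by blast
  have bB: "b k i \<in> Bd d" if "i < n" for k i using y\<tau>[OF that] y\<tau>[OF n] by (simp add: b_def ball_inv_in_Bd)
  have small: "\<forall>\<^sub>F k in sequentially. (c k)\<^sup>2 * (norm (a i))\<^sup>2 < 1" if "i < n" for i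
  proof (rule order_tendstoD(2))
    show "(\<lambda>k. (c k)\<^sup>2 * (norm (a i))\<^sup>2) \<longlonglongrightarrow> 1\<^sup>2 * (norm (a i))\<^sup>2" by (intro tendsto_intros c)
    show "1\<^sup>2 * (norm (a i))\<^sup>2 < 1" using aB[OF that] by (simp add: Bd_def power_less_one_iff)
  qed
  have e_lim: "(\<lambda>k. e (c k) i) \<longlonglongrightarrow> 0" if "i < n" for i
  proof -
    have "1 - 1\<^sup>2 * (norm (a i))\<^sup>2 \<noteq> 0" using aB[OF that] by (simp add: Bd_def abs_square_eq_1)
    then have "(\<lambda>k. e (c k) i) \<longlonglongrightarrow> (1 ^ 4 - 1) * (norm (a i))\<^sup>2 / (1 - 1\<^sup>2 * (norm (a i))\<^sup>2)"
      unfolding e_def by (intro tendsto_intros c)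
    then show ?thesis by simp
  qed
  have "(\<lambda>k. cinner (b k i) (b k j)) \<longlonglongrightarrow> cinner (a i) (a j)" if i: "i < n" and j: "j < n" for i j
  proof (rule LIM_zero_cancel, rule Lim_null_comparison)
    show "\<forall>\<^sub>F k in sequentially. norm (cinner (b k i) (b k j) - cinner (a i) (a j))
        \<le> 2 * sqrt (e (c k) i * e (c k) j) + ((c k)\<^sup>2 - 1)"
      using ev small[OF i] small[OF j] by eventually_elim (unfold b_def, rule est[OF _ i j])
    have "(\<lambda>k. 2 * sqrt (e (c k) i * e (c k) j) + ((c k)\<^sup>2 - 1)) \<longlonglongrightarrow> 2 * sqrt (0 * 0) + (1\<^sup>2 - 1)"
      by (intro tendsto_intros c e_lim i j)
    then show "(\<lambda>k. 2 * sqrt (e (c k) i * e (c k) j) + ((c k)\<^sup>2 - 1)) \<longlonglongrightarrow> 0" by simp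
  qed
  then have "\<exists>U. (\<forall>k. cunitary d (U k)) \<and> (\<forall>i<n. (\<lambda>k. U k (b k i)) \<longlonglongrightarrow> a i)"
    by (intro Gram_convergence) (use aB bB in \<open>auto simp: Bd_def\<close>)
  then obtain U where U: "\<And>k. cunitary d (U k)" and Ub: "\<And>i. i < n \<Longrightarrow> (\<lambda>k. U k (b k i)) \<longlonglongrightarrow> a i" by blast
  \<comment> \<open>Move the base point of \<open>y k\<close> to the origin, rotate, and move the
    origin to \<open>x 0\<close>.\<close>
  define \<Phi> where "\<Phi> = (\<lambda>k. ball_inv (x 0) \<circ> (U k \<circ> ball_inv (y k (\<tau> k 0))))"
  have \<Phi>: "\<Phi> k \<in> ball_Aut d" for k
    unfolding \<Phi>_def
    by (intro ball_Aut_compose ball_inv_ball_Aut cunitary_ball_Aut U x0 y\<tau>[OF n])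
  have UB: "U k (b k i) \<in> Bd d" if "i < n" for k i
    using ball_Aut_D(1)[OF cunitary_ball_Aut[OF U[of k]]] bB[OF that] by blast
  have eq: "rho_ph (x i) (\<Phi> k (y k (\<tau> k i))) = rho_ph (a i) (U k (b k i))" if i: "i < n" for i k
  proof -
    have "x i = ball_inv (x 0) (a i)" using x0 xB[OF i] by (simp add: a_def ball_inv_ball_inv Bd_def)
    moreover have "\<Phi> k (y k (\<tau> k i)) = ball_inv (x 0) (U k (b k i))" by (simp add: \<Phi>_def b_def)
    ultimately show ?thesis
      using rho_ph_ball_Aut[OF ball_inv_ball_Aut[OF x0] aB[OF i] UB[OF i]] by simp
  qed
  \<comment> \<open>The sum dominates the maximum in \<open>sym_dist\<close> and its convergence is
    immediate.\<close>
  let ?r = "\<lambda>k. \<Sum>i<n. rho_ph (a i) (U k (b k i))"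
  have "?r \<longlonglongrightarrow> (\<Sum>i<n. 0)"
    by (intro tendsto_sum rho_ph_tendsto_0 Ub) (use aB UB in \<open>auto simp: Bd_def\<close>)
  then have r0: "?r \<longlonglongrightarrow> 0" by simp
  have "aut_sym_dist d n x (y k) \<le> ?r k" for k
  proof (rule aut_sym_dist_le[OF n \<Phi> \<tau>])
    fix i assume i: "i < n"
    show "rho_ph (x i) (\<Phi> k (y k (\<tau> k i))) \<le> ?r k"
      unfolding eq[OF i] using i rho_ph_nonneg by (intro member_le_sum) auto
  qed
  then show ?thesis
    using aut_sym_dist_nonneg[OF n] by (intro Lim_null_comparison[OF always_eventually r0]) simp
qed

section \<open>The multiplier discrepancy and the equivalences\<close>

text \<open>Both maps are automorphisms corrected by a Lagrange sum whose norm tends to 0.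
  \<open>F\<close> is the inverse automorphism corrected at the fixed nodes \<open>x i\<close>; the
  other map first applies \<open>\<Phi> k\<close> and then corrects the identity at the nodes
  \<open>z k i\<close>, which converge to \<open>x i\<close>.\<close>

lemma delta_mult_of_aut:
  fixes x :: "nat \<Rightarrow> ell2" and y :: "nat \<Rightarrow> nat \<Rightarrow> ell2"
  assumes n: "0 < n" and x: "inj_on x {..<n}" "x ` {..<n} \<subseteq> Bd d"
    and y: "\<And>k. inj_on (y k) {..<n}" "\<And>k. y k ` {..<n} \<subseteq> Bd d"
    and lim: "(\<lambda>k. aut_sym_dist d n x (y k)) \<longlonglongrightarrow> 0" and c: "1 < c"
  shows "\<forall>\<^sub>F k in sequentially. delta_mult d (x ` {..<n}) (y k ` {..<n}) < ennreal c"
proof -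
  interpret B: da_space "Bd d" by (rule da_space_Bd)
  let ?X = "x ` {..<n}"
  obtain \<Phi> \<sigma> where \<Phi>: "\<And>k. \<Phi> k \<in> ball_Aut d" and \<sigma>: "\<And>k. \<sigma> k permutes {..<n}"
    and rho: "\<And>i. i < n \<Longrightarrow> (\<lambda>k. rho_ph (x i) (\<Phi> k (y k (\<sigma> k i)))) \<longlonglongrightarrow> 0"
    and zx: "\<And>i. i < n \<Longrightarrow> (\<lambda>k. \<Phi> k (y k (\<sigma> k i))) \<longlonglongrightarrow> x i"
    using aut_sym_dist_matching[OF n x(2) y(2) lim] by blast
  define y' where "y' = (\<lambda>k i. y k (\<sigma> k i))"
  define z where "z = (\<lambda>k i. \<Phi> k (y' k i))"
  have \<sigma>n: "\<sigma> k i < n" if "i < n" for k i using permutes_in_image[OF \<sigma>[of k], of i] that by simp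
  have xB: "x i \<in> Bd d" if "i < n" for i using x that by blast
  have y'B: "y' k i \<in> Bd d" if "i < n" for k i using y(2)[of k] \<sigma>n[OF that, of k] by (auto simp: y'_def)
  have y'_inj: "inj_on (y' k) {..<n}" for k
  proof (rule inj_onI)
    fix i j assume ij: "i \<in> {..<n}" "j \<in> {..<n}" "y' k i = y' k j"
    then have "\<sigma> k i = \<sigma> k j" using y(1)[of k] \<sigma>n[of _ k] by (auto simp: y'_def inj_on_def)
    then show "i = j" using permutes_inj[OF \<sigma>[of k]] by (rule injD[rotated])
  qed
  have y'_im: "y' k ` {..<n} = y k ` {..<n}" for k
  proof -
    have "y' k ` {..<n} = y k ` (\<sigma> k ` {..<n})" by (auto simp: y'_def image_image)
    then show ?thesis using permutes_image[OF \<sigma>[of k]] by simp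
  qed
  have zB: "z k i \<in> Bd d" if "i < n" for k i using ball_Aut_D(1)[OF \<Phi>[of k]] y'B[OF that] by (auto simp: z_def)
  have z_inj: "inj_on (z k) {..<n}" for k
  proof (rule inj_onI)
    fix i j assume ij: "i \<in> {..<n}" "j \<in> {..<n}" "z k i = z k j"
    then have "y' k i = y' k j" using inj_onD[OF ball_Aut_D(2)[OF \<Phi>[of k]]] y'B[of _ k] by (simp add: z_def)
    then show "i = j" using inj_onD[OF y'_inj[of k]] ij by blast
  qed
  define C1 where "C1 = (\<lambda>k. 1 + (\<Sum>i<n. lagrange_bound ?X (x i) * (8 * rho_ph (x i) (z k i))))"
  define C2 where "C2 = (\<lambda>k. 1 + (\<Sum>i<n. lagrange_bound (z k ` {..<n}) (z k i) * norm (x i - z k i)))"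
  have "C1 \<longlonglongrightarrow> 1 + (\<Sum>i<n. lagrange_bound ?X (x i) * (8 * 0))"
    unfolding C1_def z_def y'_def by (intro tendsto_intros rho) simp
  then have C1: "\<forall>\<^sub>F k in sequentially. C1 k < c" using c by (intro order_tendstoD(2)) auto
  \<comment> \<open>Indexing the factors by \<open>j\<close> instead of the moving set of nodes
    exhibits the bound as a continuous function of points whose limits are distinct.\<close>
  have lb: "lagrange_bound (z k ` {..<n}) (z k i) = (\<Prod>j\<in>{..<n} - {i}. 2 / norm (z k i - z k j))" if i: "i < n" for k i
  proof -
    have "z k ` {..<n} - {z k i} = z k ` ({..<n} - {i})" using z_inj[of k] i by (auto simp: inj_on_def)
    moreover have "inj_on (z k) ({..<n} - {i})" using z_inj[of k] by (rule inj_on_subset) auto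
    ultimately show ?thesis by (simp add: lagrange_bound_def prod.reindex)
  qed
  have zx': "(\<lambda>k. z k i) \<longlonglongrightarrow> x i" if "i < n" for i using zx[OF that] by (simp add: z_def y'_def)
  have "C2 \<longlonglongrightarrow> 1 + (\<Sum>i<n. (\<Prod>j\<in>{..<n} - {i}. 2 / norm (x i - x j)) * norm (x i - x i))"
  proof -
    have "C2 = (\<lambda>k. 1 + (\<Sum>i<n. (\<Prod>j\<in>{..<n} - {i}. 2 / norm (z k i - z k j)) * norm (x i - z k i)))"
      unfolding C2_def by (intro ext arg_cong2[of _ _ _ _ "(+)"] sum.cong refl) (simp add: lb)
    then show ?thesis
      using x(1) by (simp only:) (intro tendsto_intros zx'; auto simp: inj_on_def)
  qed
  then have C2: "\<forall>\<^sub>F k in sequentially. C2 k < c" using c by (intro order_tendstoD(2)) auto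
  have "\<forall>\<^sub>F k in sequentially. \<forall>i\<in>{..<n}. rho_ph (x i) (z k i) < 1/2"
    using order_tendstoD(2)[OF rho, of _ "1/2"] by (intro eventually_ball_finite) (auto simp: z_def y'_def)
  then show ?thesis using C1 C2
  proof eventually_elim
    case (elim k)
    obtain \<Xi> where \<Xi>: "\<Xi> \<in> ball_Aut d" "\<And>w. w \<in> Bd d \<Longrightarrow> \<Xi> (\<Phi> k w) = w"
      using ball_Aut_obtain_inv[OF \<Phi>[of k]] by metis
    have \<Xi>B: "\<Xi> w \<in> Bd d" if "w \<in> Bd d" for w using ball_Aut_D(1)[OF \<Xi>(1)] that by blast
    have \<Phi>B: "\<Phi> k w \<in> Bd d" if "w \<in> Bd d" for w using ball_Aut_D(1)[OF \<Phi>[of k]] that by blast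
    have \<Xi>z: "\<Xi> (z k i) = y' k i" if "i < n" for i using \<Xi>(2)[OF y'B[OF that]] by (simp add: z_def)
    \<comment> \<open>Neither point need converge, but their pseudohyperbolic distance is that of
      \<open>z k i\<close> and \<open>x i\<close>, and \<open>norm_diff_le_rho_ph\<close> is
      uniform.\<close>
    define v where "v = (\<lambda>i. y' k i - \<Xi> (x i))"
    have v: "norm (v i) \<le> 8 * rho_ph (x i) (z k i)" if i: "i < n" for i
    proof -
      have r: "rho_ph (\<Xi> (x i)) (y' k i) = rho_ph (x i) (z k i)"
        using rho_ph_ball_Aut[OF \<Xi>(1) xB[OF i] zB[OF i, of k]] by (simp add: \<Xi>z[OF i])
      have "norm (\<Xi> (x i) - y' k i) * (1 - rho_ph (x i) (z k i)) \<le> 4 * rho_ph (x i) (z k i)"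
        using norm_diff_le_rho_ph[of "\<Xi> (x i)" "y' k i"] \<Xi>B[OF xB[OF i]] y'B[OF i] unfolding r by (simp add: Bd_def)
      moreover have "norm (\<Xi> (x i) - y' k i) * (1/2) \<le> norm (\<Xi> (x i) - y' k i) * (1 - rho_ph (x i) (z k i))"
        by (rule mult_left_mono) (use elim(1) i in force)+
      ultimately show ?thesis by (simp add: v_def norm_minus_commute)
    qed
    define F where "F = (\<lambda>u. \<Xi> u + (\<Sum>i<n. cscale (lagrange ?X (x i) u) (v i)))"
    \<comment> \<open>Correcting at the points of \<open>y k\<close> directly would involve Lagrange
      bounds that may blow up as these points merge near the boundary; the correction is made at
      their images \<open>z k\<close>, and composing with \<open>\<Phi> k\<close> does not increase
      the norm.\<close>
    define G0 where "G0 = (\<lambda>u. u + (\<Sum>i<n. cscale (lagrange (z k ` {..<n}) (z k i) u) (x i - z k i)))"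
    have interp: "(\<Sum>i<n. cscale (lagrange (s ` {..<n}) (s i) (s j)) (w i)) = w j"
      if "inj_on s {..<n}" "j < n" for s :: "nat \<Rightarrow> ell2" and w j
    proof -
      have "(\<Sum>i<n. cscale (lagrange (s ` {..<n}) (s i) (s j)) (w i)) = (\<Sum>i<n. if i = j then w j else 0)"
      proof (rule sum.cong)
        fix i assume "i \<in> {..<n}"
        then have "i \<noteq> j \<Longrightarrow> lagrange (s ` {..<n}) (s i) (s j) = 0"
          using inj_onD[OF that(1), of j i] that(2) by (intro lagrange_other) auto
        then show "cscale (lagrange (s ` {..<n}) (s i) (s j)) (w i) = (if i = j then w j else 0)"
          by (simp add: lagrange_same cscale_simps)
      qed simp
      then show ?thesis using that by simp
    qed
    have Fx: "F (x j) = y' k j" if "j < n" for j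
      using interp[OF x(1) that, of v] by (simp add: F_def v_def)
    have Gz: "G0 (z k j) = x j" if "j < n" for j
      using interp[OF z_inj[of k] that, of "\<lambda>i. x i - z k i"] by (simp add: G0_def)
    have rF: "B.rowbnd (B.comps F) (1 + (\<Sum>i<n. lagrange_bound ?X (x i) * norm (v i)))"
      unfolding F_def
      by (rule B.rowbnd_lagrange_sum[OF _ _ rowbnd_ball_Aut[OF \<Xi>(1)]]) (use xB in \<open>auto simp: Bd_def\<close>)
    have "1 + (\<Sum>i<n. lagrange_bound ?X (x i) * norm (v i)) \<le> C1 k"
      unfolding C1_def by (intro add_left_mono sum_mono mult_left_mono v lagrange_bound_nonneg) simp
    from B.rowbnd_mono[OF rF this] have rF: "B.rowbnd (B.comps F) (C1 k)" .
    have "B.rowbnd (B.comps G0) (C2 k)"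
      unfolding G0_def C2_def
      by (rule B.rowbnd_lagrange_sum[OF _ _ B.rowbnd_id]) (use zB in \<open>auto simp: Bd_def\<close>)
    from rowbnd_compose_ball_Aut[OF \<Phi>[of k] this]
    have rG: "B.rowbnd (B.comps (\<lambda>u. G0 (\<Phi> k u))) (C2 k)" .
    have vF: "vmult d F" "vmult_norm d F \<le> ennreal (C1 k)"
    proof -
      have "F u \<in> Cd d" if "u \<in> Bd d" for u
        unfolding F_def v_def using \<Xi>B[OF that] \<Xi>B[OF xB] y'B
        by (intro Cd_closed Cd_sum) (auto simp: Bd_def)
      from vmultI[OF this rF] show "vmult d F" "vmult_norm d F \<le> ennreal (C1 k)" by blast+
    qed
    have vG: "vmult d (\<lambda>u. G0 (\<Phi> k u))" "vmult_norm d (\<lambda>u. G0 (\<Phi> k u)) \<le> ennreal (C2 k)"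
    proof -
      have "G0 (\<Phi> k u) \<in> Cd d" if "u \<in> Bd d" for u
        unfolding G0_def using \<Phi>B[OF that] xB zB
        by (intro Cd_closed Cd_sum) (auto simp: Bd_def)
      from vmultI[OF this rG] show "vmult d (\<lambda>u. G0 (\<Phi> k u))" "vmult_norm d (\<lambda>u. G0 (\<Phi> k u)) \<le> ennreal (C2 k)" by blast+
    qed
    have bij: "bij_betw F ?X (y k ` {..<n})"
      unfolding bij_betw_def
    proof
      show "inj_on F ?X" using y'_inj[of k] by (auto simp: inj_on_def Fx)
      show "F ` ?X = y k ` {..<n}" unfolding y'_im[of k, symmetric] image_image by (intro image_cong refl) (simp add: Fx)
    qed
    have GF: "\<forall>u\<in>?X. G0 (\<Phi> k (F u)) = u" using Gz by (auto simp: Fx z_def)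
    have "delta_mult d ?X (y k ` {..<n}) \<le> max (vmult_norm d F) (vmult_norm d (\<lambda>u. G0 (\<Phi> k u)))"
      unfolding delta_mult_def
      by (rule INF_lower2[of "(F, \<lambda>u. G0 (\<Phi> k u))"]) (use vF vG bij GF in auto)
    also have "\<dots> \<le> max (ennreal (C1 k)) (ennreal (C2 k))" using vF vG by (intro max.mono)
    also have "\<dots> < ennreal c" using elim(2,3) c by (auto intro!: ennreal_lessI)
    finally show ?case .
  qed
qed

theorem theorem5p4:
  fixes d :: enat and n :: nat
    and x :: "nat \<Rightarrow> ell2" and y :: "nat \<Rightarrow> nat \<Rightarrow> ell2"
    and H :: "ell2 rkhs" and Hk :: "nat \<Rightarrow> ell2 rkhs"
  assumes n: "n \<ge> 2"
    and x_inj: "inj_on x {..<n}" and x_ball: "x ` {..<n} \<subseteq> Bd d"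
    and y_inj: "\<And>k. inj_on (y k) {..<n}" and y_ball: "\<And>k. y k ` {..<n} \<subseteq> Bd d"
  defines "H \<equiv> da_restrict (x ` {..<n})"
    and "Hk \<equiv> \<lambda>k. da_restrict (y k ` {..<n})"
  shows
    "(((\<lambda>k. aut_sym_dist d n x (y k)) \<longlonglongrightarrow> 0) \<longleftrightarrow> ((\<lambda>k. rho_RK H (Hk k)) \<longlonglongrightarrow> 0)) \<and>
     (((\<lambda>k. rho_RK H (Hk k)) \<longlonglongrightarrow> 0) \<longleftrightarrow> ((\<lambda>k. rho_M H (Hk k)) \<longlonglongrightarrow> 0)) \<and>
     (((\<lambda>k. rho_M H (Hk k)) \<longlonglongrightarrow> 0) \<longleftrightarrow>
       ((\<lambda>k. INF \<phi>\<in>{\<phi>. alg_iso H (Hk k) \<phi>}. cb_distortion H (Hk k) \<phi>) \<longlonglongrightarrow> 1)) \<and>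
     (((\<lambda>k. rho_M H (Hk k)) \<longlonglongrightarrow> 0) \<longrightarrow>
       ((\<lambda>k. delta_mult d (x ` {..<n}) (y k ` {..<n})) \<longlonglongrightarrow> 1))"
proof -
  have n0: "0 < n" using n by simp
  let ?X = "x ` {..<n}" and ?Y = "\<lambda>k. y k ` {..<n}"
  have X: "da_space ?X" "finite ?X" "?X \<noteq> {}" using n0 da_space_subset[OF x_ball] by auto
  have Y: "da_space (?Y k)" "finite (?Y k)" "?Y k \<noteq> {}" for k using n0 da_space_subset[OF y_ball] by auto
  have M: "(INF \<phi>\<in>{\<phi>. alg_iso H (Hk k) \<phi>}. cb_distortion H (Hk k) \<phi>) = delta_M H (Hk k)" for k
    unfolding H_def Hk_def by (rule delta_M_alg_iso[OF X Y])
  have M_ge: "1 \<le> delta_M H (Hk k)" for k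
    unfolding delta_M_alg_iso[OF X Y, symmetric] H_def Hk_def
    by (rule INF_greatest) (use alg_iso_distortion_ge_1[OF X Y] in blast)
  have RK_ge: "1 \<le> delta_RK H (Hk k)" for k
    unfolding H_def Hk_def by (rule delta_RK_ge_1[OF X(1,3) Y(1)])
  define P1 where "P1 \<longleftrightarrow> (\<lambda>k. aut_sym_dist d n x (y k)) \<longlonglongrightarrow> 0"
  define P2 where "P2 \<longleftrightarrow> (\<forall>c>1. \<forall>\<^sub>F k in sequentially. delta_RK H (Hk k) < ennreal c)"
  define P3 where "P3 \<longleftrightarrow> (\<forall>c>1. \<forall>\<^sub>F k in sequentially. delta_M H (Hk k) < ennreal c)"
  have P2_iff: "((\<lambda>k. rho_RK H (Hk k)) \<longlonglongrightarrow> 0) \<longleftrightarrow> P2"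
    unfolding rho_RK_def P2_def by (rule ext_log_tendsto_0_iff[OF RK_ge])
  have P3_iff: "((\<lambda>k. rho_M H (Hk k)) \<longlonglongrightarrow> 0) \<longleftrightarrow> P3"
    unfolding rho_M_def P3_def by (rule ext_log_tendsto_0_iff[OF M_ge])
  have P3_iff': "((\<lambda>k. delta_M H (Hk k)) \<longlonglongrightarrow> 1) \<longleftrightarrow> P3"
    unfolding P3_def by (rule ennreal_tendsto_1_iff[OF M_ge])
  have 12: "P1 \<Longrightarrow> P2"
    unfolding P1_def P2_def H_def Hk_def
    by (intro allI impI) (rule delta_RK_of_aut[OF n0 x_inj x_ball y_inj y_ball])
  have 23: "P2 \<Longrightarrow> P3"
    unfolding P3_def
  proof (intro allI impI)
    fix c :: real assume P2: "P2" and c: "1 < c"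
    \<comment> \<open>Any \<open>b > 1\<close> with \<open>b^2 < c\<close> serves: the passage to
      multiplier algebras squares the distortion.\<close>
    define b where "b = sqrt ((1 + c) / 2)"
    have b: "1 < b" "b\<^sup>2 < c" using c by (simp_all add: b_def)
    have "\<forall>\<^sub>F k in sequentially. delta_RK H (Hk k) < ennreal b" using P2 b unfolding P2_def by blast
    then show "\<forall>\<^sub>F k in sequentially. delta_M H (Hk k) < ennreal c"
    proof eventually_elim
      case (elim k)
      have "delta_M H (Hk k) \<le> ennreal (b\<^sup>2)"
        using elim b unfolding H_def Hk_def by (intro delta_M_of_delta_RK[OF X Y(1,2)]) auto
      also have "\<dots> < ennreal c" using b c by (intro ennreal_lessI) auto
      finally show ?case .
    qed
  qed
  have 31: "P3 \<Longrightarrow> P1"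
    unfolding P3_iff'[symmetric] P1_def H_def Hk_def
    by (rule aut_of_delta_M[OF n0 x_inj x_ball y_inj y_ball])
  have mult: "P1 \<Longrightarrow> (\<lambda>k. delta_mult d ?X (?Y k)) \<longlonglongrightarrow> 1"
  proof -
    assume P1: "P1"
    \<comment> \<open>Here \<open>n \<ge> 2\<close> enters: the lower bound for the discrepancy
      needs two distinct points.\<close>
    have "x 0 \<noteq> x 1" using inj_onD[OF x_inj, of 0 1] n by auto
    then have "1 \<le> delta_mult d ?X (?Y k)" for k
      using n by (intro delta_mult_ge_1[OF x_ball y_ball, of "x 0" "x 1"]) auto
    then show ?thesis
      using delta_mult_of_aut[OF n0 x_inj x_ball y_inj y_ball P1[unfolded P1_def]]
      by (subst ennreal_tendsto_1_iff) auto
  qed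
  show ?thesis
    unfolding M P2_iff P3_iff P3_iff' P1_def[symmetric] using 12 23 31 mult by blast
qed

end
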